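(* Let $B$ be an inner function, $\psi\in K_B$, $\zeta\in\mathbb{T}$, and $n\in\mathbb{N}\cup\{\infty\}$. If $d=\dim K_B$, then the operator $A^B_{\psi+\zeta\bar B\psi}\oplus 0_{nd}$ is unitarily equivalent to a truncated Toeplitz operator.
   Context: $L^2=L^2(\mathbb{T},dm)$ with $m$ Lebesgue measure on the unit circle $\mathbb{T}$; $H^2\subset L^2$ is the Hardy space (functions whose negative Fourier coefficients are $0$), and $H^\infty=H^2\cap L^\infty$. An inner function is $\Theta\in H^2$ with $|\Theta|=1$ a.e. on $\mathbb{T}$. The model space is $K_\Theta=H^2\ominus\Theta H^2$, and $P_\Theta$ is the orthogonal projection of $L^2$ onto $K_\Theta$. For $\Theta$ inner and $\phi\in L^2$, the (bounded or unbounded) truncated Toeplitz operator $A^\Theta_\phi$ on $K_\Theta$ is $A^\Theta_\phi f=P_\Theta(\phi f)$; it is densely defined, since $K_\Theta\cap H^\infty$ is dense in $K_\Theta$. $0_k$ denotes the zero operator on a space of dimension $k$ ($k$ may be $\infty$). *)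

theory Defs
  imports "HOL-Analysis.Analysis"
begin

section \<open>Complex inner product spaces\<close>

text \<open>
  The norm and topology are those of the underlying real inner product \<open>Re \<langle>x, y\<rangle>\<close>;
  \<open>cinner\<close> is linear in the first argument.
\<close>

class complex_inner_space = real_inner +
  fixes scaleC :: "complex \<Rightarrow> 'a \<Rightarrow> 'a" (infixr "*\<^sub>C" 75)
    and cinner :: "'a \<Rightarrow> 'a \<Rightarrow> complex"
  assumes scaleC_add_right: "a *\<^sub>C (x + y) = a *\<^sub>C x + a *\<^sub>C y"
    and scaleC_add_left: "(a + b) *\<^sub>C x = a *\<^sub>C x + b *\<^sub>C x"
    and scaleC_scaleC: "a *\<^sub>C b *\<^sub>C x = (a * b) *\<^sub>C x"
    and scaleC_of_real: "complex_of_real r *\<^sub>C x = r *\<^sub>R x"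
    and cinner_commute: "cinner x y = cnj (cinner y x)"
    and cinner_add_left: "cinner (x + y) z = cinner x z + cinner y z"
    and cinner_scaleC_left: "cinner (a *\<^sub>C x) y = a * cinner x y"
    and inner_eq_Re_cinner: "inner x y = Re (cinner x y)"

instantiation prod :: (complex_inner_space, complex_inner_space) complex_inner_space
begin

definition scaleC_prod where
  "scaleC_prod a x = (a *\<^sub>C fst x, a *\<^sub>C snd x)"

definition cinner_prod where
  "cinner_prod x y = cinner (fst x) (fst y) + cinner (snd x) (snd y)"

instance
proof
  fix a b :: complex and r :: real and x y z :: "'a \<times> 'b"
  show "a *\<^sub>C (x + y) = a *\<^sub>C x + a *\<^sub>C y"
    by (simp add: scaleC_prod_def scaleC_add_right)
  show "(a + b) *\<^sub>C x = a *\<^sub>C x + b *\<^sub>C x"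
    by (simp add: scaleC_prod_def scaleC_add_left)
  show "a *\<^sub>C b *\<^sub>C x = (a * b) *\<^sub>C x"
    by (simp add: scaleC_prod_def scaleC_scaleC)
  show "complex_of_real r *\<^sub>C x = r *\<^sub>R x"
    by (simp add: scaleC_prod_def scaleC_of_real scaleR_prod_def)
  show "cinner x y = cnj (cinner y x)"
    by (simp add: cinner_prod_def cinner_commute[symmetric])
  show "cinner (x + y) z = cinner x z + cinner y z"
    by (simp add: cinner_prod_def cinner_add_left)
  show "cinner (a *\<^sub>C x) y = a * cinner x y"
    by (simp add: cinner_prod_def scaleC_prod_def cinner_scaleC_left distrib_left)
  show "inner x y = Re (cinner x y)"
    by (simp add: cinner_prod_def inner_prod_def inner_eq_Re_cinner)
qed

end

definition csubspace :: "'a::complex_inner_space set \<Rightarrow> bool" where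
  "csubspace V \<longleftrightarrow> 0 \<in> V \<and> (\<forall>x\<in>V. \<forall>y\<in>V. x + y \<in> V) \<and> (\<forall>c. \<forall>x\<in>V. c *\<^sub>C x \<in> V)"

text \<open>
  \<open>V\<close> has an orthonormal basis indexed by \<open>{i. i < k}\<close>. For a complete subspace \<open>V\<close> this is
  ``the Hilbert space \<open>V\<close> has dimension \<open>k\<close>'', with \<open>\<infinity>\<close> standing for \<open>\<aleph>\<^sub>0\<close>.
\<close>

definition has_hilbert_dim :: "'a::complex_inner_space set \<Rightarrow> enat \<Rightarrow> bool" where
  "has_hilbert_dim V k \<longleftrightarrow> (\<exists>e :: nat \<Rightarrow> 'a.
     (\<forall>i. enat i < k \<longrightarrow> e i \<in> V) \<and>
     (\<forall>i j. enat i < k \<longrightarrow> enat j < k \<longrightarrow> cinner (e i) (e j) = (if i = j then 1 else 0)) \<and>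
     (\<forall>x\<in>V. (\<forall>i. enat i < k \<longrightarrow> cinner x (e i) = 0) \<longrightarrow> x = 0))"

definition orth_proj :: "'a::complex_inner_space set \<Rightarrow> 'a \<Rightarrow> 'a" where
  "orth_proj V x = (THE y. y \<in> V \<and> (\<forall>v\<in>V. cinner (x - y) v = 0))"


section \<open>Possibly unbounded operators\<close>

text \<open>
  A densely defined operator in a closed subspace \<open>V\<close> is represented by its graph, a subset of
  \<open>V \<times> V\<close>.
\<close>

definition zero_operator :: "'a::complex_inner_space set \<Rightarrow> ('a \<times> 'a) set" where
  "zero_operator V = V \<times> {0}"

definition operator_sum :: "('a \<times> 'a) set \<Rightarrow> ('b \<times> 'b) set \<Rightarrow> (('a \<times> 'b) \<times> ('a \<times> 'b)) set" where
  "operator_sum S T = {((x, u), (y, v)) | x u y v. (x, y) \<in> S \<and> (u, v) \<in> T}"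

definition unitary_between ::
  "('a::complex_inner_space \<Rightarrow> 'b::complex_inner_space) \<Rightarrow> 'a set \<Rightarrow> 'b set \<Rightarrow> bool" where
  "unitary_between U V W \<longleftrightarrow>
     U ` V = W \<and>
     (\<forall>x\<in>V. \<forall>y\<in>V. U (x + y) = U x + U y) \<and>
     (\<forall>c. \<forall>x\<in>V. U (c *\<^sub>C x) = c *\<^sub>C U x) \<and>
     (\<forall>x\<in>V. \<forall>y\<in>V. cinner (U x) (U y) = cinner x y)"

text \<open>
  Operators are compared through their closures. A densely defined bounded operator is thereby
  identified with its bounded extension to the whole space, so that for bounded operators this is
  the usual unitary equivalence of everywhere defined operators; for unbounded closable
  operators it is equality of domains and values of the closures after the unitary change of space.
\<close>

definition unitarily_equivalent ::
  "'a::complex_inner_space set \<Rightarrow> ('a \<times> 'a) set \<Rightarrow>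
   'b::complex_inner_space set \<Rightarrow> ('b \<times> 'b) set \<Rightarrow> bool" where
  "unitarily_equivalent V S W T \<longleftrightarrow>
     (\<exists>U. unitary_between U V W \<and> map_prod U U ` closure S = closure T)"


section \<open>The space \<open>L\<^sup>2\<close> of the unit circle\<close>

text \<open>Normalized Lebesgue measure on the unit circle, as a Borel measure on the complex plane.\<close>

definition circle_measure :: "complex measure" where
  "circle_measure = distr (uniform_measure lborel {0..2 * pi}) borel cis"

lemma sets_circle_measure [measurable_cong, simp]: "sets circle_measure = sets borel"
  by (simp add: circle_measure_def)

definition square_integrable :: "(complex \<Rightarrow> complex) \<Rightarrow> bool" where
  "square_integrable f \<longleftrightarrow> f \<in> borel_measurable borel \<and>
     integrable circle_measure (\<lambda>z. (cmod (f z))\<^sup>2)"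

lemma square_integrable_measurable [measurable_dest]:
  "square_integrable f \<Longrightarrow> f \<in> borel_measurable borel"
  by (simp add: square_integrable_def)

lemma square_integrable_zero: "square_integrable (\<lambda>z. 0)"
  by (simp add: square_integrable_def)

lemma square_integrable_add:
  assumes "square_integrable f" "square_integrable g"
  shows "square_integrable (\<lambda>z. f z + g z)"
proof -
  have [measurable]: "f \<in> borel_measurable borel" "g \<in> borel_measurable borel"
    using assms by (auto simp: square_integrable_def)
  have "integrable circle_measure (\<lambda>z. (cmod (f z + g z))\<^sup>2)"
  proof (rule Bochner_Integration.integrable_bound)
    show "integrable circle_measure (\<lambda>z. 2 * (cmod (f z))\<^sup>2 + 2 * (cmod (g z))\<^sup>2)"
      using assms by (auto simp: square_integrable_def)
    have "(cmod (f z + g z))\<^sup>2 \<le> 2 * (cmod (f z))\<^sup>2 + 2 * (cmod (g z))\<^sup>2" for z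
    proof -
      have "(cmod (f z + g z))\<^sup>2 \<le> (cmod (f z) + cmod (g z))\<^sup>2"
        by (intro power_mono norm_triangle_ineq) simp
      also have "\<dots> \<le> 2 * (cmod (f z))\<^sup>2 + 2 * (cmod (g z))\<^sup>2"
        using zero_le_power2[of "cmod (f z) - cmod (g z)"] by (simp add: power2_eq_square algebra_simps)
      finally show ?thesis .
    qed
    then show "AE z in circle_measure. norm ((cmod (f z + g z))\<^sup>2)
        \<le> norm (2 * (cmod (f z))\<^sup>2 + 2 * (cmod (g z))\<^sup>2)"
      by simp
  qed simp
  then show ?thesis
    by (simp add: square_integrable_def)
qed

lemma square_integrable_mult_const:
  assumes "square_integrable f"
  shows "square_integrable (\<lambda>z. c * f z)"
  using assms by (auto simp: square_integrable_def norm_mult power_mult_distrib)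

lemma square_integrable_cnj:
  assumes "square_integrable f"
  shows "square_integrable (\<lambda>z. cnj (f z))"
proof -
  have "(\<lambda>z. cnj (f z)) \<in> borel_measurable borel"
    using assms continuous_on_cnj[OF continuous_on_id, of UNIV]
    by (intro measurable_compose[OF square_integrable_measurable, of f cnj]
          borel_measurable_continuous_onI) auto
  then show ?thesis
    using assms by (simp add: square_integrable_def)
qed

lemma integrable_cnj_product:
  assumes "square_integrable f" "square_integrable g"
  shows "integrable circle_measure (\<lambda>z. f z * cnj (g z))"
proof -
  have [measurable]: "f \<in> borel_measurable borel" "(\<lambda>z. cnj (g z)) \<in> borel_measurable borel"
    using assms square_integrable_cnj[OF assms(2)] by (auto simp: square_integrable_def)
  show ?thesis
  proof (rule Bochner_Integration.integrable_bound)
    show "integrable circle_measure (\<lambda>z. (cmod (f z))\<^sup>2 + (cmod (g z))\<^sup>2)"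
      using assms by (auto simp: square_integrable_def)
    have "cmod (f z * cnj (g z)) \<le> (cmod (f z))\<^sup>2 + (cmod (g z))\<^sup>2" for z
    proof -
      have "2 * (cmod (f z) * cmod (g z)) \<le> (cmod (f z))\<^sup>2 + (cmod (g z))\<^sup>2"
        using sum_squares_bound[of "cmod (f z)" "cmod (g z)"] by (simp add: mult.assoc)
      moreover have "0 \<le> cmod (f z) * cmod (g z)" by simp
      ultimately have "cmod (f z) * cmod (g z) \<le> (cmod (f z))\<^sup>2 + (cmod (g z))\<^sup>2"
        by linarith
      then show ?thesis by (simp add: norm_mult)
    qed
    then show "AE z in circle_measure. norm (f z * cnj (g z))
        \<le> norm ((cmod (f z))\<^sup>2 + (cmod (g z))\<^sup>2)"
      by simp
  qed simp
qed

definition L2_rel :: "(complex \<Rightarrow> complex) \<Rightarrow> (complex \<Rightarrow> complex) \<Rightarrow> bool" where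
  "L2_rel f g \<longleftrightarrow> square_integrable f \<and> square_integrable g \<and> (AE z in circle_measure. f z = g z)"

quotient_type circle_L2 = "complex \<Rightarrow> complex" / partial: L2_rel
proof (rule part_equivpI)
  show "\<exists>f. L2_rel f f"
    using square_integrable_zero by (auto simp: L2_rel_def)
  show "symp L2_rel"
    by (rule sympI) (auto simp: L2_rel_def eq_commute)
  show "transp L2_rel"
  proof (rule transpI)
    fix f g h assume "L2_rel f g" "L2_rel g h"
    then show "L2_rel f h"
      unfolding L2_rel_def by (auto elim: AE_mp)
  qed
qed

instantiation circle_L2 :: complex_inner_space
begin

lift_definition zero_circle_L2 :: circle_L2 is "\<lambda>z. 0"
  by (simp add: L2_rel_def square_integrable_zero)

lift_definition plus_circle_L2 :: "circle_L2 \<Rightarrow> circle_L2 \<Rightarrow> circle_L2" is "\<lambda>f g z. f z + g z"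
  unfolding L2_rel_def by (auto intro: square_integrable_add)

lift_definition scaleC_circle_L2 :: "complex \<Rightarrow> circle_L2 \<Rightarrow> circle_L2" is "\<lambda>c f z. c * f z"
  unfolding L2_rel_def by (auto intro: square_integrable_mult_const)

lift_definition cinner_circle_L2 :: "circle_L2 \<Rightarrow> circle_L2 \<Rightarrow> complex"
  is "\<lambda>f g. \<integral>z. f z * cnj (g z) \<partial>circle_measure"
proof -
  fix f f' g g' assume *: "L2_rel f f'" "L2_rel g g'"
  then have "AE z in circle_measure. f z * cnj (g z) = f' z * cnj (g' z)"
    unfolding L2_rel_def by auto
  moreover have "integrable circle_measure (\<lambda>z. f z * cnj (g z))"
    "integrable circle_measure (\<lambda>z. f' z * cnj (g' z))"
    using * by (auto simp: L2_rel_def intro!: integrable_cnj_product)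
  ultimately show "(\<integral>z. f z * cnj (g z) \<partial>circle_measure) = (\<integral>z. f' z * cnj (g' z) \<partial>circle_measure)"
    by (intro integral_cong_AE) auto
qed

definition uminus_circle_L2 :: "circle_L2 \<Rightarrow> circle_L2" where
  "uminus_circle_L2 f = (-1) *\<^sub>C f"

definition minus_circle_L2 :: "circle_L2 \<Rightarrow> circle_L2 \<Rightarrow> circle_L2" where
  "minus_circle_L2 f g = f + (- g)"

definition scaleR_circle_L2 :: "real \<Rightarrow> circle_L2 \<Rightarrow> circle_L2" where
  "scaleR_circle_L2 r f = complex_of_real r *\<^sub>C f"

definition inner_circle_L2 :: "circle_L2 \<Rightarrow> circle_L2 \<Rightarrow> real" where
  "inner_circle_L2 f g = Re (cinner f g)"

definition norm_circle_L2 :: "circle_L2 \<Rightarrow> real" where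
  "norm_circle_L2 f = sqrt (inner f f)"

definition sgn_circle_L2 :: "circle_L2 \<Rightarrow> circle_L2" where
  "sgn_circle_L2 f = inverse (norm f) *\<^sub>R f"

definition dist_circle_L2 :: "circle_L2 \<Rightarrow> circle_L2 \<Rightarrow> real" where
  "dist_circle_L2 f g = norm (f - g)"

definition uniformity_circle_L2 :: "(circle_L2 \<times> circle_L2) filter" where
  "uniformity_circle_L2 = (INF e\<in>{0 <..}. principal {(x, y). dist x y < e})"

definition open_circle_L2 :: "circle_L2 set \<Rightarrow> bool" where
  "open_circle_L2 U \<longleftrightarrow> (\<forall>x\<in>U. eventually (\<lambda>(x', y). x' = x \<longrightarrow> y \<in> U) uniformity)"

instance
proof
  fix a b :: complex and r s :: real and x y z :: circle_L2 and V :: "circle_L2 set"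
  have add_assoc: "x + y + z = x + (y + z)" for x y z :: circle_L2
    by transfer (auto simp: L2_rel_def algebra_simps intro!: square_integrable_add)
  have add_commute: "x + y = y + x" for x y :: circle_L2
    by transfer (auto simp: L2_rel_def algebra_simps intro!: square_integrable_add)
  have add_zero: "0 + x = x" for x :: circle_L2
    by transfer (auto simp: L2_rel_def)
  have neg: "- x + x = 0" for x :: circle_L2
    unfolding uminus_circle_L2_def
    by transfer (auto simp: L2_rel_def intro!: square_integrable_zero)
  have sar: "c *\<^sub>C (x + y) = c *\<^sub>C x + c *\<^sub>C y" for c and x y :: circle_L2
    by transfer (auto simp: L2_rel_def algebra_simps
        intro!: square_integrable_add square_integrable_mult_const)
  have sal: "(c + d) *\<^sub>C x = c *\<^sub>C x + d *\<^sub>C x" for c d and x :: circle_L2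
    by transfer (auto simp: L2_rel_def algebra_simps
        intro!: square_integrable_add square_integrable_mult_const)
  have ss: "c *\<^sub>C d *\<^sub>C x = (c * d) *\<^sub>C x" for c d and x :: circle_L2
    by transfer (auto simp: L2_rel_def algebra_simps intro!: square_integrable_mult_const)
  have one: "1 *\<^sub>C x = x" for x :: circle_L2
    by transfer (auto simp: L2_rel_def)
  have cc: "cinner x y = cnj (cinner y x)" for x y :: circle_L2
    by transfer (simp add: L2_rel_def Bochner_Integration.integral_cnj[symmetric] mult.commute)
  have cal: "cinner (x + y) z = cinner x z + cinner y z" for x y z :: circle_L2
    by transfer (simp add: L2_rel_def distrib_right integrable_cnj_product)
  have csl: "cinner (c *\<^sub>C x) y = c * cinner x y" for c and x y :: circle_L2
    by transfer (simp add: L2_rel_def mult.assoc)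
  have self: "Re (cinner x x) \<ge> 0 \<and> (Re (cinner x x) = 0 \<longrightarrow> x = 0)" for x :: circle_L2
  proof (transfer, goal_cases)
    case (1 f)
    then have f: "square_integrable f" by (simp add: L2_rel_def)
    have eq: "f z * cnj (f z) = complex_of_real ((cmod (f z))\<^sup>2)" for z
      by (metis complex_norm_square)
    have re: "Re (\<integral>z. f z * cnj (f z) \<partial>circle_measure) = (\<integral>z. (cmod (f z))\<^sup>2 \<partial>circle_measure)"
      unfolding eq by (simp only: integral_complex_of_real Re_complex_of_real)
    have "(\<integral>z. (cmod (f z))\<^sup>2 \<partial>circle_measure) = 0 \<longleftrightarrow> (AE z in circle_measure. (cmod (f z))\<^sup>2 = 0)"
      using f by (intro integral_nonneg_eq_0_iff_AE) (auto simp: square_integrable_def)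
    then show ?case
      using f unfolding re by (auto simp: L2_rel_def square_integrable_zero)
  qed
  show "x + y + z = x + (y + z)" by (rule add_assoc)
  show "x + y = y + x" by (rule add_commute)
  show "0 + x = x" by (rule add_zero)
  show "- x + x = 0" by (rule neg)
  show "x - y = x + - y" by (rule minus_circle_L2_def)
  show "r *\<^sub>R (x + y) = r *\<^sub>R x + r *\<^sub>R y" by (simp add: scaleR_circle_L2_def sar)
  show "(r + s) *\<^sub>R x = r *\<^sub>R x + s *\<^sub>R x" by (simp add: scaleR_circle_L2_def sal)
  show "r *\<^sub>R s *\<^sub>R x = (r * s) *\<^sub>R x" by (simp add: scaleR_circle_L2_def ss)
  show "1 *\<^sub>R x = x" by (simp add: scaleR_circle_L2_def one)
  show "sgn x = inverse (norm x) *\<^sub>R x" by (rule sgn_circle_L2_def)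
  show "dist x y = norm (x - y)" by (rule dist_circle_L2_def)
  show "uniformity = (INF e\<in>{0 <..}. principal {(x, y :: circle_L2). dist x y < e})"
    by (rule uniformity_circle_L2_def)
  show "open V \<longleftrightarrow> (\<forall>x\<in>V. eventually (\<lambda>(x', y). x' = x \<longrightarrow> y \<in> V) uniformity)"
    by (rule open_circle_L2_def)
  show "inner x y = inner y x"
    unfolding inner_circle_L2_def by (subst cc) simp
  show "inner (x + y) z = inner x z + inner y z" by (simp add: inner_circle_L2_def cal)
  show "inner (r *\<^sub>R x) y = r * inner x y"
    by (simp add: inner_circle_L2_def scaleR_circle_L2_def csl)
  show "0 \<le> inner x x" using self by (simp add: inner_circle_L2_def)
  have "cinner 0 (0 :: circle_L2) = 0" by transfer simp
  then show "inner x x = 0 \<longleftrightarrow> x = 0" using self[of x] by (auto simp: inner_circle_L2_def)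
  show "norm x = sqrt (inner x x)" by (rule norm_circle_L2_def)
  show "a *\<^sub>C (x + y) = a *\<^sub>C x + a *\<^sub>C y" by (rule sar)
  show "(a + b) *\<^sub>C x = a *\<^sub>C x + b *\<^sub>C x" by (rule sal)
  show "a *\<^sub>C b *\<^sub>C x = (a * b) *\<^sub>C x" by (rule ss)
  show "complex_of_real r *\<^sub>C x = r *\<^sub>R x" by (simp add: scaleR_circle_L2_def)
  show "cinner x y = cnj (cinner y x)" by (rule cc)
  show "cinner (x + y) z = cinner x z + cinner y z" by (rule cal)
  show "cinner (a *\<^sub>C x) y = a * cinner x y" by (rule csl)
  show "inner x y = Re (cinner x y)" by (rule inner_circle_L2_def)
qed

end

lift_definition cnj_L2 :: "circle_L2 \<Rightarrow> circle_L2" is "\<lambda>f z. cnj (f z)"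
  unfolding L2_rel_def by (auto intro: square_integrable_cnj)

lift_definition mult_in_L2 :: "circle_L2 \<Rightarrow> circle_L2 \<Rightarrow> bool"
  is "\<lambda>f g. square_integrable (\<lambda>z. f z * g z)"
proof -
  have *: "square_integrable (\<lambda>z. f' z * g' z)"
    if "L2_rel f f'" "L2_rel g g'" "square_integrable (\<lambda>z. f z * g z)" for f f' g g'
  proof -
    have [measurable]: "f \<in> borel_measurable borel" "g \<in> borel_measurable borel"
      "f' \<in> borel_measurable borel" "g' \<in> borel_measurable borel"
      using that by (auto simp: L2_rel_def square_integrable_def)
    have "AE z in circle_measure. (cmod (f z * g z))\<^sup>2 = (cmod (f' z * g' z))\<^sup>2"
      using that by (auto simp: L2_rel_def)
    then have "integrable circle_measure (\<lambda>z. (cmod (f z * g z))\<^sup>2)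
        \<longleftrightarrow> integrable circle_measure (\<lambda>z. (cmod (f' z * g' z))\<^sup>2)"
      by (intro integrable_cong_AE) auto
    then show ?thesis
      using that by (simp add: square_integrable_def)
  qed
  have sym: "L2_rel g f" if "L2_rel f g" for f g
    using that by (auto simp: L2_rel_def eq_commute)
  fix f f' g g' assume "L2_rel f f'" "L2_rel g g'"
  then show "square_integrable (\<lambda>z. f z * g z) = square_integrable (\<lambda>z. f' z * g' z)"
    using * sym by metis
qed

text \<open>
  The pointwise product is only meaningful here when it lies in \<open>L\<^sup>2\<close>, i.e. under \<open>mult_in_L2\<close>
  (for instance if one factor is unimodular); otherwise it takes the dummy value \<open>0\<close>.
\<close>

lift_definition mult_L2 :: "circle_L2 \<Rightarrow> circle_L2 \<Rightarrow> circle_L2" (infixl "\<odot>" 70)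
  is "\<lambda>f g. if square_integrable (\<lambda>z. f z * g z) then (\<lambda>z. f z * g z) else (\<lambda>z. 0)"
proof -
  fix f f' g g' assume *: "L2_rel f f'" "L2_rel g g'"
  have "square_integrable (\<lambda>z. f z * g z) = square_integrable (\<lambda>z. f' z * g' z)"
    using * mult_in_L2.rsp unfolding rel_fun_def by blast
  moreover have "AE z in circle_measure. f z * g z = f' z * g' z"
    using * by (auto simp: L2_rel_def)
  ultimately show "L2_rel
      (if square_integrable (\<lambda>z. f z * g z) then (\<lambda>z. f z * g z) else (\<lambda>z. 0))
      (if square_integrable (\<lambda>z. f' z * g' z) then (\<lambda>z. f' z * g' z) else (\<lambda>z. 0))"
    by (simp add: L2_rel_def square_integrable_zero)
qed

lift_definition unimodular :: "circle_L2 \<Rightarrow> bool"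
  is "\<lambda>f. AE z in circle_measure. cmod (f z) = 1"
proof -
  fix f g assume "L2_rel f g"
  then have "AE z in circle_measure. f z = g z" by (simp add: L2_rel_def)
  then show "(AE z in circle_measure. cmod (f z) = 1) = (AE z in circle_measure. cmod (g z) = 1)"
    by (intro eventually_subst) (auto elim: eventually_mono)
qed

lift_definition fourier_coeff :: "circle_L2 \<Rightarrow> int \<Rightarrow> complex"
  is "\<lambda>f k. \<integral>z. f z * z powi (- k) \<partial>circle_measure"
proof -
  have pw: "(\<lambda>z::complex. z powi m) \<in> borel_measurable borel" for m
    unfolding power_int_def by measurable
  fix f g assume "L2_rel f g"
  then show "(\<lambda>k. \<integral>z. f z * z powi (- k) \<partial>circle_measure) = (\<lambda>k. \<integral>z. g z * z powi (- k) \<partial>circle_measure)"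
    using pw by (intro ext integral_cong_AE) (auto simp: L2_rel_def square_integrable_def)
qed


section \<open>Model spaces and truncated Toeplitz operators\<close>

definition Hardy2 :: "circle_L2 set" where
  "Hardy2 = {f. \<forall>k<0. fourier_coeff f k = 0}"

definition inner_function :: "circle_L2 \<Rightarrow> bool" where
  "inner_function \<Theta> \<longleftrightarrow> \<Theta> \<in> Hardy2 \<and> unimodular \<Theta>"

definition model_space :: "circle_L2 \<Rightarrow> circle_L2 set" where
  "model_space \<Theta> = {f \<in> Hardy2. \<forall>h\<in>Hardy2. cinner f (\<Theta> \<odot> h) = 0}"

text \<open>
  The graph of \<open>f \<mapsto> P\<^sub>\<Theta> (\<phi> f)\<close> on its natural domain, the \<open>f \<in> K\<^sub>\<Theta>\<close> with \<open>\<phi> f \<in> L\<^sup>2\<close>; this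
  domain contains all bounded functions of \<open>K\<^sub>\<Theta>\<close>.
\<close>

definition truncated_Toeplitz :: "circle_L2 \<Rightarrow> circle_L2 \<Rightarrow> (circle_L2 \<times> circle_L2) set" where
  "truncated_Toeplitz \<Theta> \<phi> =
     {(f, orth_proj (model_space \<Theta>) (\<phi> \<odot> f)) | f. f \<in> model_space \<Theta> \<and> mult_in_L2 \<phi> f}"

end

theory Submission
  imports Defs
begin

text \<open>
  Replacing \<open>B\<close> by \<open>b = cnj \<zeta> B\<close> changes neither the model space nor the operator and reduces to \<open>\<zeta> = 1\<close>.
  The operator \<open>A\<close> with symbol \<open>\<psi> (1 + cnj b)\<close> commutes with a Clark unitary operator \<open>U\<close> of \<open>K\<^sub>b\<close>; in
  the spectral representation of \<open>U\<close> it is the multiplication by \<open>\<psi>\<close>. Hence the bounded functions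
  \<open>U\<^sup>n k\<^sub>0\<close> form a core of \<open>A\<close>, which settles all questions about domains of unbounded operators.

  Let \<open>u\<close> be an inner function with \<open>u(0) = 0\<close>, \<open>u(1) = 1\<close> that is smooth near \<open>1\<close>, let \<open>s = u \<circ> b\<close>,
  \<open>s\<^sub>1 = s / b\<close>, and let \<open>k = (1 - s) / (1 - b)\<close> come from the reproducing kernel of \<open>K\<^sub>u\<close> at the boundary
  point \<open>1\<close>. With \<open>K = k(1)\<close>, multiplication by \<open>k / \<surd>K\<close> embeds \<open>K\<^sub>b\<close> isometrically in \<open>K\<^sub>s\<close>, the complement
  \<open>W\<close> of its range is the closure of \<open>(1 - b) K\<^sub>s\<^sub>1\<close>, and the truncated Toeplitz operator with symbol
  \<open>\<psi> (k + cnj (b k)) / K\<close> is \<open>A\<close> on the range and \<open>0\<close> on \<open>W\<close>. The choice \<open>u(w) = w\<^sup>n\<^sup>+\<^sup>1\<close> gives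
  \<open>dim W = n d\<close>; the choice \<open>u(w) = w exp (- (1 - w) / (1 + w))\<close> gives \<open>dim W = \<infinity>\<close>.
\<close>

section \<open>Complex inner product spaces\<close>

text \<open>The symbol is only square integrable, so the operators may be unbounded, and agreement
  on a core does not by itself identify the closures. Both closed graphs are therefore computed. A
  closed relation \<open>N\<close>, written down by adjoint equations, contains the Toeplitz graph
  of the new symbol and the transported graph of the direct sum; a set \<open>R\<close> of bounded
  pairs lies in both graphs. Once no nonzero element of \<open>N\<close> is orthogonal to
  \<open>R\<close>, both closures equal \<open>N\<close>. This totality is a uniqueness statement
  about the Clark operator, obtained without a spectral theorem. The isometry comes from the
  expansion of \<open>k\<close> where \<open>b\<close> is near 1: almost everywhere
  \<open>k * cnj k\<close> is \<open>K\<close> plus \<open>b\<close> times a bounded Hardy function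
  plus \<open>cnj b\<close> times the conjugate of one, and such terms integrate to zero against
  \<open>f * cnj g\<close> for \<open>f\<close>, \<open>g\<close> in the model space of
  \<open>b\<close>. The symbol is found from \<open>(k + cnj (b * k)) * (1 - b) = cnj s - s\<close>.
  Smoothness of \<open>u\<close> keeps \<open>(k - K) / (1 - b)\<close> bounded. The exponential
  choice serves infinitely many copies of a finite dimensional space; infinitely many copies of an
  infinite dimensional one amount to a single copy.\<close>

lemma scaleC_zero_left [simp]: "0 *\<^sub>C (x::'a::complex_inner_space) = 0"
  using scaleC_of_real[of 0 x] by simp

lemma scaleC_one [simp]: "1 *\<^sub>C (x::'a::complex_inner_space) = x"
  using scaleC_of_real[of 1 x] by simp

lemma scaleC_minus_one [simp]: "(-1) *\<^sub>C (x::'a::complex_inner_space) = - x"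
  using scaleC_of_real[of "-1" x] by simp

lemma scaleC_zero_right [simp]: "a *\<^sub>C (0::'a::complex_inner_space) = 0"
  using scaleC_add_right[of a 0 0] by simp

lemma cinner_zero_left [simp]: "cinner 0 (x::'a::complex_inner_space) = 0"
  using cinner_add_left[of 0 0 x] by simp

lemma cinner_zero_right [simp]: "cinner (x::'a::complex_inner_space) 0 = 0"
  by (subst cinner_commute) simp

lemma cinner_add_right: "cinner (x::'a::complex_inner_space) (y + z) = cinner x y + cinner x z"
  by (metis cinner_add_left cinner_commute complex_cnj_add)

lemma cinner_scaleC_right: "cinner (x::'a::complex_inner_space) (a *\<^sub>C y) = cnj a * cinner x y"
  by (metis cinner_scaleC_left cinner_commute complex_cnj_mult)

lemma cinner_minus_left [simp]: "cinner (- x::'a::complex_inner_space) y = - cinner x y"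
  using cinner_scaleC_left[of "-1" x y] by simp

lemma cinner_minus_right [simp]: "cinner (x::'a::complex_inner_space) (- y) = - cinner x y"
  using cinner_scaleC_right[of x "-1" y] by simp

lemma cinner_diff_left: "cinner (x - y::'a::complex_inner_space) z = cinner x z - cinner y z"
  using cinner_add_left[of x "-y" z] by simp

lemma cinner_diff_right: "cinner (x::'a::complex_inner_space) (y - z) = cinner x y - cinner x z"
  using cinner_add_right[of x y "-z"] by simp

lemmas cinner_linear = cinner_add_left cinner_add_right cinner_diff_left cinner_diff_right
  cinner_scaleC_left cinner_scaleC_right

lemma cinner_eq_0_commute: "cinner (x::'a::complex_inner_space) y = 0 \<longleftrightarrow> cinner y x = 0"
  by (metis cinner_commute complex_cnj_zero)

lemma cinner_self: "cinner (x::'a::complex_inner_space) x = complex_of_real ((norm x)\<^sup>2)"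
proof -
  have "Im (cinner x x) = 0"
    using cinner_commute[of x x] by (metis Reals_cnj_iff complex_is_Real_iff)
  then show ?thesis
    by (simp add: complex_eq_iff power2_norm_eq_inner inner_eq_Re_cinner)
qed

lemma cinner_self_eq_0 [simp]: "cinner (x::'a::complex_inner_space) x = 0 \<longleftrightarrow> x = 0"
  by (simp add: cinner_self)

lemma norm_scaleC: "norm (a *\<^sub>C (x::'a::complex_inner_space)) = cmod a * norm x"
proof -
  have "cinner (a *\<^sub>C x) (a *\<^sub>C x) = (a * cnj a) * cinner x x"
    by (simp add: cinner_scaleC_left cinner_scaleC_right)
  then have "complex_of_real ((norm (a *\<^sub>C x))\<^sup>2) = complex_of_real ((cmod a * norm x)\<^sup>2)"
    unfolding cinner_self complex_norm_square[symmetric] by (simp add: power_mult_distrib)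
  then have "(norm (a *\<^sub>C x))\<^sup>2 = (cmod a * norm x)\<^sup>2" by (rule of_real_eq_iff[THEN iffD1])
  then show ?thesis by simp
qed

text \<open>The imaginary part is the real inner product of \<open>x\<close> with
  \<open>\<i> *\<^sub>C y\<close>. Continuity of \<open>cinner\<close> thereby reduces to that of
  the real inner product.\<close>

lemma cinner_eq_inner:
  "cinner (x::'a::complex_inner_space) y = complex_of_real (inner x y) + \<i> * complex_of_real (inner x (\<i> *\<^sub>C y))"
  by (simp add: complex_eq_iff inner_eq_Re_cinner cinner_scaleC_right)

lemma tendsto_scaleC:
  assumes "(f \<longlongrightarrow> (l::'a::complex_inner_space)) F"
  shows "((\<lambda>x. a *\<^sub>C f x) \<longlongrightarrow> a *\<^sub>C l) F"
proof -
  have "bounded_linear (\<lambda>x::'a. a *\<^sub>C x)"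
    by (rule bounded_linear_intro[of _ "cmod a"])
      (auto simp: scaleC_add_right norm_scaleC scaleC_of_real[symmetric] scaleC_scaleC mult.commute)
  from bounded_linear.tendsto[OF this assms] show ?thesis .
qed

lemma tendsto_cinner:
  assumes "(f \<longlongrightarrow> (l::'a::complex_inner_space)) F" "(g \<longlongrightarrow> m) F"
  shows "((\<lambda>x. cinner (f x) (g x)) \<longlongrightarrow> cinner l m) F"
  unfolding cinner_eq_inner by (intro tendsto_intros tendsto_scaleC assms)

lemma csubspaceD:
  assumes "csubspace V"
  shows "0 \<in> V" "x \<in> V \<Longrightarrow> y \<in> V \<Longrightarrow> x + y \<in> V" "x \<in> V \<Longrightarrow> c *\<^sub>C x \<in> V"
    "x \<in> V \<Longrightarrow> y \<in> V \<Longrightarrow> x - y \<in> V" "x \<in> V \<Longrightarrow> - x \<in> V" "x \<in> V \<Longrightarrow> r *\<^sub>R x \<in> V"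
proof -
  show "0 \<in> V" "x \<in> V \<Longrightarrow> y \<in> V \<Longrightarrow> x + y \<in> V" and s: "x \<in> V \<Longrightarrow> c *\<^sub>C x \<in> V" for x y c
    using assms by (auto simp: csubspace_def)
  show "x \<in> V \<Longrightarrow> - x \<in> V" "x \<in> V \<Longrightarrow> r *\<^sub>R x \<in> V" for x r
    using s[of x "-1"] s[of x "complex_of_real r"] by (auto simp: scaleC_of_real)
  then show "x \<in> V \<Longrightarrow> y \<in> V \<Longrightarrow> x - y \<in> V" for x y
    using assms unfolding csubspace_def by (metis uminus_add_conv_diff add.commute)
qed

lemma csubspace_sum:
  "csubspace V \<Longrightarrow> (\<And>i. i \<in> I \<Longrightarrow> f i \<in> V) \<Longrightarrow> sum f I \<in> V"
  by (induction I rule: infinite_finite_induct) (auto simp: csubspaceD)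

lemma csubspace_Int: "csubspace V \<Longrightarrow> csubspace W \<Longrightarrow> csubspace (V \<inter> W)"
  by (auto simp: csubspace_def)

lemma csubspace_Times: "csubspace V \<Longrightarrow> csubspace W \<Longrightarrow> csubspace (V \<times> W)"
  by (auto simp: csubspace_def scaleC_prod_def zero_prod_def)

lemma csubspace_closure:
  fixes V :: "'a::complex_inner_space set"
  assumes "csubspace V" shows "csubspace (closure V)"
  unfolding csubspace_def
proof (intro conjI ballI allI)
  show "0 \<in> closure V" using csubspaceD(1)[OF assms] closure_subset by blast
next
  fix x y assume "x \<in> closure V" "y \<in> closure V"
  then obtain f g where "\<And>n. f n \<in> V" "f \<longlonglongrightarrow> x" "\<And>n. g n \<in> V" "g \<longlonglongrightarrow> y"
    by (meson closure_sequential)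
  then show "x + y \<in> closure V"
    unfolding closure_sequential using csubspaceD(2)[OF assms]
    by (intro exI[of _ "\<lambda>n. f n + g n"]) (auto intro: tendsto_add)
next
  fix x c assume "x \<in> closure V"
  then obtain f where "\<And>n. f n \<in> V" "f \<longlonglongrightarrow> x"
    by (meson closure_sequential)
  then show "c *\<^sub>C x \<in> closure V"
    unfolding closure_sequential using csubspaceD(3)[OF assms]
    by (intro exI[of _ "\<lambda>n. c *\<^sub>C f n"]) (auto intro: tendsto_scaleC)
qed

section \<open>Orthogonal complements and the projection theorem\<close>

definition orth_compl :: "'a::complex_inner_space set \<Rightarrow> 'a set" where
  "orth_compl S = {x. \<forall>y\<in>S. cinner x y = 0}"

lemma csubspace_orth_compl: "csubspace (orth_compl S)"
  by (auto simp: csubspace_def orth_compl_def cinner_linear)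

text \<open>The later spaces are written as intersections with orthogonal complements, so that
  closedness, and with it completeness, comes from here.\<close>

lemma closed_orth_compl: "closed (orth_compl S)"
  unfolding closed_sequential_limits
proof (intro allI impI, elim conjE)
  fix f l assume f: "\<forall>n. f n \<in> orth_compl S" and l: "f \<longlonglongrightarrow> l"
  have "cinner l y = 0" if "y \<in> S" for y
  proof -
    have "(\<lambda>n. cinner (f n) y) \<longlonglongrightarrow> cinner l y" by (rule tendsto_cinner[OF l tendsto_const])
    moreover have "(\<lambda>n. cinner (f n) y) = (\<lambda>n. 0)" using f that by (auto simp: orth_compl_def)
    ultimately show ?thesis using LIMSEQ_unique tendsto_const by metis
  qed
  then show "l \<in> orth_compl S" by (auto simp: orth_compl_def)
qed

lemma complete_Int_closed: "complete (S::'a::metric_space set) \<Longrightarrow> closed T \<Longrightarrow> complete (S \<inter> T)"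
  by (meson complete_closed_subset complete_imp_closed closed_Int inf_le1)

lemma complete_Times:
  fixes S :: "'a::metric_space set" and T :: "'b::metric_space set"
  assumes "complete S" "complete T"
  shows "complete (S \<times> T)"
  unfolding complete_def
proof (intro allI impI, elim conjE)
  fix f assume f: "\<forall>n. f n \<in> S \<times> T" and C: "Cauchy f"
  have "Cauchy (\<lambda>n. fst (f n))" "Cauchy (\<lambda>n. snd (f n))"
    using Cauchy_fst[OF C] Cauchy_snd[OF C] by auto
  moreover have "\<forall>n. fst (f n) \<in> S" "\<forall>n. snd (f n) \<in> T" using f by (auto simp: mem_Times_iff)
  ultimately obtain a b where "a \<in> S" "(\<lambda>n. fst (f n)) \<longlonglongrightarrow> a" "b \<in> T" "(\<lambda>n. snd (f n)) \<longlonglongrightarrow> b"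
    using assms unfolding complete_def by meson
  then show "\<exists>l\<in>S \<times> T. f \<longlonglongrightarrow> l"
    using tendsto_Pair[of "\<lambda>n. fst (f n)" a sequentially "\<lambda>n. snd (f n)" b] by auto
qed

text \<open>First variation at a minimum: for small \<open>t\<close> of suitable sign a nonzero
  linear term would outweigh the quadratic one.\<close>

lemma real_quadratic_nonneg:
  fixes a b :: real
  assumes "\<And>t. 0 \<le> t * a + t\<^sup>2 * b" and "b \<ge> 0"
  shows "a = 0"
proof (rule ccontr)
  assume a: "a \<noteq> 0"
  \<comment> \<open>The denominator \<open>b + 1\<close>, instead of \<open>2 * b\<close> as for the
    vertex of the parabola, also covers \<open>b = 0\<close>.\<close>
  define t where "t = - a / (b + 1)"
  have "t * a + t\<^sup>2 * b = - (a\<^sup>2 / (b + 1)\<^sup>2)"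
  proof -
    have "t * a + t\<^sup>2 * b = - a\<^sup>2 / c + a\<^sup>2 * (c - 1) / c\<^sup>2" if "c = b + 1" for c
      unfolding t_def that by (simp add: power2_eq_square)
    moreover have "- a\<^sup>2 / c + a\<^sup>2 * (c - 1) / c\<^sup>2 = - (a\<^sup>2 / c\<^sup>2)" if "c > 0" for c
      using that by (simp add: power2_eq_square field_simps)
    ultimately show ?thesis using assms(2) by (metis add_nonneg_pos zero_less_one)
  qed
  moreover have "a\<^sup>2 / (b + 1)\<^sup>2 > 0" using a assms(2) by simp
  ultimately show False using assms(1)[of t] by simp
qed

text \<open>Completeness is required of \<open>V\<close> itself because the type of the added
  Hilbert space may be incomplete. A minimizing sequence is Cauchy by the parallelogram law, and the
  first variation at its limit vanishes.\<close>

theorem projection_exists: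
  fixes V :: "'a::complex_inner_space set"
  assumes V: "csubspace V" and cV: "complete V"
  shows "\<exists>y\<in>V. \<forall>v\<in>V. cinner (x - y) v = 0"
proof -
  define \<delta> where "\<delta> = infdist x V"
  have ne: "V \<noteq> {}" using csubspaceD(1)[OF V] by auto
  have d0: "\<delta> \<ge> 0" by (simp add: \<delta>_def infdist_nonneg)
  have dle: "\<delta> \<le> dist x v" if "v \<in> V" for v using that by (simp add: \<delta>_def infdist_le)
  have "\<exists>v\<in>V. dist x v < \<delta> + 1 / real (Suc n)" for n
    using cInf_less_iff[of "dist x ` V" "\<delta> + 1 / real (Suc n)"] ne
    by (auto simp: \<delta>_def infdist_notempty)
  then obtain v where v: "\<And>n. v n \<in> V" "\<And>n. dist x (v n) < \<delta> + 1 / real (Suc n)" by metis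
  have lim: "(\<lambda>n. dist x (v n)) \<longlonglongrightarrow> \<delta>"
  proof (rule tendsto_sandwich)
    show "(\<lambda>n. \<delta>) \<longlonglongrightarrow> \<delta>" by simp
    show "(\<lambda>n. \<delta> + 1 / real (Suc n)) \<longlonglongrightarrow> \<delta>"
      using tendsto_add[OF tendsto_const LIMSEQ_inverse_real_of_nat, of \<delta>]
      by (simp add: inverse_eq_divide)
    show "eventually (\<lambda>n. \<delta> \<le> dist x (v n)) sequentially"
      using dle[OF v(1)] by simp
    show "eventually (\<lambda>n. dist x (v n) \<le> \<delta> + 1 / real (Suc n)) sequentially"
      using v(2) by (intro always_eventually allI less_imp_le)
  qed
  \<comment> \<open>The midpoint \<open>w\<close> of \<open>v m\<close> and \<open>v n\<close> stays
    in \<open>V\<close>, so its distance to \<open>x\<close> is at least \<delta>; the parallelogram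
    law converts this into a bound on \<open>dist (v m) (v n)\<close>.\<close>
  have para: "(dist (v m) (v n))\<^sup>2 \<le> 2 * (dist x (v m))\<^sup>2 + 2 * (dist x (v n))\<^sup>2 - 4 * \<delta>\<^sup>2" for m n
  proof -
    define w where "w = (1/2) *\<^sub>R (v m + v n)"
    have "w \<in> V" unfolding w_def by (intro csubspaceD[OF V] v)
    then have "\<delta>\<^sup>2 \<le> (dist x w)\<^sup>2" using dle d0 by (simp add: power_mono)
    moreover have "4 * (dist x w)\<^sup>2 = (norm ((x - v m) + (x - v n)))\<^sup>2"
    proof -
      have "(x - v m) + (x - v n) = 2 *\<^sub>R (x - w)"
        by (simp add: w_def scaleR_2 algebra_simps)
      then show ?thesis by (simp add: dist_norm power_mult_distrib)
    qed
    moreover have "(norm ((x - v m) + (x - v n)))\<^sup>2 + (norm ((x - v m) - (x - v n)))\<^sup>2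
        = 2 * (norm (x - v m))\<^sup>2 + 2 * (norm (x - v n))\<^sup>2"
      by (simp add: power2_norm_eq_inner inner_add inner_diff inner_commute algebra_simps)
    moreover have "norm ((x - v m) - (x - v n)) = dist (v m) (v n)"
      by (simp add: dist_norm norm_minus_commute)
    ultimately show ?thesis by (simp add: dist_norm)
  qed
  have "Cauchy v"
    unfolding Cauchy_def
  proof (intro allI impI)
    fix e :: real assume e: "e > 0"
    have "(\<lambda>n. (dist x (v n))\<^sup>2) \<longlonglongrightarrow> \<delta>\<^sup>2" by (intro tendsto_intros lim)
    then have "eventually (\<lambda>n. (dist x (v n))\<^sup>2 < \<delta>\<^sup>2 + e\<^sup>2 / 4) sequentially"
      using e by (intro order_tendstoD) auto
    then obtain M where M: "\<And>n. n \<ge> M \<Longrightarrow> (dist x (v n))\<^sup>2 < \<delta>\<^sup>2 + e\<^sup>2 / 4"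
      by (auto simp: eventually_sequentially)
    have "dist (v m) (v n) < e" if "m \<ge> M" "n \<ge> M" for m n
    proof -
      have "(dist (v m) (v n))\<^sup>2 < e\<^sup>2"
        using para[of m n] M[OF that(1)] M[OF that(2)] by linarith
      then show ?thesis using e by (simp add: power_less_imp_less_base)
    qed
    then show "\<exists>M. \<forall>m\<ge>M. \<forall>n\<ge>M. dist (v m) (v n) < e" by blast
  qed
  then obtain y where y: "y \<in> V" "v \<longlonglongrightarrow> y" using cV v(1) unfolding complete_def by meson
  have dy: "dist x y = \<delta>"
    using LIMSEQ_unique[OF lim tendsto_dist[OF tendsto_const y(2)]] by simp
  have re: "Re (cinner (x - y) w) = 0" if w: "w \<in> V" for w
  proof (rule real_quadratic_nonneg[where b = "(norm w)\<^sup>2"])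
    fix t :: real
    have "y - (t/2) *\<^sub>R w \<in> V" by (intro csubspaceD[OF V] y(1) w)
    from dle[OF this] have "(norm (x - y))\<^sup>2 \<le> (norm (x - y + (t/2) *\<^sub>R w))\<^sup>2"
      using dy d0 by (intro power_mono) (auto simp: dist_norm algebra_simps)
    also have "\<dots> = (norm (x - y))\<^sup>2 + t * Re (cinner (x - y) w) + (t/2)\<^sup>2 * (norm w)\<^sup>2"
      unfolding power2_norm_eq_inner
      by (simp add: inner_add_left inner_add_right inner_eq_Re_cinner[symmetric] inner_commute
          power2_eq_square del: real_inner_class.inner_diff_left)
    finally have "0 \<le> t * Re (cinner (x - y) w) + (t\<^sup>2/4) * (norm w)\<^sup>2"
      by (simp add: power_divide)
    also have "\<dots> \<le> t * Re (cinner (x - y) w) + t\<^sup>2 * (norm w)\<^sup>2"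
      by (intro add_left_mono mult_right_mono) auto
    finally show "0 \<le> t * Re (cinner (x - y) w) + t\<^sup>2 * (norm w)\<^sup>2" .
  qed simp
  \<comment> \<open>Testing with \<open>\<i> *\<^sub>C w\<close> as well turns the vanishing real
    part into a vanishing imaginary part.\<close>
  have "cinner (x - y) w = 0" if w: "w \<in> V" for w
    using re[OF w] re[OF csubspaceD(3)[OF V w, of \<i>]]
    by (simp add: complex_eq_iff cinner_scaleC_right)
  then show ?thesis using y by blast
qed

lemma orth_proj_eqI:
  fixes V :: "'a::complex_inner_space set"
  assumes V: "csubspace V" and y: "y \<in> V" "\<And>v. v \<in> V \<Longrightarrow> cinner (x - y) v = 0"
  shows "orth_proj V x = y"
  unfolding orth_proj_def
proof (rule the_equality)
  fix z assume z: "z \<in> V \<and> (\<forall>v\<in>V. cinner (x - z) v = 0)"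
  have "z - y \<in> V" using z y csubspaceD(4)[OF V] by blast
  then have "cinner (x - y) (z - y) - cinner (x - z) (z - y) = 0" using z y by simp
  moreover have "cinner (x - y) (z - y) - cinner (x - z) (z - y) = cinner (z - y) (z - y)"
    unfolding cinner_diff_left[symmetric] by simp
  ultimately show "z = y" by simp
qed (use y in auto)

lemma orth_proj:
  fixes V :: "'a::complex_inner_space set"
  assumes V: "csubspace V" and cV: "complete V"
  shows orth_proj_in: "orth_proj V x \<in> V"
    and orth_proj_orth: "v \<in> V \<Longrightarrow> cinner (x - orth_proj V x) v = 0"
proof -
  obtain y where "y \<in> V" "\<forall>v\<in>V. cinner (x - y) v = 0"
    using projection_exists[OF V cV] by blast
  then show "orth_proj V x \<in> V" "v \<in> V \<Longrightarrow> cinner (x - orth_proj V x) v = 0"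
    using orth_proj_eqI[OF V] by auto
qed

lemma orth_proj_cinner:
  fixes V :: "'a::complex_inner_space set"
  assumes V: "csubspace V" "complete V" and "v \<in> V"
  shows "cinner (orth_proj V x) v = cinner x v" "cinner v (orth_proj V x) = cinner v x"
  using orth_proj_orth[OF assms, of x] cinner_commute[of v "orth_proj V x"] cinner_commute[of v x]
  by (auto simp: cinner_linear)

text \<open>The difference \<open>x - orth_proj Z x\<close> lies in \<open>V\<close> and is
  orthogonal to \<open>Z\<close>. With it, a linear property that defines a closed subspace is
  extended from a total set to all of \<open>V\<close>.\<close>

lemma total_subspace_eq:
  fixes V :: "'a::complex_inner_space set"
  assumes "csubspace Z" "complete Z" "Z \<subseteq> V" "csubspace V"
    and "\<And>x. x \<in> V \<Longrightarrow> (\<And>z. z \<in> Z \<Longrightarrow> cinner x z = 0) \<Longrightarrow> x = 0"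
  shows "Z = V"
proof (rule antisym[OF assms(3) subsetI])
  fix x assume x: "x \<in> V"
  have "x - orth_proj Z x = 0"
    using assms orth_proj[OF assms(1,2)] x csubspaceD(4)[OF assms(4)]
    by (metis subsetD)
  then show "x \<in> Z" using orth_proj_in[OF assms(1,2), of x] by simp
qed

section \<open>Unitary maps and closures of graphs\<close>

lemma unitary_between_simps:
  assumes "unitary_between U V W" "csubspace V"
  shows "x \<in> V \<Longrightarrow> y \<in> V \<Longrightarrow> U (x - y) = U x - U y" "U 0 = 0"
    "x \<in> V \<Longrightarrow> y \<in> V \<Longrightarrow> dist (U x) (U y) = dist x y"
proof -
  have s: "U (-1 *\<^sub>C y) = -1 *\<^sub>C U y" if "y \<in> V" for y
    using assms that unfolding unitary_between_def by blast
  have d: "U (x - y) = U x - U y" if "x \<in> V" "y \<in> V" for x y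
  proof -
    have "U (x + (- y)) = U x + U (- y)"
      using assms(1) that csubspaceD(5)[OF assms(2)] unfolding unitary_between_def by blast
    then show ?thesis using s[OF that(2)] by simp
  qed
  then show "x \<in> V \<Longrightarrow> y \<in> V \<Longrightarrow> U (x - y) = U x - U y" .
  show "U 0 = 0" using d[OF csubspaceD(1)[OF assms(2)] csubspaceD(1)[OF assms(2)]] by simp
  have "norm (U x) = norm x" if "x \<in> V" for x
  proof -
    have "cinner (U x) (U x) = cinner x x" using assms(1) that unfolding unitary_between_def by blast
    then have "(norm (U x))\<^sup>2 = (norm x)\<^sup>2" unfolding cinner_self by (rule of_real_eq_iff[THEN iffD1])
    then show ?thesis by simp
  qed
  then show "x \<in> V \<Longrightarrow> y \<in> V \<Longrightarrow> dist (U x) (U y) = dist x y"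
    using d csubspaceD(4)[OF assms(2)] by (simp add: dist_norm flip: d)
qed

text \<open>An isometric image of a complete set is complete, hence closed. The metric condition is
  confined to \<open>X\<close> because the maps to which it is applied are isometric on a subspace
  only.\<close>

lemma isometry_image_closure:
  fixes f :: "'a::metric_space \<Rightarrow> 'b::metric_space"
  assumes iso: "\<And>x y. x \<in> X \<Longrightarrow> y \<in> X \<Longrightarrow> dist (f x) (f y) = dist x y"
    and X: "complete X" and S: "S \<subseteq> X"
  shows "f ` closure S = closure (f ` S)"
proof -
  have cS: "closure S \<subseteq> X" using S X by (simp add: closure_minimal complete_imp_closed)
  have "continuous_on (closure S) f"
    unfolding continuous_on_iff
  proof (intro ballI allI impI)
    fix x e assume x: "x \<in> closure S" and e: "(0::real) < e"
    have "dist (f y) (f x) = dist y x" if "y \<in> closure S" for y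
      using subsetD[OF cS that] subsetD[OF cS x] by (rule iso)
    with e show "\<exists>d>0. \<forall>y\<in>closure S. dist y x < d \<longrightarrow> dist (f y) (f x) < e"
      by (intro exI[of _ e]) auto
  qed
  then have 1: "f ` closure S \<subseteq> closure (f ` S)" by (intro image_closure_subset) (auto simp: closure_subset)
  have "complete (closure S)" using X cS by (simp add: complete_closed_subset)
  have "complete (f ` closure S)"
    unfolding complete_def
  proof (intro allI impI, elim conjE)
    fix g assume g: "\<forall>n. g n \<in> f ` closure S" and C: "Cauchy g"
    define h where "h n = (SOME y. y \<in> closure S \<and> g n = f y)" for n
    have h: "h n \<in> closure S" "g n = f (h n)" for n
      using someI_ex[of "\<lambda>y. y \<in> closure S \<and> g n = f y"] g unfolding h_def by auto
    have "dist (h m) (h n) = dist (g m) (g n)" for m n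
      unfolding h(2) using subsetD[OF cS h(1)[of m]] subsetD[OF cS h(1)[of n]] by (rule iso[symmetric])
    then have "Cauchy h" using C by (simp add: Cauchy_def)
    then obtain l where l: "l \<in> closure S" "h \<longlonglongrightarrow> l"
      using \<open>complete (closure S)\<close> h(1) unfolding complete_def by meson
    have "dist (g n) (f l) = dist (h n) l" for n
      unfolding h(2) using subsetD[OF cS h(1)[of n]] subsetD[OF cS l(1)] by (rule iso)
    then have "g \<longlonglongrightarrow> f l" using l(2) by (simp add: lim_sequentially)
    then show "\<exists>l\<in>f ` closure S. g \<longlonglongrightarrow> l" using l(1) by blast
  qed
  then have "closed (f ` closure S)" by (rule complete_imp_closed)
  then have "closure (f ` S) \<subseteq> f ` closure S"
    by (intro closure_minimal image_mono closure_subset)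
  with 1 show ?thesis by blast
qed

lemma unitary_graph_closure:
  assumes U: "unitary_between U V W" and V: "csubspace V" "complete V" and S: "S \<subseteq> V \<times> V"
  shows "map_prod U U ` closure S = closure (map_prod U U ` S)"
proof (rule isometry_image_closure[OF _ complete_Times[OF V(2) V(2)] S])
  fix p q assume "p \<in> V \<times> V" "q \<in> V \<times> V"
  then show "dist (map_prod U U p) (map_prod U U q) = dist p q"
    using unitary_between_simps(3)[OF U V(1)] by (cases p, cases q) (auto simp: dist_Pair_Pair)
qed

section \<open>Orthonormal bases\<close>

lemma cinner_sum_left: "cinner (\<Sum>i\<in>I. f i) (y::'a::complex_inner_space) = (\<Sum>i\<in>I. cinner (f i) y)"
  by (induction I rule: infinite_finite_induct) (auto simp: cinner_add_left)

lemma cinner_sum_right: "cinner (y::'a::complex_inner_space) (\<Sum>i\<in>I. f i) = (\<Sum>i\<in>I. cinner y (f i))"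
  by (induction I rule: infinite_finite_induct) (auto simp: cinner_add_right)

lemma cinner_orthonormal_sums:
  fixes e :: "'i \<Rightarrow> 'a::complex_inner_space"
  assumes "finite I" "\<And>i j. i \<in> I \<Longrightarrow> j \<in> I \<Longrightarrow> cinner (e i) (e j) = (if i = j then 1 else 0)"
  shows "cinner (\<Sum>i\<in>I. a i *\<^sub>C e i) (\<Sum>i\<in>I. b i *\<^sub>C e i) = (\<Sum>i\<in>I. a i * cnj (b i))"
    and "j \<in> I \<Longrightarrow> cinner (\<Sum>i\<in>I. a i *\<^sub>C e i) (e j) = a j"
    and "(norm (\<Sum>i\<in>I. a i *\<^sub>C e i))\<^sup>2 = (\<Sum>i\<in>I. (cmod (a i))\<^sup>2)"
proof -
  have j: "cinner (\<Sum>i\<in>I. a i *\<^sub>C e i) (e j) = a j" if "j \<in> I" for j a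
  proof -
    have "cinner (\<Sum>i\<in>I. a i *\<^sub>C e i) (e j) = (\<Sum>i\<in>I. if i = j then a i else 0)"
      unfolding cinner_sum_left using assms(2) that
      by (intro sum.cong refl) (simp add: cinner_scaleC_left)
    then show ?thesis using that assms(1) by simp
  qed
  then show "j \<in> I \<Longrightarrow> cinner (\<Sum>i\<in>I. a i *\<^sub>C e i) (e j) = a j" .
  have *: "cinner (\<Sum>i\<in>I. a i *\<^sub>C e i) (\<Sum>i\<in>I. b i *\<^sub>C e i) = (\<Sum>i\<in>I. a i * cnj (b i))" for a b
    unfolding cinner_sum_right
    by (intro sum.cong refl) (simp add: cinner_scaleC_right j)
  show "cinner (\<Sum>i\<in>I. a i *\<^sub>C e i) (\<Sum>i\<in>I. b i *\<^sub>C e i) = (\<Sum>i\<in>I. a i * cnj (b i))" by (rule *)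
  have "complex_of_real ((norm (\<Sum>i\<in>I. a i *\<^sub>C e i))\<^sup>2) = complex_of_real (\<Sum>i\<in>I. (cmod (a i))\<^sup>2)"
    unfolding cinner_self[symmetric] * of_real_sum complex_norm_square by simp
  then show "(norm (\<Sum>i\<in>I. a i *\<^sub>C e i))\<^sup>2 = (\<Sum>i\<in>I. (cmod (a i))\<^sup>2)"
    by (rule of_real_eq_iff[THEN iffD1])
qed

lemma bessel:
  fixes e :: "'i \<Rightarrow> 'a::complex_inner_space"
  assumes "finite I" "\<And>i j. i \<in> I \<Longrightarrow> j \<in> I \<Longrightarrow> cinner (e i) (e j) = (if i = j then 1 else 0)"
  shows "(norm x)\<^sup>2 = (norm (x - (\<Sum>i\<in>I. cinner x (e i) *\<^sub>C e i)))\<^sup>2 + (\<Sum>i\<in>I. (cmod (cinner x (e i)))\<^sup>2)"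
    and "(\<Sum>i\<in>I. (cmod (cinner x (e i)))\<^sup>2) \<le> (norm x)\<^sup>2"
proof -
  define p where "p = (\<Sum>i\<in>I. cinner x (e i) *\<^sub>C e i)"
  have orth: "cinner (x - p) (e j) = 0" if "j \<in> I" for j
    using cinner_orthonormal_sums(2)[OF assms that] by (simp add: p_def cinner_diff_left)
  have "cinner (x - p) p = 0"
    unfolding p_def[THEN arg_cong[of _ _ "cinner (x - p)"]] cinner_sum_right
    by (intro sum.neutral ballI) (simp add: cinner_scaleC_right orth)
  then have "cinner x x = cinner (x - p) (x - p) + cinner p p"
    using cinner_add_left[of "x - p" p x] cinner_add_right[of _ "x - p" p]
      cinner_eq_0_commute[of "x - p" p] by simp
  then have "(norm x)\<^sup>2 = (norm (x - p))\<^sup>2 + (norm p)\<^sup>2"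
    unfolding cinner_self of_real_add[symmetric] by (rule of_real_eq_iff[THEN iffD1])
  moreover have "(norm p)\<^sup>2 = (\<Sum>i\<in>I. (cmod (cinner x (e i)))\<^sup>2)"
    unfolding p_def by (rule cinner_orthonormal_sums(3)[OF assms])
  ultimately show "(norm x)\<^sup>2 = (norm (x - (\<Sum>i\<in>I. cinner x (e i) *\<^sub>C e i)))\<^sup>2 + (\<Sum>i\<in>I. (cmod (cinner x (e i)))\<^sup>2)"
    by (simp add: p_def)
  then show "(\<Sum>i\<in>I. (cmod (cinner x (e i)))\<^sup>2) \<le> (norm x)\<^sup>2" by simp
qed

text \<open>The Riesz-Fischer theorem. The index set is a subset of the natural numbers cut off by
  \<open>{..<n}\<close>, so that finite and infinite orthonormal systems are treated alike.\<close>

lemma orthonormal_series: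
  fixes V :: "'a::complex_inner_space set"
  assumes V: "csubspace V" "complete V"
    and e: "\<And>i. i \<in> I \<Longrightarrow> e i \<in> V"
      "\<And>i j. i \<in> I \<Longrightarrow> j \<in> I \<Longrightarrow> cinner (e i) (e j) = (if i = j then 1 else 0)"
    and bd: "\<And>n. (\<Sum>i\<in>I \<inter> {..<n}. (cmod (c i))\<^sup>2) \<le> C"
  shows "\<exists>y\<in>V. (\<lambda>n. \<Sum>i\<in>I \<inter> {..<n}. c i *\<^sub>C e i) \<longlonglongrightarrow> y \<and> (\<forall>i\<in>I. cinner y (e i) = c i)"
proof -
  define c' where "c' i = (if i \<in> I then (cmod (c i))\<^sup>2 else 0)" for i
  define s where "s n = (\<Sum>i\<in>I \<inter> {..<n}. c i *\<^sub>C e i)" for n :: nat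
  have c'_sum: "(\<Sum>i<n. c' i) = (\<Sum>i\<in>I \<inter> {..<n}. (cmod (c i))\<^sup>2)" for n
    unfolding c'_def by (subst sum.inter_restrict[symmetric]) (simp_all add: Int_commute)
  have "summable c'"
    using bd c'_sum by (intro summableI_nonneg_bounded[where x = C]) (auto simp: c'_def)
  then have cau: "Cauchy (\<lambda>n. \<Sum>i<n. c' i)" by (simp add: summable_iff_convergent convergent_Cauchy)
  have diff: "(norm (s m - s n))\<^sup>2 = (\<Sum>i<m. c' i) - (\<Sum>i<n. c' i)" if "n \<le> m" for m n
  proof -
    have un: "I \<inter> {..<m} = (I \<inter> {..<n}) \<union> (I \<inter> {n..<m})" using that by auto
    have "s m - s n = (\<Sum>i\<in>I \<inter> {n..<m}. c i *\<^sub>C e i)"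
      unfolding s_def un by (subst sum.union_disjoint) auto
    then have "(norm (s m - s n))\<^sup>2 = (\<Sum>i\<in>I \<inter> {n..<m}. (cmod (c i))\<^sup>2)"
      using cinner_orthonormal_sums(3)[of "I \<inter> {n..<m}" e c] e(2) by auto
    also have "\<dots> = (\<Sum>i<m. c' i) - (\<Sum>i<n. c' i)"
      unfolding c'_sum un by (subst sum.union_disjoint) auto
    finally show ?thesis .
  qed
  \<comment> \<open>The partial sums of vectors inherit the Cauchy property from the partial sums of
    the scalar series \<open>c'\<close>.\<close>
  have dist: "(dist (s m) (s n))\<^sup>2 = dist (\<Sum>i<m. c' i) (\<Sum>i<n. c' i)" for m n
  proof (cases "n \<le> m")
    case True
    have "(\<Sum>i<n. c' i) \<le> (\<Sum>i<m. c' i)" using True diff[OF True] by (metis diff_ge_0_iff_ge zero_le_power2)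
    then show ?thesis using diff[OF True] by (simp add: dist_norm)
  next
    case False
    then have nm: "m \<le> n" by simp
    have "(\<Sum>i<m. c' i) \<le> (\<Sum>i<n. c' i)" using diff[OF nm] by (metis diff_ge_0_iff_ge zero_le_power2)
    then show ?thesis using diff[OF nm] by (simp add: dist_norm norm_minus_commute)
  qed
  have "Cauchy s"
    unfolding Cauchy_def
  proof (intro allI impI)
    fix r :: real assume r: "r > 0"
    then obtain M where M: "\<And>m n. m \<ge> M \<Longrightarrow> n \<ge> M \<Longrightarrow> dist (\<Sum>i<m. c' i) (\<Sum>i<n. c' i) < r\<^sup>2"
      using cau[unfolded Cauchy_def] by (meson zero_less_power)
    have "dist (s m) (s n) < r" if "m \<ge> M" "n \<ge> M" for m n
      using M[OF that] r unfolding dist[symmetric] by (simp add: power_less_imp_less_base)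
    then show "\<exists>M. \<forall>m\<ge>M. \<forall>n\<ge>M. dist (s m) (s n) < r" by blast
  qed
  moreover have "s n \<in> V" for n
    unfolding s_def using e(1) by (intro csubspace_sum[OF V(1)] csubspaceD(3)[OF V(1)]) auto
  ultimately obtain y where y: "y \<in> V" "s \<longlonglongrightarrow> y" using V(2) unfolding complete_def by meson
  have "cinner y (e i) = c i" if i: "i \<in> I" for i
  proof (rule LIMSEQ_unique)
    show "(\<lambda>n. cinner (s n) (e i)) \<longlonglongrightarrow> cinner y (e i)" by (intro tendsto_cinner y tendsto_const)
    have "cinner (s n) (e i) = c i" if "n > i" for n
      unfolding s_def using cinner_orthonormal_sums(2)[of "I \<inter> {..<n}" e i c] e(2) i that by auto
    then show "(\<lambda>n. cinner (s n) (e i)) \<longlonglongrightarrow> c i"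
      by (intro tendsto_eventually) (auto simp: eventually_sequentially intro!: exI[of _ "Suc i"])
  qed
  with y show ?thesis unfolding s_def by blast
qed

text \<open>Moves the coefficients of \<open>x\<close> to another orthonormal system. Both
  expansions are recorded as limits, since inner products will be compared through partial
  sums.\<close>

lemma onb_transfer:
  fixes V :: "'a::complex_inner_space set" and W :: "'b::complex_inner_space set"
  assumes V: "csubspace V" "complete V" and W: "csubspace W" "complete W"
    and e: "\<And>i. i \<in> I \<Longrightarrow> e i \<in> V"
      "\<And>i j. i \<in> I \<Longrightarrow> j \<in> I \<Longrightarrow> cinner (e i) (e j) = (if i = j then 1 else 0)"
      "\<And>x. x \<in> V \<Longrightarrow> (\<And>i. i \<in> I \<Longrightarrow> cinner x (e i) = 0) \<Longrightarrow> x = 0"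
    and f: "\<And>i. i \<in> I \<Longrightarrow> f i \<in> W"
      "\<And>i j. i \<in> I \<Longrightarrow> j \<in> I \<Longrightarrow> cinner (f i) (f j) = (if i = j then 1 else 0)"
    and x: "x \<in> V"
  shows "\<exists>y\<in>W. (\<forall>i\<in>I. cinner y (f i) = cinner x (e i)) \<and>
    (\<lambda>n. \<Sum>i\<in>I \<inter> {..<n}. cinner x (e i) *\<^sub>C e i) \<longlonglongrightarrow> x \<and>
    (\<lambda>n. \<Sum>i\<in>I \<inter> {..<n::nat}. cinner x (e i) *\<^sub>C f i) \<longlonglongrightarrow> y"
proof -
  have bd: "(\<Sum>i\<in>I \<inter> {..<n}. (cmod (cinner x (e i)))\<^sup>2) \<le> (norm x)\<^sup>2" for n
    using e(2) by (intro bessel(2)) auto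
  obtain y where y: "y \<in> W" "(\<lambda>n. \<Sum>i\<in>I \<inter> {..<n}. cinner x (e i) *\<^sub>C f i) \<longlonglongrightarrow> y"
    "\<forall>i\<in>I. cinner y (f i) = cinner x (e i)"
  proof -
    have "\<exists>y\<in>W. (\<lambda>n. \<Sum>i\<in>I \<inter> {..<n}. cinner x (e i) *\<^sub>C f i) \<longlonglongrightarrow> y \<and> (\<forall>i\<in>I. cinner y (f i) = cinner x (e i))"
      by (rule orthonormal_series[OF W]) (rule f bd | assumption)+
    then show ?thesis using that by blast
  qed
  obtain x' where x': "x' \<in> V" "(\<lambda>n. \<Sum>i\<in>I \<inter> {..<n}. cinner x (e i) *\<^sub>C e i) \<longlonglongrightarrow> x'"
    "\<forall>i\<in>I. cinner x' (e i) = cinner x (e i)"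
  proof -
    have "\<exists>y\<in>V. (\<lambda>n. \<Sum>i\<in>I \<inter> {..<n}. cinner x (e i) *\<^sub>C e i) \<longlonglongrightarrow> y \<and> (\<forall>i\<in>I. cinner y (e i) = cinner x (e i))"
      by (rule orthonormal_series[OF V]) (rule e(1,2) bd | assumption)+
    then show ?thesis using that by blast
  qed
  \<comment> \<open>The sum of the series has the same coefficients as \<open>x\<close>, so the
    difference is orthogonal to the basis.\<close>
  have "x - x' = 0"
  proof (rule e(3))
    show "x - x' \<in> V" by (rule csubspaceD(4)[OF V(1) x x'(1)])
    show "cinner (x - x') (e i) = 0" if "i \<in> I" for i using x'(3) that by (simp add: cinner_diff_left)
  qed
  then have "x' = x" by simp
  then have "(\<lambda>n. \<Sum>i\<in>I \<inter> {..<n}. cinner x (e i) *\<^sub>C e i) \<longlonglongrightarrow> x" using x'(2) by simp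
  then show ?thesis by (intro bexI[OF _ y(1)] conjI y)
qed

definition onb :: "'i set \<Rightarrow> ('i \<Rightarrow> 'a::complex_inner_space) \<Rightarrow> 'a set \<Rightarrow> bool" where
  "onb I e V \<longleftrightarrow> (\<forall>i\<in>I. e i \<in> V) \<and> (\<forall>i\<in>I. \<forall>j\<in>I. cinner (e i) (e j) = (if i = j then 1 else 0)) \<and>
    (\<forall>x\<in>V. (\<forall>i\<in>I. cinner x (e i) = 0) \<longrightarrow> x = 0)"

lemma onbD:
  assumes "onb I e V"
  shows "i \<in> I \<Longrightarrow> e i \<in> V"
    "i \<in> I \<Longrightarrow> j \<in> I \<Longrightarrow> cinner (e i) (e j) = (if i = j then 1 else 0)"
    "x \<in> V \<Longrightarrow> (\<And>i. i \<in> I \<Longrightarrow> cinner x (e i) = 0) \<Longrightarrow> x = 0"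
  using assms by (simp_all add: onb_def)

lemma has_hilbert_dim_onb: "has_hilbert_dim V k \<longleftrightarrow> (\<exists>e. onb {i. enat i < k} e V)"
  unfolding has_hilbert_dim_def onb_def by simp

lemma has_hilbert_dim_enat: "has_hilbert_dim V (enat p) \<longleftrightarrow> (\<exists>e. onb {..<p} e V)"
  unfolding has_hilbert_dim_onb by (simp add: lessThan_def)

lemma has_hilbert_dim_infinity: "has_hilbert_dim V \<infinity> \<longleftrightarrow> (\<exists>e :: nat \<Rightarrow> _. onb UNIV e V)"
  unfolding has_hilbert_dim_onb by simp

text \<open>The map keeps coefficients. Linearity follows because coefficients determine a vector,
  surjectivity from the transfer in the opposite direction, and preservation of inner products from
  the partial sums.\<close>

lemma same_dim_unitary:
  fixes V :: "'a::complex_inner_space set" and W :: "'b::complex_inner_space set"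
  assumes V: "csubspace V" "complete V" and W: "csubspace W" "complete W"
    and "has_hilbert_dim V k" "has_hilbert_dim W k"
  shows "\<exists>U. unitary_between U V W"
proof -
  define I where "I = {i. enat i < k}"
  obtain e f where onb: "onb I e V" "onb I f W"
    using assms(5,6) unfolding has_hilbert_dim_onb I_def by blast
  note e = onbD[OF onb(1)] and f = onbD[OF onb(2)]
  have VW: "\<exists>y\<in>W. (\<forall>i\<in>I. cinner y (f i) = cinner x (e i)) \<and>
    (\<lambda>n. \<Sum>i\<in>I \<inter> {..<n}. cinner x (e i) *\<^sub>C e i) \<longlonglongrightarrow> x \<and>
    (\<lambda>n. \<Sum>i\<in>I \<inter> {..<n::nat}. cinner x (e i) *\<^sub>C f i) \<longlonglongrightarrow> y" if "x \<in> V" for x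
    by (rule onb_transfer[OF V W]) (rule e f that | assumption)+
  have WV: "\<exists>x\<in>V. \<forall>i\<in>I. cinner x (e i) = cinner y (f i)" if "y \<in> W" for y
  proof -
    have "\<exists>x\<in>V. (\<forall>i\<in>I. cinner x (e i) = cinner y (f i)) \<and>
      (\<lambda>n. \<Sum>i\<in>I \<inter> {..<n}. cinner y (f i) *\<^sub>C f i) \<longlonglongrightarrow> y \<and>
      (\<lambda>n. \<Sum>i\<in>I \<inter> {..<n::nat}. cinner y (f i) *\<^sub>C e i) \<longlonglongrightarrow> x"
      by (rule onb_transfer[OF W V]) (rule e f that | assumption)+
    then show ?thesis by blast
  qed
  have "\<forall>x. \<exists>y. x \<in> V \<longrightarrow> y \<in> W \<and> (\<forall>i\<in>I. cinner y (f i) = cinner x (e i)) \<and>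
    (\<lambda>n. \<Sum>i\<in>I \<inter> {..<n}. cinner x (e i) *\<^sub>C e i) \<longlonglongrightarrow> x \<and>
    (\<lambda>n. \<Sum>i\<in>I \<inter> {..<n::nat}. cinner x (e i) *\<^sub>C f i) \<longlonglongrightarrow> y"
    using VW by blast
  then obtain U where U': "\<forall>x. x \<in> V \<longrightarrow> U x \<in> W \<and> (\<forall>i\<in>I. cinner (U x) (f i) = cinner x (e i)) \<and>
    (\<lambda>n. \<Sum>i\<in>I \<inter> {..<n}. cinner x (e i) *\<^sub>C e i) \<longlonglongrightarrow> x \<and>
    (\<lambda>n. \<Sum>i\<in>I \<inter> {..<n::nat}. cinner x (e i) *\<^sub>C f i) \<longlonglongrightarrow> U x"
    by (drule_tac choice) blast
  have U: "x \<in> V \<Longrightarrow> U x \<in> W"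
    "x \<in> V \<Longrightarrow> i \<in> I \<Longrightarrow> cinner (U x) (f i) = cinner x (e i)"
    "x \<in> V \<Longrightarrow> (\<lambda>n. \<Sum>i\<in>I \<inter> {..<n}. cinner x (e i) *\<^sub>C e i) \<longlonglongrightarrow> x"
    "x \<in> V \<Longrightarrow> (\<lambda>n. \<Sum>i\<in>I \<inter> {..<n::nat}. cinner x (e i) *\<^sub>C f i) \<longlonglongrightarrow> U x" for x i
    using U' by simp_all
  have eqI: "x = y" if "x \<in> W" "y \<in> W" "\<And>i. i \<in> I \<Longrightarrow> cinner x (f i) = cinner y (f i)" for x y
  proof -
    have "x - y = 0"
    proof (rule f(3))
      show "x - y \<in> W" by (rule csubspaceD(4)[OF W(1) that(1,2)])
      show "cinner (x - y) (f i) = 0" if "i \<in> I" for i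
        using \<open>\<And>i. i \<in> I \<Longrightarrow> cinner x (f i) = cinner y (f i)\<close>[OF that] by (simp add: cinner_diff_left)
    qed
    then show ?thesis by simp
  qed
  have "unitary_between U V W"
    unfolding unitary_between_def
  proof (intro conjI ballI allI)
    show "U ` V = W"
    proof (intro antisym subsetI)
      fix y assume y: "y \<in> W"
      obtain x where x: "x \<in> V" "\<forall>i\<in>I. cinner x (e i) = cinner y (f i)"
        using WV[OF y] by blast
      then have "U x = y" using y U by (intro eqI) auto
      then show "y \<in> U ` V" using x by blast
    qed (use U in auto)
  next
    fix x y assume "x \<in> V" "y \<in> V"
    then show "U (x + y) = U x + U y"
      by (intro eqI) (auto simp: U csubspaceD[OF V(1)] csubspaceD[OF W(1)] cinner_add_left)
  next
    fix c x assume "x \<in> V"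
    then show "U (c *\<^sub>C x) = c *\<^sub>C U x"
      by (intro eqI) (auto simp: U csubspaceD[OF V(1)] csubspaceD[OF W(1)] cinner_scaleC_left)
  next
    fix x y assume xy: "x \<in> V" "y \<in> V"
    show "cinner (U x) (U y) = cinner x y"
    proof (rule LIMSEQ_unique)
      let ?s = "\<lambda>n. \<Sum>i\<in>I \<inter> {..<n}. cinner x (e i) * cnj (cinner y (e i))"
      have "cinner (\<Sum>i\<in>I \<inter> {..<n}. cinner x (e i) *\<^sub>C f i) (\<Sum>i\<in>I \<inter> {..<n}. cinner y (e i) *\<^sub>C f i) = ?s n" for n
        using f(2) by (intro cinner_orthonormal_sums(1)) auto
      then show "?s \<longlonglongrightarrow> cinner (U x) (U y)"
        using tendsto_cinner[OF U(4)[OF xy(1)] U(4)[OF xy(2)]] by simp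
      have "cinner (\<Sum>i\<in>I \<inter> {..<n}. cinner x (e i) *\<^sub>C e i) (\<Sum>i\<in>I \<inter> {..<n}. cinner y (e i) *\<^sub>C e i) = ?s n" for n
        using e(2) by (intro cinner_orthonormal_sums(1)) auto
      then show "?s \<longlonglongrightarrow> cinner x y"
        using tendsto_cinner[OF U(3)[OF xy(1)] U(3)[OF xy(2)]] by simp
    qed
  qed
  then show ?thesis by blast
qed

section \<open>Existence, uniqueness and additivity of the dimension\<close>

lemma cmod_cinner_commute: "cmod (cinner x y) = cmod (cinner y (x::'a::complex_inner_space))"
  by (subst cinner_commute) simp

text \<open>Double counting of the squares of \<open>cmod (cinner (f j) (e i))\<close>: for fixed
  \<open>j\<close> they sum to 1 because the \<open>e i\<close> form a basis, for fixed
  \<open>i\<close> to at most 1 by the Bessel inequality.\<close>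

lemma orthonormal_card_le:
  fixes V :: "'a::complex_inner_space set"
  assumes V: "csubspace V"
    and e: "\<And>i. i < p \<Longrightarrow> e i \<in> V"
      "\<And>i j. i < p \<Longrightarrow> j < p \<Longrightarrow> cinner (e i) (e j) = (if i = j then 1 else 0)"
      "\<And>x. x \<in> V \<Longrightarrow> (\<And>i. i < p \<Longrightarrow> cinner x (e i) = 0) \<Longrightarrow> x = 0"
    and f: "\<And>i. i < q \<Longrightarrow> f i \<in> V"
      "\<And>i j. i < q \<Longrightarrow> j < q \<Longrightarrow> cinner (f i) (f j) = (if i = j then 1 else 0)"
  shows "q \<le> (p::nat)"
proof -
  have n: "(norm x)\<^sup>2 = 1" if "cinner x x = 1" for x :: 'a
    using that unfolding cinner_self by (metis of_real_eq_1_iff)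
  have pars: "(\<Sum>i<p. (cmod (cinner (f j) (e i)))\<^sup>2) = 1" if j: "j < q" for j
  proof -
    let ?p = "\<Sum>i<p. cinner (f j) (e i) *\<^sub>C e i"
    have "f j - ?p = 0"
    proof (rule e(3))
      show "f j - ?p \<in> V"
        using e(1) f(1)[OF j] by (intro csubspaceD(4)[OF V] csubspace_sum[OF V] csubspaceD(3)[OF V]) auto
      show "cinner (f j - ?p) (e i) = 0" if "i < p" for i
        using cinner_orthonormal_sums(2)[of "{..<p}" e i] e(2) that by (simp add: cinner_diff_left)
    qed
    then show ?thesis
      using bessel(1)[of "{..<p}" e "f j"] e(2) n[of "f j"] f(2)[OF j j] by simp
  qed
  have "real q = (\<Sum>j<q. \<Sum>i<p. (cmod (cinner (f j) (e i)))\<^sup>2)" using pars by simp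
  also have "\<dots> = (\<Sum>i<p. \<Sum>j<q. (cmod (cinner (e i) (f j)))\<^sup>2)"
    by (subst sum.swap) (intro sum.cong refl arg_cong[where f = "\<lambda>r. r\<^sup>2"] cmod_cinner_commute)
  also have "\<dots> \<le> (\<Sum>i<p. (norm (e i))\<^sup>2)"
    using f(2) by (intro sum_mono bessel(2)) auto
  also have "\<dots> = real p" using e(2) n by simp
  finally show ?thesis by simp
qed

text \<open>Zorn's lemma gives a maximal orthonormal set. It is countable: each member fails to be
  orthogonal to some element of \<open>S\<close>, and by the Bessel inequality each element of
  \<open>S\<close> can account for countably many members only.\<close>

lemma hilbert_dim_exists:
  fixes V :: "'a::complex_inner_space set"
  assumes S: "countable S" "\<And>x. x \<in> V \<Longrightarrow> (\<And>y. y \<in> S \<Longrightarrow> cinner x y = 0) \<Longrightarrow> x = 0"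
    and V: "csubspace V"
  shows "\<exists>k. has_hilbert_dim V k"
proof -
  define ON where "ON = {M. M \<subseteq> V \<and> (\<forall>x\<in>M. \<forall>y\<in>M. cinner x y = (if x = y then 1 else 0))}"
  have "\<exists>M\<in>ON. \<forall>X\<in>ON. M \<subseteq> X \<longrightarrow> X = M"
  proof (rule subset_Zorn')
    fix C assume C: "subset.chain ON C"
    have sub: "C \<subseteq> ON" using C by (auto simp: subset.chain_def)
    show "\<Union>C \<in> ON"
      unfolding ON_def
    proof (intro CollectI conjI ballI)
      show "\<Union>C \<subseteq> V" using sub by (auto simp: ON_def)
      fix x y assume "x \<in> \<Union>C" "y \<in> \<Union>C"
      then obtain X Y where XY: "X \<in> C" "Y \<in> C" "x \<in> X" "y \<in> Y" by blast
      have "X \<subseteq> Y \<or> Y \<subseteq> X" using C XY by (auto simp: subset.chain_def)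
      then obtain Z where "Z \<in> C" "x \<in> Z" "y \<in> Z" using XY by blast
      then show "cinner x y = (if x = y then 1 else 0)" using sub by (auto simp: ON_def)
    qed
  qed
  then obtain M where M: "M \<in> ON" and max: "\<And>X. X \<in> ON \<Longrightarrow> M \<subseteq> X \<Longrightarrow> X = M" by blast
  have MV: "M \<subseteq> V" and on: "\<And>x y. x \<in> M \<Longrightarrow> y \<in> M \<Longrightarrow> cinner x y = (if x = y then 1 else 0)"
    using M by (auto simp: ON_def)
  have total: "x = 0" if x: "x \<in> V" "\<And>m. m \<in> M \<Longrightarrow> cinner x m = 0" for x
  proof (rule ccontr)
    assume x0: "x \<noteq> 0"
    define u where "u = complex_of_real (inverse (norm x)) *\<^sub>C x"
    have uu: "cinner u u = 1"
      using x0 by (simp add: u_def cinner_self norm_scaleC norm_inverse)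
    have um: "cinner u m = 0" "cinner m u = 0" if "m \<in> M" for m
      using x(2)[OF that] cinner_eq_0_commute[of x m]
      by (auto simp: u_def cinner_linear)
    have uV: "u \<in> V" unfolding u_def by (intro csubspaceD(3)[OF V] x)
    have uM: "u \<notin> M" using um uu by auto
    have "insert u M \<in> ON"
      unfolding ON_def using uV MV on uu um uM by auto
    from max[OF this] uM show False by auto
  qed
  \<comment> \<open>By the Bessel inequality fewer than \<open>Suc n\<close> times the squared norm
    of \<open>y\<close> members can exceed the threshold, up to rounding.\<close>
  have fin: "finite {m\<in>M. 1 / real (Suc n) < (cmod (cinner y m))\<^sup>2}" (is "finite ?A") for n y
  proof (rule ccontr)
    assume "infinite ?A"
    obtain N where N: "real N > real (Suc n) * (norm y)\<^sup>2" using reals_Archimedean2 by blast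
    obtain A where A: "finite A" "card A = N" "A \<subseteq> ?A"
      using infinite_arbitrarily_large[OF \<open>infinite ?A\<close>] by blast
    have "real N * (1 / real (Suc n)) \<le> (\<Sum>m\<in>A. (cmod (cinner y m))\<^sup>2)"
      using A by (subst A(2)[symmetric], intro sum_bounded_below) auto
    also have "\<dots> \<le> (norm y)\<^sup>2"
      using A on bessel(2)[of A "\<lambda>m. m" y] by (auto simp: subset_iff)
    finally show False using N by (simp add: field_simps)
  qed
  have "countable (\<Union>y\<in>S. \<Union>n. {m\<in>M. 1 / real (Suc n) < (cmod (cinner y m))\<^sup>2})"
    by (rule countable_UN[OF S(1)], rule countable_UN, simp, rule countable_finite, rule fin)
  moreover have "M \<subseteq> (\<Union>y\<in>S. \<Union>n. {m\<in>M. 1 / real (Suc n) < (cmod (cinner y m))\<^sup>2})"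
  proof
    fix m assume m: "m \<in> M"
    have "m \<noteq> 0" using on[OF m m] by auto
    then obtain y where y: "y \<in> S" "cinner m y \<noteq> 0" using S(2)[of m] m MV by blast
    then have "(cmod (cinner y m))\<^sup>2 > 0" using cinner_eq_0_commute[of m y] by simp
    then obtain n where "1 / real (Suc n) < (cmod (cinner y m))\<^sup>2"
      using reals_Archimedean[of "(cmod (cinner y m))\<^sup>2"] by (auto simp: inverse_eq_divide)
    then show "m \<in> (\<Union>y\<in>S. \<Union>n. {m\<in>M. 1 / real (Suc n) < (cmod (cinner y m))\<^sup>2})" using m y by blast
  qed
  ultimately have cM: "countable M" by (rule countable_subset[rotated])
  have main: "has_hilbert_dim V k" if b: "bij_betw g {i. enat i < k} M" for g k
    unfolding has_hilbert_dim_def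
  proof (intro exI[of _ g] conjI allI impI ballI)
    fix i assume "enat i < k"
    then show "g i \<in> V" using b MV by (auto simp: bij_betw_def)
  next
    fix i j assume "enat i < k" "enat j < k"
    then show "cinner (g i) (g j) = (if i = j then 1 else 0)"
      using b on by (auto simp: bij_betw_def inj_on_def)
  next
    fix x assume "x \<in> V" "\<forall>i. enat i < k \<longrightarrow> cinner x (g i) = 0"
    then show "x = 0" using b by (intro total) (auto simp: bij_betw_def)
  qed
  show ?thesis
  proof (cases "finite M")
    case True
    then obtain g where "bij_betw g {0..<card M} M" using ex_bij_betw_nat_finite by blast
    moreover have "{i. enat i < enat (card M)} = {0..<card M}" by auto
    ultimately show ?thesis using main[of g "enat (card M)"] by auto
  next
    case False
    have "bij_betw (from_nat_into M) UNIV M" by (rule bij_betw_from_nat_into[OF cM False])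
    moreover have "{i. enat i < \<infinity>} = UNIV" by auto
    ultimately show ?thesis using main[of "from_nat_into M" \<infinity>] by auto
  qed
qed

lemma hilbert_dim_le:
  fixes V :: "'a::complex_inner_space set"
  assumes V: "csubspace V" and d: "has_hilbert_dim V k"
    and f: "\<And>i. i < q \<Longrightarrow> f i \<in> V"
      "\<And>i j. i < q \<Longrightarrow> j < q \<Longrightarrow> cinner (f i) (f j) = (if i = j then 1 else 0)"
  shows "enat q \<le> k"
proof (cases k)
  case (enat p)
  obtain e where e: "onb {..<p} e V" using d unfolding enat has_hilbert_dim_enat by blast
  have "q \<le> p"
    by (rule orthonormal_card_le[OF V, of p e q f]) (use onbD[OF e] f in \<open>simp_all\<close>)
  then show ?thesis using enat by simp
qed simp

text \<open>The orthonormal systems may change with \<open>q\<close>, so no infinite system has to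
  be exhibited. The singular inner function below provides a different system for every
  \<open>q\<close>.\<close>

lemma hilbert_dim_infinity:
  fixes V :: "'a::complex_inner_space set"
  assumes V: "csubspace V" and d: "has_hilbert_dim V k"
    and f: "\<And>q::nat. \<exists>f :: nat \<Rightarrow> 'a. (\<forall>i<q. f i \<in> V) \<and> (\<forall>i<q. \<forall>j<q. cinner (f i) (f j) = (if i = j then 1 else 0))"
  shows "k = \<infinity>"
proof (cases k)
  case (enat p)
  obtain f where f': "\<forall>i<Suc p. f i \<in> V" "\<forall>i<Suc p. \<forall>j<Suc p. cinner (f i) (f j) = (if i = j then 1 else 0)"
    using f[of "Suc p"] by (elim exE conjE) (rule that)
  have "enat (Suc p) \<le> k" by (rule hilbert_dim_le[OF V d, of _ f]) (use f' in \<open>simp_all\<close>)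
  then show ?thesis using enat by simp
qed simp

lemma hilbert_dim_unique:
  fixes V :: "'a::complex_inner_space set"
  assumes V: "csubspace V" and k: "has_hilbert_dim V k" and l: "has_hilbert_dim V l"
  shows "k = l"
proof -
  have le: "l \<le> k" if kl: "has_hilbert_dim V k" "has_hilbert_dim V l" for k l
  proof -
    obtain f where f: "onb {i. enat i < l} f V" using kl(2) unfolding has_hilbert_dim_onb by blast
    show ?thesis
    proof (cases l)
      case (enat q)
      have "enat q \<le> k" by (rule hilbert_dim_le[OF V kl(1), of q f]) (use onbD[OF f] enat in \<open>simp_all\<close>)
      then show ?thesis using enat by simp
    next
      case infinity
      have "(\<forall>i<q. f i \<in> V) \<and> (\<forall>i<q. \<forall>j<q. cinner (f i) (f j) = (if i = j then 1 else 0))" for q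
        using f infinity by (simp add: onb_def)
      then have "k = \<infinity>" by (intro hilbert_dim_infinity[OF V kl(1)]) (rule exI)
      then show ?thesis by simp
    qed
  qed
  show ?thesis by (rule antisym[OF le[OF l k] le[OF k l]])
qed

text \<open>The basis \<open>e\<close> and a basis of the complement combine to a basis of
  \<open>V\<close>. The additive form remains meaningful for infinite dimensions, where subtraction
  would not be.\<close>

lemma hilbert_dim_complement:
  fixes V :: "'a::complex_inner_space set"
  assumes V: "csubspace V"
    and e: "\<And>i. i < d \<Longrightarrow> e i \<in> V"
      "\<And>i j. i < d \<Longrightarrow> j < d \<Longrightarrow> cinner (e i) (e j) = (if i = j then 1 else 0)"
    and W: "W = {w\<in>V. \<forall>i<d. cinner w (e i) = 0}"
    and k: "has_hilbert_dim W k" and l: "has_hilbert_dim V l"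
  shows "k + enat d = l"
proof (cases k)
  case (enat p)
  obtain f where onb: "onb {..<p} f W" using k unfolding enat has_hilbert_dim_enat by blast
  note f = onbD[OF onb, unfolded lessThan_iff]
  define g where "g i = (if i < p then f i else e (i - p))" for i
  have fe: "cinner (f i) (e j) = 0" "cinner (e j) (f i) = 0" if "i < p" "j < d" for i j
    using f(1)[OF that(1)] that cinner_eq_0_commute[of "f i" "e j"] by (auto simp: W)
  have "has_hilbert_dim V (enat (p + d))"
    unfolding has_hilbert_dim_def
  proof (intro exI[of _ g] conjI allI impI ballI)
    fix i assume "enat i < enat (p + d)"
    then show "g i \<in> V" using f(1) e(1) by (auto simp: g_def W)
  next
    fix i j assume "enat i < enat (p + d)" "enat j < enat (p + d)"
    then show "cinner (g i) (g j) = (if i = j then 1 else 0)"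
      by (auto simp: g_def f(2) e(2) fe)
  next
    fix x assume x: "x \<in> V" "\<forall>i. enat i < enat (p + d) \<longrightarrow> cinner x (g i) = 0"
    have "cinner x (e i) = 0" if "i < d" for i
      using x(2)[rule_format, of "p + i"] that by (simp add: g_def)
    then have "x \<in> W" using x(1) by (simp add: W)
    moreover have "cinner x (f i) = 0" if "i < p" for i
      using x(2)[rule_format, of i] that by (simp add: g_def)
    ultimately show "x = 0" by (rule f(3))
  qed
  from hilbert_dim_unique[OF V this l] show ?thesis using enat by simp
next
  case infinity
  obtain f :: "nat \<Rightarrow> 'a" where onb: "onb UNIV f W" using k unfolding infinity has_hilbert_dim_infinity by blast
  note f = onbD(1,2)[OF onb, OF UNIV_I] 
  have "(\<forall>i<q. f i \<in> V) \<and> (\<forall>i<q. \<forall>j<q. cinner (f i) (f j) = (if i = j then 1 else 0))" for q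
    using f(1) by (simp add: f(2) W)
  then have "l = \<infinity>" by (intro hilbert_dim_infinity[OF V l]) (rule exI)
  then show ?thesis using infinity by simp
qed

section \<open>A uniqueness lemma for normal operators with a cyclic vector\<close>

text \<open>
  Think of \<open>V = L\<^sup>2(\<sigma>)\<close> for a measure \<open>\<sigma>\<close> on the circle, with \<open>U\<close> the multiplication by \<open>z\<close>,
  \<open>a n = z\<^sup>n\<close>, \<open>b n = \<psi> z\<^sup>n\<close>, \<open>b' n = cnj \<psi> z\<^sup>n\<close>, and \<open>c\<close> essentially the complex conjugation. The
  assumptions on \<open>f\<close> and \<open>g\<close> then say \<open>f + g cnj \<psi> = 0\<close> and \<open>\<psi> f = g\<close>, whence \<open>(1 + \<bar>\<psi>\<bar>\<^sup>2) f = 0\<close>.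
  The spectral measure is avoided by working with the projection onto the closed span of the
  pairs \<open>(a n, b n)\<close>, whose off-diagonal blocks are interchanged by \<open>c\<close>.
\<close>

lemma cyclic_graph_uniqueness:
  fixes V :: "'a::complex_inner_space set" and a b b' :: "int \<Rightarrow> 'a"
  assumes V: "csubspace V" "complete V"
    and U: "unitary_between U V V"
    and c: "\<And>x. x \<in> V \<Longrightarrow> c x \<in> V" "\<And>x. x \<in> V \<Longrightarrow> c (c x) = x"
      "\<And>x y. x \<in> V \<Longrightarrow> y \<in> V \<Longrightarrow> cinner (c x) (c y) = cinner y x"
      "\<And>r x. x \<in> V \<Longrightarrow> c (r *\<^sub>C x) = cnj r *\<^sub>C c x"
    and aV: "\<And>n. a n \<in> V" and bV: "\<And>n. b n \<in> V"
    and Ua: "\<And>n. U (a n) = a (n + 1)" and Ub: "\<And>n. U (b n) = b (n + 1)"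
    and \<kappa>: "cmod \<kappa> = 1"
    and ca: "\<And>n. c (a n) = \<kappa> *\<^sub>C a (- n - 1)" and cb: "\<And>n. c (b n) = \<kappa> *\<^sub>C b' (- n - 1)"
    and total: "\<And>x. x \<in> V \<Longrightarrow> (\<And>n. cinner x (a n) = 0) \<Longrightarrow> x = 0"
    and f: "f \<in> V" and g: "g \<in> V"
    and fg1: "\<And>n. cinner f (a n) + cinner g (b n) = 0"
    and fg2: "\<And>n. cinner f (b' n) = cinner g (a n)"
  shows "f = 0 \<and> g = 0"
proof -
  define VV where "VV = V \<times> V"
  \<comment> \<open>\<open>Y\<close> is the orthogonal complement of the pairs in \<open>VV\<close>,
    and \<open>G\<close>, its complement in turn, is their closed span: the closed graph of the
    multiplication by \<psi>.\<close>
  define Y where "Y = orth_compl (range (\<lambda>n. (a n, b n))) \<inter> VV"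
  define G where "G = VV \<inter> orth_compl Y"
  define P where "P = orth_proj G"
  have VV: "csubspace VV" "complete VV"
    unfolding VV_def by (intro csubspace_Times complete_Times V)+
  have G: "csubspace G" "complete G"
    unfolding G_def by (intro csubspace_Int complete_Int_closed csubspace_orth_compl closed_orth_compl VV)+
  have Y_iff: "(u, v) \<in> Y \<longleftrightarrow> u \<in> V \<and> v \<in> V \<and> (\<forall>n. cinner u (a n) + cinner v (b n) = 0)" for u v
    by (auto simp: Y_def orth_compl_def VV_def cinner_prod_def)
  have G_iff: "(x, y) \<in> G \<longleftrightarrow> x \<in> V \<and> y \<in> V \<and> (\<forall>u v. (u, v) \<in> Y \<longrightarrow> cinner x u + cinner y v = 0)" for x y
    by (auto simp: G_def orth_compl_def VV_def cinner_prod_def)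
  have abG: "(a n, b n) \<in> G" for n
  proof -
    have "cinner (a n) u + cinner (b n) v = 0" if "(u, v) \<in> Y" for u v
    proof -
      have "cnj (cinner u (a n) + cinner v (b n)) = 0" using that by (simp add: Y_iff)
      then show ?thesis by (simp add: cinner_commute[symmetric])
    qed
    then show ?thesis using aV bV by (simp add: G_iff)
  qed
  have Pin: "P p \<in> G" for p unfolding P_def by (rule orth_proj_in[OF G])
  have PV: "fst (P p) \<in> V" "snd (P p) \<in> V" for p
    using Pin[of p] G_iff[of "fst (P p)" "snd (P p)"] by auto
  have Psa: "cinner (P p) q = cinner p (P q)" for p q
    using orth_proj_cinner(1)[OF G Pin[of q], of p] orth_proj_cinner(2)[OF G Pin[of p], of q]
    by (simp add: P_def)
  \<comment> \<open>The off-diagonal blocks of the projection onto the graph. In the picture of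
    multiplication operators, \<open>S\<close> multiplies by \<psi> divided by one plus its squared
    modulus, and \<open>R\<close> by the complex conjugate of that function.\<close>
  define S where "S x = snd (P (x, 0))" for x
  define R where "R y = fst (P (0, y))" for y
  have SV: "S x \<in> V" and RV: "R x \<in> V" for x unfolding S_def R_def by (rule PV)+
  have SR: "cinner (S x) y = cinner x (R y)" for x y
    using Psa[of "(x, 0)" "(0, y)"] by (simp add: S_def R_def cinner_prod_def)
  have Uin: "U x \<in> V" if "x \<in> V" for x using U that by (auto simp: unitary_between_def)
  have Ucin: "cinner (U x) (U y) = cinner x y" if "x \<in> V" "y \<in> V" for x y
    using U that by (auto simp: unitary_between_def)
  have Usurj: "\<exists>y\<in>V. x = U y" if "x \<in> V" for x using U that by (auto simp: unitary_between_def)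
  have U0: "U 0 = 0" by (rule unitary_between_simps(2)[OF U V(1)])
  have YU: "(U u, U v) \<in> Y \<longleftrightarrow> (u, v) \<in> Y" if "u \<in> V" "v \<in> V" for u v
  proof -
    have e: "cinner (U u) (a (n + 1)) + cinner (U v) (b (n + 1)) = cinner u (a n) + cinner v (b n)" for n
      unfolding Ua[symmetric] Ub[symmetric] using Ucin aV bV that by simp
    have "(\<forall>n. cinner (U u) (a n) + cinner (U v) (b n) = 0)
        \<longleftrightarrow> (\<forall>n. cinner (U u) (a (n + 1)) + cinner (U v) (b (n + 1)) = 0)"
      by (metis diff_add_cancel)
    then show ?thesis using that Uin by (auto simp: Y_iff e)
  qed
  have GU: "(U x, U y) \<in> G" if "(x, y) \<in> G" for x y
  proof -
    have xy: "x \<in> V" "y \<in> V" using that by (auto simp: G_iff)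
    have "cinner (U x) u + cinner (U y) v = 0" if uv: "(u, v) \<in> Y" for u v
    proof -
      obtain u' v' where u': "u' \<in> V" "u = U u'" and v': "v' \<in> V" "v = U v'"
        using uv Usurj Y_iff by metis
      then have "(u', v') \<in> Y" using uv YU by simp
      then have "cinner x u' + cinner y v' = 0" using \<open>(x, y) \<in> G\<close> by (simp add: G_iff)
      then show ?thesis using u' v' xy Ucin by simp
    qed
    then show ?thesis using xy Uin by (auto simp: G_iff)
  qed
  have GY: "(x, y) \<in> Y" if "x \<in> V" "y \<in> V" "\<And>p. p \<in> G \<Longrightarrow> cinner (x, y) p = 0" for x y
    using that(3)[OF abG] that(1,2) by (auto simp: Y_iff cinner_prod_def)
  have PU: "P (U x, 0) = (U (fst (P (x, 0))), U (snd (P (x, 0))))" if x: "x \<in> V" for x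
  proof -
    obtain p q where pq: "P (x, 0) = (p, q)" by force
    have pqV: "p \<in> V" "q \<in> V" using PV[of "(x, 0)"] pq by auto
    have xpV: "x - p \<in> V" "0 - q \<in> V"
      by (rule csubspaceD(4)[OF V(1) x pqV(1)], rule csubspaceD(4)[OF V(1) csubspaceD(1)[OF V(1)] pqV(2)])
    have "(x - p, 0 - q) \<in> Y"
      using orth_proj_orth[OF G, of _ "(x, 0)"] pq by (intro GY xpV) (simp add: P_def)
    then have Uy: "(U (x - p), U (0 - q)) \<in> Y" using YU xpV by blast
    have "P (U x, 0) = (U p, U q)"
      unfolding P_def
    proof (rule orth_proj_eqI[OF G(1)])
      show "(U p, U q) \<in> G" using Pin[of "(x, 0)"] pq GU by simp
      fix r assume r: "r \<in> G"
      have "(U x, 0) - (U p, U q) = (U (x - p), U (0 - q))"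
        using unitary_between_simps(1)[OF U V(1) x pqV(1)]
          unitary_between_simps(1)[OF U V(1) csubspaceD(1)[OF V(1)] pqV(2)] U0 by simp
      moreover have "cinner r (U (x - p), U (0 - q)) = 0"
        using r Uy by (simp add: G_def orth_compl_def)
      ultimately show "cinner ((U x, 0) - (U p, U q)) r = 0"
        by (simp add: cinner_eq_0_commute[of r])
    qed
    then show ?thesis using pq by simp
  qed
  \<comment> \<open>The projection commutes with \<open>U\<close> in both components, so this matrix
    of \<open>S\<close> depends on \<open>n - m\<close> alone. The reflection \<open>(n, m)\<close>
    to \<open>(- m - 1, - n - 1)\<close> keeps the difference; this symmetry replaces the
    commutativity of multiplication operators.\<close>
  define \<tau> where "\<tau> n m = cinner (S (a n)) (a m)" for n m
  have \<tau>1: "\<tau> (n + 1) (m + 1) = \<tau> n m" for n m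
    unfolding \<tau>_def Ua[symmetric] S_def using PU[OF aV] Ucin[OF PV(2) aV] by simp
  have \<tau>shift: "\<tau> (n + j) (m + j) = \<tau> n m" for n m j
  proof (induction j rule: int_induct[where k = 0])
    case (step1 i) then show ?case using \<tau>1[of "n + i" "m + i"] by (simp add: ac_simps)
  next
    case (step2 i) then show ?case using \<tau>1[of "n + i - 1" "m + i - 1"] by (simp add: algebra_simps)
  qed simp
  have \<tau>sym: "\<tau> (- m - 1) (- n - 1) = \<tau> n m" for n m
    using \<tau>shift[of "- m - 1" "n + m + 1" "- n - 1"] by simp
  have eqI: "x = y" if "x \<in> V" "y \<in> V" "\<And>n. cinner (a n) x = cinner (a n) y" for x y
  proof -
    have "x - y = 0"
    proof (rule total)
      show "x - y \<in> V" using that csubspaceD(4)[OF V(1)] by blast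
      fix n have "cinner (a n) (x - y) = 0" using that(3) by (simp add: cinner_diff_right)
      then show "cinner (x - y) (a n) = 0" by (simp add: cinner_eq_0_commute[of "a n"])
    qed
    then show ?thesis by simp
  qed
  have cl: "cinner (c x) y = cinner (c y) x" if "x \<in> V" "y \<in> V" for x y
    using c(3)[OF that(1) c(1)[OF that(2)]] c(2)[OF that(2)] by simp
  have cr: "cinner x (c y) = cinner y (c x)" if "x \<in> V" "y \<in> V" for x y
    using c(3)[OF c(1)[OF that(1)] that(2)] c(2)[OF that(1)] by simp
  have \<kappa>1: "\<kappa> * (cnj \<kappa> * w) = w" "cnj \<kappa> * (\<kappa> * w) = w" for w
    using \<kappa> by (simp_all add: mult.assoc[symmetric] complex_norm_square[symmetric] mult.commute)
  have Sscale: "cinner (S (r *\<^sub>C x)) y = r * cinner (S x) y" for r x y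
    unfolding SR cinner_scaleC_left ..
  \<comment> \<open>The conjugation exchanges the two blocks. On the vectors \<open>a m\<close> this
    is the reflection symmetry of \<tau> combined with \<open>ca\<close>.\<close>
  have R1: "R (a m) = c (S (c (a m)))" for m
  proof (rule eqI[OF RV])
    show "c (S (c (a m))) \<in> V" by (rule c(1)[OF SV])
    fix n
    have "cinner (a n) (c (S (c (a m)))) = cinner (S (c (a m))) (c (a n))"
      by (rule cr[OF aV SV])
    also have "\<dots> = \<tau> (- m - 1) (- n - 1)"
      unfolding ca Sscale cinner_scaleC_right \<tau>_def by (simp add: \<kappa>1)
    finally show "cinner (a n) (R (a m)) = cinner (a n) (c (S (c (a m))))"
      unfolding SR[symmetric] using \<tau>sym by (simp add: \<tau>_def)
  qed
  \<comment> \<open>The passage from the vectors \<open>a m\<close> to all of \<open>V\<close> uses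
    the adjoint relation \<open>SR\<close> in place of linearity and continuity of
    \<open>S\<close>.\<close>
  have R2: "R y = c (S (c y))" if y: "y \<in> V" for y
  proof (rule eqI[OF RV])
    show "c (S (c y)) \<in> V" by (rule c(1)[OF SV])
    fix n
    have "cinner (a n) (c (S (c y))) = cinner (S (c y)) (c (a n))" by (rule cr[OF aV SV])
    also have "\<dots> = cnj \<kappa> * cinner (S (c y)) (a (- n - 1))" by (simp add: ca cinner_scaleC_right)
    also have "cinner (S (c y)) (a (- n - 1)) = cinner (c y) (c (S (c (a (- n - 1)))))"
      by (simp add: SR R1)
    also have "\<dots> = cinner (S (c (a (- n - 1)))) y" by (rule c(3)[OF y SV])
    also have "\<dots> = \<kappa> * cinner (S (a n)) y" by (simp add: ca Sscale)
    finally show "cinner (a n) (R y) = cinner (a n) (c (S (c y)))"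
      unfolding SR[symmetric] by (simp add: \<kappa>1)
  qed
  have Pnorm: "cinner (P p) p = complex_of_real ((norm (P p))\<^sup>2)" for p
  proof -
    have "cinner (P p) (P p) = cinner p (P p)" using orth_proj_cinner(1)[OF G Pin, of p] by (simp add: P_def)
    then show ?thesis by (simp add: Psa[of p p] cinner_self)
  qed
  have cg: "c g \<in> V" and cf: "c f \<in> V" using c(1) f g by auto
  have Y1: "(f, g) \<in> Y" using f g fg1 by (simp add: Y_iff)
  \<comment> \<open>The second hypothesis, conjugated by \<open>c\<close>, says that this pair too
    is orthogonal to the graph.\<close>
  have Y2: "(c g, - c f) \<in> Y"
  proof -
    have "cinner (c g) (a n) = cinner (c f) (b n)" for n
    proof -
      have "cinner (c g) (a n) = cinner (c (a n)) g" by (rule cl[OF g aV])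
      also have "\<dots> = \<kappa> * cnj (cinner g (a (- n - 1)))"
        by (simp add: ca cinner_scaleC_left cinner_commute[of "a (- n - 1)"])
      also have "\<dots> = cinner (c (b n)) f"
        by (simp add: cb cinner_scaleC_left cinner_commute[of "b' (- n - 1)"] fg2)
      also have "\<dots> = cinner (c f) (b n)" by (rule cl[OF bV f])
      finally show ?thesis .
    qed
    then show ?thesis using cf cg csubspaceD(5)[OF V(1)] by (simp add: Y_iff)
  qed
  have GYz: "cinner (P p) y = 0" if "y \<in> Y" for p y
    using Pin[of p] that by (auto simp: G_def orth_compl_def)
  \<comment> \<open>Pairing \<open>P (f, 0)\<close> with \<open>(f, g)\<close>, and
    \<open>P (c g, 0)\<close> with \<open>(c g, - c f)\<close>, gives two squared norms accompanied
    by the same number \<open>cinner (S f) g\<close> with opposite signs. Their sum is therefore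
    zero, and both projections vanish.\<close>
  have e1: "complex_of_real ((norm (P (f, 0)))\<^sup>2) + cinner (S f) g = 0"
    using GYz[OF Y1, of "(f, 0)"] Pnorm[of "(f, 0)"] by (simp add: cinner_prod_def S_def)
  have "complex_of_real ((norm (P (c g, 0)))\<^sup>2) - cinner (S (c g)) (c f) = 0"
    using GYz[OF Y2, of "(c g, 0)"] Pnorm[of "(c g, 0)"] by (simp add: cinner_prod_def S_def)
  moreover have "cinner (S (c g)) (c f) = cinner (S f) g"
    unfolding SR[of f] R2[OF g] by (rule cr[OF f SV, symmetric])
  ultimately have "complex_of_real ((norm (P (f, 0)))\<^sup>2 + (norm (P (c g, 0)))\<^sup>2) = 0"
    using e1 by (simp add: algebra_simps)
  then have "(norm (P (f, 0)))\<^sup>2 + (norm (P (c g, 0)))\<^sup>2 = 0" by (simp only: of_real_eq_0_iff)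
  then have z: "P (f, 0) = 0" "P (c g, 0) = 0" by (simp_all add: sum_power2_eq_zero_iff)
  have "x = 0" if x: "x \<in> V" "P (x, 0) = 0" for x
  proof (rule total[OF x(1)])
    fix n show "cinner x (a n) = 0"
      using orth_proj_orth[OF G abG[of n], of "(x, 0)"] x(2) by (simp add: P_def cinner_prod_def)
  qed
  then have "f = 0" "c g = 0" using z f cg by auto
  then have "c (c g) = 0" using c(4)[OF csubspaceD(1)[OF V(1)], of 0] by simp
  with \<open>f = 0\<close> c(2)[OF g] show ?thesis by simp
qed

section \<open>Square integrable functions on the circle\<close>

lemma space_circle_measure [simp]: "space circle_measure = UNIV"
  by (simp add: circle_measure_def)

lemma measurable_circle_measure [simp]: "borel_measurable circle_measure = borel_measurable borel"
  by (rule measurable_cong_sets) simp_all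

lemma uniform_measure_circle:
  "uniform_measure lborel {0..2 * pi} = density lborel (\<lambda>x. ennreal (indicator {0..2 * pi} x / (2 * pi)))"
  unfolding uniform_measure_def
proof (rule arg_cong[where f = "density lborel"], rule ext)
  fix x :: real
  have "emeasure lborel {0..2 * pi} = ennreal (2 * pi)" by simp
  then show "indicator {0..2 * pi} x / emeasure lborel {0..2 * pi} = ennreal (indicator {0..2 * pi} x / (2 * pi))"
    by (auto simp: indicator_def divide_ennreal[symmetric] simp del: emeasure_lborel_Icc_eq)
qed

lemma cis_measurable: "cis \<in> borel_measurable borel"
  by (intro borel_measurable_continuous_onI continuous_intros)

lemma circle_integral:
  fixes f :: "complex \<Rightarrow> complex"
  assumes "f \<in> borel_measurable borel"
  shows "(\<integral>z. f z \<partial>circle_measure) = (\<integral>x. (indicator {0..2 * pi} x / (2 * pi)) *\<^sub>R f (cis x) \<partial>lborel)"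
proof -
  have m: "(\<lambda>x. f (cis x)) \<in> borel_measurable borel"
    using measurable_compose[OF cis_measurable assms] .
  show ?thesis
    unfolding circle_measure_def uniform_measure_circle
    using cis_measurable assms m
    by (subst integral_distr) (auto intro!: integral_density)
qed

lemma prob_circle: "emeasure circle_measure UNIV = 1"
proof -
  have "emeasure circle_measure UNIV = emeasure (uniform_measure lborel {0..2 * pi}) UNIV"
    unfolding circle_measure_def using cis_measurable by (subst emeasure_distr) auto
  also have "\<dots> = 1"
    by (subst emeasure_uniform_measure) auto
  finally show ?thesis .
qed

interpretation circle: finite_measure circle_measure
  by (rule finite_measureI) (simp add: prob_circle)

lemma measure_circle [simp]: "measure circle_measure UNIV = 1"
  by (simp add: measure_def prob_circle)

lemma AE_circle: "AE z in circle_measure. cmod z = 1"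
  unfolding circle_measure_def
  by (subst AE_distr_iff) (use cis_measurable in auto)

lemma AE_circleI: "(\<And>z. cmod z = 1 \<Longrightarrow> P z) \<Longrightarrow> AE z in circle_measure. P z"
  using AE_circle by (rule AE_mp) auto

lemma circle_integral_power: "m > 0 \<Longrightarrow> (\<integral>z. z ^ m \<partial>circle_measure) = 0"
proof -
  assume m: "m > 0"
  define F where "F x = cis (real m * x) / (\<i> * of_nat m)" for x
  have d: "(F has_vector_derivative cis (real m * x)) (at x within {0..2*pi})" for x
  proof -
    have "((\<lambda>z. exp (\<i> * of_nat m * z)) has_field_derivative (\<i> * of_nat m * exp (\<i> * of_nat m * of_real x))) (at (of_real x))"
      by (auto intro!: derivative_eq_intros)
    then have "((\<lambda>x. exp (\<i> * of_nat m * complex_of_real x)) has_vector_derivative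
        (\<i> * of_nat m * exp (\<i> * of_nat m * of_real x))) (at x within {0..2*pi})"
      by (rule has_vector_derivative_real_field)
    then have "((\<lambda>x. cis (real m * x)) has_vector_derivative (\<i> * of_nat m * cis (real m * x))) (at x within {0..2*pi})"
      by (simp add: cis_conv_exp mult.assoc)
    from has_vector_derivative_divide[OF this, of "\<i> * of_nat m"] show ?thesis
      using m unfolding F_def by (simp add: field_simps)
  qed
  have c: "continuous_on {0..2*pi} (\<lambda>x. cis (real m * x))" by (intro continuous_intros)
  have "(\<integral>x. indicator {0..2 * pi} x *\<^sub>R cis (real m * x) \<partial>lborel) = F (2 * pi) - F 0"
    by (rule integral_FTC_Icc[OF _ d c]) auto
  also have "\<dots> = 0"
  proof -
    have "cis (real m * (2 * pi)) = 1" using Complex.DeMoivre[of "2 * pi" m] by simp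
    then show ?thesis by (simp add: F_def)
  qed
  finally have 1: "(\<integral>x. indicator {0..2 * pi} x *\<^sub>R cis (real m * x) \<partial>lborel) = 0" .
  have "(\<integral>z. z ^ m \<partial>circle_measure) = (\<integral>x. (indicator {0..2 * pi} x / (2 * pi)) *\<^sub>R cis (real m * x) \<partial>lborel)"
    by (subst circle_integral) (auto simp: Complex.DeMoivre)
  also have "\<dots> = (1 / (2 * pi)) *\<^sub>R (\<integral>x. indicator {0..2 * pi} x *\<^sub>R cis (real m * x) \<partial>lborel)"
    by (subst integral_scaleR_right[symmetric]) simp
  finally show ?thesis using 1 by simp
qed

lemma borel_measurable_cnj [measurable (raw)]:
  assumes "f \<in> borel_measurable M"
  shows "(\<lambda>x. cnj (f x)) \<in> borel_measurable M"
  using measurable_compose[OF assms borel_measurable_continuous_onI[OF continuous_on_cnj[OF continuous_on_id]]] .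

lemma borel_measurable_powi [measurable (raw)]:
  "(f :: 'a \<Rightarrow> complex) \<in> borel_measurable M \<Longrightarrow> (\<lambda>x. f x powi m) \<in> borel_measurable M"
proof -
  assume [measurable]: "f \<in> borel_measurable M"
  show ?thesis by (cases "0 \<le> m") (simp_all add: power_int_def)
qed

lemma square_integrable_bounded_mult:
  assumes "square_integrable f" "b \<in> borel_measurable borel" "\<And>z. cmod z = 1 \<Longrightarrow> cmod (b z) \<le> C"
  shows "square_integrable (\<lambda>z. b z * f z)"
proof -
  have [measurable]: "f \<in> borel_measurable borel" "b \<in> borel_measurable borel"
    using assms by (auto simp: square_integrable_def)
  have "integrable circle_measure (\<lambda>z. (cmod (b z * f z))\<^sup>2)"
  proof (rule Bochner_Integration.integrable_bound)
    show "integrable circle_measure (\<lambda>z. C\<^sup>2 * (cmod (f z))\<^sup>2)"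
      using assms(1) by (simp add: square_integrable_def)
    show "AE z in circle_measure. norm ((cmod (b z * f z))\<^sup>2) \<le> norm (C\<^sup>2 * (cmod (f z))\<^sup>2)"
      by (rule AE_circleI)
        (auto simp: norm_mult power_mult_distrib intro!: mult_right_mono power_mono assms(3))
  qed simp
  then show ?thesis by (simp add: square_integrable_def)
qed

lemma square_integrable_one: "square_integrable (\<lambda>z. 1)"
  by (simp add: square_integrable_def)

lemma square_integrable_bounded:
  assumes "b \<in> borel_measurable borel" "\<And>z. cmod z = 1 \<Longrightarrow> cmod (b z) \<le> C"
  shows "square_integrable b"
  using square_integrable_bounded_mult[OF square_integrable_one assms] by simp

lemma square_integrable_diff:
  "square_integrable f \<Longrightarrow> square_integrable g \<Longrightarrow> square_integrable (\<lambda>z. f z - g z)"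
  using square_integrable_add[of f "\<lambda>z. (-1) * g z"] square_integrable_mult_const[of g "-1"] by simp

lemma square_integrable_id_mult:
  "square_integrable f \<Longrightarrow> square_integrable (\<lambda>z. z * f z)"
  by (rule square_integrable_bounded_mult[where C = 1]) auto

lemma square_integrable_power_mult:
  "square_integrable f \<Longrightarrow> square_integrable (\<lambda>z. z ^ n * f z)"
  by (rule square_integrable_bounded_mult[where C = 1]) (auto simp: norm_power)

lemma integrable_product:
  "square_integrable f \<Longrightarrow> square_integrable g \<Longrightarrow> integrable circle_measure (\<lambda>z. f z * g z)"
  using integrable_cnj_product[OF _ square_integrable_cnj, of f g] by simp

lemma square_integrable_integrable: "square_integrable f \<Longrightarrow> integrable circle_measure f"
  using integrable_product[OF _ square_integrable_one] by simp

section \<open>Passing between classes and representing functions\<close>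

abbreviation cls :: "(complex \<Rightarrow> complex) \<Rightarrow> circle_L2" where "cls \<equiv> abs_circle_L2"

lemma L2_rel_refl: "square_integrable f \<Longrightarrow> L2_rel f f"
  by (simp add: L2_rel_def)

lemma cls_surj: obtains f where "square_integrable f" "x = cls f"
  using Quotient_rep_reflp[OF Quotient_circle_L2, of x] Quotient_abs_rep[OF Quotient_circle_L2, of x]
  by (auto simp: L2_rel_def)

lemma cls_eq_iff:
  "square_integrable f \<Longrightarrow> square_integrable g \<Longrightarrow> cls f = cls g \<longleftrightarrow> (AE z in circle_measure. f z = g z)"
  using Quotient_rel[OF Quotient_circle_L2, of f g] by (auto simp: L2_rel_def)

lemma cls_zero: "cls (\<lambda>z. 0) = 0"
  by (simp add: zero_circle_L2.abs_eq)

lemma cls_add: "square_integrable f \<Longrightarrow> square_integrable g \<Longrightarrow> cls f + cls g = cls (\<lambda>z. f z + g z)"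
  by (simp add: plus_circle_L2.abs_eq L2_rel_refl)

lemma cls_scaleC: "square_integrable f \<Longrightarrow> c *\<^sub>C cls f = cls (\<lambda>z. c * f z)"
  by (simp add: scaleC_circle_L2.abs_eq L2_rel_refl)

lemma cls_diff: "square_integrable f \<Longrightarrow> square_integrable g \<Longrightarrow> cls f - cls g = cls (\<lambda>z. f z - g z)"
  using cls_add[of f "\<lambda>z. (-1) * g z"] cls_scaleC[of g "-1"] square_integrable_mult_const[of g "-1"]
  by (simp add: minus_circle_L2_def)

lemma cls_cinner:
  "square_integrable f \<Longrightarrow> square_integrable g \<Longrightarrow> cinner (cls f) (cls g) = (\<integral>z. f z * cnj (g z) \<partial>circle_measure)"
  by (simp add: cinner_circle_L2.abs_eq L2_rel_refl)

lemma cls_norm: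
  assumes "square_integrable f" shows "(norm (cls f))\<^sup>2 = (\<integral>z. (cmod (f z))\<^sup>2 \<partial>circle_measure)"
proof -
  have "complex_of_real ((norm (cls f))\<^sup>2) = (\<integral>z. complex_of_real ((cmod (f z))\<^sup>2) \<partial>circle_measure)"
    unfolding cinner_self[symmetric] cls_cinner[OF assms assms] complex_norm_square ..
  then show ?thesis by (simp only: integral_complex_of_real of_real_eq_iff)
qed

lemma cls_cnj: "square_integrable f \<Longrightarrow> cnj_L2 (cls f) = cls (\<lambda>z. cnj (f z))"
  by (simp add: cnj_L2.abs_eq L2_rel_refl)

lemma cls_mult_in:
  "square_integrable f \<Longrightarrow> square_integrable g \<Longrightarrow> mult_in_L2 (cls f) (cls g) \<longleftrightarrow> square_integrable (\<lambda>z. f z * g z)"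
  by (simp add: mult_in_L2.abs_eq L2_rel_refl)

lemma cls_mult:
  "square_integrable f \<Longrightarrow> square_integrable g \<Longrightarrow> square_integrable (\<lambda>z. f z * g z) \<Longrightarrow>
    cls f \<odot> cls g = cls (\<lambda>z. f z * g z)"
  by (simp add: mult_L2.abs_eq L2_rel_refl)

lemma cls_unimodular: "square_integrable f \<Longrightarrow> unimodular (cls f) \<longleftrightarrow> (AE z in circle_measure. cmod (f z) = 1)"
  by (simp add: unimodular.abs_eq L2_rel_refl)

lemma cls_fourier: "square_integrable f \<Longrightarrow> fourier_coeff (cls f) k = (\<integral>z. f z * z powi (- k) \<partial>circle_measure)"
  by (simp add: fourier_coeff.abs_eq L2_rel_refl)

text \<open>Along a fast subsequence the increments are summable almost everywhere, which provides a
  pointwise limit; Fatou's lemma identifies it as the limit in norm.\<close>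

lemma circle_L2_Cauchy_converges:
  fixes X :: "nat \<Rightarrow> circle_L2"
  assumes "Cauchy X"
  shows "\<exists>l. X \<longlonglongrightarrow> l"
proof -
  have "\<exists>N. \<forall>m\<ge>N. \<forall>n\<ge>N. dist (X m) (X n) < (1/2)^k" for k :: nat
    using assms unfolding Cauchy_def by simp
  then obtain N where N: "\<And>k m n. m \<ge> N k \<Longrightarrow> n \<ge> N k \<Longrightarrow> dist (X m) (X n) < (1/2)^k" by metis
  \<comment> \<open>Adding up all the thresholds makes \<open>r\<close> strictly increasing and at
    least \<open>N k\<close>.\<close>
  define r where "r k = k + (\<Sum>i\<le>k. N i)" for k
  have rN: "N k \<le> r k" for k
    unfolding r_def by (simp add: sum.remove[of "{..k}" k] trans_le_add2)
  have r: "strict_mono r" by (rule strict_mono_Suc_iff[THEN iffD2]) (simp add: r_def)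
  then have rmono: "r k \<le> r m" if "k \<le> m" for k m using that by (simp add: strict_mono_less_eq)
  have "\<exists>f. square_integrable f \<and> X (r k) = cls f" for k using cls_surj[of "X (r k)"] by metis
  then obtain f where f: "\<And>k. square_integrable (f k)" "\<And>k. X (r k) = cls (f k)" by metis
  have [measurable]: "f k \<in> borel_measurable borel" for k using f(1) by (simp add: square_integrable_def)
  have sqd: "square_integrable (\<lambda>z. f m z - f k z)" for m k by (intro square_integrable_diff f)
  have nrm: "(\<integral>z. (cmod (f m z - f k z))\<^sup>2 \<partial>circle_measure) \<le> ((1/2)^k)\<^sup>2" if "k \<le> m" for m k
  proof -
    have "dist (X (r m)) (X (r k)) < (1/2)^k"
      using rN[of k] rmono[OF that] by (intro N) auto
    then have "(norm (X (r m) - X (r k)))\<^sup>2 \<le> ((1/2)^k)\<^sup>2"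
      by (intro power_mono) (auto simp: dist_norm)
    then show ?thesis unfolding f(2) cls_diff[OF f(1) f(1)] cls_norm[OF sqd] .
  qed
  have int_d: "(\<integral>\<^sup>+z. ennreal (cmod (f (Suc k) z - f k z)) \<partial>circle_measure) \<le> ennreal ((1/2)^k)" for k
  proof -
    define e :: real where "e = (1/2)^k"
    have e: "e > 0" by (simp add: e_def)
    let ?d = "\<lambda>z. cmod (f (Suc k) z - f k z)"
    have i2: "integrable circle_measure (\<lambda>z. (?d z)\<^sup>2)" using sqd by (simp add: square_integrable_def)
    have i1: "integrable circle_measure ?d" using square_integrable_integrable[OF sqd] by (rule integrable_norm)
    \<comment> \<open>The arithmetic-geometric mean inequality with weight \<open>e\<close> bounds
      the first moment by the second, in the role of the Cauchy-Schwarz inequality.\<close>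
    have pt: "?d z \<le> (e + (?d z)\<^sup>2 / e) / 2" for z
    proof -
      have "2 * e * ?d z \<le> e\<^sup>2 + (?d z)\<^sup>2" by (rule sum_squares_bound)
      then show ?thesis using e by (simp add: field_simps power2_eq_square)
    qed
    have "(\<integral>z. ?d z \<partial>circle_measure) \<le> (\<integral>z. (e + (?d z)\<^sup>2 / e) / 2 \<partial>circle_measure)"
      using i1 i2 pt by (intro integral_mono) auto
    also have "\<dots> = (e + (\<integral>z. (?d z)\<^sup>2 \<partial>circle_measure) / e) / 2"
      using i2 by simp
    also have "\<dots> \<le> (e + e\<^sup>2 / e) / 2"
      using nrm[of k "Suc k"] e by (intro divide_right_mono add_left_mono) (auto simp: e_def)
    also have "\<dots> = e" using e by (simp add: power2_eq_square)
    finally show ?thesis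
      using nn_integral_eq_integral[OF i1] by (simp add: e_def ennreal_leI)
  qed
  have "(\<integral>\<^sup>+z. (\<Sum>k. ennreal (cmod (f (Suc k) z - f k z))) \<partial>circle_measure)
      = (\<Sum>k. \<integral>\<^sup>+z. ennreal (cmod (f (Suc k) z - f k z)) \<partial>circle_measure)"
    by (rule nn_integral_suminf) simp
  also have "\<dots> \<le> (\<Sum>k. ennreal ((1/2)^k))" by (intro suminf_le int_d) auto
  also have "\<dots> < \<infinity>" by (subst suminf_ennreal2) auto
  finally have "AE z in circle_measure. (\<Sum>k. ennreal (cmod (f (Suc k) z - f k z))) \<noteq> \<infinity>"
    by (intro nn_integral_noteq_infinite) auto
  then have conv: "AE z in circle_measure. convergent (\<lambda>k. f k z)"
  proof (rule AE_mp, intro AE_I2 impI)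
    fix z assume "(\<Sum>k. ennreal (cmod (f (Suc k) z - f k z))) \<noteq> \<infinity>"
    then have "summable (\<lambda>k. cmod (f (Suc k) z - f k z))"
      by (intro summable_suminf_not_top) auto
    then have "summable (\<lambda>k. f (Suc k) z - f k z)" by (rule summable_norm_cancel)
    then have "convergent (\<lambda>n. \<Sum>k<n. (f (Suc k) z - f k z))" by (simp add: summable_iff_convergent)
    then have "convergent (\<lambda>n. f n z - f 0 z)" using sum_lessThan_telescope[of "\<lambda>k. f k z"] by simp
    then have "convergent (\<lambda>n. (f n z - f 0 z) + f 0 z)" by (intro convergent_add convergent_const)
    then show "convergent (\<lambda>k. f k z)" by simp
  qed
  define g where "g z = lim (\<lambda>k. f k z)" for z
  have [measurable]: "g \<in> borel_measurable borel" unfolding g_def by measurable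
  have lim: "AE z in circle_measure. (\<lambda>k. f k z) \<longlonglongrightarrow> g z"
    using conv unfolding g_def by (simp add: convergent_LIMSEQ_iff)
  \<comment> \<open>The index \<open>m\<close> goes to infinity for fixed \<open>k\<close> in the
    estimate \<open>nrm\<close>.\<close>
  have fatou: "(\<integral>\<^sup>+z. ennreal ((cmod (g z - f k z))\<^sup>2) \<partial>circle_measure) \<le> ennreal (((1/2)^k)\<^sup>2)" for k
  proof -
    have "(\<integral>\<^sup>+z. ennreal ((cmod (g z - f k z))\<^sup>2) \<partial>circle_measure)
        = (\<integral>\<^sup>+z. liminf (\<lambda>m. ennreal ((cmod (f m z - f k z))\<^sup>2)) \<partial>circle_measure)"
    proof (rule nn_integral_cong_AE, use lim in \<open>rule AE_mp\<close>, intro AE_I2 impI)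
      fix z assume "(\<lambda>k. f k z) \<longlonglongrightarrow> g z"
      then have "(\<lambda>m. ennreal ((cmod (f m z - f k z))\<^sup>2)) \<longlonglongrightarrow> ennreal ((cmod (g z - f k z))\<^sup>2)"
        by (intro tendsto_intros)
      then show "ennreal ((cmod (g z - f k z))\<^sup>2) = liminf (\<lambda>m. ennreal ((cmod (f m z - f k z))\<^sup>2))"
        by (rule lim_imp_Liminf[OF sequentially_bot, symmetric])
    qed
    also have "\<dots> \<le> liminf (\<lambda>m. \<integral>\<^sup>+z. ennreal ((cmod (f m z - f k z))\<^sup>2) \<partial>circle_measure)"
      by (rule nn_integral_liminf) simp
    also have "\<dots> \<le> ennreal (((1/2)^k)\<^sup>2)"
    proof (rule Liminf_le)
      have "(\<integral>\<^sup>+z. ennreal ((cmod (f m z - f k z))\<^sup>2) \<partial>circle_measure) \<le> ennreal (((1/2)^k)\<^sup>2)" if "m \<ge> k" for m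
        using nrm[OF that] sqd[of m k] by (subst nn_integral_eq_integral) (auto simp: square_integrable_def intro: ennreal_leI)
      then show "\<forall>\<^sub>F m in sequentially. (\<integral>\<^sup>+z. ennreal ((cmod (f m z - f k z))\<^sup>2) \<partial>circle_measure) \<le> ennreal (((1/2)^k)\<^sup>2)"
        by (auto simp: eventually_sequentially)
    qed simp
    finally show ?thesis .
  qed
  have sqg: "square_integrable (\<lambda>z. g z - f k z)" for k
    unfolding square_integrable_def
    using fatou[of k] by (auto intro!: integrableI_bounded simp: less_top[symmetric] top_unique le_less_trans)
  have g: "square_integrable g"
    using square_integrable_add[OF sqg[of 0] f(1)[of 0]] by simp
  have "norm (X (r k) - cls g) \<le> (1/2)^k" for k
  proof -
    have "(norm (cls g - X (r k)))\<^sup>2 = (\<integral>z. (cmod (g z - f k z))\<^sup>2 \<partial>circle_measure)"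
      unfolding f(2) cls_diff[OF g f(1)] by (rule cls_norm[OF sqg])
    also have "ennreal \<dots> \<le> ennreal (((1/2)^k)\<^sup>2)"
      using fatou[of k] sqg[of k] by (subst nn_integral_eq_integral[symmetric]) (auto simp: square_integrable_def)
    finally have "(norm (cls g - X (r k)))\<^sup>2 \<le> ((1/2)^k)\<^sup>2" by (simp add: ennreal_le_iff)
    then have "norm (cls g - X (r k)) \<le> (1/2)^k" by (rule power2_le_imp_le) simp
    then show ?thesis by (simp add: norm_minus_commute)
  qed
  then have "(\<lambda>k. X (r k) - cls g) \<longlonglongrightarrow> 0"
    by (intro Lim_null_comparison[OF always_eventually[OF allI] LIMSEQ_realpow_zero[of "1/2::real"]]) auto
  then have "(X \<circ> r) \<longlonglongrightarrow> cls g" by (simp add: LIM_zero_iff o_def)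
  then have "X \<longlonglongrightarrow> cls g" by (rule Cauchy_converges_subseq[OF assms r])
  then show ?thesis ..
qed

lemma complete_circle_L2: "complete (UNIV :: circle_L2 set)"
  using circle_L2_Cauchy_converges by (auto simp: complete_def)

lemma complete_closed_circle_L2: "closed (S :: circle_L2 set) \<Longrightarrow> complete S"
  using complete_closed_subset[OF _ subset_UNIV complete_circle_L2] .

subsection \<open>Uniqueness of Fourier coefficients\<close>

definition null_fourier :: "(complex \<Rightarrow> complex) \<Rightarrow> bool" where
  "null_fourier f \<longleftrightarrow> integrable circle_measure f \<and> (\<forall>k. (\<integral>z. f z * z powi k \<partial>circle_measure) = 0)"

lemma integrable_circle_bounded_mult:
  fixes f b :: "complex \<Rightarrow> complex"
  assumes "integrable circle_measure f" "b \<in> borel_measurable borel" "\<And>z. cmod z = 1 \<Longrightarrow> cmod (b z) \<le> C"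
  shows "integrable circle_measure (\<lambda>z. f z * b z)"
proof (rule Bochner_Integration.integrable_bound)
  show "integrable circle_measure (\<lambda>z. C * cmod (f z))" using assms(1) by simp
  show "(\<lambda>z. f z * b z) \<in> borel_measurable circle_measure"
    using assms(1,2) borel_measurable_integrable by fastforce
  show "AE z in circle_measure. norm (f z * b z) \<le> norm (C * cmod (f z))"
  proof (rule AE_circleI)
    fix z :: complex assume z: "cmod z = 1"
    then have "0 \<le> C" using assms(3)[OF z] norm_ge_zero order_trans by blast
    then show "norm (f z * b z) \<le> norm (C * cmod (f z))"
      using assms(3)[OF z] by (simp add: norm_mult abs_mult mult.commute mult_right_mono)
  qed
qed

lemma null_fourier_measurable: "null_fourier f \<Longrightarrow> f \<in> borel_measurable borel"
  using borel_measurable_integrable[of circle_measure f] by (simp add: null_fourier_def)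

lemma null_fourier_mult_powi:
  assumes "null_fourier f" shows "null_fourier (\<lambda>z. f z * z powi j)"
  unfolding null_fourier_def
proof (intro conjI allI)
  show "integrable circle_measure (\<lambda>z. f z * z powi j)"
    using assms by (intro integrable_circle_bounded_mult[where C = 1]) (auto simp: null_fourier_def norm_power_int)
  fix k
  have [measurable]: "f \<in> borel_measurable borel"
    using assms borel_measurable_integrable by (auto simp: null_fourier_def)
  have "(\<integral>z. f z * z powi j * z powi k \<partial>circle_measure) = (\<integral>z. f z * z powi (j + k) \<partial>circle_measure)"
  proof (intro integral_cong_AE AE_circleI)
    fix z :: complex assume "cmod z = 1"
    then have "z \<noteq> 0" by auto
    then show "f z * z powi j * z powi k = f z * z powi (j + k)" by (simp add: power_int_add)
  qed simp_all
  then show "(\<integral>z. f z * z powi j * z powi k \<partial>circle_measure) = 0" using assms by (simp add: null_fourier_def)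
qed

lemma null_fourier_lincomb:
  assumes "null_fourier f" "null_fourier g" shows "null_fourier (\<lambda>z. a * f z + b * g z)"
proof -
  have i: "integrable circle_measure (\<lambda>z. f z * z powi k)" "integrable circle_measure (\<lambda>z. g z * z powi k)" for k
    using null_fourier_mult_powi[OF assms(1), of k] null_fourier_mult_powi[OF assms(2), of k]
    by (auto simp: null_fourier_def)
  have "(\<integral>z. (a * f z + b * g z) * z powi k \<partial>circle_measure)
      = (\<integral>z. a * (f z * z powi k) + b * (g z * z powi k) \<partial>circle_measure)" for k
    by (simp add: algebra_simps)
  then show ?thesis using assms i by (simp add: null_fourier_def)
qed

lemma null_fourier_cong:
  assumes "null_fourier f" "g \<in> borel_measurable borel" "\<And>z. cmod z = 1 \<Longrightarrow> f z = g z"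
  shows "null_fourier g"
proof -
  have [measurable]: "f \<in> borel_measurable borel" "g \<in> borel_measurable borel"
    using assms borel_measurable_integrable by (auto simp: null_fourier_def)
  have "integrable circle_measure g"
    using assms integrable_cong_AE[of f circle_measure g] by (auto simp: null_fourier_def intro!: AE_circleI)
  moreover have "(\<integral>z. g z * z powi k \<partial>circle_measure) = (\<integral>z. f z * z powi k \<partial>circle_measure)" for k
    by (intro integral_cong_AE AE_circleI) (auto simp: assms(3))
  ultimately show ?thesis using assms(1) by (simp add: null_fourier_def)
qed

text \<open>On the circle \<open>cnj z\<close> is the inverse of \<open>z\<close>, so real
  polynomials in the real and imaginary part are trigonometric polynomials. This is the class of
  functions to which the Stone-Weierstrass theorem applies.\<close>

lemma null_fourier_polynomial:
  assumes "real_polynomial_function p"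
  shows "null_fourier f \<Longrightarrow> null_fourier (\<lambda>z. f z * complex_of_real (p z))"
  using assms
proof (induction p arbitrary: f rule: real_polynomial_function.induct)
  case (linear p)
  have p: "p z = Re z * p 1 + Im z * p \<i>" for z
  proof -
    have "p (Re z *\<^sub>R 1 + Im z *\<^sub>R \<i>) = Re z *\<^sub>R p 1 + Im z *\<^sub>R p \<i>"
      using linear(1) by (simp add: bounded_linear.linear linear_add linear_scale)
    moreover have "Re z *\<^sub>R 1 + Im z *\<^sub>R \<i> = z" by (simp add: complex_eq_iff)
    ultimately show ?thesis by simp
  qed
  have [measurable]: "f \<in> borel_measurable borel" "p \<in> borel_measurable borel"
    using null_fourier_measurable[OF linear.prems] linear(1)
    by (auto intro!: borel_measurable_continuous_onI linear_continuous_on)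
  define a b where "a = complex_of_real (p 1)" and "b = complex_of_real (p \<i>)"
  have "null_fourier (\<lambda>z. (a / 2 + b / (2 * \<i>)) * (f z * z powi 1) + (a / 2 - b / (2 * \<i>)) * (f z * z powi (-1)))"
    by (intro null_fourier_lincomb null_fourier_mult_powi linear.prems)
  then show ?case
  proof (rule null_fourier_cong)
    fix z :: complex assume z: "cmod z = 1"
    have zi: "z powi (-1) = cnj z"
      using z by (simp add: power_int_minus inverse_eq_divide complex_div_cnj[of 1])
    have re: "complex_of_real (Re z) = (z + cnj z) / 2" and im: "complex_of_real (Im z) = (z - cnj z) / (2 * \<i>)"
      by (simp_all add: complex_eq_iff)
    have pz: "complex_of_real (p z) = (z + cnj z) / 2 * a + (z - cnj z) / (2 * \<i>) * b"
      unfolding p[of z] a_def b_def by (simp add: re im)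
    show "(a / 2 + b / (2 * \<i>)) * (f z * z powi 1) + (a / 2 - b / (2 * \<i>)) * (f z * z powi (-1))
        = f z * complex_of_real (p z)"
      unfolding zi pz by (simp add: field_simps)
  qed simp
next
  case (const c)
  then show ?case using null_fourier_lincomb[of f f "complex_of_real c" 0] by (simp add: mult.commute)
next
  case (add p q)
  then show ?case
    using null_fourier_lincomb[of "\<lambda>z. f z * complex_of_real (p z)" "\<lambda>z. f z * complex_of_real (q z)" 1 1]
    by (simp add: algebra_simps)
next
  case (mult p q)
  have "null_fourier (\<lambda>z. (f z * complex_of_real (p z)) * complex_of_real (q z))"
    by (intro mult.IH mult.prems)
  then show ?case by (simp add: mult.assoc)
qed

lemma null_fourier_continuous:
  assumes f: "null_fourier f" and g: "continuous_on UNIV g"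
  shows "(\<integral>z. f z * complex_of_real (g z) \<partial>circle_measure) = 0"
proof -
  have [measurable]: "f \<in> borel_measurable borel" "g \<in> borel_measurable borel"
    using f g borel_measurable_integrable by (auto simp: null_fourier_def intro: borel_measurable_continuous_onI)
  have fi: "integrable circle_measure f" using f by (simp add: null_fourier_def)
  define I where "I = (\<integral>z. cmod (f z) \<partial>circle_measure)"
  have I: "I \<ge> 0" by (simp add: I_def)
  have bd: "cmod (\<integral>z. f z * complex_of_real (g z) \<partial>circle_measure) \<le> e * I" if e: "e > 0" for e
  proof -
    have cg: "continuous_on (sphere 0 1) g" using g continuous_on_subset by blast
    obtain p where p: "real_polynomial_function p" "\<And>z. z \<in> sphere 0 1 \<Longrightarrow> \<bar>g z - p z\<bar> < e"
      using Stone_Weierstrass_real_polynomial_function[OF compact_sphere cg e] by blast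
    have cp: "continuous_on UNIV p"
      using p(1) by (simp add: continuous_on_polymonial_function real_polynomial_function_eq)
    then have [measurable]: "p \<in> borel_measurable borel" by (rule borel_measurable_continuous_onI)
    have nf: "null_fourier (\<lambda>z. f z * complex_of_real (p z))" by (rule null_fourier_polynomial[OF p(1) f])
    then have ip: "integrable circle_measure (\<lambda>z. f z * complex_of_real (p z))"
      and zp: "(\<integral>z. f z * complex_of_real (p z) \<partial>circle_measure) = 0"
      by (auto simp: null_fourier_def dest: spec[of _ 0])
    have id: "integrable circle_measure (\<lambda>z. f z * complex_of_real (g z - p z))"
      by (rule integrable_circle_bounded_mult[OF fi, where C = e]) (use p(2) in \<open>auto intro: less_imp_le simp del: of_real_diff\<close>)
    have "(\<integral>z. f z * complex_of_real (g z) \<partial>circle_measure)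
        = (\<integral>z. f z * complex_of_real (g z - p z) + f z * complex_of_real (p z) \<partial>circle_measure)"
      by (simp add: algebra_simps)
    also have "\<dots> = (\<integral>z. f z * complex_of_real (g z - p z) \<partial>circle_measure)"
      using id ip zp by (subst Bochner_Integration.integral_add) auto
    also have "cmod \<dots> \<le> (\<integral>z. e * cmod (f z) \<partial>circle_measure)"
    proof (rule order_trans[OF integral_norm_bound integral_mono_AE])
      show "AE z in circle_measure. norm (f z * complex_of_real (g z - p z)) \<le> e * cmod (f z)"
      proof (rule AE_circleI)
        fix z :: complex assume "cmod z = 1"
        then have "\<bar>g z - p z\<bar> \<le> e" using p(2)[of z] by simp
        then have "cmod (f z) * \<bar>g z - p z\<bar> \<le> cmod (f z) * e" by (rule mult_left_mono) simp
        then show "norm (f z * complex_of_real (g z - p z)) \<le> e * cmod (f z)"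
          by (simp add: norm_mult mult.commute del: of_real_diff)
      qed
    qed (use id fi in auto)
    finally show ?thesis by (simp add: I_def)
  qed
  have "cmod (\<integral>z. f z * complex_of_real (g z) \<partial>circle_measure) \<le> 0 + e" if "e > 0" for e
  proof -
    have "e / (I + 1) * I \<le> e" using that I by (simp add: field_simps)
    then show ?thesis using bd[of "e / (I + 1)"] that I by simp
  qed
  then show ?thesis using field_le_epsilon[of "cmod (\<integral>z. f z * complex_of_real (g z) \<partial>circle_measure)" 0] by simp
qed

text \<open>Orthogonality to continuous functions passes to indicators of closed sets by dominated
  convergence, then to all Borel sets by a monotone class argument, and finally to the sets where a
  real part is positive.\<close>

lemma null_fourier_AE:
  assumes f: "null_fourier f"
  shows "AE z in circle_measure. f z = 0"
proof -
  have [measurable]: "f \<in> borel_measurable borel"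
    using f borel_measurable_integrable by (auto simp: null_fourier_def)
  have fi: "integrable circle_measure f" using f by (simp add: null_fourier_def)
  have closed: "(\<integral>z. indicator C z *\<^sub>R f z \<partial>circle_measure) = 0" if C: "closed C" for C
  proof (cases "C = {}")
    case False
    \<comment> \<open>Continuous cutoffs decreasing to the indicator of \<open>C\<close>.\<close>
    define g where "g n z = max 0 (1 - real n * infdist z C)" for n :: nat and z
    have gc: "continuous_on UNIV (g n)" for n unfolding g_def by (intro continuous_intros)
    then have [measurable]: "g n \<in> borel_measurable borel" for n by (rule borel_measurable_continuous_onI)
    have [measurable]: "C \<in> sets borel" using C by simp
    have lim: "(\<lambda>n. g n z) \<longlonglongrightarrow> indicator C z" for z
    proof (cases "z \<in> C")
      case True
      then show ?thesis by (simp add: g_def)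
    next
      case nz: False
      then have pos: "infdist z C > 0" using C False in_closed_iff_infdist_zero infdist_nonneg
        by (metis less_eq_real_def)
      obtain N where N: "real N > 1 / infdist z C" using reals_Archimedean2 by blast
      have "g n z = 0" if "n \<ge> N" for n
      proof -
        have "real n * infdist z C \<ge> real N * infdist z C" using that pos by (simp add: mult_right_mono)
        moreover have "real N * infdist z C > 1" using N pos by (simp add: field_simps)
        ultimately show ?thesis by (simp add: g_def)
      qed
      then show ?thesis using nz
        by (intro tendsto_eventually) (auto simp: eventually_sequentially)
    qed
    have "(\<lambda>n. \<integral>z. f z * complex_of_real (g n z) \<partial>circle_measure) \<longlonglongrightarrow> (\<integral>z. indicator C z *\<^sub>R f z \<partial>circle_measure)"
    proof (rule integral_dominated_convergence[where w = "\<lambda>z. cmod (f z)"])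
      show "AE z in circle_measure. (\<lambda>n. f z * complex_of_real (g n z)) \<longlonglongrightarrow> indicator C z *\<^sub>R f z"
        using tendsto_mult[OF tendsto_const tendsto_of_real[OF lim]]
        by (auto simp: scaleR_conv_of_real mult.commute)
      show "AE z in circle_measure. norm (f z * complex_of_real (g n z)) \<le> cmod (f z)" for n
        by (auto simp: g_def norm_mult infdist_nonneg intro!: mult_left_le)
    qed (use fi in auto)
    then show ?thesis using null_fourier_continuous[OF f gc] by (simp add: LIMSEQ_const_iff)
  qed simp
  have sets: "set_lebesgue_integral circle_measure A f = 0" if A: "A \<in> sets borel" for A
  proof -
    have si: "set_integrable circle_measure B f" if "B \<in> sets borel" for B
      unfolding set_integrable_def using that fi by (intro integrable_mult_indicator) auto
    have "Int_stable (Collect (closed :: complex set \<Rightarrow> bool))" by (auto simp: Int_stable_def)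
    moreover have "Collect (closed :: complex set \<Rightarrow> bool) \<subseteq> Pow UNIV" by simp
    moreover have "A \<in> sigma_sets UNIV (Collect closed)" using A by (simp add: borel_eq_closed)
    ultimately show ?thesis
    proof (induction rule: sigma_sets_induct_disjoint)
      case (basic A)
      then show ?case using closed by (simp add: set_lebesgue_integral_def)
    next
      case empty
      show ?case by (simp add: set_lebesgue_integral_def)
    next
      case (compl A)
      then have A: "A \<in> sets borel" by (simp add: borel_eq_closed)
      have "set_lebesgue_integral circle_measure (A \<union> (UNIV - A)) f
          = set_lebesgue_integral circle_measure A f + set_lebesgue_integral circle_measure (UNIV - A) f"
        using A by (intro set_integral_Un si) auto
      moreover have "set_lebesgue_integral circle_measure UNIV f = 0"
        using closed[of UNIV] by (simp add: set_lebesgue_integral_def)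
      ultimately show ?case using compl by simp
    next
      case (union A)
      then have A: "\<And>i. A i \<in> sets borel" by (auto simp: borel_eq_closed)
      have "set_lebesgue_integral circle_measure (\<Union>i. A i) f = (\<Sum>i. set_lebesgue_integral circle_measure (A i) f)"
        using union A by (intro lebesgue_integral_countable_add si) (auto simp: disjoint_family_on_def)
      then show ?case using union by simp
    qed
  qed
  \<comment> \<open>Integrating over the set where the real part is positive shows that it is null.
    The four choices 1, -1, \<i> and -\<i> of \<open>c\<close> then force both parts of
    \<open>f z\<close> to be zero.\<close>
  have re: "AE z in circle_measure. Re (c * f z) \<le> 0" for c
  proof -
    let ?A = "{z. Re (c * f z) > 0}"
    have A: "?A \<in> sets borel" by measurable
    have fA: "integrable circle_measure (\<lambda>z. c * (indicator ?A z *\<^sub>R f z))"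
      using fi A by (intro integrable_mult_right integrable_mult_indicator) auto
    have "(\<integral>z. c * (indicator ?A z *\<^sub>R f z) \<partial>circle_measure) = 0"
      using sets[OF A] by (simp only: set_lebesgue_integral_def integral_mult_right_zero mult_zero_right)
    then have "(\<integral>z. Re (c * (indicator ?A z *\<^sub>R f z)) \<partial>circle_measure) = 0"
      unfolding integral_Re[OF fA] by (simp only: zero_complex.sel)
    moreover have "integrable circle_measure (\<lambda>z. Re (c * (indicator ?A z *\<^sub>R f z)))" using fA by (rule integrable_Re)
    moreover have "0 \<le> Re (c * (indicator ?A z *\<^sub>R f z))" for z by (auto simp: indicator_def)
    ultimately have "AE z in circle_measure. Re (c * (indicator ?A z *\<^sub>R f z)) = 0"
      by (subst (asm) integral_nonneg_eq_0_iff_AE) auto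
    then show ?thesis by (rule AE_mp) (auto simp: indicator_def split: if_splits)
  qed
  show ?thesis
    using re[of 1] re[of "-1"] re[of \<i>] re[of "-\<i>"]
    by eventually_elim (auto simp: complex_eq_iff)
qed

section \<open>Hardy space functions\<close>

lemma circle_simps:
  assumes "cmod z = 1"
  shows "z * cnj z = 1" "cnj z * z = 1" "z * (cnj z * w) = w" "cnj z * (z * w) = w" "z \<noteq> 0"
proof -
  show *: "z * cnj z = 1" "cnj z * z = 1" using assms complex_norm_square[of z] by (simp_all add: mult.commute)
  then show "z * (cnj z * w) = w" "cnj z * (z * w) = w" by (simp_all add: mult.assoc[symmetric])
  show "z \<noteq> 0" using * by auto
qed

text \<open>Integrability is included because the Bochner integral of a non-integrable function is 0
  by convention; with it, such functions can be added.\<close>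

definition null :: "(complex \<Rightarrow> complex) \<Rightarrow> bool" where
  "null F \<longleftrightarrow> integrable circle_measure F \<and> (\<integral>z. F z \<partial>circle_measure) = 0"

lemma nullD: "null F \<Longrightarrow> (\<integral>z. F z \<partial>circle_measure) = 0"
  by (simp add: null_def)

lemma null_add: "null F \<Longrightarrow> null G \<Longrightarrow> null (\<lambda>z. F z + G z)"
  and null_diff: "null F \<Longrightarrow> null G \<Longrightarrow> null (\<lambda>z. F z - G z)"
  and null_cmult: "null F \<Longrightarrow> null (\<lambda>z. c * F z)"
  by (simp_all add: null_def)

lemma null_cnj: "null F \<Longrightarrow> null (\<lambda>z. cnj (F z))"
  by (simp add: null_def Bochner_Integration.integral_cnj)

lemma circle_integral_cong:
  fixes F G :: "complex \<Rightarrow> complex"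
  assumes "\<And>z. cmod z = 1 \<Longrightarrow> F z = G z" "F \<in> borel_measurable borel" "G \<in> borel_measurable borel"
  shows "(\<integral>z. F z \<partial>circle_measure) = (\<integral>z. G z \<partial>circle_measure)"
  by (intro integral_cong_AE AE_circleI) (simp_all add: assms)

lemma null_cong:
  assumes "null F" "\<And>z. cmod z = 1 \<Longrightarrow> G z = F z" "G \<in> borel_measurable borel"
  shows "null G"
proof -
  have F: "F \<in> borel_measurable borel" using assms(1) borel_measurable_integrable[of circle_measure F] by (simp add: null_def)
  have "integrable circle_measure G \<longleftrightarrow> integrable circle_measure F"
    by (intro integrable_cong_AE AE_circleI) (simp_all add: assms F)
  moreover have "(\<integral>z. G z \<partial>circle_measure) = (\<integral>z. F z \<partial>circle_measure)"
    by (intro circle_integral_cong assms F)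
  ultimately show ?thesis using assms(1) by (simp add: null_def)
qed

definition hardy :: "(complex \<Rightarrow> complex) \<Rightarrow> bool" where
  "hardy f \<longleftrightarrow> square_integrable f \<and> (\<forall>k. (\<integral>z. f z * z ^ Suc k \<partial>circle_measure) = 0)"

lemma hardy_sq: "hardy f \<Longrightarrow> square_integrable f"
  by (simp add: hardy_def)

lemma hardy_meas [measurable_dest]: "hardy f \<Longrightarrow> f \<in> borel_measurable borel"
  by (simp add: hardy_def square_integrable_def)

lemma hardy_null: "hardy f \<Longrightarrow> null (\<lambda>z. f z * z ^ Suc k)"
  using integrable_product[OF hardy_sq square_integrable_power_mult[OF square_integrable_one, of "Suc k"], of f]
  by (simp add: hardy_def null_def)

lemma hardyI: "square_integrable f \<Longrightarrow> (\<And>k. null (\<lambda>z. f z * z ^ Suc k)) \<Longrightarrow> hardy f"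
  by (simp add: hardy_def null_def)

lemma square_integrable_cong:
  assumes "square_integrable f" "g \<in> borel_measurable borel" "AE z in circle_measure. f z = g z"
  shows "square_integrable g"
proof -
  have [measurable]: "f \<in> borel_measurable borel" "g \<in> borel_measurable borel"
    using assms by (auto simp: square_integrable_def)
  have "integrable circle_measure (\<lambda>z. (cmod (g z))\<^sup>2) \<longleftrightarrow> integrable circle_measure (\<lambda>z. (cmod (f z))\<^sup>2)"
    using assms(3) by (intro integrable_cong_AE) auto
  then show ?thesis using assms by (simp add: square_integrable_def)
qed

lemma hardy_cong_AE:
  assumes "hardy f" "g \<in> borel_measurable borel" "AE z in circle_measure. f z = g z"
  shows "hardy g"
proof -
  have [measurable]: "f \<in> borel_measurable borel" "g \<in> borel_measurable borel"
    using assms by (auto dest: hardy_meas)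
  have "(\<integral>z. g z * z ^ Suc k \<partial>circle_measure) = (\<integral>z. f z * z ^ Suc k \<partial>circle_measure)" for k
    using assms(3) by (intro integral_cong_AE) auto
  then show ?thesis
    using assms square_integrable_cong[OF hardy_sq assms(2,3)] by (simp add: hardy_def)
qed

lemma hardy_cong:
  "hardy f \<Longrightarrow> g \<in> borel_measurable borel \<Longrightarrow> (\<And>z. cmod z = 1 \<Longrightarrow> g z = f z) \<Longrightarrow> hardy g"
  by (rule hardy_cong_AE) (auto intro: AE_circleI)

lemma hardy_add: "hardy f \<Longrightarrow> hardy g \<Longrightarrow> hardy (\<lambda>z. f z + g z)"
  using null_add[OF hardy_null[of f] hardy_null[of g]]
  by (intro hardyI[OF square_integrable_add[OF hardy_sq hardy_sq]]) (simp_all add: distrib_right)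

lemma hardy_cmult: "hardy f \<Longrightarrow> hardy (\<lambda>z. c * f z)"
  using null_cmult[OF hardy_null[of f]]
  by (intro hardyI[OF square_integrable_mult_const[OF hardy_sq]]) (simp_all add: mult.assoc)

lemma hardy_diff: "hardy f \<Longrightarrow> hardy g \<Longrightarrow> hardy (\<lambda>z. f z - g z)"
  using hardy_add[of f "\<lambda>z. (-1) * g z"] hardy_cmult[of g "-1"] by simp

lemma hardy_power: "hardy (\<lambda>z. z ^ n)"
proof (rule hardyI)
  show "square_integrable (\<lambda>z. z ^ n)"
    using square_integrable_power_mult[OF square_integrable_one, of n] by simp
  fix k
  have "integrable circle_measure (\<lambda>z. z ^ (n + Suc k))"
    using square_integrable_integrable[OF square_integrable_power_mult[OF square_integrable_one, of "n + Suc k"]] by simp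
  then show "null (\<lambda>z. z ^ n * z ^ Suc k)"
    using circle_integral_power[of "n + Suc k"] by (simp only: null_def power_add[symmetric])
qed

lemma hardy_const: "hardy (\<lambda>z. c)"
  using hardy_cmult[OF hardy_power[of 0], of c] by simp

lemma hardy_id_mult:
  assumes "hardy f" shows "hardy (\<lambda>z. z * f z)"
proof (rule hardyI)
  show "square_integrable (\<lambda>z. z * f z)" using assms by (intro square_integrable_id_mult hardy_sq)
  show "null (\<lambda>z. z * f z * z ^ Suc k)" for k
    using hardy_null[OF assms, of "Suc k"] by (simp add: ac_simps)
qed

lemma hardy_power_mult: "hardy f \<Longrightarrow> hardy (\<lambda>z. z ^ n * f z)"
proof (induction n)
  case (Suc n) then show ?case using hardy_id_mult[of "\<lambda>z. z ^ n * f z"] by (simp add: ac_simps)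
qed simp

lemma Hardy2_iff:
  assumes "square_integrable f" shows "cls f \<in> Hardy2 \<longleftrightarrow> hardy f"
proof -
  have "(\<forall>k<0. fourier_coeff (cls f) k = 0) \<longleftrightarrow> (\<forall>j. fourier_coeff (cls f) (- int (Suc j)) = 0)" (is "?A \<longleftrightarrow> ?B")
  proof (intro iffI allI impI)
    fix k :: int assume B: ?B and "k < 0"
    then show "fourier_coeff (cls f) k = 0" using B[rule_format, of "nat (- k - 1)"] by simp
  qed auto
  also have "\<dots> \<longleftrightarrow> (\<forall>j. (\<integral>z. f z * z ^ Suc j \<partial>circle_measure) = 0)"
    unfolding cls_fourier[OF assms] minus_minus power_int_of_nat ..
  finally show ?thesis using assms by (simp add: Hardy2_def hardy_def)
qed

lemma Hardy2_E:
  assumes "x \<in> Hardy2" obtains f where "hardy f" "x = cls f"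
  using cls_surj[of x] assms Hardy2_iff by metis

lemma Hardy2_orth_compl: "Hardy2 = orth_compl (range (\<lambda>k. cls (\<lambda>z. cnj (z ^ Suc k))))"
proof -
  have sq: "square_integrable (\<lambda>z. cnj (z ^ Suc k))" for k by (rule square_integrable_cnj[OF hardy_sq[OF hardy_power]])
  have "x \<in> Hardy2 \<longleftrightarrow> (\<forall>k. cinner x (cls (\<lambda>z. cnj (z ^ Suc k))) = 0)" for x
  proof -
    obtain f where f: "square_integrable f" "x = cls f" by (rule cls_surj)
    show ?thesis unfolding f(2) Hardy2_iff[OF f(1)] cls_cinner[OF f(1) sq] using f(1) by (simp add: hardy_def)
  qed
  then show ?thesis by (auto simp: orth_compl_def)
qed

lemma Hardy2: "csubspace Hardy2" "complete Hardy2"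
  unfolding Hardy2_orth_compl by (intro csubspace_orth_compl complete_closed_circle_L2 closed_orth_compl)+

lemma hardy_null_fourier:
  assumes "hardy f" and "\<And>k. (\<integral>z. f z * cnj (z ^ k) \<partial>circle_measure) = 0"
  shows "AE z in circle_measure. f z = 0"
proof (rule null_fourier_AE)
  have [measurable]: "f \<in> borel_measurable borel" using assms(1) by (rule hardy_meas)
  have "(\<integral>z. f z * z powi k \<partial>circle_measure) = 0" for k
  proof (cases "k > 0")
    case True
    then obtain j where "k = int (Suc j)" by (metis Suc_pred zero_less_imp_eq_int of_nat_0_less_iff)
    then show ?thesis using assms(1) by (simp only: hardy_def power_int_of_nat)
  next
    case False
    define j where "j = nat (- k)"
    have kj: "k = - int j" using False by (simp add: j_def)
    have "(\<integral>z. f z * z powi k \<partial>circle_measure) = (\<integral>z. f z * cnj (z ^ j) \<partial>circle_measure)"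
    proof (rule circle_integral_cong)
      fix z :: complex assume z: "cmod z = 1"
      have "z ^ j * cnj (z ^ j) = 1" using z by (intro circle_simps) (simp add: norm_power)
      then have "inverse (z ^ j) = cnj (z ^ j)" by (rule inverse_unique)
      then show "f z * z powi k = f z * cnj (z ^ j)" by (simp add: kj power_int_minus)
    qed measurable
    then show ?thesis using assms(2) by simp
  qed
  then show "null_fourier f"
    using square_integrable_integrable[OF hardy_sq[OF assms(1)]] by (simp add: null_fourier_def)
qed

text \<open>The analytic fact behind all orthogonality computations below. For fixed
  \<open>f\<close> the functions \<open>g\<close> with vanishing integral form a closed subspace of
  the Hardy space that contains every monomial.\<close>

lemma hardy_product_null:
  assumes f: "hardy f" and g: "hardy g"
  shows "null (\<lambda>z. z * (f z * g z))"
proof -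
  have [measurable]: "f \<in> borel_measurable borel" "g \<in> borel_measurable borel" using f g by (auto dest: hardy_meas)
  have sf: "square_integrable (\<lambda>z. cnj (z * f z))"
    by (intro square_integrable_cnj square_integrable_id_mult hardy_sq f)
  \<comment> \<open>The condition on \<open>g\<close> is linear and expressed as orthogonality to
    one vector, so that \<open>Z\<close> is closed; totality of the monomials then gives all of
    \<open>Hardy2\<close>.\<close>
  define Z where "Z = Hardy2 \<inter> orth_compl {cls (\<lambda>z. cnj (z * f z))}"
  have inZ: "cls h \<in> Z \<longleftrightarrow> hardy h \<and> (\<integral>z. h z * (z * f z) \<partial>circle_measure) = 0" if "square_integrable h" for h
    unfolding Z_def orth_compl_def using that sf
    by (simp add: Hardy2_iff cls_cinner del: complex_cnj_mult)
  have "Z = Hardy2"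
  proof (rule total_subspace_eq)
    show "csubspace Z" "complete Z" "Z \<subseteq> Hardy2" "csubspace Hardy2"
      unfolding Z_def using Hardy2 by (auto intro!: csubspace_Int csubspace_orth_compl complete_Int_closed closed_orth_compl)
    fix x assume x: "x \<in> Hardy2" and orth: "\<And>z. z \<in> Z \<Longrightarrow> cinner x z = 0"
    obtain h where h: "hardy h" "x = cls h" using Hardy2_E[OF x] .
    have "(\<integral>z. h z * cnj (z ^ k) \<partial>circle_measure) = 0" for k
    proof -
      have "(\<integral>z. z ^ k * (z * f z) \<partial>circle_measure) = 0"
        using nullD[OF hardy_null[OF f, of k]] by (simp add: ac_simps)
      then have "cls (\<lambda>z. z ^ k) \<in> Z" by (simp add: inZ hardy_sq hardy_power)
      from orth[OF this] show ?thesis by (simp add: h(2) cls_cinner hardy_sq h(1) hardy_power)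
    qed
    then have "AE z in circle_measure. h z = 0" by (intro hardy_null_fourier h)
    then show "x = 0"
      using cls_eq_iff[OF hardy_sq[OF h(1)] square_integrable_zero] by (simp add: h(2) cls_zero)
  qed
  then have "(\<integral>z. g z * (z * f z) \<partial>circle_measure) = 0"
    using inZ[OF hardy_sq[OF g]] Hardy2_iff[OF hardy_sq[OF g]] g by blast
  moreover have "integrable circle_measure (\<lambda>z. g z * (z * f z))"
    by (intro integrable_product square_integrable_id_mult hardy_sq f g)
  ultimately show ?thesis by (simp add: null_def ac_simps)
qed

text \<open>The working form of the previous fact: integrals are shown to vanish by splitting the
  integrand into products \<open>z * (p z * q z)\<close> of Hardy functions and conjugates of such
  products.\<close>

lemma null_hardyI:
  assumes "hardy p" "hardy q" "\<And>z. cmod z = 1 \<Longrightarrow> F z = z * (p z * q z)" "F \<in> borel_measurable borel"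
  shows "null F"
  by (rule null_cong[OF hardy_product_null[OF assms(1,2)]]) (use assms in auto)

lemma null_cohardyI:
  assumes "hardy p" "hardy q" "\<And>z. cmod z = 1 \<Longrightarrow> cnj (F z) = z * (p z * q z)" "F \<in> borel_measurable borel"
  shows "null F"
proof -
  have "null (\<lambda>z. cnj (F z))" by (rule null_hardyI[OF assms(1-3)]) (use assms(4) in measurable)
  from null_cnj[OF this] show ?thesis by simp
qed

text \<open>The Fourier coefficients of \<open>f\<close> vanish on the negative side, those of its
  conjugate likewise, and only the constant one remains.\<close>

lemma hardy_real_const:
  assumes "hardy f" "hardy (\<lambda>z. cnj (f z))"
  shows "AE z in circle_measure. f z = (\<integral>z. f z \<partial>circle_measure)"
proof -
  define c where "c = (\<integral>z. f z \<partial>circle_measure)"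
  have [measurable]: "f \<in> borel_measurable borel" using assms by (auto dest: hardy_meas)
  have fi: "integrable circle_measure f" by (intro square_integrable_integrable hardy_sq assms)
  have "AE z in circle_measure. f z - c = 0"
  proof (rule hardy_null_fourier)
    show "hardy (\<lambda>z. f z - c)" by (intro hardy_diff hardy_const assms)
    fix k show "(\<integral>z. (f z - c) * cnj (z ^ k) \<partial>circle_measure) = 0"
    proof (cases k)
      case 0 then show ?thesis using fi by (simp add: c_def)
    next
      case (Suc j)
      have "null (\<lambda>z. cnj ((cnj (f z) - cnj c) * z ^ Suc j))"
        by (intro null_cnj hardy_null hardy_diff hardy_const assms)
      then show ?thesis using Suc by (simp add: null_def)
    qed
  qed
  then show ?thesis by (simp add: c_def)
qed

section \<open>Bounded Hardy functions\<close>

text \<open>The bound is imposed at every point of the circle and not almost everywhere, so that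
  pointwise estimates can be chained without exceptional sets.\<close>

definition bhardy :: "(complex \<Rightarrow> complex) \<Rightarrow> bool" where
  "bhardy b \<longleftrightarrow> hardy b \<and> (\<exists>C. \<forall>z. cmod z = 1 \<longrightarrow> cmod (b z) \<le> C)"

lemma bhardy_hardy: "bhardy b \<Longrightarrow> hardy b"
  by (simp add: bhardy_def)

lemma bhardy_meas [measurable_dest]: "bhardy b \<Longrightarrow> b \<in> borel_measurable borel"
  by (auto simp: bhardy_def dest: hardy_meas)

lemma bhardy_sq_mult: "bhardy b \<Longrightarrow> square_integrable f \<Longrightarrow> square_integrable (\<lambda>z. b z * f z)"
  using square_integrable_bounded_mult bhardy_meas unfolding bhardy_def by blast

lemma bhardy_mult_hardy:
  assumes b: "bhardy b" and f: "hardy f"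
  shows "hardy (\<lambda>z. b z * f z)"
proof (rule hardyI)
  have [measurable]: "f \<in> borel_measurable borel" "b \<in> borel_measurable borel" using f b by (auto dest: hardy_meas bhardy_meas)
  show "square_integrable (\<lambda>z. b z * f z)" by (intro bhardy_sq_mult hardy_sq b f)
  show "null (\<lambda>z. b z * f z * z ^ Suc k)" for k
    by (rule null_hardyI[OF bhardy_hardy[OF b] hardy_power_mult[OF f, of k]]) (auto simp: ac_simps)
qed

lemma bhardyI: "hardy b \<Longrightarrow> (\<And>z. cmod z = 1 \<Longrightarrow> cmod (b z) \<le> C) \<Longrightarrow> bhardy b"
  by (auto simp: bhardy_def)

lemma bhardy_mult:
  assumes "bhardy b" "bhardy c" shows "bhardy (\<lambda>z. b z * c z)"
proof -
  obtain B C where "\<And>z. cmod z = 1 \<Longrightarrow> cmod (b z) \<le> B" "\<And>z. cmod z = 1 \<Longrightarrow> cmod (c z) \<le> C"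
    using assms by (auto simp: bhardy_def)
  then have "cmod (b z * c z) \<le> B * C" if "cmod z = 1" for z
    using that by (simp add: norm_mult mult_mono' )
  then show ?thesis by (rule bhardyI[OF bhardy_mult_hardy[OF assms(1) bhardy_hardy[OF assms(2)]]])
qed

lemma bhardy_add:
  assumes "bhardy b" "bhardy c" shows "bhardy (\<lambda>z. b z + c z)"
proof -
  obtain B C where "\<And>z. cmod z = 1 \<Longrightarrow> cmod (b z) \<le> B" "\<And>z. cmod z = 1 \<Longrightarrow> cmod (c z) \<le> C"
    using assms by (auto simp: bhardy_def)
  then have "cmod (b z + c z) \<le> B + C" if "cmod z = 1" for z
    using that norm_triangle_mono by blast
  then show ?thesis by (rule bhardyI[OF hardy_add[OF bhardy_hardy[OF assms(1)] bhardy_hardy[OF assms(2)]]])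
qed

lemma bhardy_const: "bhardy (\<lambda>z. c)"
  by (rule bhardyI[OF hardy_const order_refl])

lemma bhardy_id: "bhardy (\<lambda>z. z)"
  using hardy_power[of 1] by (intro bhardyI[where C = 1]) auto

lemma bhardy_cmult: "bhardy b \<Longrightarrow> bhardy (\<lambda>z. c * b z)"
  by (rule bhardy_mult[OF bhardy_const])

lemma bhardy_diff: "bhardy b \<Longrightarrow> bhardy c \<Longrightarrow> bhardy (\<lambda>z. b z - c z)"
  using bhardy_add[of b "\<lambda>z. (-1) * c z"] bhardy_cmult[of c "-1"] by simp

lemma bhardy_power: "bhardy b \<Longrightarrow> bhardy (\<lambda>z. b z ^ n)"
  by (induction n) (auto intro: bhardy_const bhardy_mult)

lemma bhardy_sum: "(\<And>i. i \<in> I \<Longrightarrow> bhardy (f i)) \<Longrightarrow> bhardy (\<lambda>z. \<Sum>i\<in>I. f i z)"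
  by (induction I rule: infinite_finite_induct) (auto intro: bhardy_const bhardy_add)

lemmas bhardy_intros = bhardy_const bhardy_id bhardy_cmult bhardy_diff bhardy_add bhardy_mult bhardy_power bhardy_sum

text \<open>Dominated convergence keeps the negative Fourier coefficients zero. Functions that would
  otherwise need an analytic extension to the disc are built as such limits.\<close>

lemma bhardy_limit:
  fixes f :: "nat \<Rightarrow> complex \<Rightarrow> complex"
  assumes f: "\<And>n. bhardy (f n)" and bd: "\<And>n z. cmod z = 1 \<Longrightarrow> cmod (f n z) \<le> C"
    and lim: "AE z in circle_measure. (\<lambda>n. f n z) \<longlonglongrightarrow> g z"
    and g: "g \<in> borel_measurable borel" "\<And>z. cmod z = 1 \<Longrightarrow> cmod (g z) \<le> C"
  shows "bhardy g"
proof (rule bhardyI[OF hardyI g(2)])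
  have [measurable]: "g \<in> borel_measurable borel" "f n \<in> borel_measurable borel" for n
    using g f by (auto dest: bhardy_meas)
  show sq: "square_integrable g" by (rule square_integrable_bounded[OF g])
  fix k
  have "(\<lambda>n. \<integral>z. f n z * z ^ Suc k \<partial>circle_measure) \<longlonglongrightarrow> (\<integral>z. g z * z ^ Suc k \<partial>circle_measure)"
  proof (rule integral_dominated_convergence[where w = "\<lambda>z. C"])
    show "AE z in circle_measure. (\<lambda>n. f n z * z ^ Suc k) \<longlonglongrightarrow> g z * z ^ Suc k"
      using lim by eventually_elim (intro tendsto_intros)
    show "AE z in circle_measure. norm (f n z * z ^ Suc k) \<le> C" for n
      by (rule AE_circleI) (simp add: norm_mult norm_power bd)
  qed (auto)
  moreover have "(\<integral>z. f n z * z ^ Suc k \<partial>circle_measure) = 0" for n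
    using f by (simp add: bhardy_def hardy_def)
  ultimately have "(\<integral>z. g z * z ^ Suc k \<partial>circle_measure) = 0" by (simp add: LIMSEQ_const_iff)
  then show "null (\<lambda>z. g z * z ^ Suc k)"
    using integrable_product[OF sq square_integrable_power_mult[OF square_integrable_one, of "Suc k"]]
    by (simp add: null_def)
qed auto

text \<open>The partial sums of the geometric series are polynomials in \<open>b\<close> with a
  common bound.\<close>

lemma bhardy_neumann:
  assumes b: "bhardy b" "\<And>z. cmod z = 1 \<Longrightarrow> cmod (b z) \<le> 1" and \<rho>: "cmod \<rho> < 1"
  shows "bhardy (\<lambda>z. 1 / (1 - \<rho> * b z))"
proof (rule bhardy_limit[where f = "\<lambda>n z. \<Sum>i<n. (\<rho> * b z) ^ i" and C = "1 / (1 - cmod \<rho>)"])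
  have [measurable]: "b \<in> borel_measurable borel" using b by (auto dest: bhardy_meas)
  have le: "cmod (\<rho> * b z) \<le> cmod \<rho>" if "cmod z = 1" for z
    using b(2)[OF that] by (simp add: norm_mult mult_left_le)
  show "bhardy (\<lambda>z. \<Sum>i<n. (\<rho> * b z) ^ i)" for n by (intro bhardy_intros b)
  fix z :: complex assume z: "cmod z = 1"
  show "cmod (\<Sum>i<n. (\<rho> * b z) ^ i) \<le> 1 / (1 - cmod \<rho>)" for n
  proof -
    have "cmod (\<Sum>i<n. (\<rho> * b z) ^ i) \<le> (\<Sum>i<n. cmod \<rho> ^ i)"
      using le[OF z] by (intro sum_norm_le) (simp add: norm_power power_mono)
    also have "\<dots> \<le> (\<Sum>i. cmod \<rho> ^ i)" using \<rho> by (intro sum_le_suminf) auto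
    also have "\<dots> = 1 / (1 - cmod \<rho>)" using \<rho> by (intro suminf_geometric) auto
    finally show ?thesis .
  qed
  have "1 - cmod \<rho> \<le> cmod (1 - \<rho> * b z)"
    using norm_triangle_ineq2[of 1 "\<rho> * b z"] le[OF z] by simp
  then show "cmod (1 / (1 - \<rho> * b z)) \<le> 1 / (1 - cmod \<rho>)"
    using \<rho> by (simp add: norm_divide frac_le)
next
  show "AE z in circle_measure. (\<lambda>n. \<Sum>i<n. (\<rho> * b z) ^ i) \<longlonglongrightarrow> 1 / (1 - \<rho> * b z)"
  proof (rule AE_circleI)
    fix z :: complex assume z: "cmod z = 1"
    have "cmod (\<rho> * b z) < 1" using b(2)[OF z] \<rho> mult_left_le[of "cmod (b z)" "cmod \<rho>"] by (simp add: norm_mult)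
    from geometric_sums[OF this] show "(\<lambda>n. \<Sum>i<n. (\<rho> * b z) ^ i) \<longlonglongrightarrow> 1 / (1 - \<rho> * b z)"
      by (simp add: sums_def)
  qed
  have [measurable]: "b \<in> borel_measurable borel" using b by (auto dest: bhardy_meas)
  show "(\<lambda>z. 1 / (1 - \<rho> * b z)) \<in> borel_measurable borel" by measurable
qed

lemma bhardy_exp:
  assumes b: "bhardy b"
  shows "bhardy (\<lambda>z. exp (b z))"
proof -
  obtain C where C: "\<And>z. cmod z = 1 \<Longrightarrow> cmod (b z) \<le> C" using b by (auto simp: bhardy_def)
  show ?thesis
  proof (rule bhardy_limit[where f = "\<lambda>n z. \<Sum>i<n. (1 / fact i) * b z ^ i" and C = "exp C"])
    show "bhardy (\<lambda>z. \<Sum>i<n. (1 / fact i) * b z ^ i)" for n by (intro bhardy_intros b)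
    fix z :: complex assume z: "cmod z = 1"
    have C0: "0 \<le> C" using C[OF z] norm_ge_zero order_trans by blast
    show "cmod (\<Sum>i<n. (1 / fact i) * b z ^ i) \<le> exp C" for n
    proof -
      have "cmod (\<Sum>i<n. (1 / fact i) * b z ^ i) \<le> (\<Sum>i<n. inverse (fact i) * C ^ i)"
        using C[OF z] by (intro sum_norm_le)
          (simp add: norm_mult norm_divide norm_power power_mono inverse_eq_divide divide_right_mono)
      also have "\<dots> \<le> (\<Sum>i. inverse (fact i) * C ^ i)"
        using C0 summable_exp[of C] by (intro sum_le_suminf) auto
      also have "\<dots> = exp C" by (simp add: exp_def)
      finally show ?thesis .
    qed
    show "cmod (exp (b z)) \<le> exp C"
      using C[OF z] complex_Re_le_cmod[of "b z"] by (simp add: norm_exp_eq_Re)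
  next
    show "AE z in circle_measure. (\<lambda>n. \<Sum>i<n. (1 / fact i) * b z ^ i) \<longlonglongrightarrow> exp (b z)"
      using exp_converges[of "b _"] by (simp add: sums_def scaleR_conv_of_real inverse_eq_divide)
    have [measurable]: "b \<in> borel_measurable borel" using b by (auto dest: bhardy_meas)
    show "(\<lambda>z. exp (b z)) \<in> borel_measurable borel" by measurable
  qed
qed

section \<open>Inner functions and model spaces\<close>

text \<open>Unimodularity at every point of the circle, arranged by changing the representative on a
  null set, makes \<open>cnj (b z)\<close> the pointwise inverse of \<open>b z\<close> in all
  algebraic identities.\<close>

locale inner_fun =
  fixes b :: "complex \<Rightarrow> complex"
  assumes b_hardy: "hardy b" and b_unit: "\<And>z. cmod z = 1 \<Longrightarrow> cmod (b z) = 1"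
begin

lemma b_meas [measurable]: "b \<in> borel_measurable borel" by (rule hardy_meas[OF b_hardy])

lemma bb: "bhardy b" by (rule bhardyI[OF b_hardy, of 1]) (simp add: b_unit)

lemma b_simps:
  assumes "cmod z = 1"
  shows "b z * cnj (b z) = 1" "cnj (b z) * b z = 1" "b z * (cnj (b z) * w) = w" "cnj (b z) * (b z * w) = w" "b z \<noteq> 0"
  using circle_simps[OF b_unit[OF assms]] by auto

lemma inner_function_cls: "inner_function (cls b)"
  by (simp add: inner_function_def Hardy2_iff hardy_sq b_hardy cls_unimodular AE_circleI b_unit)

end

lemma inner_functionE:
  assumes "inner_function B" obtains b where "inner_fun b" "B = cls b"
proof -
  obtain f where f: "hardy f" "B = cls f" using assms Hardy2_E by (auto simp: inner_function_def)
  have [measurable]: "f \<in> borel_measurable borel" by (rule hardy_meas[OF f(1)])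
  have un: "AE z in circle_measure. cmod (f z) = 1"
    using assms f by (simp add: inner_function_def cls_unimodular hardy_sq)
  \<comment> \<open>On the exceptional null set the value is replaced by 1.\<close>
  define b where "b z = (if cmod (f z) = 1 then f z else 1)" for z
  have [measurable]: "b \<in> borel_measurable borel" unfolding b_def by measurable
  have eq: "AE z in circle_measure. f z = b z" using un by eventually_elim (simp add: b_def)
  have "hardy b" by (rule hardy_cong_AE[OF f(1) _ eq]) measurable
  then show thesis
    using eq cls_eq_iff[OF hardy_sq[OF f(1)], of b] f(2)
    by (intro that[of b]) (auto simp: inner_fun_def b_def hardy_sq)
qed

text \<open>The description of the model space as the intersection of the Hardy space with its image
  under \<open>f\<close> to \<open>b * cnj (z * f)\<close>. Unlike orthogonality to multiples of
  \<open>b\<close>, it is visibly symmetric under that conjugation.\<close>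

definition model :: "(complex \<Rightarrow> complex) \<Rightarrow> (complex \<Rightarrow> complex) \<Rightarrow> bool" where
  "model b f \<longleftrightarrow> hardy f \<and> hardy (\<lambda>z. b z * cnj (z * f z))"

lemma model_hardy: "model b f \<Longrightarrow> hardy f" "model b f \<Longrightarrow> hardy (\<lambda>z. b z * cnj (z * f z))"
  by (simp_all add: model_def)

context inner_fun
begin

lemma model_null:
  assumes f: "model b f" and h: "hardy h"
  shows "null (\<lambda>z. f z * cnj (b z * h z))"
proof -
  have [measurable]: "f \<in> borel_measurable borel" "h \<in> borel_measurable borel"
    using f h by (auto dest: model_hardy hardy_meas)
  show ?thesis
    by (rule null_cohardyI[OF model_hardy(2)[OF f] h]) (auto simp: circle_simps ac_simps)
qed

lemma model_space_iff:
  assumes "square_integrable f" shows "cls f \<in> model_space (cls b) \<longleftrightarrow> model b f"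
proof
  assume f: "model b f"
  have "cinner (cls f) (cls b \<odot> h) = 0" if hH: "h \<in> Hardy2" for h
  proof -
    obtain h' where h: "hardy h'" "h = cls h'" using Hardy2_E[OF hH] .
    have "square_integrable (\<lambda>z. b z * h' z)" by (intro bhardy_sq_mult bb hardy_sq h)
    then show ?thesis
      using nullD[OF model_null[OF f h(1)]] h(1)
      by (simp add: h(2) cls_mult hardy_sq b_hardy cls_cinner assms)
  qed
  then show "cls f \<in> model_space (cls b)"
    using f by (auto simp: model_space_def Hardy2_iff assms model_hardy)
next
  assume f: "cls f \<in> model_space (cls b)"
  then have hf: "hardy f" by (simp add: model_space_def Hardy2_iff assms)
  have [measurable]: "f \<in> borel_measurable borel" by (rule hardy_meas[OF hf])
  have sq: "square_integrable (\<lambda>z. b z * cnj (z * f z))"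
    by (intro bhardy_sq_mult bb square_integrable_cnj square_integrable_id_mult assms)
  have "hardy (\<lambda>z. b z * cnj (z * f z))"
  proof (rule hardyI[OF sq])
    fix k
    have sq': "square_integrable (\<lambda>z. b z * z ^ k)" by (intro bhardy_sq_mult bb hardy_sq hardy_power)
    have "cinner (cls f) (cls b \<odot> cls (\<lambda>z. z ^ k)) = 0"
      using f Hardy2_iff[OF hardy_sq[OF hardy_power]] by (simp add: model_space_def hardy_power)
    then have "(\<integral>z. f z * cnj (b z * z ^ k) \<partial>circle_measure) = 0"
      by (simp add: cls_mult hardy_sq b_hardy hardy_power sq' cls_cinner assms)
    then have "null (\<lambda>z. cnj (f z * cnj (b z * z ^ k)))"
      using integrable_cnj_product[OF assms sq'] by (intro null_cnj) (simp add: null_def)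
    then show "null (\<lambda>z. b z * cnj (z * f z) * z ^ Suc k)"
      by (rule null_cong) (auto simp: circle_simps ac_simps)
  qed
  with hf show "model b f" by (simp add: model_def)
qed

lemma model_space_E:
  assumes "x \<in> model_space (cls b)" obtains f where "model b f" "x = cls f"
  using cls_surj[of x] assms model_space_iff by metis

lemma model_spaceI: "model b f \<Longrightarrow> cls f \<in> model_space (cls b)"
  by (simp add: model_space_iff hardy_sq model_hardy)

lemma model_space_orth_compl:
  "model_space (cls b) = Hardy2 \<inter> orth_compl ((\<lambda>h. cls b \<odot> h) ` Hardy2)"
  by (auto simp: model_space_def orth_compl_def)

lemma model_space: "csubspace (model_space (cls b))" "complete (model_space (cls b))"
  unfolding model_space_orth_compl
  by (intro csubspace_Int complete_Int_closed csubspace_orth_compl closed_orth_compl Hardy2)+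

lemma model_conj: 
  assumes f: "model b f" shows "model b (\<lambda>z. b z * cnj (z * f z))"
proof -
  have [measurable]: "f \<in> borel_measurable borel" using f by (auto dest: model_hardy hardy_meas)
  have "hardy (\<lambda>z. b z * cnj (z * (b z * cnj (z * f z))))"
    by (rule hardy_cong[OF model_hardy(1)[OF f]]) (auto simp: circle_simps b_simps ac_simps)
  then show ?thesis using f by (simp add: model_def)
qed

lemma model_add: "model b f \<Longrightarrow> model b g \<Longrightarrow> model b (\<lambda>z. f z + g z)"
  using hardy_add[of "\<lambda>z. b z * cnj (z * f z)" "\<lambda>z. b z * cnj (z * g z)"]
  by (auto simp: model_def algebra_simps intro: hardy_add)

lemma model_cmult: "model b f \<Longrightarrow> model b (\<lambda>z. c * f z)"
  using hardy_cmult[of "\<lambda>z. b z * cnj (z * f z)" "cnj c"]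
  by (auto simp: model_def algebra_simps intro: hardy_cmult)

lemma model_diff: "model b f \<Longrightarrow> model b g \<Longrightarrow> model b (\<lambda>z. f z - g z)"
  using model_add[of f "\<lambda>z. (-1) * g z"] model_cmult[of g "-1"] by simp

text \<open>Both integrands have the form covered by \<open>null_hardyI\<close> and
  \<open>null_cohardyI\<close>: \<open>b * cnj g\<close> is \<open>z\<close> times the Hardy
  function conjugate to \<open>g\<close>. These are the error terms that every later symbol
  computation discards.\<close>

lemma model_pair_null:
  assumes "model b f" "model b g"
  shows "null (\<lambda>z. cnj (b z) * (f z * cnj (g z)))" "null (\<lambda>z. b z * (f z * cnj (g z)))"
proof -
  have [measurable]: "f \<in> borel_measurable borel" "g \<in> borel_measurable borel"
    using assms by (auto dest: model_hardy hardy_meas)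
  show "null (\<lambda>z. cnj (b z) * (f z * cnj (g z)))"
    by (rule null_cohardyI[OF model_hardy(2)[OF assms(1)] model_hardy(1)[OF assms(2)]]) (auto simp: circle_simps ac_simps)
  show "null (\<lambda>z. b z * (f z * cnj (g z)))"
    by (rule null_hardyI[OF model_hardy(2)[OF assms(2)] model_hardy(1)[OF assms(1)]]) (auto simp: circle_simps ac_simps)
qed

text \<open>The orthogonal decomposition of the Hardy space into the model space and the multiples
  of \<open>b\<close>.\<close>

lemma hardy_decomp:
  assumes f: "hardy f"
  shows "\<exists>x h. model b x \<and> hardy h \<and> (\<forall>z. cmod z = 1 \<longrightarrow> f z = x z + b z * h z)"
proof -
  \<comment> \<open>This is the space of multiples of \<open>b\<close>, described as the Hardy
    functions \<open>q\<close> for which \<open>cnj b * q\<close> is again a Hardy function; in this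
    form it is closed.\<close>
  define Z where "Z = Hardy2 \<inter> orth_compl (range (\<lambda>k. cls (\<lambda>z. b z * cnj (z ^ Suc k))))"
  have Z: "csubspace Z" "complete Z"
    unfolding Z_def by (intro csubspace_Int complete_Int_closed csubspace_orth_compl closed_orth_compl Hardy2)+
  have sqk: "square_integrable (\<lambda>z. b z * cnj (z ^ Suc k))" for k
    by (intro bhardy_sq_mult bb square_integrable_cnj hardy_sq hardy_power)
  have sqc: "square_integrable (\<lambda>z. cnj (b z) * q z)" if "square_integrable q" for q
    using square_integrable_cnj[OF bhardy_sq_mult[OF bb square_integrable_cnj[OF that]]] by simp
  have inZ: "cls q \<in> Z \<longleftrightarrow> hardy q \<and> hardy (\<lambda>z. cnj (b z) * q z)" if q: "square_integrable q" for q
  proof -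
    have "(\<integral>z. q z * cnj (b z * cnj (z ^ Suc k)) \<partial>circle_measure) = (\<integral>z. cnj (b z) * q z * z ^ Suc k \<partial>circle_measure)" for k
      by (simp add: ac_simps)
    then have "cls q \<in> Z \<longleftrightarrow> hardy q \<and> (\<forall>k. (\<integral>z. cnj (b z) * q z * z ^ Suc k \<partial>circle_measure) = 0)"
      unfolding Z_def Int_iff Hardy2_iff[OF q] orth_compl_def mem_Collect_eq ball_simps(9)
      by (simp only: cls_cinner[OF q sqk] ball_simps(10) image_iff rangeI UNIV_I ball_UNIV)
    then show ?thesis using sqc[OF q] by (simp add: hardy_def)
  qed
  define x where "x = cls f - orth_proj Z (cls f)"
  obtain q where q: "square_integrable q" "orth_proj Z (cls f) = cls q" by (rule cls_surj)
  have "cls q \<in> Z" using orth_proj_in[OF Z, of "cls f"] q by simp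
  then have q2: "hardy q" "hardy (\<lambda>z. cnj (b z) * q z)" using inZ[OF q(1)] by auto
  have xf: "x = cls (\<lambda>z. f z - q z)" by (simp add: x_def q(2) cls_diff hardy_sq f q(1))
  have hx: "hardy (\<lambda>z. f z - q z)" by (intro hardy_diff f q2)
  have "cinner x (cls b \<odot> h) = 0" if hH: "h \<in> Hardy2" for h
  proof -
    obtain h' where h: "hardy h'" "h = cls h'" using Hardy2_E[OF hH] .
    have [measurable]: "h' \<in> borel_measurable borel" by (rule hardy_meas[OF h(1)])
    have hb: "hardy (\<lambda>z. b z * h' z)" by (intro bhardy_mult_hardy bb h)
    have "hardy (\<lambda>z. cnj (b z) * (b z * h' z))" by (rule hardy_cong[OF h(1)]) (auto simp: b_simps)
    then have "cls b \<odot> h \<in> Z" using hb by (simp add: h(2) cls_mult hardy_sq b_hardy h(1) inZ)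
    then show ?thesis unfolding x_def by (rule orth_proj_orth[OF Z])
  qed
  then have "x \<in> model_space (cls b)" using hx by (simp add: model_space_def xf Hardy2_iff hardy_sq)
  then have "model b (\<lambda>z. f z - q z)" using model_space_iff[OF hardy_sq[OF hx]] by (simp add: xf)
  moreover have "f z = (f z - q z) + b z * (cnj (b z) * q z)" if "cmod z = 1" for z
    using b_simps[OF that] by simp
  ultimately show ?thesis using q2 by blast
qed

lemma model_of_orth:
  assumes "hardy f" "\<And>g. model b g \<Longrightarrow> (\<integral>z. f z * cnj (g z) \<partial>circle_measure) = 0"
  shows "\<exists>h. hardy h \<and> (AE z in circle_measure. f z = b z * h z)"
proof -
  obtain x h where x: "model b x" and h: "hardy h" and e: "\<forall>z. cmod z = 1 \<longrightarrow> f z = x z + b z * h z"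
    using hardy_decomp[OF assms(1)] by blast
  have [measurable]: "f \<in> borel_measurable borel" "x \<in> borel_measurable borel" "h \<in> borel_measurable borel"
    using assms(1) x h by (auto dest: hardy_meas model_hardy)
  have sx: "square_integrable x" by (intro hardy_sq model_hardy(1)[OF x])
  have "null (\<lambda>z. cnj (x z * cnj (b z * h z)))" by (intro null_cnj model_null x h)
  moreover have "null (\<lambda>z. f z * cnj (x z))"
    using assms(2)[OF x] integrable_cnj_product[OF hardy_sq[OF assms(1)] sx] by (simp add: null_def)
  ultimately have "null (\<lambda>z. f z * cnj (x z) - cnj (x z * cnj (b z * h z)))" by (rule null_diff[rotated])
  then have "null (\<lambda>z. x z * cnj (x z))"
    by (rule null_cong) (auto simp: e algebra_simps)
  then have "cinner (cls x) (cls x) = 0" by (simp add: cls_cinner sx null_def)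
  then have "cls x = cls (\<lambda>z. 0)" by (simp add: cls_zero)
  then have "AE z in circle_measure. x z = 0" using cls_eq_iff[OF sx square_integrable_zero] by simp
  with AE_circle have "AE z in circle_measure. f z = b z * h z" by eventually_elim (simp add: e)
  with h show ?thesis by blast
qed

end

section \<open>The Clark unitary operator\<close>

definition fun_of :: "circle_L2 \<Rightarrow> complex \<Rightarrow> complex" where
  "fun_of x = (SOME f. square_integrable f \<and> x = cls f)"

lemma fun_of: "square_integrable (fun_of x)" "cls (fun_of x) = x"
proof -
  have "\<exists>f. square_integrable f \<and> x = cls f" by (rule cls_surj[of x]) blast
  then have "square_integrable (fun_of x) \<and> x = cls (fun_of x)"
    unfolding fun_of_def by (rule someI_ex)
  then show "square_integrable (fun_of x)" "cls (fun_of x) = x" by simp_all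
qed

lemma fun_of_cls: "square_integrable f \<Longrightarrow> AE z in circle_measure. fun_of (cls f) z = f z"
  using cls_eq_iff[OF fun_of(1), of f "cls f"] by (simp add: fun_of(2))

definition mulL :: "(complex \<Rightarrow> complex) \<Rightarrow> circle_L2 \<Rightarrow> circle_L2" where
  "mulL m x = cls (\<lambda>z. m z * fun_of x z)"

text \<open>For \<open>m = b\<close> this is the antilinear conjugation of the model space of
  \<open>b\<close>. A chosen representative makes it a total map on classes.\<close>

definition conjL :: "(complex \<Rightarrow> complex) \<Rightarrow> circle_L2 \<Rightarrow> circle_L2" where
  "conjL m x = cls (\<lambda>z. m z * cnj (z * fun_of x z))"

lemma mulL_cls: "bhardy m \<Longrightarrow> square_integrable f \<Longrightarrow> mulL m (cls f) = cls (\<lambda>z. m z * f z)"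
  unfolding mulL_def using fun_of_cls[of f]
  by (subst cls_eq_iff) (auto intro!: bhardy_sq_mult fun_of(1))

lemma square_integrable_conj:
  "bhardy m \<Longrightarrow> square_integrable f \<Longrightarrow> square_integrable (\<lambda>z. m z * cnj (z * f z))"
  by (rule bhardy_sq_mult[OF _ square_integrable_cnj[OF square_integrable_id_mult]])

lemma conjL_cls: "bhardy m \<Longrightarrow> square_integrable f \<Longrightarrow> conjL m (cls f) = cls (\<lambda>z. m z * cnj (z * f z))"
  unfolding conjL_def using fun_of_cls[of f]
  by (subst cls_eq_iff[OF square_integrable_conj[OF _ fun_of(1)] square_integrable_conj]) auto

lemma cls_eqI:
  "square_integrable f \<Longrightarrow> g \<in> borel_measurable borel \<Longrightarrow> (\<And>z. cmod z = 1 \<Longrightarrow> f z = g z) \<Longrightarrow> cls f = cls g"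
proof -
  assume f: "square_integrable f" and g: "g \<in> borel_measurable borel" and eq: "\<And>z. cmod z = 1 \<Longrightarrow> f z = g z"
  have AE: "AE z in circle_measure. f z = g z" using eq by (rule AE_circleI)
  show ?thesis by (rule cls_eq_iff[THEN iffD2, OF f square_integrable_cong[OF f g AE] AE])
qed

lemma hardy_div:
  assumes f: "hardy f" and 0: "(\<integral>z. f z \<partial>circle_measure) = 0"
  shows "hardy (\<lambda>z. cnj z * f z)"
proof (rule hardyI)
  have [measurable]: "f \<in> borel_measurable borel" by (rule hardy_meas[OF f])
  show "square_integrable (\<lambda>z. cnj z * f z)"
    using f by (intro square_integrable_bounded_mult[where C = 1] hardy_sq) auto
  fix k
  have "null (\<lambda>z. f z * z ^ k)"
  proof (cases k)
    case 0
    then show ?thesis using square_integrable_integrable[OF hardy_sq[OF f]] assms(2) by (simp add: null_def)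
  next
    case (Suc j)
    then show ?thesis using hardy_null[OF f, of j] by simp
  qed
  then show "null (\<lambda>z. cnj z * f z * z ^ Suc k)"
    by (rule null_cong) (auto simp: circle_simps ac_simps)
qed

context inner_fun
begin

abbreviation V :: "circle_L2 set" where "V \<equiv> model_space (cls b)"
abbreviation C :: "circle_L2 \<Rightarrow> circle_L2" where "C \<equiv> conjL b"

text \<open>The value at the origin of the analytic extension of \<open>b\<close>.\<close>

definition b0 :: complex where "b0 = (\<integral>z. b z \<partial>circle_measure)"

lemma C_cls: "square_integrable f \<Longrightarrow> C (cls f) = cls (\<lambda>z. b z * cnj (z * f z))"
  by (rule conjL_cls[OF bb])

lemma C_in: "x \<in> V \<Longrightarrow> C x \<in> V"
  by (elim model_space_E) (simp add: C_cls hardy_sq model_hardy model_spaceI[OF model_conj] del: complex_cnj_mult)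

lemma C_C: "C (C x) = x"
proof -
  obtain f where f: "square_integrable f" "x = cls f" by (rule cls_surj)
  have [measurable]: "f \<in> borel_measurable borel" using f(1) by (rule square_integrable_measurable)
  have "C (C x) = cls (\<lambda>z. b z * cnj (z * (b z * cnj (z * f z))))"
    by (simp only: f(2) C_cls f(1) square_integrable_conj[OF bb])
  also have "\<dots> = cls f"
    by (rule cls_eqI) (auto intro!: square_integrable_conj[OF bb] f simp del: complex_cnj_mult, simp add: circle_simps b_simps ac_simps)
  finally show ?thesis by (simp add: f)
qed

lemma C_cinner: "cinner (C x) (C y) = cinner y x"
proof -
  obtain f where f: "square_integrable f" "x = cls f" by (rule cls_surj)
  obtain g where g: "square_integrable g" "y = cls g" by (rule cls_surj)
  have [measurable]: "f \<in> borel_measurable borel" "g \<in> borel_measurable borel"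
    using f g by (auto intro: square_integrable_measurable)
  have "cinner (C x) (C y) = (\<integral>z. (b z * cnj (z * f z)) * cnj (b z * cnj (z * g z)) \<partial>circle_measure)"
    by (simp only: f(2) g(2) C_cls f(1) g(1) cls_cinner square_integrable_conj[OF bb])
  also have "\<dots> = (\<integral>z. g z * cnj (f z) \<partial>circle_measure)"
    by (rule circle_integral_cong) (auto simp: circle_simps b_simps ac_simps)
  finally show ?thesis by (simp add: f g cls_cinner)
qed

lemma C_scaleC: "C (r *\<^sub>C x) = cnj r *\<^sub>C C x"
proof -
  obtain f where f: "square_integrable f" "x = cls f" by (rule cls_surj)
  have "C (r *\<^sub>C x) = cls (\<lambda>z. b z * cnj (z * (r * f z)))"
    by (simp only: f(2) cls_scaleC f(1) C_cls square_integrable_mult_const)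
  also have "\<dots> = cnj r *\<^sub>C C x"
    by (simp only: f(2) cls_scaleC f(1) C_cls square_integrable_conj[OF bb]) (simp add: ac_simps)
  finally show ?thesis .
qed

lemma b0_norm: "(norm (cls (\<lambda>z. b z - b0)))\<^sup>2 = 1 - (cmod b0)\<^sup>2"
proof -
  have i: "integrable circle_measure b" by (intro square_integrable_integrable hardy_sq b_hardy)
  have "cinner (cls (\<lambda>z. b z - b0)) (cls (\<lambda>z. b z - b0)) = (\<integral>z. (b z - b0) * cnj (b z - b0) \<partial>circle_measure)"
    by (intro cls_cinner hardy_sq hardy_diff b_hardy hardy_const)
  also have "\<dots> = (\<integral>z. (1 + b0 * cnj b0 - cnj b0 * b z) - b0 * cnj (b z) \<partial>circle_measure)"
    by (rule circle_integral_cong) (auto simp: b_simps algebra_simps)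
  also have "\<dots> = (1 + b0 * cnj b0 - cnj b0 * b0) - b0 * cnj b0"
    using i by (simp add: b0_def Bochner_Integration.integral_cnj)
  also have "\<dots> = complex_of_real (1 - (cmod b0)\<^sup>2)" by (simp add: complex_norm_square[symmetric] mult.commute)
  finally show ?thesis unfolding cinner_self by (rule of_real_eq_iff[THEN iffD1])
qed

text \<open>The squared distance of \<open>b\<close> from the constant \<open>b0\<close> is
  \<open>1 - (cmod b0)\<^sup>2\<close>, so an inner function is either strictly contractive at the
  origin or constant.\<close>

lemma b0_cases: "cmod b0 < 1 \<or> (AE z in circle_measure. b z = b0)"
proof (cases "cmod b0 < 1")
  case False
  then have "(cmod b0)\<^sup>2 \<ge> 1" by (simp add: one_le_power)
  then have "(norm (cls (\<lambda>z. b z - b0)))\<^sup>2 \<le> 0" by (simp add: b0_norm)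
  then have "cls (\<lambda>z. b z - b0) = cls (\<lambda>z. 0)" by (simp add: cls_zero)
  then have "AE z in circle_measure. b z - b0 = 0"
    by (subst (asm) cls_eq_iff) (auto intro!: square_integrable_zero hardy_sq hardy_diff b_hardy hardy_const)
  then show ?thesis by simp
qed simp

lemma model_trivial:
  assumes c: "\<not> cmod b0 < 1" and f: "model b f" shows "cls f = 0"
proof -
  have [measurable]: "f \<in> borel_measurable borel" using f by (auto dest: model_hardy hardy_meas)
  have sf: "square_integrable f" by (intro hardy_sq model_hardy(1)[OF f])
  have AE: "AE z in circle_measure. b z = b0" using b0_cases c by simp
  have "(\<integral>z. f z * cnj (b z * f z) \<partial>circle_measure) = 0" by (rule nullD[OF model_null[OF f model_hardy(1)[OF f]]])
  also have "(\<integral>z. f z * cnj (b z * f z) \<partial>circle_measure) = (\<integral>z. cnj b0 * (f z * cnj (f z)) \<partial>circle_measure)"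
    using AE by (intro integral_cong_AE) (auto simp: ac_simps)
  also have "\<dots> = cnj b0 * cinner (cls f) (cls f)" by (simp add: cls_cinner sf)
  finally show ?thesis using c by auto
qed

lemma V_trivial: "\<not> cmod b0 < 1 \<Longrightarrow> V = {0}"
  using model_trivial csubspaceD(1)[OF model_space(1)] by (auto elim: model_space_E)

end

text \<open>The nonconstant inner functions. For these \<open>b0\<close> differs from 1 and
  \<open>b z \<noteq> 1\<close> almost everywhere, as required for the Clark operator and for
  division by \<open>1 - b\<close>.\<close>

locale nc_inner = inner_fun +
  assumes b0_lt: "cmod b0 < 1"
begin

text \<open>The indicator of the set where \<open>b = 1\<close> is the limit of the powers of
  \<open>(1 + b) / 2\<close>. It is thus a real Hardy function, hence constant, and the value 1
  would make \<open>b\<close> constant.\<close>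

lemma AE_b_neq_1: "AE z in circle_measure. b z \<noteq> 1"
proof -
  define ch :: "complex \<Rightarrow> complex" where "ch z = (if b z = 1 then 1 else 0)" for z
  have [measurable]: "ch \<in> borel_measurable borel" unfolding ch_def by measurable
  have le: "cmod ((1/2) * (1 + b z)) \<le> 1" if "cmod z = 1" for z
    using norm_triangle_ineq[of 1 "b z"] b_unit[OF that] by (simp add: norm_mult)
  have lt: "cmod ((1/2) * (1 + b z)) < 1" if z: "cmod z = 1" and "b z \<noteq> 1" for z
  proof -
    have sq1: "Re (b z) * Re (b z) + Im (b z) * Im (b z) = 1"
      using b_unit[OF z] cmod_power2[of "b z"] by (simp add: power2_eq_square)
    have "Re (b z) \<noteq> 1"
    proof
      assume re: "Re (b z) = 1"
      then have "Im (b z) = 0" using sq1 by simp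
      with re that(2) show False by (simp add: complex_eq_iff)
    qed
    moreover have "Re (b z) \<le> 1" using b_unit[OF z] complex_Re_le_cmod[of "b z"] by simp
    moreover have "(cmod ((1/2) * (1 + b z)))\<^sup>2 = (1 + Re (b z)) / 2"
      using sq1 unfolding cmod_power2 by (simp add: power2_eq_square field_simps)
    ultimately have "(cmod ((1/2) * (1 + b z)))\<^sup>2 < 1" by simp
    then show ?thesis by (simp add: power2_less_1_iff)
  qed
  have "bhardy ch"
  proof (rule bhardy_limit[where f = "\<lambda>n z. ((1/2) * (1 + b z)) ^ n" and C = 1])
    show "bhardy (\<lambda>z. ((1/2) * (1 + b z)) ^ n)" for n by (intro bhardy_intros bb)
    show "cmod (((1/2) * (1 + b z)) ^ n) \<le> 1" if "cmod z = 1" for n z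
      using le[OF that] unfolding norm_power by (intro power_le_one) auto
    show "AE z in circle_measure. (\<lambda>n. ((1/2) * (1 + b z)) ^ n) \<longlonglongrightarrow> ch z"
    proof (rule AE_circleI)
      fix z :: complex assume z: "cmod z = 1"
      show "(\<lambda>n. ((1/2) * (1 + b z)) ^ n) \<longlonglongrightarrow> ch z"
      proof (cases "b z = 1")
        case True then show ?thesis by (simp add: ch_def)
      next
        case False
        then show ?thesis using LIMSEQ_power_zero[OF lt[OF z False]] by (simp add: ch_def)
      qed
    qed
  qed (auto simp: ch_def)
  then have h: "hardy ch" by (rule bhardy_hardy)
  moreover have "cnj (ch z) = ch z" for z by (simp add: ch_def)
  ultimately have const: "AE z in circle_measure. ch z = (\<integral>z. ch z \<partial>circle_measure)" by (intro hardy_real_const) simp_all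
  show ?thesis
  proof (cases "(\<integral>z. ch z \<partial>circle_measure) = 1")
    case True
    have "AE z in circle_measure. b z = 1"
      using const unfolding True by eventually_elim (simp add: ch_def split: if_splits)
    then have "(\<integral>z. b z \<partial>circle_measure) = (\<integral>z. 1 \<partial>circle_measure)" by (intro integral_cong_AE) auto
    then have "b0 = 1" by (simp add: b0_def)
    then show ?thesis using b0_lt by simp
  next
    case False
    show ?thesis using const by eventually_elim (use False in \<open>auto simp: ch_def split: if_splits\<close>)
  qed
qed

definition \<beta> :: complex where "\<beta> = 1 - cnj b0"

lemma beta_nz: "\<beta> \<noteq> 0" "1 - b0 \<noteq> 0"
proof -
  have "b0 \<noteq> 1" using b0_lt by auto
  moreover from this have "cnj b0 \<noteq> 1" by (metis complex_cnj_cnj complex_cnj_one)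
  ultimately show "\<beta> \<noteq> 0" "1 - b0 \<noteq> 0" by (simp_all add: \<beta>_def)
qed

definition lf :: "(complex \<Rightarrow> complex) \<Rightarrow> complex" where
  "lf f = (\<integral>z. z * f z * cnj (b z) \<partial>circle_measure) / \<beta>"

text \<open>The Clark operator, a unitary rank one perturbation of the compressed shift. The
  correction is a multiple of \<open>b - 1\<close>, so that formally the operator multiplies by
  \<open>z\<close> on the set \<open>b = 1\<close> carrying the Clark measure.\<close>

definition shiftf :: "(complex \<Rightarrow> complex) \<Rightarrow> complex \<Rightarrow> complex" where
  "shiftf f z = z * f z - (b z - 1) * lf f"

definition U :: "circle_L2 \<Rightarrow> circle_L2" where "U x = cls (shiftf (fun_of x))"

lemma b_int: "integrable circle_measure b" "(\<integral>z. b z \<partial>circle_measure) = b0" "(\<integral>z. cnj (b z) \<partial>circle_measure) = cnj b0"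
  by (auto simp: b0_def Bochner_Integration.integral_cnj intro: square_integrable_integrable hardy_sq b_hardy)

lemma sq_b1: "square_integrable (\<lambda>z. b z - 1)"
  by (intro square_integrable_diff hardy_sq b_hardy hardy_const)

lemma sq_shiftf: "square_integrable f \<Longrightarrow> square_integrable (shiftf f)"
  unfolding shiftf_def
  by (intro square_integrable_diff square_integrable_id_mult)
    (auto simp: mult.commute[of _ "lf f"] intro!: square_integrable_mult_const sq_b1)

lemma lf_cong:
  assumes "square_integrable f" "square_integrable g" "AE z in circle_measure. f z = g z"
  shows "lf f = lf g"
proof -
  have [measurable]: "f \<in> borel_measurable borel" "g \<in> borel_measurable borel"
    using assms by (auto intro: square_integrable_measurable)
  have "(\<integral>z. z * f z * cnj (b z) \<partial>circle_measure) = (\<integral>z. z * g z * cnj (b z) \<partial>circle_measure)"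
    using assms(3) by (intro integral_cong_AE) auto
  then show ?thesis by (simp add: lf_def)
qed

lemma U_cls: "square_integrable f \<Longrightarrow> U (cls f) = cls (shiftf f)"
  unfolding U_def using fun_of_cls[of f] lf_cong[OF fun_of(1) _ fun_of_cls, of f]
  by (subst cls_eq_iff[OF sq_shiftf[OF fun_of(1)] sq_shiftf]) (auto simp: shiftf_def)

lemma int_zfb: "square_integrable f \<Longrightarrow> integrable circle_measure (\<lambda>z. z * f z * cnj (b z))"
  by (rule integrable_cnj_product[OF square_integrable_id_mult hardy_sq[OF b_hardy]])

lemma lf_beta: "(\<integral>z. z * f z * cnj (b z) \<partial>circle_measure) = \<beta> * lf f"
  using beta_nz by (simp add: lf_def)

lemma lf_add: "square_integrable f \<Longrightarrow> square_integrable g \<Longrightarrow> lf (\<lambda>z. f z + g z) = lf f + lf g"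
  using int_zfb[of f] int_zfb[of g] by (simp add: lf_def algebra_simps add_divide_distrib)

lemma lf_cmult: "lf (\<lambda>z. c * f z) = c * lf f"
  by (simp add: lf_def mult.assoc mult.left_commute[of _ c])

lemma U_add: "U (x + y) = U x + U y"
proof -
  obtain f where f: "square_integrable f" "x = cls f" by (rule cls_surj)
  obtain g where g: "square_integrable g" "y = cls g" by (rule cls_surj)
  show ?thesis
    using f g by (simp add: cls_add U_cls square_integrable_add sq_shiftf)
      (simp add: shiftf_def[abs_def] lf_add algebra_simps)
qed

lemma U_scaleC: "U (c *\<^sub>C x) = c *\<^sub>C U x"
proof -
  obtain f where f: "square_integrable f" "x = cls f" by (rule cls_surj)
  show ?thesis
    using f by (simp add: cls_scaleC U_cls square_integrable_mult_const sq_shiftf)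
      (simp add: shiftf_def[abs_def] lf_cmult algebra_simps)
qed

lemma conj_shiftf:
  "cmod z = 1 \<Longrightarrow> b z * cnj (z * shiftf f z) = cnj z * (b z * cnj (z * f z) + (b z - 1) * cnj (lf f))"
  using b_simps[of z] by (simp add: shiftf_def algebra_simps)

text \<open>This condition dictates the normalization \<beta> of \<open>lf\<close>: the conjugate of
  \<open>shiftf f\<close> contains a factor \<open>cnj z\<close>, and it stays in the Hardy space
  because the remaining factor has mean zero.\<close>

lemma conj_shift_mean:
  assumes "square_integrable f"
  shows "(\<integral>z. b z * cnj (z * f z) + (b z - 1) * cnj (lf f) \<partial>circle_measure) = 0"
proof -
  have eq: "(\<lambda>z. b z * cnj (z * f z)) = (\<lambda>z. cnj (z * f z * cnj (b z)))" by (auto simp: ac_simps)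
  have i1: "integrable circle_measure (\<lambda>z. b z * cnj (z * f z))"
    unfolding eq using int_zfb[OF assms] by (rule integrable_cnj)
  have m1: "(\<integral>z. b z * cnj (z * f z) \<partial>circle_measure) = cnj (\<beta> * lf f)"
    unfolding eq Bochner_Integration.integral_cnj lf_beta ..
  have m2: "(\<integral>z. (b z - 1) * cnj (lf f) \<partial>circle_measure) = (b0 - 1) * cnj (lf f)"
    using b_int by simp
  have i2: "integrable circle_measure (\<lambda>z. (b z - 1) * cnj (lf f))" using b_int by simp
  show ?thesis
    unfolding Bochner_Integration.integral_add[OF i1 i2] m1 m2 by (simp add: \<beta>_def algebra_simps)
qed

lemma model_shiftf:
  assumes f: "model b f" shows "model b (shiftf f)"
proof -
  have [measurable]: "f \<in> borel_measurable borel" using f by (auto dest: model_hardy hardy_meas)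
  have b1: "hardy (\<lambda>z. (b z - 1) * c)" for c
    using hardy_cmult[OF hardy_diff[OF b_hardy hardy_const], of c] by (simp add: mult.commute)
  have h: "hardy (shiftf f)"
    unfolding shiftf_def by (intro hardy_diff hardy_id_mult model_hardy(1)[OF f] b1)
  then have [measurable]: "shiftf f \<in> borel_measurable borel" by (rule hardy_meas)
  have "hardy (\<lambda>z. cnj z * (b z * cnj (z * f z) + (b z - 1) * cnj (lf f)))"
    by (intro hardy_div hardy_add model_hardy(2)[OF f] b1 conj_shift_mean hardy_sq model_hardy(1)[OF f])
  then have "hardy (\<lambda>z. b z * cnj (z * shiftf f z))"
    by (rule hardy_cong) (auto simp: conj_shiftf simp del: complex_cnj_mult)
  with h show ?thesis by (simp add: model_def)
qed

lemma U_in: "x \<in> V \<Longrightarrow> U x \<in> V"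
  by (elim model_space_E) (simp add: U_cls hardy_sq model_hardy model_spaceI model_shiftf)

text \<open>With \<open>w\<close> the class of \<open>b - 1\<close>, the two mixed terms contribute
  \<open>- (\<beta> + cnj \<beta>) * lf f * cnj (lf g)\<close>, which the term with
  \<open>cinner w w = \<beta> + cnj \<beta>\<close> cancels.\<close>

lemma U_cinner:
  assumes "x \<in> V" "y \<in> V" shows "cinner (U x) (U y) = cinner x y"
proof -
  obtain f where f: "model b f" "x = cls f" using model_space_E[OF assms(1)] .
  obtain g where g: "model b g" "y = cls g" using model_space_E[OF assms(2)] .
  have hf: "hardy f" and hg: "hardy g" using f g by (auto dest: model_hardy)
  have sf: "square_integrable f" and sg: "square_integrable g" using hf hg by (auto dest: hardy_sq)
  have [measurable]: "f \<in> borel_measurable borel" "g \<in> borel_measurable borel"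
    using hf hg by (auto dest: hardy_meas)
  define w where "w = cls (\<lambda>z. b z - 1)"
  have Ux: "U (cls h) = cls (\<lambda>z. z * h z) - lf h *\<^sub>C w" if "square_integrable h" for h
    using that by (simp add: U_cls w_def cls_scaleC sq_b1 cls_diff square_integrable_id_mult
        square_integrable_mult_const) (simp add: shiftf_def[abs_def] mult.commute)
  have zw: "cinner (cls (\<lambda>z. z * h z)) w = \<beta> * lf h" if h: "hardy h" for h
  proof -
    have "(\<integral>z. z * h z \<partial>circle_measure) = 0"
      using h by (auto simp: hardy_def mult.commute dest: spec[of _ 0])
    moreover have "integrable circle_measure (\<lambda>z. z * h z)"
      by (intro square_integrable_integrable square_integrable_id_mult hardy_sq[OF h])
    moreover have "cinner (cls (\<lambda>z. z * h z)) w = (\<integral>z. z * h z * cnj (b z) - z * h z \<partial>circle_measure)"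
      unfolding w_def by (subst cls_cinner) (auto intro!: square_integrable_id_mult hardy_sq[OF h] sq_b1 simp: algebra_simps)
    ultimately show ?thesis using int_zfb[OF hardy_sq[OF h]] lf_beta[of h] by simp
  qed
  have ww: "cinner w w = \<beta> + cnj \<beta>"
  proof -
    have "cinner w w = (\<integral>z. (2 - b z) - cnj (b z) \<partial>circle_measure)"
      unfolding w_def cls_cinner[OF sq_b1 sq_b1]
      by (rule circle_integral_cong) (auto simp: b_simps algebra_simps)
    also have "\<dots> = 2 - b0 - cnj b0" using b_int by simp
    finally show ?thesis by (simp add: \<beta>_def)
  qed
  have zz: "cinner (cls (\<lambda>z. z * f z)) (cls (\<lambda>z. z * g z)) = cinner x y"
  proof -
    have "cinner (cls (\<lambda>z. z * f z)) (cls (\<lambda>z. z * g z)) = (\<integral>z. f z * cnj (g z) \<partial>circle_measure)"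
      by (subst cls_cinner) (auto intro!: square_integrable_id_mult sf sg circle_integral_cong simp: circle_simps ac_simps)
    then show ?thesis by (simp add: f g cls_cinner sf sg)
  qed
  have wz: "cinner w (cls (\<lambda>z. z * g z)) = cnj (\<beta> * lf g)"
    unfolding zw[OF hg, symmetric] by (rule cinner_commute)
  show ?thesis
    unfolding f(2) g(2) Ux[OF sf] Ux[OF sg]
    by (simp add: cinner_linear zw hf ww wz zz[unfolded f(2) g(2)] algebra_simps)
qed

text \<open>The inverse of \<open>U\<close> is therefore \<open>C U C\<close>, which gives
  surjectivity and, later, an explicit adjoint.\<close>

lemma U_C_U:
  assumes "x \<in> V" shows "U (C (U x)) = C x"
proof -
  obtain f where f: "model b f" "x = cls f" using model_space_E[OF assms] .
  have hf: "hardy f" using f by (auto dest: model_hardy)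
  have sf: "square_integrable f" using hf by (rule hardy_sq)
  have [measurable]: "f \<in> borel_measurable borel" using hf by (rule hardy_meas)
  define h where "h z = b z * cnj (z * f z) + (b z - 1) * cnj (lf f)" for z
  define g where "g z = cnj z * h z" for z
  have sc: "square_integrable (\<lambda>z. b z * cnj (z * f z))" by (rule square_integrable_conj[OF bb sf])
  have sh: "square_integrable h"
    unfolding h_def using square_integrable_mult_const[OF sq_b1, of "cnj (lf f)"]
    by (intro square_integrable_add sc) (simp add: mult.commute)
  then have [measurable]: "h \<in> borel_measurable borel" by (rule square_integrable_measurable)
  have sg: "square_integrable g"
    unfolding g_def by (intro square_integrable_bounded_mult[where C = 1] sh) auto
  have "C (U x) = cls (\<lambda>z. b z * cnj (z * shiftf f z))"
    by (simp only: f(2) U_cls sf C_cls sq_shiftf)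
  also have "\<dots> = cls g"
  proof (rule cls_eqI[OF square_integrable_conj[OF bb sq_shiftf[OF sf]]])
    show "g \<in> borel_measurable borel" using sg by (rule square_integrable_measurable)
    show "b z * cnj (z * shiftf f z) = g z" if "cmod z = 1" for z
      unfolding g_def h_def by (rule conj_shiftf[OF that])
  qed
  finally have CU: "C (U x) = cls g" .
  have [measurable]: "g \<in> borel_measurable borel" using sg by (rule square_integrable_measurable)
  have "lf g = cnj (lf f)"
  proof -
    have zf: "null (\<lambda>z. cnj (f z * z ^ Suc 0))" by (intro null_cnj hardy_null hf)
    have n1: "null (\<lambda>z. cnj (z * f z))" using zf by (simp add: mult.commute)
    have "(\<integral>z. z * g z * cnj (b z) \<partial>circle_measure)
        = (\<integral>z. cnj (z * f z) + (1 - cnj (b z)) * cnj (lf f) \<partial>circle_measure)"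
      by (rule circle_integral_cong) (auto simp: g_def h_def circle_simps b_simps algebra_simps)
    also have "\<dots> = (\<integral>z. (1 - cnj (b z)) * cnj (lf f) \<partial>circle_measure)"
      using n1 b_int by (subst Bochner_Integration.integral_add) (auto simp: null_def)
    also have "\<dots> = \<beta> * cnj (lf f)" using b_int by (simp add: \<beta>_def)
    finally show ?thesis using beta_nz by (simp add: lf_def)
  qed
  then have "shiftf g z = b z * cnj (z * f z)" if "cmod z = 1" for z
    using that by (simp add: shiftf_def g_def h_def circle_simps)
  then have "U (cls g) = cls (\<lambda>z. b z * cnj (z * f z))"
    unfolding U_cls[OF sg] by (intro cls_eqI sq_shiftf sg) auto
  moreover have "C x = cls (\<lambda>z. b z * cnj (z * f z))" by (simp only: f(2) C_cls sf)
  ultimately show ?thesis using CU by (simp only:)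
qed

lemma unitary_U: "unitary_between U V V"
  unfolding unitary_between_def
proof (intro conjI ballI allI)
  show "U ` V = V"
  proof (intro antisym subsetI)
    fix x assume x: "x \<in> V"
    have "U (C (U (C x))) = x" using U_C_U[OF C_in[OF x]] by (simp add: C_C)
    then show "x \<in> U ` V" using C_in[OF U_in[OF C_in[OF x]]] by (metis image_eqI)
  qed (auto intro: U_in)
qed (auto intro: U_cinner U_add U_scaleC)

text \<open>The reproducing kernel of the model space at the origin; it serves as the cyclic vector
  of \<open>U\<close>.\<close>

definition E :: circle_L2 where "E = cls (\<lambda>z. 1 - cnj b0 * b z)"
definition \<kappa> :: complex where "\<kappa> = (1 - b0) / \<beta>"

lemma model_e: "model b (\<lambda>z. 1 - cnj b0 * b z)"
proof -
  have "(\<integral>z. b z - b0 \<partial>circle_measure) = 0" using b_int by simp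
  then have "hardy (\<lambda>z. cnj z * (b z - b0))" by (intro hardy_div hardy_diff b_hardy hardy_const)
  then have "hardy (\<lambda>z. b z * cnj (z * (1 - cnj b0 * b z)))"
    by (rule hardy_cong) (auto simp: b_simps algebra_simps)
  then show ?thesis by (simp add: model_def hardy_diff hardy_cmult hardy_const b_hardy)
qed

lemma E_in: "E \<in> V" unfolding E_def by (rule model_spaceI[OF model_e])

lemma U_C_E: "U (C E) = \<kappa> *\<^sub>C E"
proof -
  have se: "square_integrable (\<lambda>z. 1 - cnj b0 * b z)" by (intro hardy_sq model_hardy(1)[OF model_e])
  have bm: "(\<integral>z. b z - b0 \<partial>circle_measure) = 0" using b_int by simp
  define g where "g z = cnj z * (b z - b0)" for z
  have sg: "square_integrable g"
    unfolding g_def by (intro hardy_sq hardy_div hardy_diff b_hardy hardy_const bm)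
  then have [measurable]: "g \<in> borel_measurable borel" by (rule square_integrable_measurable)
  have CE: "C E = cls g"
    unfolding E_def C_cls[OF se]
    by (rule cls_eqI[OF square_integrable_conj[OF bb se]]) (auto simp: g_def b_simps algebra_simps)
  have l: "\<beta> * lf g = 1 - b0 * cnj b0"
  proof -
    have "\<beta> * lf g = (\<integral>z. 1 - b0 * cnj (b z) \<partial>circle_measure)"
      unfolding lf_beta[symmetric]
      by (rule circle_integral_cong) (auto simp: g_def circle_simps b_simps algebra_simps)
    also have "\<dots> = 1 - b0 * cnj b0" using b_int by simp
    finally show ?thesis .
  qed
  have "shiftf g z = \<kappa> * (1 - cnj b0 * b z)" if z: "cmod z = 1" for z
  proof -
    have "\<beta> * shiftf g z = \<beta> * (z * g z) - (b z - 1) * (\<beta> * lf g)"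
      by (simp add: shiftf_def algebra_simps)
    also have "z * g z = b z - b0" by (simp add: g_def circle_simps[OF z])
    also have "\<beta> * (b z - b0) - (b z - 1) * (\<beta> * lf g) = (1 - b0) * (1 - cnj b0 * b z)"
      unfolding l by (simp add: \<beta>_def algebra_simps)
    finally show ?thesis using beta_nz by (simp add: \<kappa>_def nonzero_eq_divide_eq mult.commute)
  qed
  then show ?thesis
    unfolding CE[unfolded E_def] E_def cls_scaleC[OF se] U_cls[OF sg]
    by (intro cls_eqI sq_shiftf sg) auto
qed

lemma kappa: "cmod \<kappa> = 1"
proof -
  have "cmod \<beta> = cmod (1 - b0)" unfolding \<beta>_def by (metis complex_cnj_diff complex_cnj_one complex_mod_cnj)
  then show ?thesis using beta_nz by (simp add: \<kappa>_def norm_divide)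
qed

lemma kappa_cnj: "cnj \<kappa> * \<kappa> = 1" "\<kappa> * cnj \<kappa> = 1"
  using circle_simps[OF kappa] by auto

text \<open>The vectors \<open>U\<close> to the power \<open>n\<close> applied to \<open>E\<close>,
  for all integers. Negative powers are expressed through the conjugation:
  \<open>U (C E) = \<kappa> *\<^sub>C E\<close> makes \<open>C\<close> reflect \<open>n\<close> to
  \<open>- n - 1\<close>, and boundedness of the representatives is preserved.\<close>

definition a :: "int \<Rightarrow> circle_L2" where
  "a n = (if 0 \<le> n then (U ^^ nat n) E else cnj \<kappa> *\<^sub>C C ((U ^^ nat (- n - 1)) E))"

lemma U_pow_in: "(U ^^ n) E \<in> V"
  by (induction n) (auto intro: E_in U_in)

lemma a_in: "a n \<in> V"
  unfolding a_def by (auto intro: U_pow_in C_in csubspaceD(3)[OF model_space(1)])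

lemma C_a: "C (a n) = \<kappa> *\<^sub>C a (- n - 1)"
  by (auto simp: a_def C_scaleC C_C scaleC_scaleC kappa_cnj)

lemma U_a: "U (a n) = a (n + 1)"
proof (cases "0 \<le> n")
  case True
  then show ?thesis by (simp add: a_def nat_add_distrib)
next
  case False
  show ?thesis
  proof (cases "n = -1")
    case True
    then show ?thesis by (simp add: a_def U_scaleC U_C_E scaleC_scaleC kappa_cnj)
  next
    case ne: False
    define m where "m = nat (- n - 2)"
    have "nat (- n - 1) = Suc m" "nat (- (n + 1) - 1) = m" using False ne by (auto simp: m_def)
    then show ?thesis using False ne by (simp add: a_def U_scaleC U_C_U U_pow_in)
  qed
qed

lemma cinner_E:
  assumes f: "model b f" shows "cinner (cls f) E = (\<integral>z. f z \<partial>circle_measure)"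
proof -
  have sf: "square_integrable f" and se: "square_integrable (\<lambda>z. 1 - cnj b0 * b z)"
    by (intro hardy_sq model_hardy(1)[OF f] model_hardy(1)[OF model_e])+
  have n: "null (\<lambda>z. b0 * (f z * cnj (b z)))" using null_cmult[OF model_null[OF f hardy_const[of 1]], of b0] by simp
  have "cinner (cls f) E = (\<integral>z. f z - b0 * (f z * cnj (b z)) \<partial>circle_measure)"
    unfolding E_def cls_cinner[OF sf se] by (simp add: algebra_simps)
  also have "\<dots> = (\<integral>z. f z \<partial>circle_measure)"
    using n square_integrable_integrable[OF sf]
    by (subst Bochner_Integration.integral_diff) (simp_all only: null_def diff_zero)
  finally show ?thesis .
qed

text \<open>Orthogonality to \<open>E\<close> means a zero at the origin, which can be divided out;
  the quotient satisfies the same conditions shifted by one. So \<open>f\<close> is divisible by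
  every power of \<open>z\<close>, and all its Fourier coefficients vanish.\<close>

lemma a_total:
  assumes x: "x \<in> V" and orth: "\<And>n. cinner x (a n) = 0"
  shows "x = 0"
proof -
  obtain f where f: "model b f" "x = cls f" using model_space_E[OF x] .
  have step: "\<exists>g. model b g \<and> (\<forall>n::nat. cinner (cls g) (a (int n)) = 0) \<and> (\<forall>z. cmod z = 1 \<longrightarrow> f z = z ^ k * g z)" for k
  proof (induction k)
    case 0
    then show ?case using f orth by auto
  next
    case (Suc k)
    then obtain g where g: "model b g" "\<And>n::nat. cinner (cls g) (a (int n)) = 0"
      and fg: "\<And>z. cmod z = 1 \<Longrightarrow> f z = z ^ k * g z" by auto
    have [measurable]: "g \<in> borel_measurable borel" using g by (auto dest: model_hardy hardy_meas)
    have "a 0 = E" by (simp add: a_def)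
    then have g0: "(\<integral>z. g z \<partial>circle_measure) = 0" using g(2)[of 0] cinner_E[OF g(1)] by simp
    define h where "h z = cnj z * g z" for z
    have hh: "hardy h" unfolding h_def by (rule hardy_div[OF model_hardy(1)[OF g(1)] g0])
    have "hardy (\<lambda>z. z * (b z * cnj (z * g z)))" by (intro hardy_id_mult model_hardy(2)[OF g(1)])
    then have "hardy (\<lambda>z. b z * cnj (z * h z))"
      by (rule hardy_cong) (auto simp: h_def circle_simps ac_simps)
    then have mh: "model b h" using hh by (simp add: model_def)
    have sh: "square_integrable h" by (rule hardy_sq[OF hh])
    have "(\<integral>z. z * h z * cnj (b z) \<partial>circle_measure) = (\<integral>z. g z * cnj (b z * 1) \<partial>circle_measure)"
      by (rule circle_integral_cong) (auto simp: h_def circle_simps)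
    \<comment> \<open>Since \<open>g\<close> is orthogonal to \<open>b\<close>, the rank one
      correction vanishes on \<open>h\<close>, and \<open>U\<close> takes the quotient
      \<open>h\<close> back to \<open>g\<close>.\<close>
    then have "lf h = 0" using nullD[OF model_null[OF g(1) hardy_const, of 1]] by (simp add: lf_def)
    then have "U (cls h) = cls g"
      unfolding U_cls[OF sh] by (intro cls_eqI sq_shiftf sh) (auto simp: shiftf_def h_def circle_simps)
    then have "cinner (cls h) (a (int n)) = cinner (cls g) (a (int (Suc n)))" for n
      using U_cinner[OF model_spaceI[OF mh] a_in, of "int n"] by (simp add: U_a add.commute)
    then have "cinner (cls h) (a (int n)) = 0" for n using g(2)[of "Suc n"] by simp
    moreover have "f z = z ^ Suc k * h z" if "cmod z = 1" for z
      using fg[OF that] circle_simps[OF that] by (simp add: h_def ac_simps)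
    ultimately show ?case using mh by blast
  qed
  have "AE z in circle_measure. f z = 0"
  proof (rule hardy_null_fourier[OF model_hardy(1)[OF f(1)]])
    fix k
    obtain g where g: "model b g" and fg: "\<forall>z. cmod z = 1 \<longrightarrow> f z = z ^ Suc k * g z" using step by blast
    have [measurable]: "f \<in> borel_measurable borel" "g \<in> borel_measurable borel" using f g by (auto dest: model_hardy hardy_meas)
    have "(\<integral>z. f z * cnj (z ^ k) \<partial>circle_measure) = (\<integral>z. g z * z ^ Suc 0 \<partial>circle_measure)"
    proof (rule circle_integral_cong)
      fix z :: complex assume z: "cmod z = 1"
      have "z ^ k * cnj (z ^ k) = 1" using z by (intro circle_simps) (simp add: norm_power)
      then have "(z ^ k * cnj (z ^ k)) * (z * g z) = z * g z" by simp
      then show "f z * cnj (z ^ k) = g z * z ^ Suc 0" using fg z by (simp add: ac_simps)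
    qed measurable
    then show "(\<integral>z. f z * cnj (z ^ k) \<partial>circle_measure) = 0"
      using nullD[OF hardy_null[OF model_hardy(1)[OF g], of 0]] by simp
  qed
  then show ?thesis
    using cls_eq_iff[OF hardy_sq[OF model_hardy(1)[OF f(1)]] square_integrable_zero] by (simp add: f cls_zero)
qed

end

section \<open>Bounded functions in model spaces\<close>

definition bmodel :: "(complex \<Rightarrow> complex) \<Rightarrow> (complex \<Rightarrow> complex) \<Rightarrow> bool" where
  "bmodel b f \<longleftrightarrow> model b f \<and> bhardy f"

lemma (in inner_fun) bmodel_conj:
  assumes "bmodel b f"
  shows "bmodel b (\<lambda>z. b z * cnj (z * f z))" "bhardy (\<lambda>z. b z * cnj (z * f z))"
proof -
  obtain K where K: "\<And>z. cmod z = 1 \<Longrightarrow> cmod (f z) \<le> K" using assms by (auto simp: bmodel_def bhardy_def)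
  have "model b f" using assms by (simp add: bmodel_def)
  then have m: "model b (\<lambda>z. b z * cnj (z * f z))" by (rule model_conj)
  have "bhardy (\<lambda>z. b z * cnj (z * f z))"
    by (rule bhardyI[OF model_hardy(1)[OF m], of K]) (simp add: norm_mult b_unit K)
  with m show "bmodel b (\<lambda>z. b z * cnj (z * f z))" "bhardy (\<lambda>z. b z * cnj (z * f z))"
    by (simp_all add: bmodel_def)
qed

context nc_inner
begin

lemma bmodel_shiftf: assumes "bmodel b f" shows "bmodel b (shiftf f)"
proof -
  have "bhardy (\<lambda>z. z * f z - lf f * (b z - 1))" using assms by (intro bhardy_intros bb) (simp add: bmodel_def)
  then show ?thesis using assms model_shiftf[of f]
    by (simp add: bmodel_def shiftf_def[abs_def] mult.commute)
qed

lemma U_pow_bmodel: "\<exists>f. bmodel b f \<and> (U ^^ n) E = cls f"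
proof (induction n)
  case 0
  have "bhardy (\<lambda>z. 1 - cnj b0 * b z)" by (intro bhardy_intros bb)
  then show ?case using model_e by (auto simp: bmodel_def E_def)
next
  case (Suc n)
  then obtain f where f: "bmodel b f" "(U ^^ n) E = cls f" by blast
  then have "square_integrable f" by (auto simp: bmodel_def dest: bhardy_hardy hardy_sq)
  then show ?case using f bmodel_shiftf[OF f(1)] by (auto simp: U_cls)
qed

text \<open>Bounded representatives can be multiplied by any square integrable symbol, so these
  vectors lie in the domain of every truncated Toeplitz operator on the model space.\<close>

lemma a_bmodel: "\<exists>f. bmodel b f \<and> a n = cls f"
proof (cases "0 \<le> n")
  case True
  then show ?thesis using U_pow_bmodel by (simp add: a_def)
next
  case False
  obtain f where f: "bmodel b f" "(U ^^ nat (- n - 1)) E = cls f" using U_pow_bmodel by blast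
  have sf: "square_integrable f" using f(1) by (auto simp: bmodel_def dest: bhardy_hardy hardy_sq)
  let ?g = "\<lambda>z. cnj \<kappa> * (b z * cnj (z * f z))"
  have "bmodel b ?g"
    using bmodel_conj[OF f(1)] unfolding bmodel_def by (intro conjI model_cmult bhardy_cmult) auto
  moreover have "a n = cls ?g"
    using False f(2) by (simp only: a_def if_False C_cls[OF sf] cls_scaleC[OF square_integrable_conj[OF bb sf]])
  ultimately show ?thesis by blast
qed

end

text \<open>In the nonconstant case the bounded vectors \<open>a n\<close> are total. Constant inner
  functions have to be covered too, because \<open>s1 = 1\<close> occurs when no copies are added;
  their model space is trivial.\<close>

lemma (in inner_fun) bmodel_dense:
  assumes x: "square_integrable x" and orth: "\<And>g. bmodel b g \<Longrightarrow> (\<integral>z. x z * cnj (g z) \<partial>circle_measure) = 0"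
    and g: "model b g"
  shows "(\<integral>z. x z * cnj (g z) \<partial>circle_measure) = 0"
proof (cases "cmod b0 < 1")
  case True
  then interpret nc_inner by unfold_locales
  define p where "p = orth_proj V (cls x)"
  have pV: "p \<in> V" unfolding p_def by (rule orth_proj_in[OF model_space])
  have "cinner p (a n) = 0" for n
  proof -
    obtain f where f: "bmodel b f" "a n = cls f" using a_bmodel by blast
    then have sf: "square_integrable f" by (auto simp: bmodel_def dest: bhardy_hardy hardy_sq)
    have "cinner p (a n) = cinner (cls x) (a n)" unfolding p_def by (rule orth_proj_cinner(1)[OF model_space a_in])
    then show ?thesis using orth[OF f(1)] by (simp add: f(2) cls_cinner x sf)
  qed
  then have "p = 0" by (rule a_total[OF pV])
  then have "cinner (cls x) (cls g) = 0"
    using orth_proj_cinner(1)[OF model_space model_spaceI[OF g], of "cls x"] by (simp add: p_def)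
  then show ?thesis using hardy_sq[OF model_hardy(1)[OF g]] by (simp add: cls_cinner x)
next
  case False
  then have "cls g = 0" using model_trivial g by blast
  then have "cinner (cls x) (cls g) = 0" by simp
  then show ?thesis using hardy_sq[OF model_hardy(1)[OF g]] by (simp add: cls_cinner x)
qed

section \<open>Truncated Toeplitz operators\<close>

lemma cnj_bhardy_sq_mult:
  assumes "bhardy m" "square_integrable f" shows "square_integrable (\<lambda>z. cnj (m z) * f z)"
  using square_integrable_cnj[OF bhardy_sq_mult[OF assms(1) square_integrable_cnj[OF assms(2)]]] by simp

lemma null_cong_AE:
  assumes "null F" "AE z in circle_measure. G z = F z" "G \<in> borel_measurable borel"
  shows "null G"
proof -
  have F: "F \<in> borel_measurable borel" using assms(1) borel_measurable_integrable[of circle_measure F] by (simp add: null_def)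
  have "integrable circle_measure G \<longleftrightarrow> integrable circle_measure F"
    using assms by (intro integrable_cong_AE) (simp_all add: F)
  moreover have "(\<integral>z. G z \<partial>circle_measure) = (\<integral>z. F z \<partial>circle_measure)"
    using assms by (intro integral_cong_AE) (simp_all add: F)
  ultimately show ?thesis using assms(1) by (simp add: null_def)
qed

lemma bmodel_simps:
  assumes "bmodel b f"
  shows "model b f" "bhardy f" "hardy f" "square_integrable f" "f \<in> borel_measurable borel"
  using assms by (auto simp: bmodel_def dest: bhardy_hardy hardy_sq hardy_meas)

lemma model_simps:
  assumes "model b f"
  shows "hardy f" "hardy (\<lambda>z. b z * cnj (z * f z))" "square_integrable f" "f \<in> borel_measurable borel"
  using assms by (auto simp: model_def dest: hardy_sq hardy_meas)

context inner_fun
begin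

lemma V_eqI:
  assumes "x \<in> V" "y \<in> V" "\<And>v. v \<in> V \<Longrightarrow> cinner x v = cinner y v"
  shows "x = y"
proof -
  have "x - y \<in> V" by (rule csubspaceD(4)[OF model_space(1) assms(1,2)])
  then have "cinner (x - y) (x - y) = 0" using assms(3) by (simp add: cinner_diff_left)
  then show ?thesis by simp
qed

lemma truncated_ToeplitzI:
  assumes \<phi>: "square_integrable \<phi>" and f: "model b f" and g: "model b g" and pf: "square_integrable (\<lambda>z. \<phi> z * f z)"
    and orth: "\<And>y. model b y \<Longrightarrow> (\<integral>z. (\<phi> z * f z - g z) * cnj (y z) \<partial>circle_measure) = 0"
  shows "(cls f, cls g) \<in> truncated_Toeplitz (cls b) (cls \<phi>)"
proof -
  note sf = model_simps(3)[OF f] and sg = model_simps(3)[OF g]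
  have "orth_proj V (cls \<phi> \<odot> cls f) = cls g"
  proof (rule orth_proj_eqI[OF model_space(1) model_spaceI[OF g]])
    fix v assume "v \<in> V"
    then obtain y where y: "model b y" "v = cls y" by (rule model_space_E)
    show "cinner (cls \<phi> \<odot> cls f - cls g) v = 0"
      using orth[OF y(1)] by (simp add: y(2) cls_mult \<phi> sf pf cls_diff sg cls_cinner square_integrable_diff model_simps(3)[OF y(1)])
  qed
  then show ?thesis
    unfolding truncated_Toeplitz_def using model_spaceI[OF f] cls_mult_in[OF \<phi> sf] pf by (auto intro!: exI[of _ "cls f"])
qed

lemma truncated_ToeplitzE:
  assumes \<phi>: "square_integrable \<phi>" and xy: "(x, y) \<in> truncated_Toeplitz (cls b) (cls \<phi>)"
  obtains f g where "model b f" "model b g" "x = cls f" "y = cls g" "square_integrable (\<lambda>z. \<phi> z * f z)"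
    "\<forall>v. model b v \<longrightarrow> (\<integral>z. \<phi> z * f z * cnj (v z) \<partial>circle_measure) = (\<integral>z. g z * cnj (v z) \<partial>circle_measure)"
proof -
  have x: "x \<in> V" "mult_in_L2 (cls \<phi>) x" and y: "y = orth_proj V (cls \<phi> \<odot> x)"
    using xy by (auto simp: truncated_Toeplitz_def)
  obtain f where f: "model b f" "x = cls f" using model_space_E[OF x(1)] .
  have yV: "y \<in> V" unfolding y by (rule orth_proj_in[OF model_space])
  obtain g where g: "model b g" "y = cls g" using model_space_E[OF yV] .
  note sf = model_simps(3)[OF f(1)] and sg = model_simps(3)[OF g(1)]
  have pf: "square_integrable (\<lambda>z. \<phi> z * f z)" using x(2) cls_mult_in[OF \<phi> sf] f(2) by simp
  show thesis
  proof (rule that[OF f(1) g(1) f(2) g(2) pf], intro allI impI)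
    fix v assume v: "model b v"
    have "cinner (cls g) (cls v) = cinner (cls \<phi> \<odot> cls f) (cls v)"
      unfolding g(2)[symmetric] f(2)[symmetric] y by (rule orth_proj_cinner(1)[OF model_space model_spaceI[OF v]])
    then show "(\<integral>z. \<phi> z * f z * cnj (v z) \<partial>circle_measure) = (\<integral>z. g z * cnj (v z) \<partial>circle_measure)"
      by (simp add: cls_cinner cls_mult \<phi> sf sg pf model_simps(3)[OF v])
  qed
qed

lemma csubspace_truncated_Toeplitz:
  assumes \<phi>: "square_integrable \<phi>"
  shows "csubspace (truncated_Toeplitz (cls b) (cls \<phi>))"
proof -
  have int: "integrable circle_measure (\<lambda>z. p z * cnj (y z))" if "square_integrable p" "model b y" for p y
    using that(1) model_simps(3)[OF that(2)] by (rule integrable_cnj_product)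
  show ?thesis
    unfolding csubspace_def
  proof (intro conjI ballI allI)
    have "(cls (\<lambda>z. 0 * (0::complex)), cls (\<lambda>z. 0)) \<in> truncated_Toeplitz (cls b) (cls \<phi>)"
      by (rule truncated_ToeplitzI[OF \<phi>]) (auto simp: model_def hardy_const square_integrable_zero)
    then show "0 \<in> truncated_Toeplitz (cls b) (cls \<phi>)" by (simp add: cls_zero zero_prod_def)
  next
    fix p q assume pq: "p \<in> truncated_Toeplitz (cls b) (cls \<phi>)" "q \<in> truncated_Toeplitz (cls b) (cls \<phi>)"
    obtain x1 y1 x2 y2 where e: "p = (x1, y1)" "q = (x2, y2)" by (cases p, cases q)
    obtain f1 g1 where 1: "model b f1" "model b g1" "x1 = cls f1" "y1 = cls g1" "square_integrable (\<lambda>z. \<phi> z * f1 z)"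
      "\<forall>v. model b v \<longrightarrow> (\<integral>z. \<phi> z * f1 z * cnj (v z) \<partial>circle_measure) = (\<integral>z. g1 z * cnj (v z) \<partial>circle_measure)"
      using truncated_ToeplitzE[OF \<phi> pq(1)[unfolded e(1)]] .
    obtain f2 g2 where 2: "model b f2" "model b g2" "x2 = cls f2" "y2 = cls g2" "square_integrable (\<lambda>z. \<phi> z * f2 z)"
      "\<forall>v. model b v \<longrightarrow> (\<integral>z. \<phi> z * f2 z * cnj (v z) \<partial>circle_measure) = (\<integral>z. g2 z * cnj (v z) \<partial>circle_measure)"
      using truncated_ToeplitzE[OF \<phi> pq(2)[unfolded e(2)]] .
    have "(cls (\<lambda>z. f1 z + f2 z), cls (\<lambda>z. g1 z + g2 z)) \<in> truncated_Toeplitz (cls b) (cls \<phi>)"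
    proof (rule truncated_ToeplitzI[OF \<phi> model_add[OF 1(1) 2(1)] model_add[OF 1(2) 2(2)]])
      show "square_integrable (\<lambda>z. \<phi> z * (f1 z + f2 z))"
        using square_integrable_add[OF 1(5) 2(5)] by (simp add: distrib_left)
      fix y assume y: "model b y"
      have "(\<integral>z. (\<phi> z * (f1 z + f2 z) - (g1 z + g2 z)) * cnj (y z) \<partial>circle_measure)
        = (\<integral>z. (\<phi> z * f1 z * cnj (y z) + \<phi> z * f2 z * cnj (y z)) - (g1 z * cnj (y z) + g2 z * cnj (y z)) \<partial>circle_measure)"
        by (simp add: algebra_simps)
      then show "(\<integral>z. (\<phi> z * (f1 z + f2 z) - (g1 z + g2 z)) * cnj (y z) \<partial>circle_measure) = 0"
        using int[OF 1(5) y] int[OF 2(5) y] int[OF model_simps(3)[OF 1(2)] y] int[OF model_simps(3)[OF 2(2)] y]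
        by (simp add: 1(6)[rule_format, OF y] 2(6)[rule_format, OF y])
    qed
    then show "p + q \<in> truncated_Toeplitz (cls b) (cls \<phi>)"
      by (simp add: e 1(3,4) 2(3,4) cls_add model_simps(3)[OF 1(1)] model_simps(3)[OF 1(2)]
          model_simps(3)[OF 2(1)] model_simps(3)[OF 2(2)])
  next
    fix c p assume p: "p \<in> truncated_Toeplitz (cls b) (cls \<phi>)"
    obtain x1 y1 where e: "p = (x1, y1)" by (cases p)
    obtain f1 g1 where 1: "model b f1" "model b g1" "x1 = cls f1" "y1 = cls g1" "square_integrable (\<lambda>z. \<phi> z * f1 z)"
      "\<forall>v. model b v \<longrightarrow> (\<integral>z. \<phi> z * f1 z * cnj (v z) \<partial>circle_measure) = (\<integral>z. g1 z * cnj (v z) \<partial>circle_measure)"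
      using truncated_ToeplitzE[OF \<phi> p[unfolded e(1)]] .
    have "(cls (\<lambda>z. c * f1 z), cls (\<lambda>z. c * g1 z)) \<in> truncated_Toeplitz (cls b) (cls \<phi>)"
    proof (rule truncated_ToeplitzI[OF \<phi> model_cmult[OF 1(1)] model_cmult[OF 1(2)]])
      show "square_integrable (\<lambda>z. \<phi> z * (c * f1 z))"
        using square_integrable_mult_const[OF 1(5), of c] by (simp add: mult.left_commute)
      fix y assume y: "model b y"
      have "(\<integral>z. (\<phi> z * (c * f1 z) - c * g1 z) * cnj (y z) \<partial>circle_measure)
        = (\<integral>z. c * (\<phi> z * f1 z * cnj (y z)) - c * (g1 z * cnj (y z)) \<partial>circle_measure)"
        by (simp add: algebra_simps)
      then show "(\<integral>z. (\<phi> z * (c * f1 z) - c * g1 z) * cnj (y z) \<partial>circle_measure) = 0"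
        using int[OF 1(5) y] int[OF model_simps(3)[OF 1(2)] y] by (simp add: 1(6)[rule_format, OF y])
    qed
    then show "c *\<^sub>C p \<in> truncated_Toeplitz (cls b) (cls \<phi>)"
      by (simp add: e 1(3,4) scaleC_prod_def cls_scaleC model_simps(3)[OF 1(1)] model_simps(3)[OF 1(2)])
  qed
qed

text \<open>Truncated Toeplitz operators are complex symmetric with respect to the conjugation of the model space.\<close>

lemma Toeplitz_conj:
  assumes [measurable]: "\<phi> \<in> borel_measurable borel" "f \<in> borel_measurable borel" "g \<in> borel_measurable borel"
  shows "(\<integral>z. \<phi> z * f z * cnj (g z) \<partial>circle_measure)
    = (\<integral>z. \<phi> z * (b z * cnj (z * g z)) * cnj (b z * cnj (z * f z)) \<partial>circle_measure)"
  by (rule circle_integral_cong) (auto simp: circle_simps b_simps ac_simps)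

text \<open>The product lies in the model space of the square of \<open>b\<close>: the conjugate of
  the product with respect to that square is \<open>z\<close> times the product of the two
  conjugates. The condition on \<open>X1\<close> is read off from this.\<close>

lemma model_mult_decomp:
  assumes \<psi>: "model b \<psi>" and h: "bmodel b h"
  shows "\<exists>X0 X1. model b X0 \<and> model b X1 \<and> (\<forall>z. cmod z = 1 \<longrightarrow> \<psi> z * h z = X0 z + b z * X1 z)"
proof -
  note hs = bmodel_simps[OF h] and ps = model_simps[OF \<psi>]
  have "hardy (\<lambda>z. h z * \<psi> z)" by (rule bhardy_mult_hardy[OF hs(2) ps(1)])
  then obtain X0 X1 where X: "model b X0" "hardy X1" "\<forall>z. cmod z = 1 \<longrightarrow> h z * \<psi> z = X0 z + b z * X1 z"
    using hardy_decomp by blast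
  have [measurable]: "X1 \<in> borel_measurable borel" using X(2) by (rule hardy_meas)
  have "hardy (\<lambda>z. z * ((b z * cnj (z * h z)) * (b z * cnj (z * \<psi> z))) - b z * (b z * cnj (z * X0 z)))"
    by (intro hardy_diff hardy_id_mult bhardy_mult_hardy bmodel_conj(2)[OF h] ps bb model_hardy(2)[OF X(1)])
  then have "hardy (\<lambda>z. b z * cnj (z * X1 z))"
  proof (rule hardy_cong)
    fix z :: complex assume z: "cmod z = 1"
    have "X1 z = cnj (b z) * (h z * \<psi> z - X0 z)" using X(3) z b_simps[OF z] by simp
    then have "b z * cnj (z * X1 z) = b z * cnj (z * (cnj (b z) * (h z * \<psi> z - X0 z)))" by simp
    then show "b z * cnj (z * X1 z) = z * ((b z * cnj (z * h z)) * (b z * cnj (z * \<psi> z))) - b z * (b z * cnj (z * X0 z))"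
      by (simp add: algebra_simps circle_simps[OF z])
  qed measurable
  with X show ?thesis by (auto simp: model_def mult.commute)
qed

end

section \<open>The operator with the symbol \<open>\<psi> * (1 + cnj b)\<close>\<close>

locale clark_symbol = nc_inner +
  fixes \<psi> :: "complex \<Rightarrow> complex"
  assumes psi: "model b \<psi>"
begin

lemma psi_meas [measurable]: "\<psi> \<in> borel_measurable borel" by (rule model_simps(4)[OF psi])

definition sym :: "complex \<Rightarrow> complex" where "sym z = \<psi> z * (1 + cnj (b z))"
definition A :: "circle_L2 \<Rightarrow> circle_L2" where "A x = orth_proj V (cls sym \<odot> x)"
definition decomp :: "(complex \<Rightarrow> complex) \<Rightarrow> (complex \<Rightarrow> complex) \<Rightarrow> (complex \<Rightarrow> complex) \<Rightarrow> bool" where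
  "decomp h X0 X1 \<longleftrightarrow> model b X0 \<and> model b X1 \<and> (\<forall>z. cmod z = 1 \<longrightarrow> \<psi> z * h z = X0 z + b z * X1 z)"

lemma sym_sq: "square_integrable sym"
  using square_integrable_add[OF model_simps(3)[OF psi] cnj_bhardy_sq_mult[OF bb model_simps(3)[OF psi]]]
  by (simp add: sym_def[abs_def] algebra_simps)

lemma sym_meas [measurable]: "sym \<in> borel_measurable borel"
  by (rule square_integrable_measurable[OF sym_sq])

lemma decomp_ex: "bmodel b h \<Longrightarrow> \<exists>X0 X1. decomp h X0 X1"
  using model_mult_decomp[OF psi] by (auto simp: decomp_def)

lemma decomp_cmult: "decomp h X0 X1 \<Longrightarrow> decomp (\<lambda>z. c * h z) (\<lambda>z. c * X0 z) (\<lambda>z. c * X1 z)"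
  by (auto simp: decomp_def model_cmult algebra_simps)

text \<open>Multiplying \<open>X0 + b * X1\<close> by \<open>1 + cnj b\<close> yields
  \<open>X0 + X1\<close> and two terms of the kind treated in \<open>model_pair_null\<close>. So the
  operator sends \<open>h\<close> to \<open>X0 + X1\<close>, the formal value of
  \<open>\<psi> * h\<close> on the set \<open>b = 1\<close>.\<close>

lemma decomp_null:
  assumes h: "bmodel b h" and X: "decomp h X0 X1" and y: "model b y"
  shows "null (\<lambda>z. (sym z * h z - (X0 z + X1 z)) * cnj (y z))"
proof -
  have X0: "model b X0" and X1: "model b X1" using X by (auto simp: decomp_def)
  note [measurable] = bmodel_simps(5)[OF h] model_simps(4)[OF X0] model_simps(4)[OF X1] model_simps(4)[OF y]
  have "null (\<lambda>z. b z * (X1 z * cnj (y z)) + cnj (b z) * (X0 z * cnj (y z)))"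
    by (intro null_add model_pair_null X0 X1 y)
  then show ?thesis
  proof (rule null_cong)
    fix z :: complex assume z: "cmod z = 1"
    have "sym z * h z = (X0 z + b z * X1 z) * (1 + cnj (b z))" using X z by (simp add: sym_def decomp_def ac_simps)
    then show "(sym z * h z - (X0 z + X1 z)) * cnj (y z) = b z * (X1 z * cnj (y z)) + cnj (b z) * (X0 z * cnj (y z))"
      using b_simps[OF z] by (simp add: algebra_simps)
  qed measurable
qed

lemma bmodel_sq_mult: "bmodel b h \<Longrightarrow> square_integrable p \<Longrightarrow> square_integrable (\<lambda>z. p z * h z)"
  using bhardy_sq_mult[of h p] by (simp add: bmodel_simps mult.commute)

lemma graph_A:
  assumes h: "bmodel b h" and X: "decomp h X0 X1"
  shows "(cls h, cls (\<lambda>z. X0 z + X1 z)) \<in> truncated_Toeplitz (cls b) (cls sym)"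
  using X decomp_null[OF h X]
  by (intro truncated_ToeplitzI sym_sq bmodel_simps(1)[OF h] model_add bmodel_sq_mult[OF h])
    (auto simp: decomp_def null_def)

lemma A_cls:
  assumes h: "bmodel b h" and X: "decomp h X0 X1"
  shows "A (cls h) = cls (\<lambda>z. X0 z + X1 z)"
  using graph_A[OF assms] by (auto simp: A_def truncated_Toeplitz_def)

lemma A_in: "A x \<in> V" unfolding A_def by (rule orth_proj_in[OF model_space])

lemma A_scaleC: assumes h: "bmodel b h" shows "A (c *\<^sub>C cls h) = c *\<^sub>C A (cls h)"
proof -
  obtain X0 X1 where X: "decomp h X0 X1" using decomp_ex[OF h] by blast
  have "bmodel b (\<lambda>z. c * h z)" using h by (simp add: bmodel_def model_cmult bhardy_cmult)
  from A_cls[OF this decomp_cmult[OF X]] have "A (c *\<^sub>C cls h) = cls (\<lambda>z. c * (X0 z + X1 z))"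
    by (simp add: cls_scaleC bmodel_simps[OF h] distrib_left)
  also have "\<dots> = c *\<^sub>C A (cls h)"
  proof -
    have "square_integrable (\<lambda>z. X0 z + X1 z)"
      using X unfolding decomp_def by (intro square_integrable_add) (blast intro: model_simps(3))+
    then show ?thesis by (simp add: A_cls[OF h X] cls_scaleC)
  qed
  finally show ?thesis .
qed

lemma A_cinner:
  assumes h: "bmodel b h" and y: "model b y"
  shows "cinner (A (cls h)) (cls y) = (\<integral>z. sym z * h z * cnj (y z) \<partial>circle_measure)"
proof -
  note sh = bmodel_simps(4)[OF h] and ssh = bmodel_sq_mult[OF h sym_sq]
  have "cinner (A (cls h)) (cls y) = cinner (cls sym \<odot> cls h) (cls y)"
    unfolding A_def by (rule orth_proj_cinner(1)[OF model_space model_spaceI[OF y]])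
  then show ?thesis by (simp add: cls_mult sym_sq sh ssh cls_cinner model_simps(3)[OF y])
qed

text \<open>Tested weakly. The adjoint of \<open>U\<close> is \<open>C U C\<close>, whose action on
  \<open>y\<close> is the explicit function \<open>y'\<close>; the difference of the two integrands
  is then a combination of four null functions.\<close>

lemma A_U:
  assumes h: "bmodel b h" shows "A (U (cls h)) = U (A (cls h))"
proof (rule V_eqI[OF A_in U_in[OF A_in]])
  fix v assume v: "v \<in> V"
  then obtain y where y: "model b y" "v = cls y" by (rule model_space_E)
  note hs = bmodel_simps[OF h] and ys = model_simps[OF y(1)]
  define m where "m = cnj (lf (\<lambda>z. b z * cnj (z * y z)))"
  note [measurable] = hs(5) ys(4)
  have sc: "square_integrable (\<lambda>z. b z * cnj (z * y z))" by (rule square_integrable_conj[OF bb ys(3)])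
  have mc: "model b (shiftf (\<lambda>z. b z * cnj (z * y z)))" by (rule model_shiftf[OF model_conj[OF y(1)]])
  define y' where "y' z = b z * cnj (z * shiftf (\<lambda>z. b z * cnj (z * y z)) z)" for z
  have my': "model b y'" unfolding y'_def by (rule model_conj[OF mc])
  note [measurable] = model_simps(4)[OF my']
  have CUC: "C (U (C v)) = cls y'"
    unfolding y'_def[abs_def] y(2) by (simp only: C_cls ys(3) U_cls sc sq_shiftf)
  have UCUC: "U (C (U (C v))) = v" using U_C_U[OF C_in[OF v]] by (simp add: C_C)
  have y': "y' z = cnj z * (y z + (b z - 1) * m)" if z: "cmod z = 1" for z
    unfolding y'_def conj_shiftf[OF z] m_def using z by (simp add: circle_simps b_simps ac_simps)
  have "cinner (U (A (cls h))) v = cinner (A (cls h)) (cls y')"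
    using U_cinner[OF A_in model_spaceI[OF my'], of "cls h"] UCUC CUC by simp
  also have "\<dots> = (\<integral>z. sym z * h z * cnj (y' z) \<partial>circle_measure)" by (rule A_cinner[OF h my'])
  finally have r: "cinner (U (A (cls h))) v = (\<integral>z. sym z * h z * cnj (y' z) \<partial>circle_measure)" .
  have bs: "bmodel b (shiftf h)" by (rule bmodel_shiftf[OF h])
  note [measurable] = bmodel_simps(5)[OF bs]
  have l: "cinner (A (U (cls h))) v = (\<integral>z. sym z * shiftf h z * cnj (y z) \<partial>circle_measure)"
    unfolding U_cls[OF hs(4)] y(2) by (rule A_cinner[OF bs y(1)])
  have n1: "null (\<lambda>z. b z * (\<psi> z * cnj (y z)))" "null (\<lambda>z. cnj (b z) * (\<psi> z * cnj (y z)))"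
    by (intro model_pair_null psi y)+
  have n2: "null (\<lambda>z. z * (\<psi> z * h z))" by (intro hardy_product_null model_simps(1)[OF psi] hs(3))
  have n3: "null (\<lambda>z. z * \<psi> z * h z * (cnj (b z) * cnj (b z)))"
    by (rule null_cohardyI[OF model_simps(2)[OF psi] model_simps(2)[OF hs(1)]]) (auto simp: circle_simps ac_simps)
  let ?N = "\<lambda>z. (- lf h) * (b z * (\<psi> z * cnj (y z)) - cnj (b z) * (\<psi> z * cnj (y z)))
    - cnj m * (z * \<psi> z * h z * (cnj (b z) * cnj (b z)) - z * (\<psi> z * h z))"
  have "null ?N" by (intro null_diff null_cmult n1 n2 n3)
  moreover have eq: "sym z * shiftf h z * cnj (y z) - sym z * h z * cnj (y' z) = ?N z" if z: "cmod z = 1" for z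
  proof -
    \<comment> \<open>Here the special form of the symbol enters: the factor
      \<open>1 + cnj b\<close> turns both rank one corrections into expressions whose terms are all
      null.\<close>
    have 1: "(1 + cnj (b z)) * (b z - 1) = b z - cnj (b z)" using b_simps[OF z] by (simp add: algebra_simps)
    have 2: "(1 + cnj (b z)) * (cnj (b z) - 1) = cnj (b z) * cnj (b z) - 1" by (simp add: algebra_simps)
    have "sym z * shiftf h z * cnj (y z) - sym z * h z * cnj (y' z)
      = - lf h * \<psi> z * ((1 + cnj (b z)) * (b z - 1)) * cnj (y z) - \<psi> z * h z * z * cnj m * ((1 + cnj (b z)) * (cnj (b z) - 1))"
      unfolding y'[OF z] by (simp add: shiftf_def sym_def algebra_simps)
    then show ?thesis unfolding 1 2 by (simp add: algebra_simps)
  qed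
  ultimately have "null (\<lambda>z. sym z * shiftf h z * cnj (y z) - sym z * h z * cnj (y' z))"
    by (rule null_cong) measurable
  moreover have "integrable circle_measure (\<lambda>z. sym z * shiftf h z * cnj (y z))"
    by (intro integrable_cnj_product bmodel_sq_mult[OF bs] sym_sq ys(3))
  moreover have "integrable circle_measure (\<lambda>z. sym z * h z * cnj (y' z))"
    by (intro integrable_cnj_product bmodel_sq_mult[OF h] sym_sq model_simps(3)[OF my'])
  ultimately show "cinner (A (U (cls h))) v = cinner (U (A (cls h))) v"
    unfolding l r by (simp add: null_def)
qed

definition bA :: "int \<Rightarrow> circle_L2" where "bA n = A (a n)"
text \<open>By complex symmetry \<open>C A C\<close> is the formal adjoint of \<open>A\<close>, so
  these vectors play the part of the adjoint applied to \<open>a n\<close>.\<close>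

definition bB :: "int \<Rightarrow> circle_L2" where "bB n = C (A (C (a n)))"

lemma U_bA: "U (bA n) = bA (n + 1)"
proof -
  obtain h where h: "bmodel b h" "a n = cls h" using a_bmodel by blast
  show ?thesis unfolding bA_def U_a[symmetric] h(2) by (rule A_U[OF h(1), symmetric])
qed

lemma C_bA: "C (bA n) = \<kappa> *\<^sub>C bB (- n - 1)"
proof -
  obtain h where h: "bmodel b h" "a n = cls h" using a_bmodel by blast
  have "C (a (- n - 1)) = \<kappa> *\<^sub>C a n" by (simp add: C_a)
  then have "bB (- n - 1) = C (\<kappa> *\<^sub>C A (a n))" unfolding bB_def h(2) by (simp add: A_scaleC[OF h(1)])
  then show ?thesis by (simp add: bA_def C_scaleC scaleC_scaleC kappa_cnj)
qed

lemma bA_in: "bA n \<in> V"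
  unfolding bA_def by (rule A_in)

lemma clark_uniqueness:
  assumes "f \<in> V" "g \<in> V" "\<And>n. cinner f (a n) + cinner g (bA n) = 0" "\<And>n. cinner f (bB n) = cinner g (a n)"
  shows "f = 0 \<and> g = 0"
  by (rule cyclic_graph_uniqueness[OF model_space unitary_U, of C a bA \<kappa> bB f g])
    (use assms in \<open>auto intro: C_in C_C C_cinner C_scaleC a_in bA_in kappa a_total simp: U_a U_bA C_a C_bA\<close>)

text \<open>The first component may be unbounded. Complex symmetry moves the symbol to the bounded
  conjugate of \<open>a n\<close>, on which \<open>A\<close> is given by its integral
  formula.\<close>

lemma graph_sym:
  assumes xy: "(x, y) \<in> truncated_Toeplitz (cls b) (cls sym)"
  shows "cinner x (bB n) = cinner y (a n)"
proof -
  obtain f g where f: "model b f" "model b g" "x = cls f" "y = cls g" "square_integrable (\<lambda>z. sym z * f z)"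
    "\<forall>v. model b v \<longrightarrow> (\<integral>z. sym z * f z * cnj (v z) \<partial>circle_measure) = (\<integral>z. g z * cnj (v z) \<partial>circle_measure)"
    using truncated_ToeplitzE[OF sym_sq xy] .
  obtain h where h: "bmodel b h" "a n = cls h" using a_bmodel by blast
  note sf = model_simps(3)[OF f(1)] and hs = bmodel_simps[OF h(1)]
  have "cinner y (a n) = (\<integral>z. sym z * f z * cnj (h z) \<partial>circle_measure)"
    using f(6)[rule_format, OF hs(1)] by (simp add: f(4) h(2) cls_cinner model_simps(3)[OF f(2)] hs)
  also have "\<dots> = (\<integral>z. sym z * (b z * cnj (z * h z)) * cnj (b z * cnj (z * f z)) \<partial>circle_measure)"
    by (rule Toeplitz_conj[OF sym_meas model_simps(4)[OF f(1)] hs(5)])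
  also have "\<dots> = cinner (A (C (a n))) (C x)"
    unfolding f(3) h(2) C_cls[OF sf] C_cls[OF hs(4)]
    by (rule A_cinner[OF bmodel_conj(1)[OF h(1)] model_conj[OF f(1)], symmetric])
  also have "\<dots> = cinner x (bB n)"
    using C_cinner[of "C x" "A (C (a n))"] by (simp add: bB_def C_C)
  finally show ?thesis by simp
qed

end

section \<open>Adding a zero operator\<close>

lemma AE_circle_mp:
  "AE z in circle_measure. P z \<Longrightarrow> (\<And>z. cmod z = 1 \<Longrightarrow> P z \<Longrightarrow> Q z) \<Longrightarrow> AE z in circle_measure. Q z"
proof -
  assume P: "AE z in circle_measure. P z" and Q: "\<And>z. cmod z = 1 \<Longrightarrow> P z \<Longrightarrow> Q z"
  from AE_circle P show ?thesis by eventually_elim (rule Q)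
qed

text \<open>
  The equations for \<open>k\<close> and \<open>r\<close> express that \<open>u(w)\<close> has a second order expansion at \<open>w = 1\<close>, where \<open>s = u \<circ> b\<close>.
\<close>

locale dilation = clark_symbol b \<psi> + S: inner_fun s + S1: inner_fun s1
  for b \<psi> s s1 :: "complex \<Rightarrow> complex" +
  fixes k r :: "complex \<Rightarrow> complex" and K :: real
  assumes s_eq: "\<And>z. cmod z = 1 \<Longrightarrow> s z = b z * s1 z"
    and k: "bhardy k" and r: "bhardy r" and K: "K > 0"
    and k_eq: "\<And>z. cmod z = 1 \<Longrightarrow> k z * (1 - b z) = 1 - s z"
    and r_eq: "\<And>z. cmod z = 1 \<Longrightarrow> r z * (1 - b z) = k z - complex_of_real K"
begin

abbreviation VS :: "circle_L2 set" where "VS \<equiv> model_space (cls s)"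

lemma k_meas [measurable]: "k \<in> borel_measurable borel" and r_meas [measurable]: "r \<in> borel_measurable borel"
  using k r by (auto dest: bhardy_meas)

text \<open>The conjugations on the two model spaces are thereby intertwined by multiplication by
  \<open>k\<close>. Off the set \<open>b = 1\<close> one divides by \<open>b - 1\<close>; on it
  \<open>k_eq\<close> gives \<open>s = 1\<close>, and \<open>r_eq\<close> gives the real value
  \<open>k = K\<close>.\<close>

lemma s_cnj_k: assumes z: "cmod z = 1" shows "s z * cnj (k z) = b z * k z"
proof (cases "b z = 1")
  case True
  then have "s z = 1" "k z = complex_of_real K" using k_eq[OF z] r_eq[OF z] by auto
  then show ?thesis using True by simp
next
  case False
  have "cnj (k z) * (1 - cnj (b z)) = 1 - cnj (s z)"
    using arg_cong[OF k_eq[OF z], of cnj] by simp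
  then have "s z * b z * (cnj (k z) * (1 - cnj (b z))) = s z * b z * (1 - cnj (s z))" by simp
  then have "s z * cnj (k z) * (b z - 1) = b z * (s z - 1)"
    by (simp add: algebra_simps b_simps[OF z] S.b_simps[OF z])
  also have "\<dots> = b z * k z * (b z - 1)" using arg_cong[OF k_eq[OF z], of "\<lambda>w. - b z * w"] by (simp add: algebra_simps)
  finally show ?thesis using False by simp
qed

lemma cnj_b_cnj_k: assumes z: "cmod z = 1" shows "cnj (b z) * cnj (k z) = cnj (s z) * k z"
proof -
  have "cnj (b z) * cnj (k z) = (s z * cnj (s z)) * (cnj (b z) * cnj (k z))" by (simp add: S.b_simps[OF z])
  also have "\<dots> = cnj (b z) * cnj (s z) * (s z * cnj (k z))" by (simp only: ac_simps)
  also have "\<dots> = (b z * cnj (b z)) * (cnj (s z) * k z)" unfolding s_cnj_k[OF z] by (simp only: ac_simps)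
  finally show ?thesis by (simp add: b_simps[OF z])
qed

text \<open>Chosen so that \<open>F * (1 - b) = cnj s - s\<close>: multiplied by a bounded
  \<open>v\<close> from the model space of \<open>s1\<close> and by \<psi>, the right-hand side is
  orthogonal to the model space of \<open>s\<close>.\<close>

definition F :: "complex \<Rightarrow> complex" where "F z = k z + cnj (b z * k z)"
definition \<phi> :: "complex \<Rightarrow> complex" where "\<phi> z = \<psi> z * F z / complex_of_real K"

lemma F_eq: assumes z: "cmod z = 1" shows "F z * (1 - b z) = cnj (s z) - s z"
proof -
  have kc: "cnj (k z) * (1 - cnj (b z)) = 1 - cnj (s z)"
    using arg_cong[OF k_eq[OF z], of cnj] by simp
  have "cnj (b z * k z) * (1 - b z) = - (cnj (k z) * (1 - cnj (b z)))"
    by (simp add: algebra_simps b_simps[OF z])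
  then have "cnj (b z * k z) * (1 - b z) = cnj (s z) - 1" unfolding kc by simp
  then show ?thesis using k_eq[OF z] by (simp add: F_def distrib_right)
qed

text \<open>Obtained after multiplication by \<open>1 - b\<close>, which is then cancelled. The
  terms with \<open>r\<close> are the bounded remainders of the expansion of \<open>k\<close> at
  \<open>b = 1\<close>.\<close>

lemma F_k:
  assumes z: "cmod z = 1" and nb: "b z \<noteq> 1"
  shows "F z * k z = K * k z + K * cnj (b z) - cnj (b z) * cnj (b z) * cnj (r z) - s z * r z"
proof -
  have rc: "cnj (r z) * (1 - cnj (b z)) = cnj (k z) - K"
    using arg_cong[OF r_eq[OF z], of cnj] by simp
  have "cnj (b z) * cnj (b z) * cnj (r z) * (1 - b z) = - (cnj (b z) * (cnj (r z) * (1 - cnj (b z))))"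
    using b_simps[OF z] by (simp add: algebra_simps)
  then have 1: "cnj (b z) * cnj (b z) * cnj (r z) * (1 - b z) = - (cnj (s z) * k z) + K * cnj (b z)"
    unfolding rc using cnj_b_cnj_k[OF z] by (simp add: algebra_simps)
  have "(K * k z + K * cnj (b z) - cnj (b z) * cnj (b z) * cnj (r z) - s z * r z) * (1 - b z)
      = K * (k z * (1 - b z)) + K * (cnj (b z) * (1 - b z)) - cnj (b z) * cnj (b z) * cnj (r z) * (1 - b z) - s z * (r z * (1 - b z))"
    by (simp add: algebra_simps)
  also have "\<dots> = K * (1 - s z) + K * (cnj (b z) - 1) - (- (cnj (s z) * k z) + K * cnj (b z)) - s z * (k z - K)"
    unfolding 1 k_eq[OF z] r_eq[OF z] using b_simps[OF z] by (simp add: right_diff_distrib)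
  also have "\<dots> = (cnj (s z) - s z) * k z" by (simp add: algebra_simps)
  also have "\<dots> = F z * k z * (1 - b z)" unfolding F_eq[OF z, symmetric] by (simp add: ac_simps)
  finally show ?thesis using nb by simp
qed

lemma phi_sq: "square_integrable \<phi>"
proof -
  have "square_integrable (\<lambda>z. k z * \<psi> z + cnj (b z * k z) * \<psi> z)"
    by (intro square_integrable_add bhardy_sq_mult cnj_bhardy_sq_mult bhardy_mult k bb model_simps(3)[OF psi])
  from square_integrable_mult_const[OF this, of "1 / complex_of_real K"] show ?thesis
    by (simp add: \<phi>_def[abs_def] F_def algebra_simps add_divide_distrib)
qed

lemma phi_meas [measurable]: "\<phi> \<in> borel_measurable borel"
  by (rule square_integrable_measurable[OF phi_sq])

lemma model_k_mult:
  assumes f: "model b f" shows "model s (\<lambda>z. k z * f z)"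
proof -
  note [measurable] = model_simps(4)[OF f] S.b_meas
  have "hardy (\<lambda>z. k z * (b z * cnj (z * f z)))" by (intro bhardy_mult_hardy k model_simps(2)[OF f])
  then have "hardy (\<lambda>z. s z * cnj (z * (k z * f z)))"
  proof (rule hardy_cong)
    fix z :: complex assume z: "cmod z = 1"
    have "s z * cnj (z * (k z * f z)) = (s z * cnj (k z)) * cnj (z * f z)" by (simp add: ac_simps)
    then show "s z * cnj (z * (k z * f z)) = k z * (b z * cnj (z * f z))"
      unfolding s_cnj_k[OF z] by (simp add: ac_simps)
  qed measurable
  then show ?thesis by (simp add: model_def bhardy_mult_hardy k model_simps(1)[OF f])
qed

text \<open>By \<open>F_k\<close>, \<open>k * cnj k\<close> equals \<open>K\<close> plus
  \<open>b\<close> times a bounded Hardy function minus \<open>cnj b * cnj r\<close>. Against two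
  functions of the model space the last two terms integrate to zero.\<close>

lemma k_cinner:
  assumes f: "model b f" and g: "model b g"
  shows "(\<integral>z. (k z * f z) * cnj (k z * g z) \<partial>circle_measure) = K * (\<integral>z. f z * cnj (g z) \<partial>circle_measure)"
proof -
  note [measurable] = model_simps(4)[OF f] model_simps(4)[OF g] S.b_meas
  note fs = model_simps[OF f] and gs = model_simps[OF g]
  have i1: "integrable circle_measure (\<lambda>z. (k z * f z) * cnj (k z * g z))"
    by (intro integrable_cnj_product bhardy_sq_mult k fs gs)
  have i2: "integrable circle_measure (\<lambda>z. complex_of_real K * (f z * cnj (g z)))"
    by (intro integrable_mult_right integrable_cnj_product fs gs)
  have m: "bhardy (\<lambda>z. K * k z - s z * r z - k z * k z)" by (intro bhardy_intros k r S.bb)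
  have n1: "null (\<lambda>z. b z * ((K * k z - s z * r z - k z * k z) * f z * cnj (g z)))"
    by (rule null_hardyI[OF bhardy_mult_hardy[OF m fs(1)] gs(2)]) (auto simp: circle_simps ac_simps)
  have n2: "null (\<lambda>z. cnj (b z) * (cnj (r z) * f z * cnj (g z)))"
    by (rule null_cohardyI[OF fs(2) bhardy_mult_hardy[OF r gs(1)]]) (auto simp: circle_simps ac_simps)
  have "null (\<lambda>z. (k z * f z) * cnj (k z * g z) - complex_of_real K * (f z * cnj (g z)))"
  proof (rule null_cong_AE[OF null_diff[OF n1 n2]])
    show "AE z in circle_measure. (k z * f z) * cnj (k z * g z) - complex_of_real K * (f z * cnj (g z))
      = b z * ((K * k z - s z * r z - k z * k z) * f z * cnj (g z)) - cnj (b z) * (cnj (r z) * f z * cnj (g z))"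
    proof (rule AE_circle_mp[OF AE_b_neq_1])
      fix z assume z: "cmod z = 1" and nb: "b z \<noteq> 1"
      have "k z * cnj (k z) = b z * (F z * k z) - b z * k z * k z"
        using b_simps[OF z] by (simp add: F_def algebra_simps)
      also have "\<dots> = K + b z * (K * k z - s z * r z - k z * k z) - cnj (b z) * cnj (r z)"
        unfolding F_k[OF z nb] using b_simps[OF z] by (simp add: algebra_simps)
      finally have kk: "k z * cnj (k z) = K + b z * (K * k z - s z * r z - k z * k z) - cnj (b z) * cnj (r z)" .
      have "(k z * f z) * cnj (k z * g z) = (k z * cnj (k z)) * (f z * cnj (g z))" by (simp add: ac_simps)
      then show "(k z * f z) * cnj (k z * g z) - complex_of_real K * (f z * cnj (g z))
        = b z * ((K * k z - s z * r z - k z * k z) * f z * cnj (g z)) - cnj (b z) * (cnj (r z) * f z * cnj (g z))"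
        unfolding kk by (simp add: algebra_simps)
    qed
  qed measurable
  then show ?thesis using i1 i2 by (simp add: null_def)
qed

text \<open>Writing \<open>\<psi> * h\<close> as \<open>X0 + X1 - (1 - b) * X1\<close> makes
  \<open>F_k\<close> and \<open>F_eq\<close> applicable. Besides \<open>k * (X0 + X1)\<close> five
  terms remain, each orthogonal to the model space of \<open>s\<close>: the new operator acts on
  \<open>k * h\<close> as \<open>A\<close> does on \<open>h\<close>.\<close>

lemma phi_k_null:
  assumes h: "bmodel b h" and X: "decomp h X0 X1" and y: "model s y"
  shows "null (\<lambda>z. (\<phi> z * (k z * h z) - k z * (X0 z + X1 z)) * cnj (y z))"
proof -
  have X0: "model b X0" and X1: "model b X1" using X by (auto simp: decomp_def)
  define g where "g z = X0 z + X1 z" for z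
  have g: "model b g" unfolding g_def by (rule model_add[OF X0 X1])
  note [measurable] = bmodel_simps(5)[OF h] model_simps(4)[OF X0] model_simps(4)[OF X1] model_simps(4)[OF y]
    model_simps(4)[OF g] S.b_meas
  note gs = model_simps[OF g] and xs = model_simps[OF X1] and ys = model_simps[OF y]
  have n1: "null (\<lambda>z. cnj (b z) * g z * cnj (y z))"
    by (rule null_cohardyI[OF gs(2) ys(1)]) (auto simp: circle_simps ac_simps)
  have n2: "null (\<lambda>z. cnj (b z) * cnj (b z) * cnj (r z) * g z * cnj (y z))"
    by (rule null_cohardyI[OF gs(2) bhardy_mult_hardy[OF bb bhardy_mult_hardy[OF r ys(1)]]]) (auto simp: circle_simps ac_simps)
  have n3: "null (\<lambda>z. s z * r z * g z * cnj (y z))"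
    by (rule null_hardyI[OF bhardy_mult_hardy[OF r gs(1)] ys(2)]) (auto simp: circle_simps ac_simps)
  have n4: "null (\<lambda>z. cnj (b z) * cnj (k z) * X1 z * cnj (y z))"
    by (rule null_cohardyI[OF xs(2) bhardy_mult_hardy[OF k ys(1)]]) (auto simp: circle_simps ac_simps)
  have n5: "null (\<lambda>z. s z * k z * X1 z * cnj (y z))"
    by (rule null_hardyI[OF bhardy_mult_hardy[OF k xs(1)] ys(2)]) (auto simp: circle_simps ac_simps)
  define c where "c = 1 / complex_of_real K"
  have cK: "c * complex_of_real K = 1" using K by (simp add: c_def)
  have "null (\<lambda>z. cnj (b z) * g z * cnj (y z) - c * (cnj (b z) * cnj (b z) * cnj (r z) * g z * cnj (y z))
     - c * (s z * r z * g z * cnj (y z)) - c * (cnj (b z) * cnj (k z) * X1 z * cnj (y z)) + c * (s z * k z * X1 z * cnj (y z)))"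
    (is "null ?N") by (intro null_add null_diff null_cmult n1 n2 n3 n4 n5)
  then show ?thesis
  proof (rule null_cong_AE)
    show "AE z in circle_measure. (\<phi> z * (k z * h z) - k z * (X0 z + X1 z)) * cnj (y z) = ?N z"
    proof (rule AE_circle_mp[OF AE_b_neq_1])
      fix z assume z: "cmod z = 1" and nb: "b z \<noteq> 1"
      have ph: "\<psi> z * h z = g z - (1 - b z) * X1 z" using X z by (simp add: decomp_def g_def algebra_simps)
      have "\<phi> z * (k z * h z) = c * (F z * k z * (\<psi> z * h z))" by (simp add: \<phi>_def c_def ac_simps)
      also have "F z * k z * (\<psi> z * h z) = (F z * k z) * g z - (F z * (1 - b z)) * k z * X1 z"
        unfolding ph by (simp add: algebra_simps)
      also have "\<dots> = (F z * k z) * g z - cnj (s z) * k z * X1 z + s z * k z * X1 z"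
        unfolding F_eq[OF z] by (simp add: algebra_simps)
      also have "\<dots> = (K * k z + K * cnj (b z) - cnj (b z) * cnj (b z) * cnj (r z) - s z * r z) * g z
          - cnj (b z) * cnj (k z) * X1 z + s z * k z * X1 z"
        unfolding F_k[OF z nb] cnj_b_cnj_k[OF z] ..
      finally have fin: "\<phi> z * (k z * h z) = (c * K) * (k z * g z) + (c * K) * (cnj (b z) * g z)
          - c * (cnj (b z) * cnj (b z) * cnj (r z) * g z) - c * (s z * r z * g z)
          - c * (cnj (b z) * cnj (k z) * X1 z) + c * (s z * k z * X1 z)" by (simp add: algebra_simps)
      show "(\<phi> z * (k z * h z) - k z * (X0 z + X1 z)) * cnj (y z) = ?N z"
        unfolding g_def[symmetric] fin cK by (simp add: algebra_simps)
    qed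
  qed measurable
qed

lemma model_w:
  assumes v: "model s1 v" shows "model s (\<lambda>z. (1 - b z) * v z)"
    and "cmod z = 1 \<Longrightarrow> s z * cnj (z * ((1 - b z) * v z)) = (1 - b z) * (- 1 * (s1 z * cnj (z * v z)))"
proof -
  note [measurable] = model_simps(4)[OF v] S.b_meas
  note vs = model_simps[OF v]
  have eq: "s z * cnj (z * ((1 - b z) * v z)) = (1 - b z) * (- 1 * (s1 z * cnj (z * v z)))" if z: "cmod z = 1" for z
  proof -
    have "s z * cnj (z * ((1 - b z) * v z)) = (b z * (1 - cnj (b z))) * (s1 z * cnj (z * v z))"
      by (simp add: s_eq[OF z] ac_simps)
    also have "b z * (1 - cnj (b z)) = - (1 - b z)" using b_simps[OF z] by (simp add: algebra_simps)
    finally show ?thesis by (simp only: mult_minus1 mult_minus_left mult_minus_right mult_1_left)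
  qed
  then show "cmod z = 1 \<Longrightarrow> s z * cnj (z * ((1 - b z) * v z)) = (1 - b z) * (- 1 * (s1 z * cnj (z * v z)))" .
  have b1: "bhardy (\<lambda>z. 1 - b z)" by (intro bhardy_intros bb)
  have "hardy (\<lambda>z. (1 - b z) * (- 1 * (s1 z * cnj (z * v z))))" by (intro bhardy_mult_hardy[OF b1] hardy_cmult vs)
  then have "hardy (\<lambda>z. s z * cnj (z * ((1 - b z) * v z)))" by (rule hardy_cong) (use eq in measurable)
  then show "model s (\<lambda>z. (1 - b z) * v z)" by (simp add: model_def bhardy_mult_hardy[OF b1] vs)
qed

text \<open>The factor \<open>F * (1 - b)\<close> is \<open>cnj s - s\<close>, and each of the two
  resulting products is orthogonal to the model space of \<open>s\<close>. The factorization
  \<open>s = b * s1\<close> is used for the one with \<open>cnj s\<close>.\<close>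

lemma phi_w_null:
  assumes v: "bmodel s1 v" and y: "model s y"
  shows "null (\<lambda>z. \<phi> z * ((1 - b z) * v z) * cnj (y z))"
proof -
  note vs = bmodel_simps[OF v] and ys = model_simps[OF y] and ps = model_simps[OF psi]
  note [measurable] = vs(5) ys(4) S.b_meas S1.b_meas
  have n1: "null (\<lambda>z. s z * \<psi> z * v z * cnj (y z))"
    by (rule null_hardyI[OF bhardy_mult_hardy[OF vs(2) ps(1)] ys(2)]) (auto simp: circle_simps ac_simps)
  have n2: "null (\<lambda>z. cnj (s z) * \<psi> z * v z * cnj (y z))"
    by (rule null_cohardyI[OF ps(2) hardy_id_mult[OF bhardy_mult_hardy[OF S1.bmodel_conj(2)[OF v] ys(1)]]])
      (auto simp: s_eq circle_simps ac_simps)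
  have "null (\<lambda>z. (1 / complex_of_real K) * (cnj (s z) * \<psi> z * v z * cnj (y z) - s z * \<psi> z * v z * cnj (y z)))"
    by (intro null_cmult null_diff n1 n2)
  then show ?thesis
  proof (rule null_cong)
    fix z :: complex assume z: "cmod z = 1"
    have "\<phi> z * ((1 - b z) * v z) * cnj (y z) = (1 / K) * ((F z * (1 - b z)) * \<psi> z * v z * cnj (y z))"
      by (simp add: \<phi>_def ac_simps)
    then show "\<phi> z * ((1 - b z) * v z) * cnj (y z)
      = (1 / complex_of_real K) * (cnj (s z) * \<psi> z * v z * cnj (y z) - s z * \<psi> z * v z * cnj (y z))"
      unfolding F_eq[OF z] by (simp add: algebra_simps)
  qed measurable
qed

text \<open>On the circle \<open>(1 - b) * cnj k = cnj s1 - b\<close>. One term vanishes because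
  \<open>v\<close> belongs to the model space of \<open>s1\<close>, the other because
  \<open>f\<close> belongs to that of \<open>b\<close>.\<close>

lemma w_k_null:
  assumes v: "model s1 v" and f: "model b f"
  shows "null (\<lambda>z. (1 - b z) * v z * cnj (k z * f z))"
proof -
  note vs = model_simps[OF v] and fs = model_simps[OF f]
  note [measurable] = vs(4) fs(4) S.b_meas S1.b_meas
  have n1: "null (\<lambda>z. b z * v z * cnj (f z))"
    by (rule null_hardyI[OF fs(2) vs(1)]) (auto simp: circle_simps ac_simps)
  have n2: "null (\<lambda>z. cnj (s1 z) * v z * cnj (f z))"
    by (rule null_cohardyI[OF vs(2) fs(1)]) (auto simp: circle_simps ac_simps)
  show ?thesis
  proof (rule null_cong[OF null_diff[OF n2 n1]])
    fix z :: complex assume z: "cmod z = 1"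
    have kc: "cnj (k z) * (1 - cnj (b z)) = 1 - cnj (s z)"
      using arg_cong[OF k_eq[OF z], of cnj] by simp
    have "(1 - b z) * cnj (k z) = - b z * (cnj (k z) * (1 - cnj (b z)))"
      using b_simps[OF z] by (simp add: algebra_simps)
    also have "\<dots> = cnj (s1 z) - b z"
      unfolding kc using b_simps[OF z] by (simp add: s_eq[OF z] algebra_simps)
    finally have bk: "(1 - b z) * cnj (k z) = cnj (s1 z) - b z" .
    have p: "(1 - b z) * v z * cnj (k z * f z) = ((1 - b z) * cnj (k z)) * (v z * cnj (f z))"
      by (simp add: ac_simps)
    show "(1 - b z) * v z * cnj (k z * f z) = cnj (s1 z) * v z * cnj (f z) - b z * v z * cnj (f z)"
      unfolding p bk by (simp add: algebra_simps)
  qed measurable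
qed

text \<open>
  A function \<open>y\<close> of \<open>K\<^sub>s\<close> has the forms \<open>y\<^sub>0 + b y\<^sub>1\<close> and \<open>y\<^sub>1 + s\<^sub>1 y\<^sub>2\<close>, the latter by orthogonality to
  the functions \<open>(1 - b) v\<close>. The difference \<open>y\<^sub>0 - y\<^sub>2\<close> is a multiple of \<open>1 - b\<close> in the Hardy space and
  belongs to \<open>K\<^sub>b\<close>, hence vanishes.
\<close>

lemma range_k:
  assumes y: "model s y" and orth: "\<And>v. bmodel s1 v \<Longrightarrow> (\<integral>z. y z * cnj ((1 - b z) * v z) \<partial>circle_measure) = 0"
  shows "\<exists>f. model b f \<and> (AE z in circle_measure. y z = k z * f z)"
proof -
  note ys = model_simps[OF y]
  note [measurable] = ys(4) S.b_meas S1.b_meas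
  obtain y0 y1 where y0: "model b y0" and hy1: "hardy y1" and yy: "\<And>z. cmod z = 1 \<Longrightarrow> y z = y0 z + b z * y1 z"
    using hardy_decomp[OF ys(1)] by blast
  note y0s = model_simps[OF y0]
  note [measurable] = y0s(4) hardy_meas[OF hy1]
  have y1_eq: "y1 z = cnj (b z) * (y z - y0 z)" if "cmod z = 1" for z using yy[OF that] b_simps[OF that] by simp
  have "hardy (\<lambda>z. s z * cnj (z * y z) - s1 z * (b z * cnj (z * y0 z)))"
    by (intro hardy_diff bhardy_mult_hardy S1.bb y0s ys(2))
  then have "hardy (\<lambda>z. s1 z * cnj (z * y1 z))"
    by (rule hardy_cong) (auto simp: y1_eq s_eq algebra_simps)
  then have y1: "model s1 y1" using hy1 by (simp add: model_def)
  note y1s = model_simps[OF y1]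
  \<comment> \<open>Moving \<open>1 - b\<close> to the other factor, the hypothesis says that
    \<open>x\<close> is orthogonal to the bounded functions in the model space of \<open>s1\<close>,
    and by density to all of them.\<close>
  define x where "x z = y z - cnj (b z) * y z" for z
  have sx: "square_integrable x"
    unfolding x_def by (intro square_integrable_diff cnj_bhardy_sq_mult bb ys)
  have xo: "(\<integral>z. x z * cnj (v z) \<partial>circle_measure) = 0" if v: "model s1 v" for v
  proof (rule S1.bmodel_dense[OF sx _ v])
    fix v assume v: "bmodel s1 v"
    have "(\<integral>z. x z * cnj (v z) \<partial>circle_measure) = (\<integral>z. y z * cnj ((1 - b z) * v z) \<partial>circle_measure)"
      by (simp add: x_def algebra_simps)
    then show "(\<integral>z. x z * cnj (v z) \<partial>circle_measure) = 0" using orth[OF v] by simp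
  qed
  have "\<exists>h. hardy h \<and> (AE z in circle_measure. y z - y1 z = s1 z * h z)"
  proof (rule S1.model_of_orth)
    show "hardy (\<lambda>z. y z - y1 z)" by (intro hardy_diff ys y1s)
    fix v assume v: "model s1 v"
    note vs = model_simps[OF v]
    note [measurable] = vs(4)
    have 1: "null (\<lambda>z. x z * cnj (v z))"
      using xo[OF v] integrable_cnj_product[OF sx vs(3)] by (simp add: null_def)
    have 2: "null (\<lambda>z. cnj (b z) * y0 z * cnj (v z))"
      by (rule null_cohardyI[OF y0s(2) vs(1)]) (auto simp: circle_simps ac_simps)
    have "null (\<lambda>z. (y z - y1 z) * cnj (v z))"
      by (rule null_cong[OF null_add[OF 1 2]]) (auto simp: x_def y1_eq algebra_simps)
    then show "(\<integral>z. (y z - y1 z) * cnj (v z) \<partial>circle_measure) = 0" by (rule nullD)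
  qed
  then obtain h where h: "hardy h" "AE z in circle_measure. y z - y1 z = s1 z * h z" by blast
  define y2 where "y2 z = cnj (s1 z) * (y z - y1 z)" for z
  have hy2: "hardy y2"
  proof (rule hardy_cong_AE[OF h(1)])
    show "AE z in circle_measure. h z = y2 z"
      by (rule AE_circle_mp[OF h(2)]) (simp add: y2_def S1.b_simps)
  qed (simp add: y2_def[abs_def])
  note [measurable] = hardy_meas[OF hy2]
  have y2e: "y z = y1 z + s1 z * y2 z" if "cmod z = 1" for z using that by (simp add: y2_def S1.b_simps)
  have "hardy (\<lambda>z. s z * cnj (z * y z) - b z * (s1 z * cnj (z * y1 z)))"
    by (intro hardy_diff bhardy_mult_hardy bb y1s(2) ys(2))
  then have "hardy (\<lambda>z. b z * cnj (z * y2 z))"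
    by (rule hardy_cong) (auto simp: y2_def s_eq algebra_simps)
  then have y2: "model b y2" using hy2 by (simp add: model_def)
  define d where "d z = y0 z - y2 z" for z
  \<comment> \<open>The quotient of \<open>d\<close> by \<open>1 - b\<close>: apply
    \<open>(1 - b) * (k - s1) = 1 - s1\<close> to the two forms of \<open>y\<close>.\<close>
  define m where "m z = y1 z - (k z - s1 z) * y2 z" for z
  have d: "model b d" unfolding d_def by (rule model_diff[OF y0 y2])
  have hm: "hardy m" unfolding m_def by (intro hardy_diff y1s bhardy_mult_hardy bhardy_diff k S1.bb hy2)
  note [measurable] = model_simps(4)[OF d] hardy_meas[OF hm]
  have y01: "(1 - b z) * y1 z = y0 z - s1 z * y2 z" if "cmod z = 1" for z
    using yy[OF that] y2e[OF that] by (simp add: algebra_simps)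
  have dm: "d z = (1 - b z) * m z" if z: "cmod z = 1" for z
  proof -
    have "(1 - b z) * (k z - s1 z) = 1 - s1 z" using k_eq[OF z] s_eq[OF z] by (simp add: algebra_simps)
    then have "(1 - b z) * m z = (y0 z - s1 z * y2 z) - (1 - s1 z) * y2 z"
      unfolding m_def right_diff_distrib mult.assoc[symmetric] y01[OF z] by simp
    then show ?thesis by (simp add: d_def algebra_simps)
  qed
  \<comment> \<open>The function \<open>d\<close> is orthogonal to \<open>b * m\<close>. Since
    \<open>d = (1 - b) * m\<close>, this reads that \<open>(cnj b - 1) * (m * cnj m)\<close> has
    integral zero; adding the conjugate gives minus the squared modulus of \<open>d\<close>.\<close>
  have "null (\<lambda>z. cnj (b z) * d z * cnj (m z))"
    by (rule null_cohardyI[OF model_simps(2)[OF d] hm]) (auto simp: circle_simps ac_simps)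
  then have "null (\<lambda>z. (cnj (b z) - 1) * (m z * cnj (m z)))"
    by (rule null_cong) (auto simp: dm b_simps algebra_simps)
  note P = this
  have "null (\<lambda>z. d z * cnj (d z))"
    by (rule null_cong[OF null_cmult[OF null_add[OF P null_cnj[OF P]], of "- 1"]])
      (auto simp: dm b_simps algebra_simps)
  then have "cinner (cls d) (cls d) = 0" by (simp add: cls_cinner model_simps(3)[OF d] null_def)
  then have "cls d = cls (\<lambda>z. 0)" by (simp add: cls_zero)
  then have d0: "AE z in circle_measure. d z = 0" using cls_eq_iff[OF model_simps(3)[OF d] square_integrable_zero] by simp
  have "AE z in circle_measure. d z = 0 \<and> b z \<noteq> 1" using d0 AE_b_neq_1 by eventually_elim simp
  then have "AE z in circle_measure. y z = k z * y0 z"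
  proof (rule AE_circle_mp)
    fix z assume z: "cmod z = 1" and "d z = 0 \<and> b z \<noteq> 1"
    then have e: "y2 z = y0 z" and nb: "b z \<noteq> 1" by (auto simp: d_def)
    \<comment> \<open>With \<open>y2 = y0\<close> the two forms of \<open>y\<close> can be solved
      for \<open>y\<close>.\<close>
    have "(1 - b z) * y z = (1 - b z) * y1 z + (1 - b z) * s1 z * y0 z"
      using y2e[OF z] e by (simp add: algebra_simps)
    also have "\<dots> = (1 - s z) * y0 z" unfolding y01[OF z] e using s_eq[OF z] by (simp add: algebra_simps)
    also have "\<dots> = (1 - b z) * (k z * y0 z)" unfolding k_eq[OF z, symmetric] by (simp add: ac_simps)
    finally show "y z = k z * y0 z" using nb by simp
  qed
  with y0 show ?thesis by blast
qed

end

text \<open>A sandwich: the closure of \<open>Z\<close> lies in the complete space \<open>N\<close>,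
  and a vector of \<open>N\<close> orthogonal to it is orthogonal to \<open>R\<close>, hence
  zero.\<close>

lemma closure_eq_of_total:
  fixes N :: "'a::complex_inner_space set"
  assumes Z: "csubspace Z" "Z \<subseteq> N" and N: "csubspace N" "complete N"
    and R: "R \<subseteq> Z" "\<And>p. p \<in> N \<Longrightarrow> (\<And>r. r \<in> R \<Longrightarrow> cinner p r = 0) \<Longrightarrow> p = 0"
  shows "closure Z = N"
proof (rule total_subspace_eq[OF csubspace_closure[OF Z(1)] _ _ N(1)])
  show "closure Z \<subseteq> N" using Z(2) N(2) by (simp add: closure_minimal complete_imp_closed)
  then show "complete (closure Z)" using N(2) by (simp add: complete_closed_subset)
  fix p assume p: "p \<in> N" and orth: "\<And>z. z \<in> closure Z \<Longrightarrow> cinner p z = 0"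
  show "p = 0"
  proof (rule R(2)[OF p])
    fix x assume "x \<in> R"
    then have "x \<in> closure Z" using R(1) closure_subset by blast
    then show "cinner p x = 0" by (rule orth)
  qed
qed

section \<open>The isometry, its complement, and the closures of the two graphs\<close>

context dilation
begin

definition cK :: complex where "cK = complex_of_real (1 / sqrt K)"

lemma cK: "cK * cK * complex_of_real K = 1" "cnj cK = cK" "cK \<noteq> 0"
proof -
  have "cK * cK * complex_of_real K = complex_of_real ((1 / sqrt K) * (1 / sqrt K) * K)"
    unfolding cK_def by (simp only: of_real_mult)
  also have "(1 / sqrt K) * (1 / sqrt K) * K = 1" using K by simp
  finally show "cK * cK * complex_of_real K = 1" by simp
  show "cnj cK = cK" by (simp add: cK_def)
  show "cK \<noteq> 0" using K by (simp add: cK_def)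
qed

definition J :: "circle_L2 \<Rightarrow> circle_L2" where "J x = cK *\<^sub>C mulL k x"

lemma J_cls: "square_integrable f \<Longrightarrow> J (cls f) = cls (\<lambda>z. cK * (k z * f z))"
  by (simp add: J_def mulL_cls k cls_scaleC bhardy_sq_mult)

lemma J_sq: "square_integrable f \<Longrightarrow> square_integrable (\<lambda>z. cK * (k z * f z))"
  by (intro square_integrable_mult_const bhardy_sq_mult k)

lemma J_in: "x \<in> V \<Longrightarrow> J x \<in> VS"
proof -
  assume "x \<in> V"
  then obtain f where f: "model b f" "x = cls f" by (rule model_space_E)
  show ?thesis unfolding f(2) J_cls[OF model_simps(3)[OF f(1)]]
    by (intro S.model_spaceI S.model_cmult model_k_mult f)
qed

lemma J_add: "J (x + y) = J x + J y"
proof -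
  obtain f where f: "square_integrable f" "x = cls f" by (rule cls_surj)
  obtain g where g: "square_integrable g" "y = cls g" by (rule cls_surj)
  show ?thesis unfolding f(2) g(2)
    by (simp add: cls_add f(1) g(1) J_cls J_sq square_integrable_add) (simp add: algebra_simps)
qed

lemma J_scaleC: "J (c *\<^sub>C x) = c *\<^sub>C J x"
proof -
  obtain f where f: "square_integrable f" "x = cls f" by (rule cls_surj)
  show ?thesis unfolding f(2)
    by (simp add: cls_scaleC f(1) J_cls J_sq square_integrable_mult_const) (simp add: ac_simps)
qed

lemma J_cinner:
  assumes "x \<in> V" "y \<in> V" shows "cinner (J x) (J y) = cinner x y"
proof -
  obtain f where f: "model b f" "x = cls f" using model_space_E[OF assms(1)] .
  obtain g where g: "model b g" "y = cls g" using model_space_E[OF assms(2)] .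
  note fs = model_simps[OF f(1)] and gs = model_simps[OF g(1)]
  have kf: "square_integrable (\<lambda>z. k z * f z)" "square_integrable (\<lambda>z. k z * g z)"
    by (intro bhardy_sq_mult k fs gs)+
  have "cinner (J x) (J y) = cK * cnj cK * cinner (cls (\<lambda>z. k z * f z)) (cls (\<lambda>z. k z * g z))"
    unfolding f(2) g(2) J_def mulL_cls[OF k fs(3)] mulL_cls[OF k gs(3)]
    by (simp add: cinner_scaleC_left cinner_scaleC_right)
  also have "\<dots> = (cK * cK * complex_of_real K) * (\<integral>z. f z * cnj (g z) \<partial>circle_measure)"
    unfolding cls_cinner[OF kf] k_cinner[OF f(1) g(1)] cK(2) by (simp only: mult.assoc)
  finally show ?thesis by (simp add: cK f(2) g(2) cls_cinner fs gs)
qed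

lemma conj_J:
  assumes f: "square_integrable f"
  shows "conjL s (J (cls f)) = J (C (cls f))"
proof -
  have [measurable]: "f \<in> borel_measurable borel" using f by (rule square_integrable_measurable)
  have sc: "square_integrable (\<lambda>z. b z * cnj (z * f z))" by (rule square_integrable_conj[OF bb f])
  then have [measurable]: "(\<lambda>z. b z * cnj (z * f z)) \<in> borel_measurable borel" by (rule square_integrable_measurable)
  have kf: "square_integrable (\<lambda>z. cK * (k z * f z))" by (intro square_integrable_mult_const bhardy_sq_mult k f)
  show ?thesis
    unfolding C_cls[OF f] J_cls[OF f] J_cls[OF sc] conjL_cls[OF S.bb kf]
  proof (rule cls_eqI[OF square_integrable_conj[OF S.bb kf]])
    fix z :: complex assume z: "cmod z = 1"
    have "s z * cnj (z * (cK * (k z * f z))) = cnj cK * ((s z * cnj (k z)) * cnj (z * f z))" by (simp add: ac_simps)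
    then show "s z * cnj (z * (cK * (k z * f z))) = cK * (k z * (b z * cnj (z * f z)))"
      unfolding s_cnj_k[OF z] cK(2) by (simp add: ac_simps)
  qed measurable
qed

definition W :: "circle_L2 set" where "W = {w \<in> VS. \<forall>x\<in>V. cinner w (J x) = 0}"

lemma W_orth_compl: "W = VS \<inter> orth_compl (J ` V)"
  by (auto simp: W_def orth_compl_def)

lemma W: "csubspace W" "complete W"
  unfolding W_orth_compl
  by (intro csubspace_Int complete_Int_closed csubspace_orth_compl closed_orth_compl S.model_space)+

lemma J_unitary: "unitary_between J V (J ` V)"
  unfolding unitary_between_def by (auto simp: J_add J_scaleC J_cinner)

lemma JV: "csubspace (J ` V)" "complete (J ` V)"
proof -
  have J0: "J 0 = 0" by (rule unitary_between_simps(2)[OF J_unitary model_space(1)])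
  show "csubspace (J ` V)"
    unfolding csubspace_def
  proof (intro conjI ballI allI)
    show "0 \<in> J ` V" using J0 csubspaceD(1)[OF model_space(1)] by (metis image_eqI)
    show "x + y \<in> J ` V" if xy: "x \<in> J ` V" "y \<in> J ` V" for x y
    proof -
      obtain x' y' where "x' \<in> V" "x = J x'" "y' \<in> V" "y = J y'" using xy by blast
      then show ?thesis
        using imageI[OF csubspaceD(2)[OF model_space(1), of x' y'], of J] by (simp add: J_add)
    qed
    show "c *\<^sub>C x \<in> J ` V" if xy: "x \<in> J ` V" for c x
    proof -
      obtain x' where "x' \<in> V" "x = J x'" using xy by blast
      then show ?thesis
        using imageI[OF csubspaceD(3)[OF model_space(1), of x' c], of J] by (simp add: J_scaleC)
    qed
  qed
  have "J ` closure V = closure (J ` V)"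
    by (rule isometry_image_closure[OF unitary_between_simps(3)[OF J_unitary model_space(1)] model_space(2) order_refl])
  then have "closed (J ` V)"
    using complete_imp_closed[OF model_space(2)] by (metis closed_closure closure_closed)
  then show "complete (J ` V)" by (rule complete_closed_circle_L2)
qed

definition wv :: "(complex \<Rightarrow> complex) \<Rightarrow> circle_L2" where "wv v = cls (\<lambda>z. (1 - b z) * v z)"

lemma sq_w: "bmodel s1 v \<Longrightarrow> square_integrable (\<lambda>z. (1 - b z) * v z)"
  by (intro model_simps(3)[OF model_w(1)] bmodel_simps)

lemma wv_orth_J:
  assumes v: "bmodel s1 v" and x: "x \<in> V" shows "cinner (wv v) (J x) = 0"
proof -
  obtain f where f: "model b f" "x = cls f" using model_space_E[OF x] .
  note fs = model_simps[OF f(1)]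
  have kf: "square_integrable (\<lambda>z. k z * f z)" by (intro bhardy_sq_mult k fs)
  show ?thesis
    unfolding wv_def f(2) J_def mulL_cls[OF k fs(3)] cinner_scaleC_right cls_cinner[OF sq_w[OF v] kf]
    using nullD[OF w_k_null[OF bmodel_simps(1)[OF v] f(1)]] by simp
qed

lemma wv_W: "bmodel s1 v \<Longrightarrow> wv v \<in> W"
  using wv_orth_J[of v] S.model_spaceI[OF model_w(1)[OF bmodel_simps(1)[of s1 v]]]
  by (simp add: W_def wv_def)

text \<open>The bounded pairs that will be found in both graphs: images of the Clark core, and
  vectors of the complement paired with 0.\<close>

definition R :: "(circle_L2 \<times> circle_L2) set" where
  "R = range (\<lambda>n. (J (a n), J (bA n))) \<union> (\<lambda>v. (wv v, 0)) ` {v. bmodel s1 v}"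

text \<open>The adjoint of the relation generated by the pairs of \<open>J (a n)\<close> with
  \<open>J (bB n)\<close> and of \<open>wv v\<close> with 0. As an orthogonal complement it is
  closed from the start.\<close>

definition N :: "(circle_L2 \<times> circle_L2) set" where
  "N = (VS \<times> VS) \<inter> orth_compl (range (\<lambda>n. (J (bB n), - J (a n))) \<union> (\<lambda>v. (0, wv v)) ` {v. bmodel s1 v})"

lemma N_iff: "(x, y) \<in> N \<longleftrightarrow> x \<in> VS \<and> y \<in> VS \<and> (\<forall>n. cinner x (J (bB n)) = cinner y (J (a n))) \<and>
    (\<forall>v. bmodel s1 v \<longrightarrow> cinner y (wv v) = 0)"
  by (auto simp: N_def orth_compl_def cinner_prod_def ball_Un)

lemma N: "csubspace N" "complete N"
  unfolding N_def
  by (intro csubspace_Int complete_Int_closed csubspace_orth_compl closed_orth_compl csubspace_Times complete_Times S.model_space)+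

lemma bB_in: "bB n \<in> V" unfolding bB_def by (intro C_in A_in)

lemma range_J:
  assumes y: "y \<in> VS" and orth: "\<And>v. bmodel s1 v \<Longrightarrow> cinner y (wv v) = 0"
  shows "\<exists>x\<in>V. y = J x"
proof -
  obtain g where g: "model s g" "y = cls g" using S.model_space_E[OF y] .
  note gs = model_simps[OF g(1)]
  have "(\<integral>z. g z * cnj ((1 - b z) * v z) \<partial>circle_measure) = 0" if v: "bmodel s1 v" for v
    using orth[OF v] unfolding g(2) wv_def cls_cinner[OF gs(3) sq_w[OF v]] .
  from range_k[OF g(1) this] obtain f where f: "model b f" "AE z in circle_measure. g z = k z * f z" by blast
  note fs = model_simps[OF f(1)]
  have kf: "square_integrable (\<lambda>z. k z * f z)" by (intro bhardy_sq_mult k fs)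
  have "y = mulL k (cls f)"
    unfolding g(2) mulL_cls[OF k fs(3)] using cls_eq_iff[OF gs(3) kf] f(2) by simp
  then have "y = J ((1 / cK) *\<^sub>C cls f)"
    unfolding J_scaleC using cK(3) by (simp add: J_def scaleC_scaleC)
  moreover have "(1 / cK) *\<^sub>C cls f \<in> V" by (intro csubspaceD(3)[OF model_space(1)] model_spaceI f)
  ultimately show ?thesis by blast
qed

text \<open>Orthogonality to the vectors \<open>wv v\<close> places both components in the range of
  \<open>J\<close>; pulled back by the isometry, the remaining equations are those of
  \<open>clark_uniqueness\<close>.\<close>

lemma R_total:
  assumes p: "p \<in> N" and orth: "\<And>q. q \<in> R \<Longrightarrow> cinner p q = 0"
  shows "p = 0"
proof -
  obtain x y where xy: "p = (x, y)" by (cases p)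
  have Nxy: "x \<in> VS" "y \<in> VS" "\<And>n. cinner x (J (bB n)) = cinner y (J (a n))" "\<And>v. bmodel s1 v \<Longrightarrow> cinner y (wv v) = 0"
    using p unfolding xy N_iff by auto
  have o1: "cinner x (J (a n)) + cinner y (J (bA n)) = 0" for n
    using orth[of "(J (a n), J (bA n))"] by (simp add: R_def xy cinner_prod_def)
  have o2: "cinner x (wv v) = 0" if "bmodel s1 v" for v
    using orth[of "(wv v, 0)"] that by (simp add: R_def xy cinner_prod_def)
  obtain f where f: "f \<in> V" "x = J f" using range_J[OF Nxy(1) o2] by blast
  obtain g where g: "g \<in> V" "y = J g" using range_J[OF Nxy(2,4)] by blast
  have "f = 0 \<and> g = 0"
  proof (rule clark_uniqueness[OF f(1) g(1)])
    show "cinner f (a n) + cinner g (bA n) = 0" for n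
      using o1[of n] by (simp add: f g J_cinner a_in bA_in)
    show "cinner f (bB n) = cinner g (a n)" for n
      using Nxy(3)[of n] by (simp add: f g J_cinner a_in bB_in)
  qed
  then show ?thesis
    using unitary_between_simps(2)[OF J_unitary model_space(1)] by (simp add: xy f g zero_prod_def)
qed

lemma R_in_Toeplitz: "R \<subseteq> truncated_Toeplitz (cls s) (cls \<phi>)"
proof -
  have "(J (a n), J (bA n)) \<in> truncated_Toeplitz (cls s) (cls \<phi>)" for n
  proof -
    obtain h where h: "bmodel b h" "a n = cls h" using a_bmodel by blast
    obtain X0 X1 where X: "decomp h X0 X1" using decomp_ex[OF h(1)] by blast
    have m: "model b (\<lambda>z. X0 z + X1 z)" using X by (auto simp: decomp_def intro: model_add)
    note hs = bmodel_simps[OF h(1)]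
    have kh: "bhardy (\<lambda>z. cK * (k z * h z))" by (intro bhardy_cmult bhardy_mult k hs)
    have "(cls (\<lambda>z. cK * (k z * h z)), cls (\<lambda>z. cK * (k z * (X0 z + X1 z)))) \<in> truncated_Toeplitz (cls s) (cls \<phi>)"
    proof (rule S.truncated_ToeplitzI[OF phi_sq])
      show "model s (\<lambda>z. cK * (k z * h z))" "model s (\<lambda>z. cK * (k z * (X0 z + X1 z)))"
        by (intro S.model_cmult model_k_mult hs m)+
      show "square_integrable (\<lambda>z. \<phi> z * (cK * (k z * h z)))"
        using bhardy_sq_mult[OF kh phi_sq] by (simp add: mult.commute)
      fix y assume y: "model s y"
      have "null (\<lambda>z. cK * ((\<phi> z * (k z * h z) - k z * (X0 z + X1 z)) * cnj (y z)))"
        by (intro null_cmult phi_k_null h X y)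
      then show "(\<integral>z. (\<phi> z * (cK * (k z * h z)) - cK * (k z * (X0 z + X1 z))) * cnj (y z) \<partial>circle_measure) = 0"
        by (simp add: null_def algebra_simps)
    qed
    then show ?thesis
      unfolding bA_def h(2) A_cls[OF h(1) X] J_cls[OF hs(4)] J_cls[OF model_simps(3)[OF m]] .
  qed
  moreover have "(wv v, 0) \<in> truncated_Toeplitz (cls s) (cls \<phi>)" if v: "bmodel s1 v" for v
  proof -
    have b1: "bhardy (\<lambda>z. (1 - b z) * v z)" by (intro bhardy_intros bb bmodel_simps[OF v])
    have "(cls (\<lambda>z. (1 - b z) * v z), cls (\<lambda>z. 0)) \<in> truncated_Toeplitz (cls s) (cls \<phi>)"
    proof (rule S.truncated_ToeplitzI[OF phi_sq model_w(1)[OF bmodel_simps(1)[OF v]]])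
      show "model s (\<lambda>z. 0)" by (simp add: model_def hardy_const)
      show "square_integrable (\<lambda>z. \<phi> z * ((1 - b z) * v z))"
        using bhardy_sq_mult[OF b1 phi_sq] by (simp add: mult.commute)
      fix y assume y: "model s y"
      show "(\<integral>z. (\<phi> z * ((1 - b z) * v z) - 0) * cnj (y z) \<partial>circle_measure) = 0"
        using nullD[OF phi_w_null[OF v y]] by simp
    qed
    then show ?thesis by (simp add: wv_def cls_zero)
  qed
  ultimately show ?thesis by (auto simp: R_def)
qed

text \<open>The functions of the domain need not be bounded. Complex symmetry lets the symbol act
  instead on the conjugate of the test function, which is again of the form \<open>k * h\<close> or
  \<open>(1 - b) * v\<close> with a bounded factor, so that \<open>phi_k_null\<close> and
  \<open>phi_w_null\<close> apply.\<close>

lemma Toeplitz_in_N: "truncated_Toeplitz (cls s) (cls \<phi>) \<subseteq> N"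
proof
  fix p assume p: "p \<in> truncated_Toeplitz (cls s) (cls \<phi>)"
  obtain x y where xy: "p = (x, y)" by (cases p)
  obtain f g where f: "model s f" "model s g" "x = cls f" "y = cls g" "square_integrable (\<lambda>z. \<phi> z * f z)"
    "\<forall>v. model s v \<longrightarrow> (\<integral>z. \<phi> z * f z * cnj (v z) \<partial>circle_measure) = (\<integral>z. g z * cnj (v z) \<partial>circle_measure)"
    using S.truncated_ToeplitzE[OF phi_sq p[unfolded xy]] .
  note fs = model_simps[OF f(1)] and gs = model_simps[OF f(2)]
  have "cinner x (J (bB n)) = cinner y (J (a n))" for n
  proof -
    obtain h where h: "bmodel b h" "a n = cls h" using a_bmodel by blast
    note hs = bmodel_simps[OF h(1)]
    have kh: "model s (\<lambda>z. cK * (k z * h z))" by (intro S.model_cmult model_k_mult hs)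
    define h' where "h' z = b z * cnj (z * h z)" for z
    have bh': "bmodel b h'" unfolding h'_def by (rule bmodel_conj(1)[OF h(1)])
    note h's = bmodel_simps[OF bh']
    have Ch: "C (a n) = cls h'" unfolding h(2) h'_def by (rule C_cls[OF hs(4)])
    obtain X0 X1 where X: "decomp h' X0 X1" using decomp_ex[OF bh'] by blast
    have m: "model b (\<lambda>z. X0 z + X1 z)" using X by (auto simp: decomp_def intro: model_add)
    have AC: "A (C (a n)) = cls (\<lambda>z. X0 z + X1 z)" unfolding Ch by (rule A_cls[OF bh' X])
    define f' where "f' z = s z * cnj (z * f z)" for z
    have f': "model s f'" unfolding f'_def by (rule S.model_conj[OF f(1)])
    note f's = model_simps[OF f']
    note [measurable] = f's(4) h's(5) hs(5) fs(4) model_simps(4)[OF m]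
    have "cinner y (J (a n)) = (\<integral>z. \<phi> z * f z * cnj (cK * (k z * h z)) \<partial>circle_measure)"
      unfolding h(2) J_cls[OF hs(4)] f(4) cls_cinner[OF gs(3) model_simps(3)[OF kh]]
      using f(6)[rule_format, OF kh] by simp
    also have "\<dots> = (\<integral>z. \<phi> z * (s z * cnj (z * (cK * (k z * h z)))) * cnj (f' z) \<partial>circle_measure)"
      unfolding f'_def by (rule S.Toeplitz_conj[OF phi_meas fs(4) model_simps(4)[OF kh]])
    also have "\<dots> = (\<integral>z. cK * (\<phi> z * (k z * h' z) * cnj (f' z)) \<partial>circle_measure)"
    proof (rule circle_integral_cong)
      fix z :: complex assume z: "cmod z = 1"
      have "s z * cnj (z * (cK * (k z * h z))) = cnj cK * ((s z * cnj (k z)) * cnj (z * h z))" by (simp add: ac_simps)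
      also have "\<dots> = cK * (k z * h' z)" unfolding s_cnj_k[OF z] cK(2) h'_def by (simp add: ac_simps)
      finally have e: "s z * cnj (z * (cK * (k z * h z))) = cK * (k z * h' z)" .
      show "\<phi> z * (s z * cnj (z * (cK * (k z * h z)))) * cnj (f' z) = cK * (\<phi> z * (k z * h' z) * cnj (f' z))"
        unfolding e by (simp add: ac_simps)
    next
      show "(\<lambda>z. \<phi> z * (s z * cnj (z * (cK * (k z * h z)))) * cnj (f' z)) \<in> borel_measurable borel"
        using S.b_meas by measurable
    qed measurable
    also have "\<dots> = (\<integral>z. cK * (k z * (X0 z + X1 z)) * cnj (f' z) \<partial>circle_measure)"
    proof -
      have n: "null (\<lambda>z. cK * ((\<phi> z * (k z * h' z) - k z * (X0 z + X1 z)) * cnj (f' z)))"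
        by (intro null_cmult phi_k_null bh' X f')
      have i: "integrable circle_measure (\<lambda>z. cK * (k z * (X0 z + X1 z)) * cnj (f' z))"
        by (intro integrable_cnj_product square_integrable_mult_const bhardy_sq_mult k model_simps(3)[OF m] f's)
      have "(\<integral>z. cK * (\<phi> z * (k z * h' z) * cnj (f' z)) \<partial>circle_measure)
        = (\<integral>z. cK * ((\<phi> z * (k z * h' z) - k z * (X0 z + X1 z)) * cnj (f' z)) + cK * (k z * (X0 z + X1 z)) * cnj (f' z) \<partial>circle_measure)"
        by (simp add: algebra_simps)
      also have "\<dots> = (\<integral>z. cK * (k z * (X0 z + X1 z)) * cnj (f' z) \<partial>circle_measure)"
        using n i unfolding null_def by (subst Bochner_Integration.integral_add) (simp_all only: add_0_left)
      finally show ?thesis .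
    qed
    also have "\<dots> = cinner (J (A (C (a n)))) (conjL s x)"
    proof -
      have "conjL s x = cls f'" unfolding f(3) f'_def by (rule conjL_cls[OF S.bb fs(3)])
      moreover have "square_integrable (\<lambda>z. cK * (k z * (X0 z + X1 z)))"
        by (intro square_integrable_mult_const bhardy_sq_mult k model_simps(3)[OF m])
      ultimately show ?thesis by (simp add: AC J_cls model_simps(3)[OF m] cls_cinner f's(3))
    qed
    also have "\<dots> = cinner (conjL s (conjL s x)) (conjL s (J (A (C (a n)))))"
      by (rule S.C_cinner[symmetric])
    also have "\<dots> = cinner x (J (bB n))"
      unfolding S.C_C AC conj_J[OF model_simps(3)[OF m]] by (simp only: AC[symmetric] bB_def)
    finally show ?thesis by simp
  qed
  moreover have "cinner y (wv v) = 0" if v: "bmodel s1 v" for v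
  proof -
    note vs = bmodel_simps[OF v]
    note ms = model_w(1)[OF vs(1)]
    define v' where "v' z = - 1 * (s1 z * cnj (z * v z))" for z
    have v': "bmodel s1 v'"
      unfolding v'_def bmodel_def using S1.bmodel_conj[OF v]
      by (intro conjI S1.model_cmult bhardy_cmult) (simp_all add: bmodel_def)
    define f' where "f' z = s z * cnj (z * f z)" for z
    have f': "model s f'" unfolding f'_def by (rule S.model_conj[OF f(1)])
    note [measurable] = model_simps(4)[OF f'] bmodel_simps(5)[OF v'] fs(4) vs(5) S.b_meas
    have "cinner y (wv v) = (\<integral>z. \<phi> z * f z * cnj ((1 - b z) * v z) \<partial>circle_measure)"
      unfolding wv_def f(4) cls_cinner[OF gs(3) sq_w[OF v]] using f(6)[rule_format, OF ms] by simp
    also have "\<dots> = (\<integral>z. \<phi> z * (s z * cnj (z * ((1 - b z) * v z))) * cnj (f' z) \<partial>circle_measure)"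
      unfolding f'_def by (rule S.Toeplitz_conj[OF phi_meas fs(4) model_simps(4)[OF ms]])
    also have "\<dots> = (\<integral>z. \<phi> z * ((1 - b z) * v' z) * cnj (f' z) \<partial>circle_measure)"
      by (rule circle_integral_cong) (simp_all only: model_w(2)[OF vs(1)] v'_def, measurable)
    also have "\<dots> = 0" by (rule nullD[OF phi_w_null[OF v' f']])
    finally show ?thesis .
  qed
  ultimately show "p \<in> N" unfolding xy N_iff using S.model_spaceI f by blast
qed

lemma Toeplitz_closure: "closure (truncated_Toeplitz (cls s) (cls \<phi>)) = N"
  by (rule closure_eq_of_total[OF S.csubspace_truncated_Toeplitz[OF phi_sq] Toeplitz_in_N N R_in_Toeplitz R_total])

text \<open>Only the dimension of \<open>E0\<close> matters, so it is identified with the complement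
  \<open>W\<close>. The image of the direct sum graph contains \<open>R\<close> and lies in
  \<open>N\<close>, as the Toeplitz graph does, and both closures are \<open>N\<close>.\<close>

theorem dilation_equivalence:
  fixes E0 :: "'h::complex_inner_space set"
  assumes E0: "csubspace E0" "complete E0" and dim: "has_hilbert_dim E0 m" "has_hilbert_dim W m"
  shows "unitarily_equivalent (V \<times> E0) (operator_sum (truncated_Toeplitz (cls b) (cls sym)) (zero_operator E0))
    VS (truncated_Toeplitz (cls s) (cls \<phi>))"
proof -
  obtain UE where UE: "unitary_between UE E0 W"
    using same_dim_unitary[OF E0 W dim] by blast
  have UE_in: "UE e \<in> W" if "e \<in> E0" for e using UE that by (auto simp: unitary_between_def)
  have WS: "w \<in> VS" and WJ: "x \<in> V \<Longrightarrow> cinner w (J x) = 0" "x \<in> V \<Longrightarrow> cinner (J x) w = 0" if "w \<in> W" for w x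
    using that cinner_eq_0_commute[of w "J x"] by (auto simp: W_def)
  \<comment> \<open>The isometry on the first summand and the identification of \<open>E0\<close>
    with the orthogonal complement of its range on the second.\<close>
  define Q where "Q p = J (fst p) + UE (snd p)" for p
  define TB where "TB = truncated_Toeplitz (cls b) (cls sym)"
  have TB: "csubspace TB" unfolding TB_def by (rule csubspace_truncated_Toeplitz[OF sym_sq])
  have TBV: "x \<in> V" "y \<in> V" if "(x, y) \<in> TB" for x y
    using that orth_proj_in[OF model_space] by (auto simp: TB_def truncated_Toeplitz_def)
  have J0: "J 0 = 0" by (rule unitary_between_simps(2)[OF J_unitary model_space(1)])
  have UE0: "UE 0 = 0" by (rule unitary_between_simps(2)[OF UE E0(1)])
  have UE_add: "UE (e + e') = UE e + UE e'" "UE (c *\<^sub>C e) = c *\<^sub>C UE e" "cinner (UE e) (UE e') = cinner e e'"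
    if "e \<in> E0" "e' \<in> E0" for e e' c
    using UE that by (auto simp: unitary_between_def)
  have Q: "unitary_between Q (V \<times> E0) VS"
    unfolding unitary_between_def
  proof (intro conjI ballI allI)
    show "Q ` (V \<times> E0) = VS"
    proof (intro antisym subsetI)
      fix y assume "y \<in> Q ` (V \<times> E0)"
      then show "y \<in> VS"
        using J_in UE_in WS csubspaceD(2)[OF S.model_space(1)] by (auto simp: Q_def)
    next
      fix y assume y: "y \<in> VS"
      obtain x where x: "x \<in> V" "\<forall>v\<in>J ` V. cinner (y - J x) v = 0"
        using projection_exists[OF JV] by blast
      have "y - J x \<in> VS" by (rule csubspaceD(4)[OF S.model_space(1) y J_in[OF x(1)]])
      then have "y - J x \<in> W" using x(2) by (simp add: W_def)
      then have "y - J x \<in> UE ` E0" using UE by (simp add: unitary_between_def)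
      then obtain e where e: "e \<in> E0" "y - J x = UE e" by blast
      then have "Q (x, e) = y" by (simp add: Q_def flip: e(2))
      then show "y \<in> Q ` (V \<times> E0)" using x(1) e(1) by blast
    qed
  next
    fix p q assume "p \<in> V \<times> E0" "q \<in> V \<times> E0"
    then show "Q (p + q) = Q p + Q q" by (auto simp: Q_def J_add UE_add algebra_simps)
  next
    fix c p assume "p \<in> V \<times> E0"
    then show "Q (c *\<^sub>C p) = c *\<^sub>C Q p" by (auto simp: Q_def J_scaleC UE_add scaleC_prod_def scaleC_add_right)
  next
    fix p q assume pq: "p \<in> V \<times> E0" "q \<in> V \<times> E0"
    then show "cinner (Q p) (Q q) = cinner p q"
      by (auto simp: Q_def cinner_linear J_cinner UE_add UE_in WJ cinner_prod_def)
  qed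
  let ?S = "operator_sum TB (zero_operator E0)"
  have SV: "?S \<subseteq> (V \<times> E0) \<times> (V \<times> E0)"
    using TBV csubspaceD(1)[OF E0(1)] by (auto simp: operator_sum_def zero_operator_def)
  have Simg: "map_prod Q Q ` ?S = {(J x + UE e, J y) | x y e. (x, y) \<in> TB \<and> e \<in> E0}" (is "_ = ?Z")
  proof (intro antisym subsetI)
    fix p assume "p \<in> map_prod Q Q ` ?S"
    then obtain x y e where "(x, y) \<in> TB" "e \<in> E0" "p = (Q (x, e), Q (y, 0))"
      by (auto simp: operator_sum_def zero_operator_def)
    then show "p \<in> ?Z" by (auto simp: Q_def UE0)
  next
    fix p assume "p \<in> ?Z"
    then obtain x y e where "(x, y) \<in> TB" "e \<in> E0" "p = (J x + UE e, J y)" by blast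
    then have "p = map_prod Q Q ((x, e), (y, 0))" "((x, e), (y, 0)) \<in> ?S"
      by (auto simp: Q_def UE0 operator_sum_def zero_operator_def)
    then show "p \<in> map_prod Q Q ` ?S" by blast
  qed
  have "closure ?Z = N"
  proof (rule closure_eq_of_total[OF _ _ N _ R_total])
    show "csubspace ?Z"
      unfolding csubspace_def
    proof (intro conjI ballI allI)
      have "(0, 0) \<in> TB" using csubspaceD(1)[OF TB] by (simp add: zero_prod_def)
      then have "(J 0 + UE 0, J 0) \<in> ?Z" using csubspaceD(1)[OF E0(1)] by blast
      then show "0 \<in> ?Z" by (simp add: J0 UE0 zero_prod_def)
    next
      fix p q assume "p \<in> ?Z" "q \<in> ?Z"
      then obtain x y e x' y' e' where *: "(x, y) \<in> TB" "e \<in> E0" "p = (J x + UE e, J y)"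
        "(x', y') \<in> TB" "e' \<in> E0" "q = (J x' + UE e', J y')" by blast
      have "(x + x', y + y') \<in> TB" using csubspaceD(2)[OF TB *(1) *(4)] by simp
      moreover have "e + e' \<in> E0" using csubspaceD(2)[OF E0(1) *(2) *(5)] .
      moreover have "p + q = (J (x + x') + UE (e + e'), J (y + y'))" by (simp add: * J_add UE_add algebra_simps)
      ultimately show "p + q \<in> ?Z" by blast
    next
      fix c p assume "p \<in> ?Z"
      then obtain x y e where *: "(x, y) \<in> TB" "e \<in> E0" "p = (J x + UE e, J y)" by blast
      have "(c *\<^sub>C x, c *\<^sub>C y) \<in> TB" using csubspaceD(3)[OF TB *(1), of c] by (simp add: scaleC_prod_def)
      moreover have "c *\<^sub>C e \<in> E0" using csubspaceD(3)[OF E0(1) *(2)] .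
      moreover have "c *\<^sub>C p = (J (c *\<^sub>C x) + UE (c *\<^sub>C e), J (c *\<^sub>C y))"
        by (simp add: *(3) J_scaleC UE_add(2)[OF *(2) *(2)] scaleC_prod_def scaleC_add_right)
      ultimately show "c *\<^sub>C p \<in> ?Z" by blast
    qed
    show "?Z \<subseteq> N"
    proof
      fix p assume "p \<in> ?Z"
      then obtain x y e where *: "(x, y) \<in> TB" "e \<in> E0" "p = (J x + UE e, J y)" by blast
      note xy = TBV[OF *(1)] and w = UE_in[OF *(2)]
      have "J x + UE e \<in> VS" by (intro csubspaceD(2)[OF S.model_space(1)] J_in xy WS w)
      moreover have "cinner (J x + UE e) (J (bB n)) = cinner (J y) (J (a n))" for n
        using graph_sym[OF *(1)[unfolded TB_def]] by (simp add: cinner_add_left J_cinner xy bB_in a_in WJ w)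
      moreover have "cinner (J y) (wv v) = 0" if "bmodel s1 v" for v
        using wv_orth_J[OF that xy(2)] by (simp add: cinner_eq_0_commute[of "J y"])
      ultimately show "p \<in> N" using J_in[OF xy(2)] by (simp add: *(3) N_iff)
    qed
    show "R \<subseteq> ?Z"
    proof
      fix p assume "p \<in> R"
      then consider n where "p = (J (a n), J (bA n))" | v where "bmodel s1 v" "p = (wv v, 0)"
        by (auto simp: R_def)
      then show "p \<in> ?Z"
      proof cases
        case 1
        obtain h where h: "bmodel b h" "a n = cls h" using a_bmodel by blast
        obtain X0 X1 where X: "decomp h X0 X1" using decomp_ex[OF h(1)] by blast
        have "(a n, bA n) \<in> TB" unfolding TB_def bA_def h(2) A_cls[OF h(1) X] by (rule graph_A[OF h(1) X])
        moreover have "p = (J (a n) + UE 0, J (bA n))" using 1 by (simp add: UE0)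
        ultimately show ?thesis using csubspaceD(1)[OF E0(1)] by blast
      next
        case 2
        have "wv v \<in> UE ` E0" using UE wv_W[OF 2(1)] by (simp add: unitary_between_def)
        then obtain e where e: "e \<in> E0" "wv v = UE e" by blast
        have "(0, 0) \<in> TB" using csubspaceD(1)[OF TB] by (simp add: zero_prod_def)
        moreover have "p = (J 0 + UE e, J 0)" using 2 e by (simp add: J0)
        ultimately show ?thesis using e(1) by blast
      qed
    qed
  qed
  then have "map_prod Q Q ` closure ?S = closure (truncated_Toeplitz (cls s) (cls \<phi>))"
    unfolding unitary_graph_closure[OF Q csubspace_Times[OF model_space(1) E0(1)] complete_Times[OF model_space(2) E0(2)] SV]
      Simg Toeplitz_closure .
  then show ?thesis using Q unfolding unitarily_equivalent_def TB_def by blast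
qed

end

section \<open>Dimensions\<close>

text \<open>Separability: the integer powers of \<open>z\<close> are a countable set with no nonzero
  vector orthogonal to all of them.\<close>

lemma circle_hilbert_dim_exists:
  assumes V: "csubspace (V :: circle_L2 set)" shows "\<exists>k. has_hilbert_dim V k"
proof (rule hilbert_dim_exists[OF _ _ V])
  let ?S = "range (\<lambda>k. cls (\<lambda>z. cnj (z ^ Suc k))) \<union> range (\<lambda>k. cls (\<lambda>z. z ^ k))"
  show "countable ?S" by simp
  fix x assume orth: "\<And>y. y \<in> ?S \<Longrightarrow> cinner x y = 0"
  then have "x \<in> Hardy2" unfolding Hardy2_orth_compl orth_compl_def by blast
  then obtain f where f: "hardy f" "x = cls f" by (rule Hardy2_E)
  have "(\<integral>z. f z * cnj (z ^ k) \<partial>circle_measure) = 0" for k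
  proof -
    have "cinner x (cls (\<lambda>z. z ^ k)) = 0" by (rule orth) blast
    then show ?thesis by (simp add: f(2) cls_cinner hardy_sq f(1) hardy_power)
  qed
  then have "AE z in circle_measure. f z = 0" by (rule hardy_null_fourier[OF f(1)])
  then show "x = 0" using cls_eq_iff[OF hardy_sq[OF f(1)] square_integrable_zero] by (simp add: f(2) cls_zero)
qed

section \<open>Powers of an inner function\<close>

context inner_fun
begin

lemma inner_power: "inner_fun (\<lambda>z. b z ^ n)"
  by (rule inner_fun.intro) (auto intro: bhardy_hardy bhardy_power bb simp: norm_power b_unit)

lemma model_power:
  assumes f: "model b f" and j: "j < n"
  shows "model (\<lambda>z. b z ^ n) (\<lambda>z. b z ^ j * f z)"
proof -
  note fs = model_simps[OF f] and [measurable] = model_simps(4)[OF f]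
  have "hardy (\<lambda>z. b z ^ (n - Suc j) * (b z * cnj (z * f z)))"
    by (intro bhardy_mult_hardy[OF bhardy_power[OF bb]] fs(2))
  then have "hardy (\<lambda>z. b z ^ n * cnj (z * (b z ^ j * f z)))"
  proof (rule hardy_cong)
    fix z :: complex assume z: "cmod z = 1"
    have "cmod (b z ^ j) = 1" by (simp add: norm_power b_unit z)
    then have 1: "b z ^ j * cnj (b z ^ j) = 1" by (rule circle_simps(1))
    have "b z ^ n = b z ^ (n - Suc j) * b z * b z ^ j"
      using j by (simp add: power_add[symmetric] power_Suc2[symmetric] del: power_Suc)
    then have "b z ^ n * cnj (z * (b z ^ j * f z)) = b z ^ (n - Suc j) * (b z * cnj (z * f z)) * (b z ^ j * cnj (b z ^ j))"
      by (simp add: ac_simps)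
    then show "b z ^ n * cnj (z * (b z ^ j * f z)) = b z ^ (n - Suc j) * (b z * cnj (z * f z))"
      unfolding 1 by simp
  qed measurable
  then show ?thesis by (simp add: model_def bhardy_mult_hardy[OF bhardy_power[OF bb]] fs)
qed

text \<open>For \<open>j < i\<close> the common power cancels, and what remains pairs a function of
  the model space with a multiple of \<open>b\<close>.\<close>

lemma power_cinner:
  assumes f: "model b f" and g: "model b g"
  shows "(\<integral>z. (b z ^ i * f z) * cnj (b z ^ j * g z) \<partial>circle_measure) = (if i = j then (\<integral>z. f z * cnj (g z) \<partial>circle_measure) else 0)"
proof -
  note [measurable] = model_simps(4)[OF f] model_simps(4)[OF g]
  have gt: "(\<integral>z. (b z ^ i * f z) * cnj (b z ^ j * g z) \<partial>circle_measure) = 0"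
    if f: "model b f" and g: "model b g" and ij: "j < i" for i j f g
  proof -
    note [measurable] = model_simps(4)[OF f] model_simps(4)[OF g]
    define l where "l = i - Suc j"
    have i: "i = j + Suc l" using ij by (simp add: l_def)
    have "null (\<lambda>z. cnj (g z * cnj (b z * (b z ^ l * f z))))"
      by (intro null_cnj model_null g bhardy_mult_hardy[OF bhardy_power[OF bb]] model_simps(1)[OF f])
    then have "null (\<lambda>z. (b z ^ i * f z) * cnj (b z ^ j * g z))"
    proof (rule null_cong)
      fix z :: complex assume z: "cmod z = 1"
      have "cmod (b z ^ j) = 1" by (simp add: norm_power b_unit z)
      then have 1: "b z ^ j * cnj (b z ^ j) = 1" by (rule circle_simps(1))
      have "(b z ^ i * f z) * cnj (b z ^ j * g z) = (b z ^ j * cnj (b z ^ j)) * cnj (g z * cnj (b z * (b z ^ l * f z)))"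
        unfolding i power_add by (simp add: ac_simps)
      then show "(b z ^ i * f z) * cnj (b z ^ j * g z) = cnj (g z * cnj (b z * (b z ^ l * f z)))"
        unfolding 1 by simp
    qed measurable
    then show ?thesis by (rule nullD)
  qed
  show ?thesis
  proof (cases i j rule: linorder_cases)
    case less
    have "(\<integral>z. (b z ^ i * f z) * cnj (b z ^ j * g z) \<partial>circle_measure) = cnj (\<integral>z. (b z ^ j * g z) * cnj (b z ^ i * f z) \<partial>circle_measure)"
      unfolding Bochner_Integration.integral_cnj[symmetric] by (simp add: ac_simps)
    then show ?thesis using gt[OF g f less] less by simp
  next
    case equal
    have "(\<integral>z. (b z ^ j * f z) * cnj (b z ^ j * g z) \<partial>circle_measure) = (\<integral>z. f z * cnj (g z) \<partial>circle_measure)"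
    proof (rule circle_integral_cong)
      fix z :: complex assume z: "cmod z = 1"
      have "cmod (b z ^ j) = 1" by (simp add: norm_power b_unit z)
      then have 1: "b z ^ j * cnj (b z ^ j) = 1" by (rule circle_simps(1))
      have "(b z ^ j * f z) * cnj (b z ^ j * g z) = (b z ^ j * cnj (b z ^ j)) * (f z * cnj (g z))" by (simp add: ac_simps)
      then show "(b z ^ j * f z) * cnj (b z ^ j * g z) = f z * cnj (g z)" unfolding 1 by simp
    qed measurable
    then show ?thesis using equal by simp
  next
    case greater
    then show ?thesis using gt[OF f g greater] by simp
  qed
qed

lemma model_one: assumes f: "model (\<lambda>z. 1) f" shows "cls f = 0"
proof -
  note [measurable] = model_simps(4)[OF f]
  have "null (\<lambda>z. f z * cnj (f z))"
    by (rule null_hardyI[OF model_simps(1)[OF f] model_simps(2)[OF f]]) (auto simp: circle_simps ac_simps)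
  then have "cinner (cls f) (cls f) = 0" by (simp add: cls_cinner model_simps(3)[OF f] null_def)
  then show ?thesis by simp
qed

text \<open>Induction on the power: the component \<open>y0\<close> of \<open>y\<close> in the model
  space is orthogonal to a total family and vanishes, so one factor \<open>b\<close> can be removed
  from \<open>y\<close>.\<close>

lemma power_total:
  assumes e: "\<And>i. i \<in> I \<Longrightarrow> model b (e i)"
    and total: "\<And>x. x \<in> V \<Longrightarrow> (\<And>i. i \<in> I \<Longrightarrow> cinner x (cls (e i)) = 0) \<Longrightarrow> x = 0"
  shows "model (\<lambda>z. b z ^ n) y \<Longrightarrow>
    (\<And>i j. i \<in> I \<Longrightarrow> j < n \<Longrightarrow> (\<integral>z. y z * cnj (b z ^ j * e i z) \<partial>circle_measure) = 0) \<Longrightarrow> AE z in circle_measure. y z = 0"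
proof (induction n arbitrary: y)
  case 0
  then have "model (\<lambda>z. 1) y" by simp
  then have "cls y = cls (\<lambda>z. 0)" using model_one by (simp add: cls_zero)
  then show ?case using cls_eq_iff[OF model_simps(3)[OF 0(1)] square_integrable_zero] by simp
next
  case (Suc n)
  note ys = model_simps[OF Suc.prems(1)]
  obtain y0 y1 where y0: "model b y0" and y1: "hardy y1" and yy: "\<And>z. cmod z = 1 \<Longrightarrow> y z = y0 z + b z * y1 z"
    using hardy_decomp[OF ys(1)] by blast
  note [measurable] = ys(4) model_simps(4)[OF y0] hardy_meas[OF y1]
  have "cls y0 = 0"
  proof (rule total[OF model_spaceI[OF y0]])
    fix i assume i: "i \<in> I"
    note es = model_simps[OF e[OF i]]
    note [measurable] = es(4)
    have "null (\<lambda>z. y z * cnj (b z ^ 0 * e i z))"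
      using Suc.prems(2)[OF i, of 0] integrable_cnj_product[OF ys(3) es(3)] by (simp add: null_def)
    moreover have "null (\<lambda>z. cnj (e i z * cnj (b z * y1 z)))" by (intro null_cnj model_null e i y1)
    ultimately have "null (\<lambda>z. y z * cnj (b z ^ 0 * e i z) - cnj (e i z * cnj (b z * y1 z)))" by (rule null_diff)
    then have "null (\<lambda>z. y0 z * cnj (e i z))" by (rule null_cong) (auto simp: yy algebra_simps)
    then show "cinner (cls y0) (cls (e i)) = 0" by (simp add: cls_cinner model_simps(3)[OF y0] es null_def)
  qed
  then have "cls y0 = cls (\<lambda>z. 0)" by (simp add: cls_zero)
  then have y00: "AE z in circle_measure. y0 z = 0" using cls_eq_iff[OF model_simps(3)[OF y0] square_integrable_zero] by simp
  have yb: "AE z in circle_measure. y z = b z * y1 z"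
    by (rule AE_circle_mp[OF y00]) (simp add: yy)
  have "model (\<lambda>z. b z ^ n) y1"
    unfolding model_def
  proof (intro conjI y1 hardy_cong_AE[OF ys(2)])
    show "AE z in circle_measure. b z ^ Suc n * cnj (z * y z) = b z ^ n * cnj (z * y1 z)"
    proof (rule AE_circle_mp[OF yb])
      fix z assume z: "cmod z = 1" and "y z = b z * y1 z"
      then have "b z ^ Suc n * cnj (z * y z) = (b z * cnj (b z)) * (b z ^ n * cnj (z * y1 z))" by (simp add: ac_simps)
      then show "b z ^ Suc n * cnj (z * y z) = b z ^ n * cnj (z * y1 z)" by (simp only: b_simps(1)[OF z] mult_1_left)
    qed
  qed measurable
  then have "AE z in circle_measure. y1 z = 0"
  proof (rule Suc.IH)
    fix i j assume i: "i \<in> I" and j: "j < n"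
    note [measurable] = model_simps(4)[OF e[OF i]]
    have "(\<integral>z. y1 z * cnj (b z ^ j * e i z) \<partial>circle_measure) = (\<integral>z. y z * cnj (b z ^ Suc j * e i z) \<partial>circle_measure)"
    proof (rule integral_cong_AE)
      show "AE z in circle_measure. y1 z * cnj (b z ^ j * e i z) = y z * cnj (b z ^ Suc j * e i z)"
      proof (rule AE_circle_mp[OF yb])
        fix z assume z: "cmod z = 1" and "y z = b z * y1 z"
        then have "y z * cnj (b z ^ Suc j * e i z) = (b z * cnj (b z)) * (y1 z * cnj (b z ^ j * e i z))" by (simp add: ac_simps)
        then show "y1 z * cnj (b z ^ j * e i z) = y z * cnj (b z ^ Suc j * e i z)" by (simp only: b_simps(1)[OF z] mult_1_left)
      qed
    qed measurable
    then show "(\<integral>z. y1 z * cnj (b z ^ j * e i z) \<partial>circle_measure) = 0" using Suc.prems(2)[OF i, of "Suc j"] j by simp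
  qed
  with yb show ?case by eventually_elim simp
qed

text \<open>The functions \<open>b ^ j * e i\<close> form an orthonormal basis; the pair of
  \<open>j < n\<close> and \<open>i < D\<close> is encoded as the index
  \<open>j * D + i\<close>.\<close>

lemma dim_power:
  assumes "has_hilbert_dim V (enat D)"
  shows "has_hilbert_dim (model_space (cls (\<lambda>z. b z ^ n))) (enat (n * D))"
proof -
  interpret P: inner_fun "\<lambda>z. b z ^ n" by (rule inner_power)
  obtain e' where e': "onb {..<D} e' V" using assms unfolding has_hilbert_dim_enat by blast
  have "\<exists>f. model b f \<and> e' i = cls f" if "i < D" for i
    using onbD(1)[OF e', of i] that by (auto elim: model_space_E)
  then obtain e where e: "\<And>i. i < D \<Longrightarrow> model b (e i)" "\<And>i. i < D \<Longrightarrow> e' i = cls (e i)" by metis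
  define g where "g i z = b z ^ (i div D) * e (i mod D) z" for i z
  have idx: "i div D < n" "i mod D < D" if "i < n * D" for i
    using that by (auto simp: less_mult_imp_div_less) (metis mod_less_divisor mult_0_right neq0_conv not_less0)
  have mg: "model (\<lambda>z. b z ^ n) (g i)" if "i < n * D" for i
    unfolding g_def using idx[OF that] by (intro model_power e)
  have "onb {..<n * D} (\<lambda>i. cls (g i)) (model_space (cls (\<lambda>z. b z ^ n)))"
    unfolding onb_def
  proof (intro conjI ballI impI)
    fix i assume "i \<in> {..<n * D}"
    then show "cls (g i) \<in> model_space (cls (\<lambda>z. b z ^ n))" by (intro P.model_spaceI mg) simp
  next
    fix i j assume "i \<in> {..<n * D}" "j \<in> {..<n * D}"
    then have ij: "i < n * D" "j < n * D" by auto
    note ii = idx[OF ij(1)] and jj = idx[OF ij(2)]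
    have "(\<integral>z. e (i mod D) z * cnj (e (j mod D) z) \<partial>circle_measure) = cinner (e' (i mod D)) (e' (j mod D))"
      using ii jj by (simp add: e(2) cls_cinner model_simps(3)[OF e(1)])
    also have "\<dots> = (if i mod D = j mod D then 1 else 0)" using onbD(2)[OF e'] ii jj by simp
    finally have 1: "(\<integral>z. e (i mod D) z * cnj (e (j mod D) z) \<partial>circle_measure) = (if i mod D = j mod D then 1 else 0)" .
    have "cinner (cls (g i)) (cls (g j)) = (\<integral>z. g i z * cnj (g j z) \<partial>circle_measure)"
      by (intro cls_cinner model_simps(3)[OF mg] ij)
    also have "\<dots> = (if i div D = j div D then (if i mod D = j mod D then 1 else 0) else 0)"
      unfolding g_def power_cinner[OF e(1)[OF ii(2)] e(1)[OF jj(2)]] 1 ..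
    also have "\<dots> = (if i = j then 1 else 0)" by (metis div_mult_mod_eq)
    finally show "cinner (cls (g i)) (cls (g j)) = (if i = j then 1 else 0)" .
  next
    fix x assume x: "x \<in> model_space (cls (\<lambda>z. b z ^ n))" and orth: "\<forall>i\<in>{..<n * D}. cinner x (cls (g i)) = 0"
    obtain y where y: "model (\<lambda>z. b z ^ n) y" "x = cls y" using P.model_space_E[OF x] .
    have "AE z in circle_measure. y z = 0"
    proof (rule power_total[where I = "{..<D}" and e = e and n = n])
      show "\<And>i. i \<in> {..<D} \<Longrightarrow> model b (e i)" using e by simp
      show "x = 0" if x: "x \<in> V" "\<And>i. i \<in> {..<D} \<Longrightarrow> cinner x (cls (e i)) = 0" for x
        by (rule onbD(3)[OF e' x(1)]) (use x(2) e(2) in simp)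
      show "model (\<lambda>z. b z ^ n) y" by (rule y)
      fix i j assume i: "i \<in> {..<D}" and j: "j < n"
      have l: "j * D + i < n * D"
      proof -
        have "j * D + i < Suc j * D" using i by simp
        also have "\<dots> \<le> n * D" using j by (intro mult_le_mono1) simp
        finally show ?thesis .
      qed
      have "cinner x (cls (g (j * D + i))) = 0" using orth l by simp
      then have "(\<integral>z. y z * cnj (g (j * D + i) z) \<partial>circle_measure) = 0"
        by (simp add: y(2) cls_cinner model_simps(3)[OF y(1)] model_simps(3)[OF mg[OF l]])
      moreover have "g (j * D + i) z = b z ^ j * e i z" for z using i by (simp add: g_def)
      ultimately show "(\<integral>z. y z * cnj (b z ^ j * e i z) \<partial>circle_measure) = 0" by simp
    qed
    then show "x = 0" using cls_eq_iff[OF model_simps(3)[OF y(1)] square_integrable_zero] by (simp add: y(2) cls_zero)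
  qed
  then show ?thesis unfolding has_hilbert_dim_enat by blast
qed

end

section \<open>The dimension of the complement \<open>W\<close>\<close>

context dilation
begin

text \<open>The complement of the range of \<open>J\<close> is cut out by the images of a finite
  orthonormal basis, so the dimension count for complements applies.\<close>

lemma W_dim_finite:
  assumes V: "has_hilbert_dim V (enat D)" and VS: "has_hilbert_dim VS l"
  shows "\<exists>m. has_hilbert_dim W m \<and> m + enat D = l"
proof -
  obtain e where e: "onb {..<D} e V" using V unfolding has_hilbert_dim_enat by blast
  note es = onbD[OF e, unfolded lessThan_iff]
  obtain m where m: "has_hilbert_dim W m" using circle_hilbert_dim_exists[OF W(1)] by blast
  have "W = {w \<in> VS. \<forall>i<D. cinner w (J (e i)) = 0}"
  proof (intro antisym subsetI)
    fix w assume "w \<in> W" then show "w \<in> {w \<in> VS. \<forall>i<D. cinner w (J (e i)) = 0}" using es(1) by (simp add: W_def)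
  next
    fix w assume w: "w \<in> {w \<in> VS. \<forall>i<D. cinner w (J (e i)) = 0}"
    obtain x where x: "x \<in> V" "orth_proj (J ` V) w = J x" using orth_proj_in[OF JV, of w] by blast
    have "x = 0"
    proof (rule es(3)[OF x(1)])
      fix i assume i: "i < D"
      have "cinner x (e i) = cinner (J x) (J (e i))" using J_cinner[OF x(1) es(1)[OF i]] by simp
      also have "\<dots> = cinner w (J (e i))" unfolding x(2)[symmetric] by (intro orth_proj_cinner(1)[OF JV] imageI es(1)[OF i])
      finally show "cinner x (e i) = 0" using w i by simp
    qed
    then have p0: "orth_proj (J ` V) w = 0" using x(2) unitary_between_simps(2)[OF J_unitary model_space(1)] by simp
    have "cinner w (J x) = 0" if "x \<in> V" for x
      using orth_proj_cinner(1)[OF JV imageI[OF that], of w] by (simp add: p0)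
    then show "w \<in> W" using w by (simp add: W_def)
  qed
  then have "m + enat D = l"
    using es(1,2) by (intro hilbert_dim_complement[OF S.model_space(1), of D "\<lambda>i. J (e i)" W m l] m VS)
      (auto simp: J_in J_cinner)
  with m show ?thesis by blast
qed

text \<open>With infinite \<open>d\<close> a dimension count gives no information, so an orthonormal
  system in \<open>W\<close> is exhibited: the functions \<open>(1 - b) * e i\<close>, divided by
  the square root of 2.\<close>

lemma W_dim_infinite:
  assumes V: "has_hilbert_dim V \<infinity>" and sub: "\<And>f. model b f \<Longrightarrow> model s1 f"
  shows "has_hilbert_dim W \<infinity>"
proof -
  obtain e' :: "nat \<Rightarrow> circle_L2" where e': "onb UNIV e' V" using V unfolding has_hilbert_dim_infinity by blast
  have "\<exists>f. model b f \<and> e' i = cls f" for i using onbD(1)[OF e', of i] by (auto elim: model_space_E)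
  then obtain e where e: "\<And>i. model b (e i)" "\<And>i. e' i = cls (e i)" by metis
  \<comment> \<open>The squared modulus of \<open>1 - b\<close> is \<open>2 - b - cnj b\<close>, of
    which only the 2 survives by \<open>model_pair_null\<close>.\<close>
  define h where "h i = complex_of_real (1 / sqrt 2) *\<^sub>C cls (\<lambda>z. (1 - b z) * e i z)" for i
  have b1: "bhardy (\<lambda>z. 1 - b z)" by (intro bhardy_intros bb)
  have sq: "square_integrable (\<lambda>z. (1 - b z) * e i z)" for i by (intro bhardy_sq_mult b1 model_simps(3)[OF e(1)])
  have hW: "h i \<in> W" for i
  proof -
    have "cls (\<lambda>z. (1 - b z) * e i z) \<in> W"
      unfolding W_def
    proof (intro CollectI conjI ballI)
      show "cls (\<lambda>z. (1 - b z) * e i z) \<in> VS" by (intro S.model_spaceI model_w sub e)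
      fix x assume "x \<in> V"
      then obtain f where f: "model b f" "x = cls f" by (rule model_space_E)
      have kf: "square_integrable (\<lambda>z. k z * f z)" by (intro bhardy_sq_mult k model_simps(3)[OF f(1)])
      show "cinner (cls (\<lambda>z. (1 - b z) * e i z)) (J x) = 0"
        unfolding f(2) J_def mulL_cls[OF k model_simps(3)[OF f(1)]] cinner_scaleC_right cls_cinner[OF sq kf]
        using nullD[OF w_k_null[OF sub[OF e(1)] f(1)]] by simp
    qed
    then show ?thesis unfolding h_def by (rule csubspaceD(3)[OF W(1)])
  qed
  have hh: "cinner (h i) (h j) = (if i = j then 1 else 0)" for i j
  proof -
    note [measurable] = model_simps(4)[OF e(1)]
    have i: "integrable circle_measure (\<lambda>z. e i z * cnj (e j z))" by (intro integrable_cnj_product model_simps(3)[OF e(1)])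
    have n: "null (\<lambda>z. b z * (e i z * cnj (e j z)) + cnj (b z) * (e i z * cnj (e j z)))"
      by (intro null_add model_pair_null e)
    have "cinner (cls (\<lambda>z. (1 - b z) * e i z)) (cls (\<lambda>z. (1 - b z) * e j z))
      = (\<integral>z. 2 * (e i z * cnj (e j z)) - (b z * (e i z * cnj (e j z)) + cnj (b z) * (e i z * cnj (e j z))) \<partial>circle_measure)"
      unfolding cls_cinner[OF sq sq] by (rule circle_integral_cong) (auto simp: b_simps algebra_simps)
    also have "\<dots> = 2 * (\<integral>z. e i z * cnj (e j z) \<partial>circle_measure)"
      using n i unfolding null_def by (subst Bochner_Integration.integral_diff) (simp_all only: integrable_mult_right diff_zero integral_mult_right_zero)
    also have "\<dots> = 2 * cinner (e' i) (e' j)" by (simp add: e(2) cls_cinner model_simps(3)[OF e(1)])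
    also have "\<dots> = (if i = j then 2 else 0)" using onbD(2)[OF e', of i j] by simp
    finally have c: "cinner (cls (\<lambda>z. (1 - b z) * e i z)) (cls (\<lambda>z. (1 - b z) * e j z)) = (if i = j then 2 else 0)" .
    have "complex_of_real (1 / sqrt 2) * (complex_of_real (1 / sqrt 2) * 2) = complex_of_real ((1 / sqrt 2) * ((1 / sqrt 2) * 2))"
      by (simp only: of_real_mult of_real_numeral)
    also have "\<dots> = 1" by simp
    finally have "complex_of_real (1 / sqrt 2) * (complex_of_real (1 / sqrt 2) * 2) = 1" .
    then show ?thesis
      unfolding h_def cinner_scaleC_left cinner_scaleC_right c complex_cnj_complex_of_real by simp
  qed
  obtain m where m: "has_hilbert_dim W m" using circle_hilbert_dim_exists[OF W(1)] by blast
  have "(\<forall>i<q. h i \<in> W) \<and> (\<forall>i<q. \<forall>j<q. cinner (h i) (h j) = (if i = j then 1 else 0))" for q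
    using hW hh by simp
  then have "m = \<infinity>" by (intro hilbert_dim_infinity[OF W(1) m]) (rule exI)
  with m show ?thesis by simp
qed

text \<open>If the model space of \<open>s1\<close> is trivial, the vectors \<open>wv v\<close>
  impose no condition, and every element of \<open>W\<close> is in the range of \<open>J\<close>, to
  which it is orthogonal.\<close>

lemma W_dim_zero:
  assumes "\<And>f. model s1 f \<Longrightarrow> cls f = 0" shows "has_hilbert_dim W 0"
proof -
  have "w = 0" if w: "w \<in> W" for w
  proof -
    have "wv v = 0" if v: "bmodel s1 v" for v
    proof -
      have "bhardy (\<lambda>z. 1 - b z)" by (intro bhardy_intros bb)
      then have "wv v = mulL (\<lambda>z. 1 - b z) (cls v)" by (simp add: wv_def mulL_cls bmodel_simps[OF v])
      also have "cls v = cls (\<lambda>z. 0)" using assms[OF bmodel_simps(1)[OF v]] by (simp add: cls_zero)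
      also have "mulL (\<lambda>z. 1 - b z) (cls (\<lambda>z. 0)) = 0"
        using mulL_cls[OF \<open>bhardy (\<lambda>z. 1 - b z)\<close> square_integrable_zero] by (simp add: cls_zero)
      finally show ?thesis .
    qed
    moreover have "w \<in> VS" using w by (simp add: W_def)
    ultimately obtain x where x: "x \<in> V" "w = J x" using range_J[of w] by auto
    have "cinner w (J x) = 0" using w x(1) by (simp add: W_def)
    then show ?thesis using x(2) by simp
  qed
  then show ?thesis unfolding zero_enat_def has_hilbert_dim_enat by (auto simp: onb_def)
qed

end

section \<open>Finitely many copies\<close>

context clark_symbol
begin

text \<open>The case \<open>u(w) = w ^ Suc n\<close>. Here \<open>k\<close> is the geometric sum,
  with value \<open>Suc n\<close> at \<open>b = 1\<close>, and \<open>r\<close> collects the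
  quotients of \<open>b ^ j - 1\<close> by \<open>1 - b\<close>, again minus geometric sums.\<close>

lemma dilation_power:
  "dilation b \<psi> (\<lambda>z. b z ^ Suc n) (\<lambda>z. b z ^ n) (\<lambda>z. \<Sum>j<Suc n. b z ^ j) (\<lambda>z. - (\<Sum>j<Suc n. \<Sum>i<j. b z ^ i)) (real (Suc n))"
proof -
  interpret S: inner_fun "\<lambda>z. b z ^ Suc n" by (rule inner_power)
  interpret S1: inner_fun "\<lambda>z. b z ^ n" by (rule inner_power)
  have geo: "(\<Sum>j<m. b z ^ j) * (1 - b z) = 1 - b z ^ m" for m z
    using one_diff_power_eq[of "b z" m] by (simp add: mult.commute)
  show ?thesis
  proof unfold_locales
    show "bhardy (\<lambda>z. \<Sum>j<Suc n. b z ^ j)" by (intro bhardy_intros bb)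
    show "bhardy (\<lambda>z. - (\<Sum>j<Suc n. \<Sum>i<j. b z ^ i))"
    proof -
      have "bhardy (\<lambda>z. \<Sum>j<Suc n. \<Sum>i<j. b z ^ i)" by (intro bhardy_intros bb)
      from bhardy_cmult[OF this, of "-1"] show ?thesis by (simp only: mult_minus1)
    qed
    fix z
    show "(\<Sum>j<Suc n. b z ^ j) * (1 - b z) = 1 - b z ^ Suc n" by (rule geo)
    have "(\<Sum>j<Suc n. \<Sum>i<j. b z ^ i) * (1 - b z) = (\<Sum>j<Suc n. 1 - b z ^ j)"
      unfolding sum_distrib_right[where A = "{..<Suc n}"] geo ..
    also have "\<dots> = complex_of_real (real (Suc n)) - (\<Sum>j<Suc n. b z ^ j)"
      unfolding sum_subtractf by simp
    finally show "- (\<Sum>j<Suc n. \<Sum>i<j. b z ^ i) * (1 - b z) = (\<Sum>j<Suc n. b z ^ j) - complex_of_real (real (Suc n))"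
      unfolding mult_minus_left by (simp only: minus_diff_eq)
  qed simp_all
qed

lemma equivalence_finite:
  fixes E0 :: "'h::complex_inner_space set"
  assumes V: "has_hilbert_dim V d" and E0: "csubspace E0" "complete E0" "has_hilbert_dim E0 (enat n * d)"
  shows "\<exists>\<Theta> \<phi>. inner_function \<Theta> \<and> unitarily_equivalent (V \<times> E0)
    (operator_sum (truncated_Toeplitz (cls b) (cls sym)) (zero_operator E0)) (model_space \<Theta>) (truncated_Toeplitz \<Theta> \<phi>)"
proof -
  interpret D: dilation b \<psi> "\<lambda>z. b z ^ Suc n" "\<lambda>z. b z ^ n" "\<lambda>z. \<Sum>j<Suc n. b z ^ j"
    "\<lambda>z. - (\<Sum>j<Suc n. \<Sum>i<j. b z ^ i)" "real (Suc n)"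
    by (rule dilation_power)
  have "has_hilbert_dim D.W (enat n * d)"
  proof (cases d)
    case (enat D)
    obtain m where m: "has_hilbert_dim D.W m" "m + enat D = enat (Suc n * D)"
      using D.W_dim_finite[OF V[unfolded enat] dim_power[OF V[unfolded enat]]] by blast
    then have "m = enat (n * D)" by (cases m) auto
    then show ?thesis using m(1) enat by simp
  next
    \<comment> \<open>No subtraction of dimensions is possible. For \<open>n = 0\<close> the
      function \<open>s1\<close> is 1 and the complement is trivial; for larger \<open>n\<close> the
      model space of \<open>b\<close> is contained in that of \<open>s1\<close>.\<close>
    case infinity
    show ?thesis
    proof (cases n)
      case 0
      have "has_hilbert_dim D.W 0" by (rule D.W_dim_zero) (use 0 model_one in simp)
      then show ?thesis using 0 by (simp add: zero_enat_def[symmetric])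
    next
      case (Suc n')
      have "has_hilbert_dim D.W \<infinity>"
        by (rule D.W_dim_infinite[OF V[unfolded infinity]]) (use model_power[of _ 0 n] Suc in simp)
      moreover have "enat n * \<infinity> = (\<infinity>::enat)" using Suc by (simp add: imult_is_infinity zero_enat_def)
      ultimately show ?thesis using infinity by simp
    qed
  qed
  from D.dilation_equivalence[OF E0 this] D.S.inner_function_cls show ?thesis by blast
qed

end

section \<open>Infinitely many copies\<close>

context nc_inner
begin

lemma AE_b_neq_minus_1: "AE z in circle_measure. b z \<noteq> - 1"
proof -
  interpret m: inner_fun "\<lambda>z. - b z"
    using hardy_cmult[OF b_hardy, of "-1"] by (intro inner_fun.intro) (auto simp: b_unit)
  have "m.b0 = - b0" unfolding m.b0_def b0_def by simp
  then interpret m: nc_inner "\<lambda>z. - b z" by unfold_locales (simp add: b0_lt)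
  show ?thesis using m.AE_b_neq_1 by eventually_elim (metis minus_minus)
qed

text \<open>Division by \<open>1 - b\<close> is approximated by division by
  \<open>1 - \<rho> * b\<close> with \<open>\<rho> < 1\<close>, which is a geometric series; the
  quotients stay below \<open>2 * M\<close>. The bound on \<open>g\<close> has to be known in
  advance.\<close>

lemma bhardy_divide:
  assumes g: "g \<in> borel_measurable borel" "\<And>z. cmod z = 1 \<Longrightarrow> cmod (g z) \<le> M"
    and h: "bhardy h" "AE z in circle_measure. (1 - b z) * g z = h z"
  shows "bhardy g"
proof (rule bhardy_limit[where C = "2 * M"])
  define \<rho> where "\<rho> n = real n / real (Suc n)" for n
  have \<rho>: "0 \<le> \<rho> n" "\<rho> n < 1" for n by (simp_all add: \<rho>_def)
  have \<rho>1: "\<rho> \<longlonglongrightarrow> 1" unfolding \<rho>_def by (rule LIMSEQ_n_over_Suc_n)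
  define f where "f n z = ((1 - b z) * g z) * (1 / (1 - \<rho> n * b z))" for n z
  note [measurable] = g(1) bhardy_meas[OF h(1)]
  have M: "0 \<le> M" using order_trans[OF norm_ge_zero g(2)[of 1]] by simp
  have q: "cmod ((1 - b z) / (1 - \<rho> n * b z)) \<le> 2" if z: "cmod z = 1" for n z
  proof -
    have n: "cmod (\<rho> n * b z) = \<rho> n" using \<rho>[of n] b_unit[OF z] by (simp add: norm_mult)
    have 1: "1 - \<rho> n \<le> cmod (1 - \<rho> n * b z)" using norm_triangle_ineq2[of 1 "\<rho> n * b z"] n by simp
    \<comment> \<open>This gives \<open>cmod (1 - b z) \<le> 2 * cmod (1 - \<rho> n * b z)\<close>,
      the origin of the factor 2.\<close>
    have "1 - b z = (1 - \<rho> n * b z) + of_real (\<rho> n - 1) * b z" by (simp add: algebra_simps)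
    then have "cmod (1 - b z) \<le> cmod (1 - \<rho> n * b z) + cmod (of_real (\<rho> n - 1) * b z)"
      by (metis norm_triangle_ineq)
    also have "cmod (of_real (\<rho> n - 1) * b z) = 1 - \<rho> n"
      using \<rho>[of n] b_unit[OF z] unfolding norm_mult norm_of_real by simp
    finally have "cmod (1 - b z) \<le> 2 * cmod (1 - \<rho> n * b z)" using 1 by simp
    then show ?thesis using 1 \<rho>(2)[of n] by (simp add: norm_divide divide_le_eq)
  qed
  have fb: "cmod (f n z) \<le> 2 * M" if z: "cmod z = 1" for n z
  proof -
    have "f n z = ((1 - b z) / (1 - \<rho> n * b z)) * g z" by (simp add: f_def)
    then have "cmod (f n z) = cmod ((1 - b z) / (1 - \<rho> n * b z)) * cmod (g z)" by (simp only: norm_mult)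
    also have "\<dots> \<le> 2 * M" by (intro mult_mono q g(2) z) auto
    finally show ?thesis .
  qed
  show "cmod (f n z) \<le> 2 * M" if "cmod z = 1" for n z by (rule fb[OF that])
  show "bhardy (f n)" for n
  proof (rule bhardyI)
    have "bhardy (\<lambda>z. 1 / (1 - complex_of_real (\<rho> n) * b z))"
      by (rule bhardy_neumann[OF bb]) (use \<rho>[of n] b_unit in auto)
    from bhardy_mult_hardy[OF this bhardy_hardy[OF h(1)]]
    have "hardy (\<lambda>z. 1 / (1 - complex_of_real (\<rho> n) * b z) * h z)" .
    then show "hardy (f n)"
    proof (rule hardy_cong_AE)
      show "AE z in circle_measure. 1 / (1 - complex_of_real (\<rho> n) * b z) * h z = f n z"
        using h(2) by eventually_elim (simp add: f_def)
      show "f n \<in> borel_measurable borel" unfolding f_def by measurable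
    qed
    show "cmod (f n z) \<le> 2 * M" if "cmod z = 1" for z by (rule fb[OF that])
  qed
  show "AE z in circle_measure. (\<lambda>n. f n z) \<longlonglongrightarrow> g z"
    using AE_b_neq_1
  proof eventually_elim
    fix z assume nb: "b z \<noteq> 1"
    have "(\<lambda>n. ((1 - b z) * g z) * (1 / (1 - complex_of_real (\<rho> n) * b z))) \<longlonglongrightarrow> ((1 - b z) * g z) * (1 / (1 - complex_of_real 1 * b z))"
      using nb by (intro tendsto_intros \<rho>1) auto
    then show "(\<lambda>n. f n z) \<longlonglongrightarrow> g z" using nb by (simp add: f_def)
  qed
  show "cmod (g z) \<le> 2 * M" if "cmod z = 1" for z using g(2)[OF that] M by simp
qed (rule g(1))

text \<open>A Cayley transform of \<open>b\<close>; its values on the circle are purely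
  imaginary.\<close>

definition hh :: "complex \<Rightarrow> complex" where "hh z = (1 - b z) / (1 + b z)"

text \<open>
  The singular inner function \<open>exp (- t (1 - w) / (1 + w))\<close> of \<open>b\<close>; on the null set where \<open>b = - 1\<close>
  the division by zero gives \<open>hh z = 0\<close> and the value \<open>1\<close>.
\<close>

definition ex :: "real \<Rightarrow> complex \<Rightarrow> complex" where "ex t z = exp (- (t * hh z))"

lemma Re_hh: assumes z: "cmod z = 1" shows "Re (hh z) = 0"
proof (cases "b z = - 1")
  case False
  then have nz: "1 + b z \<noteq> 0" by (simp add: add_eq_0_iff)
  then have nz': "1 + cnj (b z) \<noteq> 0" by (metis complex_cnj_add complex_cnj_one complex_cnj_zero_iff)
  have "cnj (hh z) = - hh z"
    unfolding hh_def using nz nz' b_simps[OF z] by (simp add: frac_eq_eq minus_divide_left) (simp add: algebra_simps)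
  then show ?thesis by (simp add: complex_eq_iff)
qed (simp add: hh_def)

lemma ex_unit: "cmod z = 1 \<Longrightarrow> cmod (ex t z) = 1"
  by (simp add: ex_def Re_hh)

lemma hh_meas [measurable]: "hh \<in> borel_measurable borel"
  unfolding hh_def[abs_def] by measurable

lemma ex_meas [measurable]: "ex t \<in> borel_measurable borel"
  unfolding ex_def[abs_def] by measurable

text \<open>With \<open>\<rho> * b\<close> for \<open>b\<close> the exponent is a bounded Hardy
  function whose real part is at most 0, so the exponentials are bounded by 1. They converge off the
  null set \<open>b = - 1\<close>.\<close>

lemma ex_bhardy: assumes t: "t \<ge> 0" shows "bhardy (ex t)"
proof (rule bhardy_limit[where C = 1])
  define \<rho> where "\<rho> n = real n / real (Suc n)" for n
  have \<rho>: "0 \<le> \<rho> n" "\<rho> n < 1" for n by (simp_all add: \<rho>_def)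
  have \<rho>1: "\<rho> \<longlonglongrightarrow> 1" unfolding \<rho>_def by (rule LIMSEQ_n_over_Suc_n)
  define f where "f n z = exp ((- complex_of_real t) * ((1 - \<rho> n * b z) * (1 / (1 - (- complex_of_real (\<rho> n)) * b z))))" for n z
  show "bhardy (f n)" for n
    unfolding f_def
    by (intro bhardy_exp bhardy_cmult bhardy_mult bhardy_diff bhardy_const bhardy_neumann bb) (use \<rho>[of n] b_unit in auto)
  show "cmod (f n z) \<le> 1" if z: "cmod z = 1" for n z
  proof -
    define w where "w = complex_of_real (\<rho> n) * b z"
    have w: "cmod w < 1" using \<rho>[of n] b_unit[OF z] by (simp add: w_def norm_mult)
    have "(1 - w) * cnj (1 + w) = (1 - (cmod w)\<^sup>2) + (cnj w - w)"
      by (simp add: algebra_simps complex_norm_square del: of_real_power)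
    then have "Re ((1 - w) * cnj (1 + w)) = 1 - (cmod w)\<^sup>2" by simp
    moreover have "(cmod w)\<^sup>2 \<le> 1" using w by (simp add: power_le_one)
    ultimately have "Re ((1 - w) / (1 + w)) \<ge> 0" by (simp add: Re_complex_div_ge_0)
    then have "Re ((- complex_of_real t) * ((1 - w) / (1 + w))) \<le> 0" using t by (simp del: times_divide_eq_right)
    then show ?thesis unfolding f_def by (simp add: w_def[symmetric])
  qed
  show "AE z in circle_measure. (\<lambda>n. f n z) \<longlonglongrightarrow> ex t z"
    using AE_b_neq_minus_1
  proof eventually_elim
    fix z assume nb: "b z \<noteq> - 1"
    then have nz: "1 + b z \<noteq> 0" by (simp add: add_eq_0_iff)
    have "(\<lambda>n. f n z) \<longlonglongrightarrow> exp ((- complex_of_real t) * ((1 - complex_of_real 1 * b z) * (1 / (1 - (- complex_of_real 1) * b z))))"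
      unfolding f_def using nz by (intro tendsto_intros \<rho>1) auto
    then show "(\<lambda>n. f n z) \<longlonglongrightarrow> ex t z" by (simp add: ex_def hh_def)
  qed
  show "cmod (ex t z) \<le> 1" if "cmod z = 1" for z using ex_unit[OF that] by simp
qed measurable

lemma ex_inner: "t \<ge> 0 \<Longrightarrow> inner_fun (ex t)"
  by (rule inner_fun.intro) (auto intro: bhardy_hardy ex_bhardy ex_unit)

lemma ex_power: "ex (1 / real (Suc p)) z ^ Suc p = ex 1 z"
proof -
  have "ex (1 / real (Suc p)) z ^ Suc p = exp (of_nat (Suc p) * (- (complex_of_real (1 / real (Suc p)) * hh z)))"
    unfolding ex_def exp_of_nat_mult ..
  also have "of_nat (Suc p) * (- (complex_of_real (1 / real (Suc p)) * hh z)) = - ((of_nat (Suc p) * complex_of_real (1 / real (Suc p))) * hh z)"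
    by (simp only: mult_minus_right mult.assoc)
  also have "of_nat (Suc p) * complex_of_real (1 / real (Suc p)) = 1"
    by (simp del: of_nat_Suc)
  finally show ?thesis by (simp add: ex_def)
qed

lemma AE_circle_const: "(AE z in circle_measure. P) \<longleftrightarrow> P"
proof
  assume "AE z in circle_measure. P"
  show P
  proof (rule ccontr)
    assume "\<not> P"
    then have "AE z in circle_measure. False" using \<open>AE z in circle_measure. P\<close> by simp
    then obtain N where "{z \<in> space circle_measure. \<not> False} \<subseteq> N" "emeasure circle_measure N = 0" by (rule AE_E)
    then show False using prob_circle by (simp add: top.extremum_unique)
  qed
qed simp

text \<open>A constant value would keep \<open>hh\<close> away from 0, hence \<open>b\<close> away
  from 1 almost everywhere. Then \<open>1 / (1 - b)\<close> is a bounded Hardy function with real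
  part 1/2 on the circle, so it is constant, and \<open>b\<close> with it.\<close>

lemma ex_not_const:
  assumes t: "t > 0" shows "\<not> (AE z in circle_measure. ex t z = c)"
proof
  assume const: "AE z in circle_measure. ex t z = c"
  \<comment> \<open>Apart from 0 itself, solutions \<open>h\<close> of
    \<open>exp (- t * h) = c\<close> do not accumulate at 0: for \<open>c = 1\<close> they are
    nonzero multiples of the period when purely imaginary, and for other \<open>c\<close> the
    exponential near 0 is still too close to 1.\<close>
  have "\<exists>\<delta>>0. \<forall>z. cmod z = 1 \<longrightarrow> hh z \<noteq> 0 \<longrightarrow> ex t z = c \<longrightarrow> \<delta> \<le> cmod (hh z)"
  proof (cases "c = 1")
    case True
    have "2 * pi / t \<le> cmod (hh z)" if z: "cmod z = 1" "hh z \<noteq> 0" "ex t z = c" for z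
    proof -
      have "exp (- (complex_of_real t * hh z)) = 1" using z True by (simp add: ex_def)
      then obtain n :: int where n: "Im (- (complex_of_real t * hh z)) = of_int (2 * n) * pi"
        unfolding exp_eq_1 by blast
      have im: "Im (hh z) \<noteq> 0" using z(2) Re_hh[OF z(1)] by (simp add: complex_eq_iff)
      have "n \<noteq> 0" using n im t by auto
      then have "1 \<le> \<bar>real_of_int n\<bar>" by linarith
      then have "2 * pi \<le> \<bar>of_int (2 * n) * pi\<bar>" by (simp add: abs_mult)
      also have "\<dots> = t * \<bar>Im (hh z)\<bar>" unfolding n[symmetric] using t by (simp add: abs_mult)
      finally have "2 * pi / t \<le> \<bar>Im (hh z)\<bar>" using t by (simp add: divide_le_eq mult.commute)
      then show ?thesis using abs_Im_le_cmod[of "hh z"] by linarith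
    qed
    then show ?thesis using t by (intro exI[of _ "2 * pi / t"]) auto
  next
    case False
    define \<delta> where "\<delta> = min 1 (cmod (c - 1) / (exp t * t))"
    have "\<delta> > 0" using False t by (simp add: \<delta>_def)
    moreover have "\<delta> \<le> cmod (hh z)" if z: "cmod z = 1" "ex t z = c" for z
    proof (cases "cmod (hh z) \<le> 1")
      case True
      have "cmod (exp (- (complex_of_real t * hh z)) - 1) \<le> exp (t * cmod (hh z)) * (t * cmod (hh z))"
        using Taylor_exp_field[of "- (complex_of_real t * hh z)" 0] t by (simp add: norm_mult)
      also have "\<dots> \<le> exp t * (t * cmod (hh z))"
        using True t by (intro mult_right_mono) (auto simp: mult_left_le)
      finally have "cmod (c - 1) \<le> (exp t * t) * cmod (hh z)" using z(2) by (simp add: ex_def)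
      then have "cmod (c - 1) / (exp t * t) \<le> cmod (hh z)" using t by (simp add: divide_le_eq mult.commute)
      then show ?thesis by (simp add: \<delta>_def)
    qed (simp add: \<delta>_def)
    ultimately show ?thesis by blast
  qed
  then obtain \<delta> where \<delta>: "\<delta> > 0" "\<And>z. cmod z = 1 \<Longrightarrow> hh z \<noteq> 0 \<Longrightarrow> ex t z = c \<Longrightarrow> \<delta> \<le> cmod (hh z)" by blast
  define \<epsilon> where "\<epsilon> = min 1 \<delta>"
  have \<epsilon>: "\<epsilon> > 0" using \<delta> by (simp add: \<epsilon>_def)
  have AE: "AE z in circle_measure. b z \<noteq> 1 \<and> b z \<noteq> - 1 \<and> ex t z = c"
    using const AE_b_neq_1 AE_b_neq_minus_1 by eventually_elim simp
  have far: "AE z in circle_measure. \<epsilon> \<le> cmod (1 - b z)"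
  proof (rule AE_circle_mp[OF AE])
    fix z assume z: "cmod z = 1" and A: "b z \<noteq> 1 \<and> b z \<noteq> - 1 \<and> ex t z = c"
    have nz: "1 + b z \<noteq> 0" using A by (simp add: add_eq_0_iff)
    then have "hh z \<noteq> 0" using A by (simp add: hh_def)
    then have h: "\<delta> \<le> cmod (hh z)" using \<delta>(2)[OF z] A by blast
    show "\<epsilon> \<le> cmod (1 - b z)"
    proof (cases "cmod (1 - b z) \<le> 1")
      case True
      have "2 \<le> cmod (1 - b z) + cmod (1 + b z)"
        using norm_triangle_ineq[of "1 - b z" "1 + b z"] by simp
      then have "1 \<le> cmod (1 + b z)" using True by simp
      then have "cmod (hh z) \<le> cmod (1 - b z)"
        unfolding hh_def norm_divide using nz by (simp add: divide_le_eq mult_left_le mult_le_cancel_left1)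
      then show ?thesis using h by (simp add: \<epsilon>_def)
    qed (simp add: \<epsilon>_def)
  qed
  \<comment> \<open>The value 0 on the exceptional null set keeps the bound
    \<open>1 / \<epsilon>\<close> valid everywhere.\<close>
  define g where "g z = (if \<epsilon> \<le> cmod (1 - b z) then 1 / (1 - b z) else 0)" for z
  have [measurable]: "g \<in> borel_measurable borel" unfolding g_def by measurable
  have g1: "AE z in circle_measure. (1 - b z) * g z = 1"
    using far by eventually_elim (use \<epsilon> in \<open>auto simp: g_def\<close>)
  have "bhardy g"
  proof (rule bhardy_divide[OF _ _ bhardy_const g1])
    show "cmod (g z) \<le> 1 / \<epsilon>" for z using \<epsilon> by (auto simp: g_def norm_divide frac_le)
  qed measurable
  then have hg: "hardy g" by (rule bhardy_hardy)
  \<comment> \<open>For unimodular \<open>b\<close> the numbers \<open>1 / (1 - b)\<close> have real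
    part 1/2.\<close>
  have "AE z in circle_measure. cnj (g z) = 1 - g z"
  proof (rule AE_circle_mp[OF g1])
    fix z assume z: "cmod z = 1" and g: "(1 - b z) * g z = 1"
    have nb: "1 - b z \<noteq> 0" using g by auto
    then have nb': "1 - cnj (b z) \<noteq> 0" by (metis complex_cnj_diff complex_cnj_one complex_cnj_zero_iff)
    have gz: "g z = 1 / (1 - b z)" using g nb by (simp add: field_simps)
    show "cnj (g z) = 1 - g z"
      unfolding gz using nb nb' b_simps[OF z] by (simp add: field_simps)
  qed
  then have cg: "AE z in circle_measure. 1 - g z = cnj (g z)" by eventually_elim simp
  have "hardy (\<lambda>z. cnj (g z))" by (rule hardy_cong_AE[OF hardy_diff[OF hardy_const hg] _ cg]) measurable
  then have gc: "AE z in circle_measure. g z = (\<integral>z. g z \<partial>circle_measure)" by (rule hardy_real_const[OF hg])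
  define \<gamma> where "\<gamma> = (\<integral>z. g z \<partial>circle_measure)"
  have bc: "AE z in circle_measure. b z = 1 - 1 / \<gamma>"
    using gc g1 unfolding \<gamma>_def[symmetric]
  proof eventually_elim
    fix z assume "g z = \<gamma>" "(1 - b z) * g z = 1"
    then have "(1 - b z) * \<gamma> = 1" "\<gamma> \<noteq> 0" by auto
    then show "b z = 1 - 1 / \<gamma>" by (simp add: field_simps)
  qed
  have "AE z in circle_measure. cmod (1 - 1 / \<gamma>) = 1"
    by (rule AE_circle_mp[OF bc]) (metis b_unit)
  then have "cmod (1 - 1 / \<gamma>) = 1"
    using AE_circle_const by simp
  moreover have "b0 = 1 - 1 / \<gamma>"
    unfolding b0_def using bc by (subst integral_cong_AE[of _ _ "\<lambda>z. 1 - 1 / \<gamma>"]) auto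
  ultimately show False using b0_lt by simp
qed

end

section \<open>The choice of a singular factor\<close>

context clark_symbol
begin

definition s_sing :: "complex \<Rightarrow> complex" where "s_sing z = b z * ex 1 z"
text \<open>The value 3/2 is the derivative of \<open>w * exp (- (1 - w) / (1 + w))\<close> at
  \<open>w = 1\<close>: 1 from the first factor and 1/2 from the exponent.\<close>

definition k_sing :: "complex \<Rightarrow> complex" where
  "k_sing z = (if b z = 1 then 3 / 2 else (1 - s_sing z) / (1 - b z))"
definition r_sing :: "complex \<Rightarrow> complex" where
  "r_sing z = (if b z = 1 then 0 else (k_sing z - 3 / 2) / (1 - b z))"

text \<open>First and second order Taylor estimates near \<open>b = 1\<close>, crude estimates near
  \<open>b = - 1\<close>, where the exponent is unbounded. The constants are generous; only their
  existence matters.\<close>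

lemma sing_bounds:
  assumes z: "cmod z = 1"
  shows "cmod (k_sing z) \<le> 3 + exp 2" "cmod (r_sing z) \<le> 5 + exp 2"
proof -
  have "cmod (k_sing z) \<le> 3 + exp 2 \<and> cmod (r_sing z) \<le> 5 + exp 2"
  proof (cases "b z = 1")
    case True
    have "cmod (3 / 2) \<le> 3" by simp
    then show ?thesis using True exp_gt_zero[of "2::real"] by (auto simp: k_sing_def r_sing_def intro: order_trans)
  next
    case nb: False
    define E where "E = ex 1 z"
    have k: "k_sing z = (1 - b z * E) / (1 - b z)" using nb by (simp add: k_sing_def s_sing_def E_def)
    have k1: "k_sing z = 1 + b z * ((1 - E) / (1 - b z))" unfolding k using nb by (simp add: field_simps)
    have E: "cmod E = 1" unfolding E_def by (rule ex_unit[OF z])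
    have d2: "2 \<le> cmod (1 - b z) + cmod (1 + b z)"
      using norm_triangle_ineq[of "1 - b z" "1 + b z"] by simp
    have pos: "cmod (1 - b z) > 0" using nb by simp
    show ?thesis
    proof (cases "cmod (1 + b z) \<le> 1")
      \<comment> \<open>Near \<open>b = - 1\<close> the denominators \<open>1 - b\<close> have
        modulus at least 1.\<close>
      case True
      then have d: "1 \<le> cmod (1 - b z)" using d2 by simp
      have "cmod (1 - b z * E) \<le> 2" using norm_triangle_ineq4[of 1 "b z * E"] E b_unit[OF z] by (simp add: norm_mult)
      then have kb: "cmod (k_sing z) \<le> 2" unfolding k norm_divide using d by (simp add: divide_le_eq)
      have "cmod (k_sing z - 3 / 2) \<le> 2 + 3 / 2" using norm_triangle_ineq4[of "k_sing z" "3 / 2"] kb by simp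
      then have "cmod (k_sing z - 3 / 2) \<le> 5 * cmod (1 - b z)" using d by simp
      then have "cmod (r_sing z) \<le> 5" using nb pos by (simp add: r_sing_def norm_divide divide_le_eq)
      then show ?thesis using kb exp_gt_zero[of "2::real"] by linarith
    next
      \<comment> \<open>Away from \<open>b = - 1\<close> the modulus of \<open>hh\<close> is at most
        that of \<open>1 - b\<close>, so powers of \<open>hh\<close> are controlled by powers of
        \<open>1 - b\<close>.\<close>
      case False
      define h where "h = hh z"
      have nz: "1 + b z \<noteq> 0" using False by auto
      have hb: "h * (1 + b z) = 1 - b z" using nz by (simp add: h_def hh_def)
      have hd: "cmod h \<le> cmod (1 - b z)"
      proof -
        have "cmod h * 1 \<le> cmod h * cmod (1 + b z)" using False by (intro mult_left_mono) auto
        then show ?thesis using hb by (metis mult.right_neutral norm_mult)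
      qed
      have le2: "cmod (1 - b z) \<le> 2" using norm_triangle_ineq4[of 1 "b z"] b_unit[OF z] by simp
      have Eh: "E = exp (- h)" by (simp add: E_def ex_def h_def)
      have ex2: "exp (cmod h) \<le> exp 2" using hd le2 by simp
      have "cmod (E - 1) \<le> exp (cmod h) * cmod h"
        using Taylor_exp_field[of "- h" 0] by (simp add: Eh)
      also have "\<dots> \<le> exp 2 * cmod (1 - b z)" using ex2 hd by (intro mult_mono) auto
      finally have e1: "cmod ((1 - E) / (1 - b z)) \<le> exp 2"
        using pos by (simp add: norm_divide norm_minus_commute divide_le_eq)
      have "cmod (k_sing z) \<le> 1 + cmod (b z * ((1 - E) / (1 - b z)))"
        unfolding k1 using norm_triangle_ineq[of 1 "b z * ((1 - E) / (1 - b z))"] by simp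
      also have "\<dots> \<le> 1 + exp 2" unfolding norm_mult b_unit[OF z] using e1 by simp
      finally have kb: "cmod (k_sing z) \<le> 1 + exp 2" .
      define \<epsilon> where "\<epsilon> = E - (1 - h)"
      have "cmod \<epsilon> \<le> exp (cmod h) * (cmod h)\<^sup>2"
        using Taylor_exp_field[of "- h" 1] by (simp add: Eh \<epsilon>_def power2_eq_square atMost_Suc algebra_simps)
      also have "\<dots> \<le> exp 2 * (cmod (1 - b z))\<^sup>2" using ex2 hd by (intro mult_mono power_mono) auto
      finally have eb: "cmod \<epsilon> \<le> exp 2 * (cmod (1 - b z))\<^sup>2" .
      \<comment> \<open>The first order terms cancel because \<open>h * (1 + b) = 1 - b\<close>;
        this is where the constant 3/2 has to be exact. Both remaining terms are of second order in
        \<open>1 - b\<close>.\<close>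
      have eq: "(k_sing z - 3 / 2) * (1 - b z) = - (b z * \<epsilon>) - (1 - b z) * h / 2"
      proof -
        have "(k_sing z - 3 / 2) * (1 - b z) = (1 - b z * E) - 3 / 2 * (1 - b z)"
          unfolding k using nb by (simp add: field_simps)
        also have "\<dots> = - (b z * \<epsilon>) + (b z * h - (1 - b z) / 2)" by (simp add: \<epsilon>_def field_simps)
        also have "b z * h - (1 - b z) / 2 = - ((1 - b z) * h / 2)"
        proof -
          have "b z * h - (h * (1 + b z)) / 2 = - ((1 - b z) * h / 2)" by (simp add: field_simps)
          then show ?thesis unfolding hb .
        qed
        finally show ?thesis by simp
      qed
      have "cmod ((k_sing z - 3 / 2) * (1 - b z)) \<le> cmod (b z * \<epsilon>) + cmod ((1 - b z) * h / 2)"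
        unfolding eq using norm_triangle_ineq4[of "- (b z * \<epsilon>)" "(1 - b z) * h / 2"] by simp
      also have "\<dots> \<le> exp 2 * (cmod (1 - b z))\<^sup>2 + (cmod (1 - b z))\<^sup>2"
      proof (rule add_mono)
        show "cmod (b z * \<epsilon>) \<le> exp 2 * (cmod (1 - b z))\<^sup>2" using eb by (simp add: norm_mult b_unit[OF z])
        have "cmod (1 - b z) * cmod h \<le> cmod (1 - b z) * cmod (1 - b z)" using hd by (intro mult_left_mono) auto
        moreover have "0 \<le> cmod (1 - b z) * cmod (1 - b z)" by simp
        moreover have "cmod ((1 - b z) * h / 2) = cmod (1 - b z) * cmod h / 2" by (simp add: norm_mult)
        ultimately show "cmod ((1 - b z) * h / 2) \<le> (cmod (1 - b z))\<^sup>2"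
          unfolding power2_eq_square by linarith
      qed
      finally have "cmod (k_sing z - 3 / 2) * cmod (1 - b z) \<le> ((exp 2 + 1) * cmod (1 - b z)) * cmod (1 - b z)"
      proof -
        assume "cmod ((k_sing z - 3 / 2) * (1 - b z)) \<le> exp 2 * (cmod (1 - b z))\<^sup>2 + (cmod (1 - b z))\<^sup>2"
        moreover have "((exp 2 + 1) * x) * x = exp 2 * x\<^sup>2 + x\<^sup>2" for x :: real
          by (simp add: power2_eq_square algebra_simps)
        ultimately show ?thesis by (simp only: norm_mult)
      qed
      then have "cmod (k_sing z - 3 / 2) \<le> (exp 2 + 1) * cmod (1 - b z)" using pos by (rule mult_right_le_imp_le)
      then have "cmod (r_sing z) \<le> exp 2 + 1" using nb pos by (simp add: r_sing_def norm_divide divide_le_eq)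
      then show ?thesis using kb by linarith
    qed
  qed
  then show "cmod (k_sing z) \<le> 3 + exp 2" "cmod (r_sing z) \<le> 5 + exp 2" by auto
qed

text \<open>The pointwise bounds on the quotients make \<open>bhardy_divide\<close> applicable,
  first to \<open>k_sing\<close> and then to \<open>r_sing\<close>.\<close>

lemma dilation_sing: "dilation b \<psi> s_sing (ex 1) k_sing r_sing (3 / 2)"
proof -
  have e: "bhardy (ex 1)" by (rule ex_bhardy) simp
  have s: "bhardy s_sing" unfolding s_sing_def[abs_def] by (intro bhardy_mult bb e)
  note [measurable] = bhardy_meas[OF s]
  have km [measurable]: "k_sing \<in> borel_measurable borel" unfolding k_sing_def[abs_def] by measurable
  have rm [measurable]: "r_sing \<in> borel_measurable borel" unfolding r_sing_def[abs_def] by measurable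
  have ex1: "ex 1 z = 1" if "b z = 1" for z using that by (simp add: ex_def hh_def)
  have ke: "(1 - b z) * k_sing z = 1 - s_sing z" for z by (auto simp: k_sing_def s_sing_def ex1)
  have re: "(1 - b z) * r_sing z = k_sing z - 3 / 2" for z by (auto simp: r_sing_def k_sing_def)
  have k: "bhardy k_sing"
    by (rule bhardy_divide[OF km sing_bounds(1) bhardy_diff[OF bhardy_const[of 1] s]]) (simp_all add: ke)
  have r: "bhardy r_sing"
    by (rule bhardy_divide[OF rm sing_bounds(2) bhardy_diff[OF k bhardy_const[of "3 / 2"]]]) (simp_all add: re)
  show ?thesis
  proof (intro dilation.intro dilation_axioms.intro)
    show "clark_symbol b \<psi>" by unfold_locales
    show "inner_fun s_sing" using s by (intro inner_fun.intro) (auto simp: bhardy_hardy s_sing_def norm_mult b_unit ex_unit)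
    show "inner_fun (ex 1)" by (rule ex_inner) simp
    show "k_sing z * (1 - b z) = 1 - s_sing z" for z using ke[of z] by (simp add: mult.commute)
    show "r_sing z * (1 - b z) = k_sing z - complex_of_real (3 / 2)" for z using re[of z] by (simp add: mult.commute)
  qed (auto simp: s_sing_def k r)
qed

text \<open>The singular factor has inner roots of every order. If \<open>v\<close> is a root of
  order \<open>Suc q\<close>, the functions \<open>v ^ i * x\<close> with a fixed nonzero
  \<open>x\<close> in the model space of \<open>v\<close> are mutually orthogonal elements of the
  model space of \<open>ex 1\<close>, which is contained in that of \<open>s_sing\<close>.\<close>

lemma sing_dim:
  assumes l: "has_hilbert_dim (model_space (cls s_sing)) l" shows "l = \<infinity>"
proof (rule hilbert_dim_infinity[OF _ l])
  interpret D: dilation b \<psi> s_sing "ex 1" k_sing r_sing "3 / 2" by (rule dilation_sing)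
  show "csubspace (model_space (cls s_sing))" by (rule D.S.model_space)
  fix q
  \<comment> \<open>Taking \<open>Suc q\<close> keeps the root defined for \<open>q = 0\<close> as
    well.\<close>
  define v where "v = ex (1 / real (Suc q))"
  interpret v: inner_fun v unfolding v_def by (rule ex_inner) simp
  have "cmod v.b0 < 1" using v.b0_cases ex_not_const[of "1 / real (Suc q)"] unfolding v_def by auto
  then interpret v: nc_inner v by unfold_locales
  have vq: "v z ^ Suc q = ex 1 z" for z unfolding v_def by (rule ex_power)
  define x where "x z = 1 - cnj v.b0 * v z" for z
  have x: "model v x" unfolding x_def by (rule v.model_e)
  have "v.E \<noteq> 0"
  proof
    assume "v.E = 0"
    then have "cinner y v.E = 0" for y by simp
    then have "(\<integral>z. x z \<partial>circle_measure) = 0" using v.cinner_E[OF x] by simp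
    moreover have "(\<integral>z. x z \<partial>circle_measure) = 1 - cnj v.b0 * v.b0"
      using v.b_int by (simp add: x_def)
    ultimately have "cnj v.b0 * v.b0 = 1" by simp
    then have "complex_of_real ((cmod v.b0)\<^sup>2) = 1" by (simp add: complex_norm_square mult.commute del: of_real_power)
    then have "(cmod v.b0)\<^sup>2 = 1" by (simp only: of_real_eq_1_iff)
    moreover have "(cmod v.b0)\<^sup>2 < 1" using power_strict_mono[OF v.b0_lt norm_ge_zero, of 2] by simp
    ultimately show False by simp
  qed
  then have xn: "norm (cls x) > 0" by (simp add: v.E_def x_def[abs_def])
  define c where "c = complex_of_real (1 / norm (cls x))"
  define f where "f i = cls (\<lambda>z. c * (v z ^ i * x z))" for i
  have mx: "model (\<lambda>z. v z ^ Suc q) (\<lambda>z. v z ^ i * x z)" if "i < q" for i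
    using that by (intro v.model_power x) simp
  have inc: "model s_sing g" if g: "model (ex 1) g" for g
  proof -
    have "hardy (\<lambda>z. b z * (ex 1 z * cnj (z * g z)))" by (intro bhardy_mult_hardy bb model_simps(2)[OF g])
    then show ?thesis using model_simps(1)[OF g] by (simp add: model_def s_sing_def mult.assoc)
  qed
  have ms: "model s_sing (\<lambda>z. c * (v z ^ i * x z))" if "i < q" for i
    using mx[OF that] unfolding vq by (intro D.S.model_cmult inc)
  have fs: "f i \<in> model_space (cls s_sing)" if "i < q" for i
    unfolding f_def by (rule D.S.model_spaceI[OF ms[OF that]])
  have fo: "cinner (f i) (f j) = (if i = j then 1 else 0)" if "i < q" "j < q" for i j
  proof -
    have sq: "square_integrable (\<lambda>z. v z ^ i * x z)" for i
      by (intro bhardy_sq_mult bhardy_power v.bb model_simps(3)[OF x])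
    have "cinner (f i) (f j) = c * cnj c * (\<integral>z. (v z ^ i * x z) * cnj (v z ^ j * x z) \<partial>circle_measure)"
      unfolding f_def cls_scaleC[OF sq, symmetric] cinner_scaleC_left cinner_scaleC_right cls_cinner[OF sq sq]
      by (simp only: ac_simps)
    also have "\<dots> = (if i = j then c * cnj c * cinner (cls x) (cls x) else 0)"
      unfolding v.power_cinner[OF x x] by (simp add: cls_cinner model_simps(3)[OF x])
    also have "c * cnj c * cinner (cls x) (cls x) = complex_of_real ((1 / norm (cls x)) * (1 / norm (cls x)) * (norm (cls x))\<^sup>2)"
      unfolding cinner_self c_def complex_cnj_complex_of_real by (simp only: of_real_mult)
    also have "(1 / norm (cls x)) * (1 / norm (cls x)) * (norm (cls x))\<^sup>2 = 1"
      using xn by (simp add: power2_eq_square)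
    finally show ?thesis by simp
  qed
  show "\<exists>f :: nat \<Rightarrow> circle_L2. (\<forall>i<q. f i \<in> model_space (cls s_sing)) \<and> (\<forall>i<q. \<forall>j<q. cinner (f i) (f j) = (if i = j then 1 else 0))"
    using fs fo by (intro exI[of _ f]) simp
qed

text \<open>The model space of \<open>s_sing\<close> is infinite dimensional, and removing the
  finitely many dimensions of the range of \<open>J\<close> leaves an infinite dimensional
  complement.\<close>

lemma equivalence_infinite:
  fixes E0 :: "'h::complex_inner_space set"
  assumes V: "has_hilbert_dim V (enat D)" and E0: "csubspace E0" "complete E0" "has_hilbert_dim E0 \<infinity>"
  shows "\<exists>\<Theta> \<phi>. inner_function \<Theta> \<and> unitarily_equivalent (V \<times> E0)
    (operator_sum (truncated_Toeplitz (cls b) (cls sym)) (zero_operator E0)) (model_space \<Theta>) (truncated_Toeplitz \<Theta> \<phi>)"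
proof -
  interpret D: dilation b \<psi> s_sing "ex 1" k_sing r_sing "3 / 2" by (rule dilation_sing)
  obtain l where l: "has_hilbert_dim D.VS l" using circle_hilbert_dim_exists[OF D.S.model_space(1)] by blast
  obtain m where m: "has_hilbert_dim D.W m" "m + enat D = l" using D.W_dim_finite[OF V l] by blast
  have "m = \<infinity>" using m(2) sing_dim[OF l] by (cases m) auto
  from D.dilation_equivalence[OF E0 m(1)[unfolded this]] D.S.inner_function_cls show ?thesis by blast
qed

end

section \<open>Arbitrary parameters and the constant case\<close>

lemma has_hilbert_dim_0: "has_hilbert_dim V 0 \<Longrightarrow> csubspace V \<Longrightarrow> V = {0}"
  unfolding zero_enat_def has_hilbert_dim_enat by (auto simp: onb_def csubspace_def)

lemma has_hilbert_dim_trivial: "has_hilbert_dim {0} 0"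
  unfolding zero_enat_def has_hilbert_dim_enat by (auto simp: onb_def)

theorem theorem5p1:
  fixes B \<psi> :: circle_L2 and \<zeta> :: complex and n d :: enat
    and E :: "'h::complex_inner_space set"
  assumes "inner_function B"
    and "\<psi> \<in> model_space B"
    and "cmod \<zeta> = 1"
    and "has_hilbert_dim (model_space B) d"
    and "csubspace E" and "complete E" and "has_hilbert_dim E (n * d)"
  shows "\<exists>\<Theta> \<phi>. inner_function \<Theta> \<and>
    unitarily_equivalent
      (model_space B \<times> E)
      (operator_sum (truncated_Toeplitz B (\<psi> + \<zeta> *\<^sub>C (cnj_L2 B \<odot> \<psi>))) (zero_operator E))
      (model_space \<Theta>)
      (truncated_Toeplitz \<Theta> \<phi>)"
proof -
  obtain b' where b': "inner_fun b'" "B = cls b'" using inner_functionE[OF assms(1)] .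
  interpret B: inner_fun b' by (rule b'(1))
  \<comment> \<open>The conjugate of \<zeta> is taken because the symbol contains
    \<open>cnj b\<close>, which then equals \<open>\<zeta> * cnj b'\<close>.\<close>
  define b where "b z = cnj \<zeta> * b' z" for z
  interpret b: inner_fun b
    unfolding b_def using assms(3) by (intro inner_fun.intro hardy_cmult B.b_hardy) (simp add: norm_mult B.b_unit)
  have zz: "\<zeta> * cnj \<zeta> = 1" using circle_simps[OF assms(3)] by simp
  have "model b f \<longleftrightarrow> model b' f" for f
  proof -
    have "hardy (\<lambda>z. b z * cnj (z * f z))" if "hardy (\<lambda>z. b' z * cnj (z * f z))"
      using hardy_cmult[OF that, of "cnj \<zeta>"] by (simp add: b_def mult.assoc)
    moreover have "hardy (\<lambda>z. b' z * cnj (z * f z))" if "hardy (\<lambda>z. b z * cnj (z * f z))"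
    proof -
      have "(\<lambda>z. b' z * cnj (z * f z)) = (\<lambda>z. \<zeta> * (b z * cnj (z * f z)))"
        using zz by (simp add: b_def mult.assoc[symmetric])
      then show ?thesis using hardy_cmult[OF that, of \<zeta>] by (simp only:)
    qed
    ultimately show ?thesis by (auto simp: model_def)
  qed
  then have VB: "model_space B = model_space (cls b)"
    unfolding b'(2) by (metis B.model_space_E B.model_spaceI b.model_space_E b.model_spaceI subsetI subset_antisym)
  obtain p where p: "model b p" "\<psi> = cls p" using assms(2) b.model_space_E unfolding VB by metis
  note ps = model_simps[OF p(1)]
  have symbol: "\<psi> + \<zeta> *\<^sub>C (cnj_L2 B \<odot> \<psi>) = cls (\<lambda>z. p z * (1 + cnj (b z)))"
  proof -
    have sb: "square_integrable b'" by (rule hardy_sq[OF B.b_hardy])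
    have sq: "square_integrable (\<lambda>z. cnj (b' z) * p z)" by (rule cnj_bhardy_sq_mult[OF B.bb ps(3)])
    have "\<psi> + \<zeta> *\<^sub>C (cnj_L2 B \<odot> \<psi>) = cls (\<lambda>z. p z + \<zeta> * (cnj (b' z) * p z))"
      unfolding p(2) b'(2) by (simp add: cls_cnj sb cls_mult square_integrable_cnj ps sq cls_scaleC cls_add square_integrable_mult_const)
    then show ?thesis by (simp add: b_def algebra_simps)
  qed
  have TB: "truncated_Toeplitz B q = truncated_Toeplitz (cls b) q" for q
    unfolding truncated_Toeplitz_def VB ..
  show ?thesis
  proof (cases "cmod b.b0 < 1")
    case True
    interpret c: clark_symbol b p by unfold_locales (use True p in auto)
    have sym: "cls (\<lambda>z. p z * (1 + cnj (b z))) = cls c.sym" by (simp add: c.sym_def[abs_def])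
    have V: "has_hilbert_dim (model_space (cls b)) d" using assms(4) VB by simp
    \<comment> \<open>Only the product \<open>n * d\<close> enters, so \<open>n\<close> may be
      replaced by any finite \<open>n'\<close> with the same product.\<close>
    have fin: ?thesis if "n * d = enat n' * d" for n'
      using c.equivalence_finite[OF V assms(5,6), of n'] assms(7) that unfolding symbol sym TB VB by simp
    show ?thesis
    proof (cases n)
      case (enat n') then show ?thesis by (intro fin[of n']) simp
    next
      case n: infinity
      show ?thesis
      proof (cases d)
        \<comment> \<open>Infinitely many copies of an infinite dimensional space have the dimension
          of one copy.\<close>
        case infinity then show ?thesis using n by (intro fin[of 1]) (simp add: one_enat_def[symmetric])
      next
        case (enat D)
        show ?thesis
        proof (cases "D = 0")
          case True then show ?thesis using enat by (intro fin[of 0]) (simp add: zero_enat_def[symmetric])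
        next
          case False
          then have "has_hilbert_dim E \<infinity>" using assms(7) n enat by (simp add: imult_is_infinity zero_enat_def)
          then show ?thesis
            using c.equivalence_infinite[OF V[unfolded enat] assms(5,6)] unfolding symbol sym TB VB by simp
        qed
      qed
    qed
  next
    \<comment> \<open>A constant \<open>B\<close> has a trivial model space, so that
      \<open>d = 0\<close> and \<open>E\<close> is trivial as well; then \<open>B\<close> itself
      serves as \<Theta>.\<close>
    case False
    then have V0: "model_space B = {0}" using b.V_trivial VB by simp
    have "d = 0"
      using assms(4) hilbert_dim_unique[OF b.model_space(1), of d 0] has_hilbert_dim_trivial unfolding VB[symmetric] V0 by blast
    then have E0: "E = {0}" using has_hilbert_dim_0[OF _ assms(5)] assms(7) by simp
    define T where "T = truncated_Toeplitz B (cls (\<lambda>z. p z * (1 + cnj (b z))))"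
    have sq: "square_integrable (\<lambda>z. p z * (1 + cnj (b z)))"
      using square_integrable_add[OF ps(3) cnj_bhardy_sq_mult[OF b.bb ps(3)]] by (simp add: algebra_simps)
    have T: "T = {(0, 0)}"
    proof -
      have "csubspace T" unfolding T_def TB by (rule b.csubspace_truncated_Toeplitz[OF sq])
      then have "(0, 0) \<in> T" by (simp add: csubspace_def zero_prod_def)
      moreover have "orth_proj (model_space B) x = 0" for x
        using orth_proj_in[OF b.model_space, of x] unfolding VB[symmetric] V0 by simp
      ultimately show ?thesis unfolding T_def by (auto simp: truncated_Toeplitz_def V0)
    qed
    have "unitarily_equivalent (model_space B \<times> E) (operator_sum T (zero_operator E)) (model_space B) T"
      unfolding unitarily_equivalent_def
    proof (intro exI[of _ "\<lambda>_. 0"] conjI)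
      show "unitary_between (\<lambda>_. 0) (model_space B \<times> E) (model_space B)"
        unfolding V0 E0 unitary_between_def by (auto simp: cinner_prod_def)
      have "operator_sum T (zero_operator E) = {((0, 0), (0, 0))}"
        unfolding T E0 operator_sum_def zero_operator_def by auto
      then show "map_prod (\<lambda>_. 0) (\<lambda>_. 0) ` closure (operator_sum T (zero_operator E)) = closure T"
        unfolding T by simp
    qed
    then show ?thesis unfolding symbol T_def using assms(1) by blast
  qed
qed

end
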